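(* Let $(M,g)$ be a compact, connected, smooth Riemannian manifold of dimension $n\ge 2$. Fix $s\in(0,n)$ and let $\mu$ be a finite Borel measure on $M$ admitting an averaged $s$-density constant $A_\mu\in(0,\infty)$. Then $$\frac{1}{\#\{j:\lambda_j\le\lambda\}}\sum_{\lambda_j\le\lambda}\Bigl|\int_M e_j\,d\mu\Bigr|^2\approx\lambda^{-s}\qquad(\lambda\to\infty),$$ that is, there exist constants $c,C>0$ and $\lambda_*\ge 1$ such that for all $\lambda\ge\lambda_*$ the left-hand side lies between $c\,\lambda^{-s}$ and $C\,\lambda^{-s}$.
   Context: Let $\{e_j\}_{j\ge 0}$ be a complete orthonormal basis of $L^2(M)$ consisting of real Laplace eigenfunctions, $-\Delta_g e_j=\lambda_j^2 e_j$, with $0=\lambda_0<\lambda_1\le\lambda_2\le\cdots$. For real $s>0$, $\operatorname{vol}(B^s):=\pi^{s/2}/\Gamma(\tfrac s2+1)$. Let $d_g$ be the Riemannian distance, and define the distance distribution $$F(r):=(\mu\times\mu)\bigl(\{(x,y)\in M\times M: d_g(x,y)\le r\}\bigr),\qquad r\ge 0.$$ The measure $\mu$ admits an averaged $s$-density constant $A_\mu\in(0,\infty)$ if $$F(r)=\operatorname{vol}(B^s)\,A_\mu\,r^s+o(r^s)\qquad(r\to0^+).$$ *)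

theory Defs
  imports "HOL-Analysis.Analysis" "HOL-Library.Landau_Symbols"
begin

section \<open>Smooth maps between Euclidean spaces\<close>

text \<open>These predicates are meant for open sets \<open>S\<close>. Since all directional derivatives are again
  required to be \<open>C\<^sup>k\<close>, they are continuous, so this is the usual notion of \<open>C\<^sup>k\<close>.\<close>

primrec Ck_on ::
  "nat \<Rightarrow> 'a::euclidean_space set \<Rightarrow> ('a \<Rightarrow> 'b::euclidean_space) \<Rightarrow> bool" where
  "Ck_on 0 S f \<longleftrightarrow> continuous_on S f"
| "Ck_on (Suc k) S f \<longleftrightarrow>
     (\<forall>x\<in>S. f differentiable (at x)) \<and> (\<forall>v. Ck_on k S (\<lambda>x. frechet_derivative f (at x) v))"

definition smooth_on :: "'a::euclidean_space set \<Rightarrow> ('a \<Rightarrow> 'b::euclidean_space) \<Rightarrow> bool" where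
  "smooth_on S f \<longleftrightarrow> (\<forall>k. Ck_on k S f)"

definition partial_deriv :: "'n::finite \<Rightarrow> (real^'n \<Rightarrow> real) \<Rightarrow> real^'n \<Rightarrow> real" where
  "partial_deriv i f x = frechet_derivative f (at x) (axis i 1)"


section \<open>Riemannian manifolds\<close>

text \<open>A manifold without boundary is a whole type \<open>'m\<close>, second countable and Hausdorff, with an
  atlas \<open>\<A>\<close>; its dimension is \<open>CARD('n)\<close>. A chart is a pair \<open>(U, \<phi>)\<close> of a domain and a coordinate
  map; \<open>\<phi>\<close> is only meaningful on \<open>U\<close>. A metric \<open>G\<close> is given by its coefficients: \<open>G c p\<close> is the
  matrix of the inner product on the tangent space at \<open>p\<close> in the coordinate basis of the
  chart \<open>c\<close>.\<close>

type_synonym ('m, 'n) chart = "'m set \<times> ('m \<Rightarrow> real^'n)"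

type_synonym ('m, 'n) metric_coeffs = "('m, 'n) chart \<Rightarrow> 'm \<Rightarrow> real^'n^'n"

abbreviation chart_dom :: "('m, 'n) chart \<Rightarrow> 'm set" where
  "chart_dom c \<equiv> fst c"

abbreviation chart_map :: "('m, 'n) chart \<Rightarrow> 'm \<Rightarrow> real^'n" where
  "chart_map c \<equiv> snd c"

abbreviation chart_img :: "('m, 'n) chart \<Rightarrow> (real^'n) set" where
  "chart_img c \<equiv> chart_map c ` chart_dom c"

definition chart_inv :: "('m, 'n) chart \<Rightarrow> real^'n \<Rightarrow> 'm" where
  "chart_inv c = inv_into (chart_dom c) (chart_map c)"

definition transition :: "('m, 'n) chart \<Rightarrow> ('m, 'n) chart \<Rightarrow> real^'n \<Rightarrow> real^'n" where
  "transition c d = chart_map d \<circ> chart_inv c"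

locale smooth_manifold =
  fixes \<A> :: "('m::{second_countable_topology, t2_space}, 'n::finite) chart set"
  assumes open_dom: "c \<in> \<A> \<Longrightarrow> open (chart_dom c)"
    and open_img: "c \<in> \<A> \<Longrightarrow> open (chart_img c)"
    and chart_homeo:
      "c \<in> \<A> \<Longrightarrow> homeomorphism (chart_dom c) (chart_img c) (chart_map c) (chart_inv c)"
    and charts_cover: "(\<Union>c\<in>\<A>. chart_dom c) = UNIV"
    and transition_smooth:
      "c \<in> \<A> \<Longrightarrow> d \<in> \<A> \<Longrightarrow>
        smooth_on (chart_map c ` (chart_dom c \<inter> chart_dom d)) (transition c d)"

locale riemannian_manifold = smooth_manifold \<A>
  for \<A> :: "('m::{second_countable_topology, t2_space}, 'n::finite) chart set" +
  fixes G :: "('m, 'n) metric_coeffs"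
  assumes metric_smooth: "c \<in> \<A> \<Longrightarrow> smooth_on (chart_img c) (G c \<circ> chart_inv c)"
    and metric_sym: "c \<in> \<A> \<Longrightarrow> p \<in> chart_dom c \<Longrightarrow> transpose (G c p) = G c p"
    and metric_pos: "c \<in> \<A> \<Longrightarrow> p \<in> chart_dom c \<Longrightarrow> v \<noteq> 0 \<Longrightarrow> v \<bullet> (G c p *v v) > 0"
    and metric_transform:
      "c \<in> \<A> \<Longrightarrow> d \<in> \<A> \<Longrightarrow> p \<in> chart_dom c \<inter> chart_dom d \<Longrightarrow>
        J = matrix (frechet_derivative (transition c d) (at (chart_map c p))) \<Longrightarrow>
        G c p = transpose J ** G d p ** J"

definition smooth_function ::
  "('m::topological_space, 'n::finite) chart set \<Rightarrow> ('m \<Rightarrow> real) \<Rightarrow> bool" where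
  "smooth_function \<A> f \<longleftrightarrow> (\<forall>c\<in>\<A>. smooth_on (chart_img c) (f \<circ> chart_inv c))"

text \<open>An arbitrary choice of a chart around \<open>p\<close>. The two notions below defined with its help, the
  speed of a curve and the Laplacian, do not depend on the choice.\<close>

definition chart_at :: "('m, 'n) chart set \<Rightarrow> 'm \<Rightarrow> ('m, 'n) chart" where
  "chart_at \<A> p = (SOME c. c \<in> \<A> \<and> p \<in> chart_dom c)"


subsection \<open>Volume measure and Laplacian\<close>

definition riemannian_volume ::
  "('m::topological_space, 'n::finite) chart set \<Rightarrow> ('m, 'n) metric_coeffs \<Rightarrow> 'm measure" where
  "riemannian_volume \<A> G =
    (THE V. sets V = sets borel \<and>
       (\<forall>c\<in>\<A>. \<forall>B\<in>sets borel. B \<subseteq> chart_dom c \<longrightarrow>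
          emeasure V B =
            (\<integral>\<^sup>+x\<in>chart_map c ` B. ennreal (sqrt (det (G c (chart_inv c x)))) \<partial>lborel)))"

text \<open>In coordinates,
  \<open>\<Delta> f = 1/sqrt(det g) * \<Sum>i. \<partial>\<^sub>i (sqrt(det g) * (\<Sum>j. g\<^sup>i\<^sup>j * \<partial>\<^sub>j f))\<close>, a nonpositive operator.\<close>

definition laplace_chart ::
  "('m, 'n::finite) metric_coeffs \<Rightarrow> ('m, 'n) chart \<Rightarrow> ('m \<Rightarrow> real) \<Rightarrow> real^'n \<Rightarrow> real" where
  "laplace_chart G c f x =
    (let g = (\<lambda>y. G c (chart_inv c y)); dens = (\<lambda>y. sqrt (det (g y))) in
      1 / dens x *
      (\<Sum>i\<in>UNIV. partial_deriv i
         (\<lambda>y. dens y * (\<Sum>j\<in>UNIV. matrix_inv (g y) $ i $ j * partial_deriv j (f \<circ> chart_inv c) y)) x))"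

definition laplacian ::
  "('m, 'n::finite) chart set \<Rightarrow> ('m, 'n) metric_coeffs \<Rightarrow> ('m \<Rightarrow> real) \<Rightarrow> 'm \<Rightarrow> real" where
  "laplacian \<A> G f p = (let c = chart_at \<A> p in laplace_chart G c f (chart_map c p))"


subsection \<open>Riemannian distance\<close>

text \<open>\<open>C\<^sup>1\<close> up to the end points \<open>a\<close> and \<open>b\<close>, where the derivatives are one-sided.\<close>

definition C1_curve_on ::
  "('m::topological_space, 'n::finite) chart set \<Rightarrow> real \<Rightarrow> real \<Rightarrow> (real \<Rightarrow> 'm) \<Rightarrow> bool" where
  "C1_curve_on \<A> a b \<gamma> \<longleftrightarrow>
    continuous_on {a..b} \<gamma> \<and>
    (\<forall>c\<in>\<A>. let T = {t\<in>{a..b}. \<gamma> t \<in> chart_dom c} in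
       (\<forall>t\<in>T. (chart_map c \<circ> \<gamma>) differentiable (at t within {a..b})) \<and>
       continuous_on T (\<lambda>t. vector_derivative (chart_map c \<circ> \<gamma>) (at t within {a..b})))"

definition piecewise_C1_curve ::
  "('m::topological_space, 'n::finite) chart set \<Rightarrow> (real \<Rightarrow> 'm) \<Rightarrow> bool" where
  "piecewise_C1_curve \<A> \<gamma> \<longleftrightarrow>
    (\<exists>(k::nat) \<tau>. \<tau> 0 = 0 \<and> \<tau> k = 1 \<and>
       (\<forall>i<k. \<tau> i < \<tau> (Suc i) \<and> C1_curve_on \<A> (\<tau> i) (\<tau> (Suc i)) \<gamma>))"

definition curve_speed ::
  "('m, 'n::finite) chart set \<Rightarrow> ('m, 'n) metric_coeffs \<Rightarrow> (real \<Rightarrow> 'm) \<Rightarrow> real \<Rightarrow> real" where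
  "curve_speed \<A> G \<gamma> t =
    (let c = chart_at \<A> (\<gamma> t); v = vector_derivative (chart_map c \<circ> \<gamma>) (at t)
     in sqrt (v \<bullet> (G c (\<gamma> t) *v v)))"

text \<open>The speed is only meaningful off the finitely many break points of \<open>\<gamma>\<close>; these do not affect
  the integral.\<close>

definition curve_length ::
  "('m, 'n::finite) chart set \<Rightarrow> ('m, 'n) metric_coeffs \<Rightarrow> (real \<Rightarrow> 'm) \<Rightarrow> real" where
  "curve_length \<A> G \<gamma> = integral {0..1} (curve_speed \<A> G \<gamma>)"

definition riemannian_dist ::
  "('m::topological_space, 'n::finite) chart set \<Rightarrow> ('m, 'n) metric_coeffs \<Rightarrow> 'm \<Rightarrow> 'm \<Rightarrow> real" where
  "riemannian_dist \<A> G x y =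
    Inf {curve_length \<A> G \<gamma> | \<gamma>. piecewise_C1_curve \<A> \<gamma> \<and> \<gamma> 0 = x \<and> \<gamma> 1 = y}"


section \<open>Orthonormal bases of eigenfunctions\<close>

text \<open>Completeness is stated as convergence in \<open>L\<^sup>2(V)\<close> of the expansion of each real
  square-integrable function.\<close>

definition complete_orthonormal_basis :: "'m measure \<Rightarrow> (nat \<Rightarrow> 'm \<Rightarrow> real) \<Rightarrow> bool" where
  "complete_orthonormal_basis V e \<longleftrightarrow>
    (\<forall>j. e j \<in> borel_measurable V \<and> integrable V (\<lambda>x. (e j x)\<^sup>2)) \<and>
    (\<forall>i j. (\<integral>x. e i x * e j x \<partial>V) = (if i = j then 1 else 0)) \<and>
    (\<forall>f. f \<in> borel_measurable V \<and> integrable V (\<lambda>x. (f x)\<^sup>2) \<longrightarrow>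
       (\<lambda>N. \<integral>x. (f x - (\<Sum>j<N. (\<integral>y. f y * e j y \<partial>V) * e j x))\<^sup>2 \<partial>V) \<longlonglongrightarrow> 0)"

text \<open>Elements of \<open>L\<^sup>2\<close> are only classes of functions; the eigenfunctions are taken to be their
  smooth representatives, so that integrals against singular measures make sense.\<close>

definition laplace_eigenbasis ::
  "('m::topological_space, 'n::finite) chart set \<Rightarrow> ('m, 'n) metric_coeffs \<Rightarrow>
    (nat \<Rightarrow> 'm \<Rightarrow> real) \<Rightarrow> (nat \<Rightarrow> real) \<Rightarrow> bool" where
  "laplace_eigenbasis \<A> G e ev \<longleftrightarrow>
    complete_orthonormal_basis (riemannian_volume \<A> G) e \<and>
    (\<forall>j. smooth_function \<A> (e j) \<and> (\<forall>p. - laplacian \<A> G (e j) p = (ev j)\<^sup>2 * e j p)) \<and>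
    ev 0 = 0 \<and> 0 < ev 1 \<and> (\<forall>j\<ge>1. ev j \<le> ev (Suc j))"


section \<open>Distance distribution and averaged density\<close>

definition dist_distribution ::
  "('m::topological_space, 'n::finite) chart set \<Rightarrow> ('m, 'n) metric_coeffs \<Rightarrow> 'm measure \<Rightarrow>
    real \<Rightarrow> real" where
  "dist_distribution \<A> G \<mu> r = measure (\<mu> \<Otimes>\<^sub>M \<mu>) {(x, y). riemannian_dist \<A> G x y \<le> r}"

text \<open>For real \<open>s > 0\<close>, \<open>unit_ball_vol s\<close> is \<open>pi powr (s/2) / Gamma (s/2 + 1)\<close>.\<close>

definition averaged_density_constant ::
  "('m::topological_space, 'n::finite) chart set \<Rightarrow> ('m, 'n) metric_coeffs \<Rightarrow> 'm measure \<Rightarrow>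
    real \<Rightarrow> real \<Rightarrow> bool" where
  "averaged_density_constant \<A> G \<mu> s a \<longleftrightarrow>
    0 < a \<and>
    (\<lambda>r. dist_distribution \<A> G \<mu> r - unit_ball_vol s * a * r powr s)
      \<in> o[at_right 0](\<lambda>r. r powr s)"

end

theory Submission
  imports Defs "HOL-Probability.Probability"
begin

text \<open>Cover \<open>M\<close> by finitely many coordinate balls and, at scale \<open>r\<close>, by cells of size \<open>r\<close> centred at lattice
  points, and let \<open>D(r)\<close> be the sum of the squares of the \<open>\<mu>\<close>-measures of the cells. Comparing the
  Riemannian distance with the coordinate distances gives \<open>D(r) \<approx> F(r) \<approx> r\<^sup>s\<close>.

  Upper bound: a combination \<open>f\<close> of the \<open>e\<^sub>j\<close> with \<open>\<lambda>\<^sub>j \<le> 1/r\<close> is bounded on a cell by \<open>r\<^bsup>-n/2\<^esup>\<close> times its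
  \<open>L\<^sup>2\<close> norm on a larger cell. This follows by iterating an interior estimate for \<open>\<Delta>\<close>, as the
  functions \<open>(- r\<^sup>2 \<Delta>)\<^sup>k f\<close> have no larger \<open>L\<^sup>2\<close> norm than \<open>f\<close>. By duality, the sum of
  \<open>|\<integral> e\<^sub>j d\<mu>|\<^sup>2\<close> over \<open>\<lambda>\<^sub>j \<le> 1/r\<close> is at most \<open>C r\<^bsup>-n\<^esup> D(r)\<close>.

  Lower bound: let \<open>g\<close> be the sum of bump functions on the cells, weighted by the \<open>\<mu>\<close>-measures of the cells.
  Then \<open>\<integral> g d\<mu>\<close> is at least \<open>c D(r)\<close>, while \<open>(1 - r\<^sup>2 \<Delta>)\<^sup>m g\<close> has \<open>L\<^sup>2\<close> norm at most
  \<open>(C r\<^sup>n D(r))\<^bsup>1/2\<^esup>\<close>; expanding \<open>g\<close> in the \<open>e\<^sub>j\<close> shows that \<open>D(r)\<close> is at most \<open>C r\<^sup>n\<close> times the sum of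
  \<open>(1 + r\<^sup>2 \<lambda>\<^sub>j\<^sup>2)\<^bsup>-2m\<^esup> |\<integral> e\<^sub>j d\<mu>|\<^sup>2\<close>. With \<open>r = K/\<lambda>\<close> and \<open>K\<close> large, the upper bound on dyadic shells absorbs
  the frequencies above \<open>\<lambda>\<close>.

  Both bounds are uniform in the measure. For Dirac measures, where \<open>s = 0\<close>, they bound the sum of
  \<open>e\<^sub>j(x)\<^sup>2\<close> over \<open>\<lambda>\<^sub>j \<le> \<lambda>\<close>, and integrating over \<open>x\<close> shows that there are about \<open>\<lambda>\<^sup>n\<close> such \<open>j\<close>.\<close>

section \<open>Calculus of \<open>C\<^sup>k\<close> functions\<close>

text \<open>Since \<open>\<mu>\<close> may be singular, convergence in L2, which is all that
  completeness provides, says nothing about \<integral> g d\<mu>. The expansion of g is therefore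
  shown to converge uniformly: Bessel's inequality for (1 - r^2 \<Delta>)^m g bounds the sum of
  g_j^2 (1 + r^2 \<lambda>_j^2)^(2m), and the upper bound for Dirac measures, applied on dyadic
  shells, bounds the sum of e_j(x)^2 (1 + r^2 \<lambda>_j^2)^(-2m) once 4 m > n. The final choice is
  m = n.

  The absorption of the high frequencies is a comparison of powers of K. Cells of size K/\<lambda>
  make the main term proportional to K^(s-n), whereas the frequencies above \<lambda> contribute
  K^(-4n).

  The definitions leave three points to settle: the volume is a definite description, so existence
  and uniqueness are derived; the Laplacian is taken in an arbitrarily chosen chart, so charts are
  compared through its weak form; and measurability of {d \<le> r} is deduced for small r from F(r)
  > 0, as a non-measurable set has measure 0.\<close>

lemma Ck_on_cong:
  assumes "open S" "\<And>x. x \<in> S \<Longrightarrow> f x = g x" "Ck_on k S f"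
  shows "Ck_on k S g"
  using assms(2,3)
proof (induction k arbitrary: f g)
  case 0
  then show ?case by (simp cong: continuous_on_cong)
next
  case (Suc k)
  have diff: "g differentiable (at x)" if "x \<in> S" for x
  proof -
    have "f differentiable (at x)" using Suc that by simp
    then show ?thesis
      unfolding differentiable_def
      using has_derivative_transform_within_open[OF _ assms(1) that] Suc.prems(1) by blast
  qed
  moreover have "Ck_on k S (\<lambda>x. frechet_derivative g (at x) v)" for v
  proof (rule Suc.IH)
    show "Ck_on k S (\<lambda>x. frechet_derivative f (at x) v)" using Suc.prems by simp
    fix x assume "x \<in> S"
    then show "frechet_derivative f (at x) v = frechet_derivative g (at x) v"
      using frechet_derivative_transform_within_open[OF _ assms(1), of f x g] Suc.prems by simp
  qed
  ultimately show ?case by simp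
qed

text \<open>Lets the closure properties below use the derivative that the calculus rules produce in
  place of the choice operator \<open>frechet_derivative\<close>.\<close>

lemma Ck_on_SucI:
  assumes "open S" "\<And>x. x \<in> S \<Longrightarrow> (f has_derivative f' x) (at x)"
    "\<And>v. Ck_on k S (\<lambda>x. f' x v)"
  shows "Ck_on (Suc k) S f"
proof -
  have "Ck_on k S (\<lambda>x. frechet_derivative f (at x) v)" for v
    by (rule Ck_on_cong[OF assms(1) _ assms(3)[of v]]) (use assms(2) frechet_derivative_at in metis)
  then show ?thesis using assms(2) unfolding Ck_on.simps differentiable_def by blast
qed

lemma Ck_on_Suc_has_derivative:
  assumes "Ck_on (Suc k) S f" "x \<in> S"
  shows "(f has_derivative frechet_derivative f (at x)) (at x)"
  using assms by (simp add: frechet_derivative_works[symmetric])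

lemma Ck_on_Suc_imp: "Ck_on (Suc k) S f \<Longrightarrow> Ck_on k S f"
proof (induction k arbitrary: f)
  case 0
  then show ?case
    by (auto intro!: continuous_at_imp_continuous_on differentiable_imp_continuous_within)
next
  case (Suc k)
  then show ?case by (metis Ck_on.simps(2))
qed

lemma Ck_on_mono: "Ck_on k S f \<Longrightarrow> j \<le> k \<Longrightarrow> Ck_on j S f"
proof (induction "k - j" arbitrary: k)
  case (Suc d)
  then obtain k' where "k = Suc k'" by (cases k) auto
  with Suc show ?case by (metis Ck_on_Suc_imp Suc_diff_le add_diff_cancel_left' diff_Suc_1 diff_is_0_eq le_Suc_eq nat.distinct(1) plus_1_eq_Suc)
qed simp

lemma Ck_on_imp_continuous_on: "Ck_on k S f \<Longrightarrow> continuous_on S f"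
  using Ck_on_mono[of k S f 0] by simp

lemma Ck_on_subset: "Ck_on k S f \<Longrightarrow> T \<subseteq> S \<Longrightarrow> Ck_on k T f"
  by (induction k arbitrary: f) (auto intro: continuous_on_subset)

lemma Ck_on_const: "Ck_on k S (\<lambda>x. c)"
  by (induction k arbitrary: c) (auto simp: frechet_derivative_const)

lemma Ck_on_bounded_linear:
  assumes "bounded_linear h" shows "Ck_on k S h"
proof (cases k)
  case 0
  then show ?thesis using linear_continuous_on[OF assms] by simp
next
  case (Suc j)
  have "(h has_derivative h) (at x)" for x by (rule bounded_linear_imp_has_derivative[OF assms])
  then have "frechet_derivative h (at x) = h" for x by (metis frechet_derivative_at)
  then show ?thesis using Suc \<open>\<And>x. (h has_derivative h) (at x)\<close>
    by (auto simp: Ck_on_const differentiable_def)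
qed

lemma Ck_on_compose_bounded_linear:
  assumes "open S" "bounded_linear h" "Ck_on k S f"
  shows "Ck_on k S (\<lambda>x. h (f x))"
  using assms(3)
proof (induction k arbitrary: f)
  case 0
  then show ?case using bounded_linear.continuous_on[OF assms(2)] by simp
next
  case (Suc k)
  show ?case
  proof (rule Ck_on_SucI[OF assms(1)])
    show "((\<lambda>x. h (f x)) has_derivative (\<lambda>v. h (frechet_derivative f (at x) v))) (at x)" if "x \<in> S" for x
      by (rule bounded_linear.has_derivative[OF assms(2) Ck_on_Suc_has_derivative[OF Suc.prems that]])
    show "Ck_on k S (\<lambda>x. h (frechet_derivative f (at x) v))" for v
      using Suc by simp
  qed
qed

lemma Ck_on_add:
  assumes "open S" "Ck_on k S f" "Ck_on k S g"
  shows "Ck_on k S (\<lambda>x. f x + g x)"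
  using assms(2,3)
proof (induction k arbitrary: f g)
  case 0
  then show ?case by (simp add: continuous_on_add)
next
  case (Suc k)
  show ?case
    by (rule Ck_on_SucI[OF assms(1) has_derivative_add
          [OF Ck_on_Suc_has_derivative[OF Suc.prems(1)] Ck_on_Suc_has_derivative[OF Suc.prems(2)]]])
      (use Suc in auto)
qed

lemma Ck_on_bounded_bilinear:
  assumes "open S" "bounded_bilinear mul" "Ck_on k S f" "Ck_on k S g"
  shows "Ck_on k S (\<lambda>x. mul (f x) (g x))"
  using assms(3,4)
proof (induction k arbitrary: f g)
  case 0
  then show ?case by (simp add: bounded_bilinear.continuous_on[OF assms(2)])
next
  case (Suc k)
  show ?case
  proof (rule Ck_on_SucI[OF assms(1) bounded_bilinear.FDERIV[OF assms(2)
          Ck_on_Suc_has_derivative[OF Suc.prems(1)] Ck_on_Suc_has_derivative[OF Suc.prems(2)]]])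
    fix v
    show "Ck_on k S (\<lambda>x. mul (f x) (frechet_derivative g (at x) v) + mul (frechet_derivative f (at x) v) (g x))"
      using Suc.prems Suc.prems[THEN Ck_on_Suc_imp]
      by (intro Ck_on_add[OF assms(1)] Suc.IH) auto
  qed
qed

lemmas Ck_on_mult = Ck_on_bounded_bilinear[OF _ bounded_bilinear_mult]

lemma Ck_on_minus: "open S \<Longrightarrow> Ck_on k S f \<Longrightarrow> Ck_on k S (\<lambda>x. - f x)"
  by (rule Ck_on_compose_bounded_linear[OF _ bounded_linear_minus[OF bounded_linear_ident]])

lemma Ck_on_diff: "open S \<Longrightarrow> Ck_on k S f \<Longrightarrow> Ck_on k S g \<Longrightarrow> Ck_on k S (\<lambda>x. f x - g x)"
  using Ck_on_add[of S k f "\<lambda>x. - g x"] Ck_on_minus[of S k g] by simp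

lemma Ck_on_sum:
  assumes "open S" "\<And>i. i \<in> I \<Longrightarrow> Ck_on k S (f i)"
  shows "Ck_on k S (\<lambda>x. \<Sum>i\<in>I. f i x)"
  using assms(2) by (induction I rule: infinite_finite_induct)
    (auto intro: Ck_on_const Ck_on_add[OF assms(1)])

lemma Ck_on_prod:
  fixes f :: "'i \<Rightarrow> 'a::euclidean_space \<Rightarrow> real"
  assumes "open S" "\<And>i. i \<in> I \<Longrightarrow> Ck_on k S (f i)"
  shows "Ck_on k S (\<lambda>x. \<Prod>i\<in>I. f i x)"
  using assms(2) by (induction I rule: infinite_finite_induct)
    (auto intro: Ck_on_const Ck_on_mult[OF assms(1)])

lemma Ck_on_compose:
  assumes "open S" "open T" "Ck_on k S g" "Ck_on k T f" "g ` S \<subseteq> T"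
  shows "Ck_on k S (\<lambda>x. f (g x))"
  using assms(3,4)
proof (induction k arbitrary: f)
  case 0
  then show ?case using continuous_on_compose2[of T f S g] assms(5) by simp
next
  case (Suc k)
  have g': "(g has_derivative frechet_derivative g (at x)) (at x)" if "x \<in> S" for x
    by (rule Ck_on_Suc_has_derivative[OF Suc.prems(1) that])
  have f': "(f has_derivative frechet_derivative f (at (g x))) (at (g x))" if "x \<in> S" for x
    using Ck_on_Suc_has_derivative[OF Suc.prems(2)] that assms(5) by blast
  show ?case
  proof (rule Ck_on_SucI[OF assms(1)])
    show "((\<lambda>x. f (g x)) has_derivative
        (\<lambda>v. frechet_derivative f (at (g x)) (frechet_derivative g (at x) v))) (at x)"
      if "x \<in> S" for x
      using diff_chain_at[OF g'[OF that] f'[OF that]] by (simp add: o_def)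
    fix v
    \<comment> \<open>The direction of the derivative of f varies with x, whereas the induction
      hypothesis covers derivatives of f in a fixed direction. Expanding the direction in the basis
      separates the two.\<close>
    have *: "Ck_on k S (\<lambda>x. \<Sum>b\<in>Basis. (frechet_derivative g (at x) v \<bullet> b) *\<^sub>R
        frechet_derivative f (at (g x)) b)"
    proof (intro Ck_on_sum Ck_on_bounded_bilinear[OF _ bounded_bilinear_scaleR] assms(1))
      fix b
      show "Ck_on k S (\<lambda>x. frechet_derivative g (at x) v \<bullet> b)"
        using Suc.prems(1) by (intro Ck_on_compose_bounded_linear[OF assms(1) bounded_linear_inner_left]) simp
      show "Ck_on k S (\<lambda>x. frechet_derivative f (at (g x)) b)"
        using Suc.prems(2) Ck_on_Suc_imp[OF Suc.prems(1)] by (intro Suc.IH) auto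
    qed
    have eq: "(\<Sum>b\<in>Basis. (frechet_derivative g (at x) v \<bullet> b) *\<^sub>R frechet_derivative f (at (g x)) b) =
        frechet_derivative f (at (g x)) (frechet_derivative g (at x) v)"
      if "x \<in> S" for x
    proof -
      have lin: "linear (frechet_derivative f (at (g x)))"
        using f'[OF that] has_derivative_linear by blast
      have "frechet_derivative f (at (g x)) (\<Sum>b\<in>Basis. (frechet_derivative g (at x) v \<bullet> b) *\<^sub>R b)
        = (\<Sum>b\<in>Basis. (frechet_derivative g (at x) v \<bullet> b) *\<^sub>R frechet_derivative f (at (g x)) b)"
        by (simp add: linear_sum[OF lin] linear_scale[OF lin])
      then show ?thesis by (simp add: euclidean_representation)
    qed
    show "Ck_on k S (\<lambda>x. frechet_derivative f (at (g x)) (frechet_derivative g (at x) v))"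
      by (rule Ck_on_cong[OF assms(1) eq *])
  qed
qed

lemma Ck_on_compose_affine:
  assumes "open S" "open T" "bounded_linear h" "\<And>x. x \<in> S \<Longrightarrow> b + h x \<in> T" "Ck_on k T f"
  shows "Ck_on k S (\<lambda>x. f (b + h x))"
  by (rule Ck_on_compose[OF assms(1,2) Ck_on_add[OF assms(1) Ck_on_const Ck_on_bounded_linear[OF assms(3)]] assms(5)])
    (use assms(4) in auto)

lemma Ck_on_inverse:
  fixes f :: "'a::euclidean_space \<Rightarrow> real"
  assumes "open S" "\<And>x. x \<in> S \<Longrightarrow> f x \<noteq> 0" "Ck_on k S f"
  shows "Ck_on k S (\<lambda>x. inverse (f x))"
  using assms(3)
proof (induction k)
  case 0
  then show ?case by (simp add: continuous_on_inverse assms)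
next
  case (Suc k)
  then have *: "Ck_on k S (\<lambda>x. inverse (f x))" using Ck_on_Suc_imp by blast
  show ?case
  proof (rule Ck_on_SucI[OF assms(1) Deriv.has_derivative_inverse[OF assms(2)
          Ck_on_Suc_has_derivative[OF Suc.prems]]])
    show "Ck_on k S (\<lambda>x. - (inverse (f x) * frechet_derivative f (at x) v * inverse (f x)))" for v
      by (intro Ck_on_minus Ck_on_mult assms(1) *) (use Suc.prems in simp)
  qed
qed

lemma Ck_on_divide:
  fixes f g :: "'a::euclidean_space \<Rightarrow> real"
  assumes "open S" "Ck_on k S f" "\<And>x. x \<in> S \<Longrightarrow> g x \<noteq> 0" "Ck_on k S g"
  shows "Ck_on k S (\<lambda>x. f x / g x)"
  using Ck_on_mult[OF assms(1,2) Ck_on_inverse[OF assms(1,3,4)]] by (simp add: divide_inverse)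

lemma Ck_on_sqrt:
  fixes f :: "'a::euclidean_space \<Rightarrow> real"
  assumes "open S" "\<And>x. x \<in> S \<Longrightarrow> f x > 0" "Ck_on k S f"
  shows "Ck_on k S (\<lambda>x. sqrt (f x))"
  using assms(3)
proof (induction k)
  case 0
  then show ?case by (auto intro: continuous_on_real_sqrt)
next
  case (Suc k)
  then have *: "Ck_on k S (\<lambda>x. sqrt (f x))" using Ck_on_Suc_imp by blast
  have d: "((\<lambda>x. sqrt (f x)) has_derivative
      (\<lambda>v. frechet_derivative f (at x) v * (inverse (sqrt (f x)) / 2))) (at x)" if "x \<in> S" for x
    using has_derivative_compose[OF Ck_on_Suc_has_derivative[OF Suc.prems that]
        DERIV_real_sqrt[OF assms(2)[OF that], unfolded has_field_derivative_def]]
    by (simp add: mult.commute)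
  show ?case
  proof (rule Ck_on_SucI[OF assms(1) d])
    fix v
    show "Ck_on k S (\<lambda>x. frechet_derivative f (at x) v * (inverse (sqrt (f x)) / 2))"
      by (intro Ck_on_mult Ck_on_divide Ck_on_inverse Ck_on_const assms(1) *)
        (use Suc.prems assms(2) in \<open>force+\<close>)
  qed
qed

text \<open>Powers of the positive part are the source of compactly supported test functions.\<close>

lemma has_real_derivative_pospart_power:
  "((\<lambda>x. max 0 x ^ Suc (Suc n)) has_real_derivative real (Suc (Suc n)) * max 0 x ^ Suc n) (at x)"
proof (cases x "0::real" rule: linorder_cases)
  case less
  have "((\<lambda>x. 0) has_real_derivative 0) (at x)" by simp
  then have "((\<lambda>x. max 0 x ^ Suc (Suc n)) has_real_derivative 0) (at x)"
    by (rule DERIV_cong_ev[THEN iffD1, rotated -1, OF _ refl _ refl])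
      (use less eventually_nhds_in_open[of "{..<0}" x] in \<open>auto elim!: eventually_mono simp: max_def\<close>)
  then show ?thesis using less by (simp add: max_def)
next
  case greater
  have "((\<lambda>x. x ^ Suc (Suc n)) has_real_derivative real (Suc (Suc n)) * x ^ Suc n) (at x)"
    by (rule derivative_eq_intros | simp)+
  then have "((\<lambda>x. max 0 x ^ Suc (Suc n)) has_real_derivative real (Suc (Suc n)) * x ^ Suc n) (at x)"
    by (rule DERIV_cong_ev[THEN iffD1, rotated -1, OF _ refl _ refl])
      (use greater eventually_nhds_in_open[of "{0<..}" x] in \<open>auto elim!: eventually_mono simp: max_def\<close>)
  then show ?thesis using greater by (simp add: max_def)
next
  case equal
  have "((\<lambda>h::real. max 0 h ^ Suc (Suc n) / h) \<longlongrightarrow> 0) (at 0)"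
  proof (rule Lim_null_comparison)
    show "\<forall>\<^sub>F h in at 0. norm (max 0 h ^ Suc (Suc n) / h) \<le> max 0 h ^ Suc n"
      by (auto simp: eventually_at max_def intro!: exI[of _ 1])
    have "((\<lambda>h::real. max 0 h ^ Suc n) \<longlongrightarrow> max 0 0 ^ Suc n) (at 0)"
      by (intro tendsto_intros)
    then show "((\<lambda>h::real. max 0 h ^ Suc n) \<longlongrightarrow> 0) (at 0)" by simp
  qed
  then show ?thesis using equal by (simp add: DERIV_def)
qed

text \<open>Every derivative lowers the exponent by one, and the power is continuous as long as its
  exponent stays positive; hence \<open>k < K\<close>.\<close>

lemma Ck_on_pospart_power:
  fixes u :: "'a::euclidean_space \<Rightarrow> real"
  assumes "open S" "Ck_on k S u" "k < K"
  shows "Ck_on k S (\<lambda>x. max 0 (u x) ^ K)"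
  using assms(2,3)
proof (induction k arbitrary: K)
  case 0
  then show ?case by (auto intro!: continuous_intros)
next
  case (Suc k)
  then obtain n where K: "K = Suc (Suc n)" by (cases K; cases "K - 1") auto
  have *: "Ck_on k S (\<lambda>x. max 0 (u x) ^ Suc n)"
    using Suc.IH[of "Suc n"] Suc.prems Ck_on_Suc_imp K by auto
  have d: "((\<lambda>x. max 0 (u x) ^ K) has_derivative
      (\<lambda>v. frechet_derivative u (at x) v * (real K * max 0 (u x) ^ Suc n))) (at x)" if "x \<in> S" for x
    using has_derivative_compose[OF Ck_on_Suc_has_derivative[OF Suc.prems(1) that]
        has_real_derivative_pospart_power[unfolded has_field_derivative_def]]
    unfolding K by (simp add: mult.commute)
  show ?case
  proof (rule Ck_on_SucI[OF assms(1) d])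
    fix v
    show "Ck_on k S (\<lambda>x. frechet_derivative u (at x) v * (real K * max 0 (u x) ^ Suc n))"
      using Suc.prems by (intro Ck_on_mult Ck_on_const assms(1) *) auto
  qed
qed

section \<open>Determinants and inverses of matrix functions\<close>

lemma Ck_on_vec_nth:
  "open S \<Longrightarrow> Ck_on k S f \<Longrightarrow> Ck_on k S (\<lambda>x. f x $ i)"
  by (rule Ck_on_compose_bounded_linear[OF _ bounded_linear_vec_nth])

lemma Ck_on_det:
  fixes A :: "'a::euclidean_space \<Rightarrow> real^'n^'n"
  assumes "open S" "\<And>i j. Ck_on k S (\<lambda>x. A x $ i $ j)"
  shows "Ck_on k S (\<lambda>x. det (A x))"
  unfolding det_def by (intro Ck_on_sum Ck_on_mult Ck_on_prod Ck_on_const assms)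

lemma
  fixes A :: "real^'n^'n"
  assumes "det A \<noteq> 0"
  shows matrix_inv_mult: "A ** matrix_inv A = mat 1" and mult_matrix_inv: "matrix_inv A ** A = mat 1"
proof -
  have "\<exists>B. A ** B = mat 1 \<and> B ** A = mat 1"
    using assms by (simp add: invertible_det_nz[symmetric] invertible_def)
  from someI_ex[OF this, folded matrix_inv_def]
  show "A ** matrix_inv A = mat 1" "matrix_inv A ** A = mat 1" by auto
qed

text \<open>Exhibits the entries of the inverse as quotients of determinants, hence as rational
  functions of the entries of \<open>A\<close>. The regularity of the inverse metric is read off
  from this form.\<close>

lemma matrix_inv_cramer:
  fixes A :: "real^'n^'n"
  assumes "det A \<noteq> 0"
  shows "matrix_inv A $ i $ j = det (\<chi> k l. if l = i then axis j 1 $ k else A $ k $ l) / det A"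
proof -
  have "A ** matrix_inv A = mat 1" by (rule matrix_inv_mult[OF assms])
  then have "A *v (matrix_inv A *v axis j 1) = axis j 1"
    by (simp add: matrix_vector_mul_assoc)
  then have "matrix_inv A *v axis j 1 = (\<chi> i. det (\<chi> k l. if l = i then axis j 1 $ k else A $ k $ l) / det A)"
    unfolding cramer[OF assms] .
  then have "(matrix_inv A *v axis j 1) $ i = det (\<chi> k l. if l = i then axis j 1 $ k else A $ k $ l) / det A"
    by simp
  moreover have "(matrix_inv A *v axis j 1) $ i = matrix_inv A $ i $ j"
    by (simp add: matrix_vector_mult_basis column_def)
  ultimately show ?thesis by simp
qed

lemma Ck_on_matrix_inv:
  fixes A :: "'a::euclidean_space \<Rightarrow> real^'n^'n"
  assumes S: "open S" and A: "\<And>i j. Ck_on k S (\<lambda>x. A x $ i $ j)" and nz: "\<And>x. x \<in> S \<Longrightarrow> det (A x) \<noteq> 0"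
  shows "Ck_on k S (\<lambda>x. matrix_inv (A x) $ i $ j)"
proof (rule Ck_on_cong[OF S])
  show "Ck_on k S (\<lambda>x. det (\<chi> a b. if b = i then axis j 1 $ a else A x $ a $ b) / det (A x))"
  proof (intro Ck_on_divide Ck_on_det S A)
    show "Ck_on k S (\<lambda>x. (\<chi> a b. if b = i then axis j 1 $ a else A x $ a $ b) $ l $ m)" for l m
      by (cases "m = i") (simp_all add: Ck_on_const A)
  qed (use nz in auto)
qed (simp add: matrix_inv_cramer nz)


subsection \<open>Partial derivatives\<close>

lemma has_derivative_imp_partial_deriv:
  "(f has_derivative f') (at x) \<Longrightarrow> partial_deriv i f x = f' (axis i 1)"
  unfolding partial_deriv_def using frechet_derivative_at by metis

lemma Ck_on_partial_deriv: "Ck_on (Suc k) S f \<Longrightarrow> Ck_on k S (partial_deriv i f)"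
  unfolding partial_deriv_def by simp

lemma frechet_derivative_eq_sum_partial_deriv:
  fixes f :: "real^'n \<Rightarrow> real"
  assumes "f differentiable (at x)"
  shows "frechet_derivative f (at x) v = (\<Sum>i\<in>UNIV. v $ i * partial_deriv i f x)"
proof -
  have lin: "linear (frechet_derivative f (at x))"
    using assms linear_frechet_derivative by blast
  have "v = (\<Sum>i\<in>UNIV. v $ i *\<^sub>R axis i 1)" 
    using basis_expansion[of v] by (simp add: scalar_mult_eq_scaleR)
  then have "frechet_derivative f (at x) v = frechet_derivative f (at x) (\<Sum>i\<in>UNIV. v $ i *\<^sub>R axis i 1)"
    by (rule arg_cong)
  also have "\<dots> = (\<Sum>i\<in>UNIV. v $ i *\<^sub>R frechet_derivative f (at x) (axis i 1))"
    by (simp add: linear_sum[OF lin] linear_scale[OF lin])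
  finally have "frechet_derivative f (at x) v = (\<Sum>i\<in>UNIV. v $ i *\<^sub>R frechet_derivative f (at x) (axis i 1))" .
  then show ?thesis by (simp add: partial_deriv_def)
qed

lemma partial_deriv_cong_open:
  assumes "open S" "x \<in> S" "\<And>y. y \<in> S \<Longrightarrow> f y = g y"
  shows "partial_deriv i f x = partial_deriv i g x"
proof -
  have *: "(f has_derivative D) (at x) \<longleftrightarrow> (g has_derivative D) (at x)" for D
    using has_derivative_transform_within_open[OF _ assms(1,2)] assms(3) by metis
  show ?thesis unfolding partial_deriv_def frechet_derivative_def * ..
qed

lemma partial_deriv_const[simp]: "partial_deriv i (\<lambda>x. c) x = 0"
  by (simp add: partial_deriv_def frechet_derivative_const)

lemma Ck_on_imp_differentiable: "Ck_on (Suc k) S f \<Longrightarrow> x \<in> S \<Longrightarrow> f differentiable (at x)"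
  by simp

lemma partial_deriv_sum:
  assumes "\<And>j. j \<in> J \<Longrightarrow> f j differentiable (at x)"
  shows "partial_deriv i (\<lambda>x. \<Sum>j\<in>J. f j x) x = (\<Sum>j\<in>J. partial_deriv i (f j) x)"
proof -
  have "((\<lambda>x. \<Sum>j\<in>J. f j x) has_derivative (\<lambda>v. \<Sum>j\<in>J. frechet_derivative (f j) (at x) v)) (at x)"
    using assms by (intro has_derivative_sum) (simp add: frechet_derivative_works[symmetric])
  from has_derivative_imp_partial_deriv[OF this] show ?thesis by (simp add: partial_deriv_def)
qed

lemma partial_deriv_mult:
  "f differentiable (at x) \<Longrightarrow> g differentiable (at x) \<Longrightarrow>
    partial_deriv i (\<lambda>x. f x * g x) x = f x * partial_deriv i g x + partial_deriv i f x * g x"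
  unfolding frechet_derivative_works
  by (drule (1) has_derivative_mult, drule has_derivative_imp_partial_deriv[of _ _ _ i])
    (simp add: partial_deriv_def)

lemma partial_deriv_cmult:
  "f differentiable (at x) \<Longrightarrow> partial_deriv i (\<lambda>x. c * f x) x = c * partial_deriv i f x"
  using partial_deriv_mult[of "\<lambda>_. c" x f i] by simp

lemma partial_deriv_diff:
  "f differentiable (at x) \<Longrightarrow> g differentiable (at x) \<Longrightarrow>
    partial_deriv i (\<lambda>x. f x - g x) x = partial_deriv i f x - partial_deriv i g x"
  unfolding frechet_derivative_works
  by (drule (1) has_derivative_diff, drule has_derivative_imp_partial_deriv[of _ _ _ i])
    (simp add: partial_deriv_def)

lemma partial_deriv_scale:
  fixes f :: "real^'n \<Rightarrow> real"
  assumes "f differentiable (at (b + t *\<^sub>R z))"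
  shows "partial_deriv i (\<lambda>z. f (b + t *\<^sub>R z)) z = t * partial_deriv i f (b + t *\<^sub>R z)"
proof -
  have "((\<lambda>z. b + t *\<^sub>R z) has_derivative (\<lambda>z. t *\<^sub>R z)) (at z)"
    by (auto intro!: derivative_eq_intros)
  from diff_chain_at[OF this assms[unfolded frechet_derivative_works]]
  have "((\<lambda>z. f (b + t *\<^sub>R z)) has_derivative
      (\<lambda>v. frechet_derivative f (at (b + t *\<^sub>R z)) (t *\<^sub>R v))) (at z)" by (simp add: o_def)
  moreover have "linear (frechet_derivative f (at (b + t *\<^sub>R z)))"
    using assms linear_frechet_derivative by blast
  ultimately show ?thesis
    by (simp add: has_derivative_imp_partial_deriv linear_scale) (simp add: partial_deriv_def)
qed

section \<open>Integration by parts\<close>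

lemma set_integrable_compact:
  fixes f :: "'a::euclidean_space \<Rightarrow> 'b::{banach, second_countable_topology}"
  assumes "compact K" "continuous_on K f"
  shows "set_integrable lborel K f"
  using borel_integrable_compact[OF assms] by (simp add: set_integrable_def)

lemma set_integral_sum:
  fixes f :: "'i \<Rightarrow> 'a \<Rightarrow> 'b::{banach, second_countable_topology}"
  assumes "finite I" "\<And>i. i \<in> I \<Longrightarrow> set_integrable M A (f i)"
  shows "(LINT x:A|M. (\<Sum>i\<in>I. f i x)) = (\<Sum>i\<in>I. LINT x:A|M. f i x)"
  using assms unfolding set_lebesgue_integral_def set_integrable_def
  by (simp add: scaleR_sum_right Bochner_Integration.integral_sum del: sum.inter_filter sum_indicator_scaleR)

lemma continuous_on_partial_deriv: "Ck_on 1 S f \<Longrightarrow> continuous_on S (partial_deriv i f)"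
  using Ck_on_partial_deriv[of 0 S f] by simp

lemma has_vector_derivative_axis_line:
  fixes h :: "real^'n \<Rightarrow> real"
  assumes "(h has_derivative h') (at (x + t *\<^sub>R axis i 1))"
  shows "((\<lambda>t. h (x + t *\<^sub>R axis i 1)) has_vector_derivative h' (axis i 1)) (at t)"
proof -
  have "((\<lambda>t. x + t *\<^sub>R axis i (1::real)) has_derivative (\<lambda>s. s *\<^sub>R axis i 1)) (at t)"
    by (auto intro!: derivative_eq_intros)
  from diff_chain_at[OF this assms]
  show ?thesis using has_derivative_linear[OF assms]
    by (simp add: has_vector_derivative_def o_def linear_scale)
qed

text \<open>Translation invariance of \<open>lborel\<close>: the integral of the translate of h by t
  in the direction i does not depend on t, and differentiating under the integral sign at t = 0
  gives the claim. The functions \<open>H\<close> and \<open>H'\<close> are the extensions of h and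
  of its derivative by zero.\<close>

lemma integral_partial_deriv_eq_0:
  fixes h :: "real^'n \<Rightarrow> real"
  assumes \<Omega>: "open \<Omega>" "compact K" "K \<subseteq> \<Omega>" and h: "Ck_on 1 \<Omega> h"
    and 0: "\<And>x. x \<in> \<Omega> - K \<Longrightarrow> h x = 0"
  shows "(LINT x:K|lborel. partial_deriv i h x) = 0"
proof -
  define H where "H x = (if x \<in> \<Omega> then h x else 0)" for x
  define H' where "H' x = (if x \<in> \<Omega> then partial_deriv i h x else 0)" for x
  have opK: "open (- K)" using \<Omega>(2) by (simp add: compact_imp_closed open_Compl)
  have H0: "H x = 0" if "x \<notin> K" for x using 0 that by (simp add: H_def)
  have H'0: "H' x = 0" if "x \<notin> K" for x
  proof (cases "x \<in> \<Omega>")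
    case True
    then have "partial_deriv i h x = partial_deriv i (\<lambda>_. 0) x"
      using partial_deriv_cong_open[of "\<Omega> \<inter> - K" x h "\<lambda>_. 0"] opK \<Omega>(1) that 0 by auto
    then show ?thesis by (simp add: H'_def)
  qed (simp add: H'_def)
  have UN: "\<Omega> \<union> - K = UNIV" using \<Omega> by auto
  have der: "\<exists>D. (H has_derivative D) (at x) \<and> D (axis i 1) = H' x" for x
  proof (cases "x \<in> \<Omega>")
    case True
    have d: "(h has_derivative frechet_derivative h (at x)) (at x)"
      using Ck_on_Suc_has_derivative[of 0 \<Omega> h x] h True by simp
    have "(H has_derivative frechet_derivative h (at x)) (at x)"
      by (rule has_derivative_transform_within_open[OF d \<Omega>(1) True]) (simp add: H_def)
    then show ?thesis using True by (auto simp: H'_def partial_deriv_def)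
  next
    case False
    then have "x \<in> - K" using \<Omega> by auto
    have "(H has_derivative (\<lambda>_. 0)) (at x)"
      by (rule has_derivative_transform_within_open[OF has_derivative_const opK \<open>x \<in> - K\<close>, of 0])
        (simp add: H0)
    then show ?thesis using \<open>x \<in> - K\<close> H'0 by fastforce
  qed
  have contH: "continuous_on UNIV H"
    using der by (auto intro!: continuous_at_imp_continuous_on dest: has_derivative_continuous)
  have "continuous_on \<Omega> (partial_deriv i h)"
    using Ck_on_partial_deriv[of 0 \<Omega> h] h by simp
  then have "continuous_on \<Omega> H'" by (simp add: H'_def cong: continuous_on_cong)
  moreover have "continuous_on (- K) H'"
    using continuous_on_cong[of "- K" "- K" H' "\<lambda>_. 0"] H'0 by auto
  ultimately have contH': "continuous_on UNIV H'"
    using continuous_on_open_Un[OF \<Omega>(1) opK] UN by metis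
  obtain R where R: "K \<subseteq> cball 0 R" using compact_imp_bounded[OF \<Omega>(2)]
    by (metis bounded_subset_ballD ball_subset_cball subset_trans)
  \<comment> \<open>The margin 1 keeps the supports of all translates with |t| < 1 inside one fixed
    box, over which the Leibniz rule is applied.\<close>
  then obtain a b where ab: "cball 0 (R + 1) \<subseteq> cbox a (b::real^'n)"
    using bounded_subset_cbox_symmetric[OF bounded_cball] by meson
  have shiftK: "x \<in> cbox a b" if "x + t *\<^sub>R axis i 1 \<in> K" "\<bar>t\<bar> < 1" for x t
  proof -
    have "norm x \<le> norm (x + t *\<^sub>R axis i 1) + norm (t *\<^sub>R axis i (1::real) :: real^'n)"
      by (metis add_diff_cancel_right' norm_triangle_ineq4)
    also have "\<dots> \<le> R + 1" using R that by (intro add_mono) auto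
    finally show ?thesis using ab by auto
  qed
  have "cball 0 R \<subseteq> cball 0 (R + 1)" by (simp add: subset_cball)
  then have Kab: "K \<subseteq> cbox a b" using R ab by blast
  have const: "integral (cbox a b) (\<lambda>x. H (x + t *\<^sub>R axis i 1)) = (LINT x|lborel. H x)"
    if "t \<in> {-1<..<1}" for t
  proof -
    have ind: "H (x + t *\<^sub>R axis i 1) = indicator (cbox a b) x *\<^sub>R H (x + t *\<^sub>R axis i 1)" for x
      using H0 shiftK[of x t] that by (cases "x + t *\<^sub>R axis i 1 \<in> K") auto
    have "set_integrable lborel (cbox a b) (\<lambda>x. H (x + t *\<^sub>R axis i 1))"
      by (intro set_integrable_compact continuous_on_compose2[OF contH] continuous_intros) auto
    then have "integral (cbox a b) (\<lambda>x. H (x + t *\<^sub>R axis i 1)) =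
        (LINT x:cbox a b|lborel. H (x + t *\<^sub>R axis i 1))"
      by (simp add: set_borel_integral_eq_integral)
    also have "\<dots> = (LINT x|lborel. H (t *\<^sub>R axis i 1 + x))"
      unfolding set_lebesgue_integral_def ind[symmetric] by (simp add: add.commute)
    also have "\<dots> = (LINT x|distr lborel borel ((+) (t *\<^sub>R axis i 1)). H x)"
      using contH by (subst integral_distr) (auto intro: borel_measurable_continuous_onI)
    also have "\<dots> = (LINT x|lborel. H x)" by (simp add: lborel_distr_plus)
    finally show ?thesis .
  qed
  have "((\<lambda>t. integral (cbox a b) (\<lambda>x. H (x + t *\<^sub>R axis i 1))) has_vector_derivative
      integral (cbox a b) (\<lambda>x. H' (x + 0 *\<^sub>R axis i 1))) (at 0 within {-1<..<1})"
  proof (rule leibniz_rule_vector_derivative)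
    fix t x
    show "((\<lambda>t. H (x + t *\<^sub>R axis i 1)) has_vector_derivative H' (x + t *\<^sub>R axis i 1))
        (at t within {-1<..<1})"
      using der[of "x + t *\<^sub>R axis i 1"] has_vector_derivative_axis_line[of H _ x t i]
      by (metis has_vector_derivative_at_within)
    show "(\<lambda>x. H (x + t *\<^sub>R axis i 1)) integrable_on cbox a b"
      by (intro integrable_continuous continuous_on_compose2[OF contH] continuous_intros) auto
  next
    show "continuous_on ({-1<..<1} \<times> cbox a b) (\<lambda>(t, x). H' (x + t *\<^sub>R axis i 1))"
      unfolding case_prod_beta
      by (intro continuous_on_compose2[OF contH'] continuous_intros) auto
  qed auto
  then have "((\<lambda>t. integral (cbox a b) (\<lambda>x. H (x + t *\<^sub>R axis i 1))) has_vector_derivative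
      integral (cbox a b) H') (at 0)"
    by (simp add: at_within_open[of _ "{-1<..<1}"])
  moreover have "((\<lambda>t. integral (cbox a b) (\<lambda>x. H (x + t *\<^sub>R axis i 1))) has_vector_derivative 0) (at 0)"
    by (rule has_vector_derivative_transform_within_open[where S="{-1<..<1}",
          OF has_vector_derivative_const[of "LINT x|lborel. H x"]]) (simp_all add: const)
  ultimately have "integral (cbox a b) H' = 0"
    using vector_derivative_unique_at by blast
  moreover have "set_integrable lborel (cbox a b) H'"
    by (intro set_integrable_compact continuous_on_subset[OF contH']) auto
  ultimately have "(LINT x:cbox a b|lborel. H' x) = 0"
    by (simp add: set_borel_integral_eq_integral)
  moreover have "indicator (cbox a b) x *\<^sub>R H' x = indicator K x *\<^sub>R partial_deriv i h x" for x
  proof (cases "x \<in> K")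
    case True
    then show ?thesis using Kab \<Omega>(3) by (auto simp: H'_def)
  qed (simp add: H'0)
  ultimately show ?thesis unfolding set_lebesgue_integral_def by simp
qed

lemma partial_deriv_integration_by_parts:
  fixes u v :: "real^'n \<Rightarrow> real"
  assumes \<Omega>: "open \<Omega>" "compact K" "K \<subseteq> \<Omega>" and u: "Ck_on 1 \<Omega> u" and v: "Ck_on 1 \<Omega> v"
    and 0: "\<And>x. x \<in> \<Omega> - K \<Longrightarrow> u x * v x = 0"
  shows "(LINT x:K|lborel. u x * partial_deriv i v x) = - (LINT x:K|lborel. partial_deriv i u x * v x)"
proof -
  have c: "continuous_on K u" "continuous_on K v" "continuous_on K (partial_deriv i u)"
      "continuous_on K (partial_deriv i v)"
    using Ck_on_imp_continuous_on[OF u] Ck_on_imp_continuous_on[OF v]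
      Ck_on_partial_deriv[of 0 \<Omega> u i] Ck_on_partial_deriv[of 0 \<Omega> v i] u v \<Omega>(3)
    by (auto intro: continuous_on_subset)
  have "0 = (LINT x:K|lborel. partial_deriv i (\<lambda>x. u x * v x) x)"
    using integral_partial_deriv_eq_0[OF \<Omega> Ck_on_mult[OF \<Omega>(1) u v] 0] by simp
  also have "\<dots> = (LINT x:K|lborel. u x * partial_deriv i v x + partial_deriv i u x * v x)"
    using Ck_on_imp_differentiable[of 0 \<Omega> u] Ck_on_imp_differentiable[of 0 \<Omega> v] u v \<Omega>
    by (intro set_lebesgue_integral_cong) (auto simp: partial_deriv_mult subset_iff compact_imp_closed)
  also have "\<dots> = (LINT x:K|lborel. u x * partial_deriv i v x) + (LINT x:K|lborel. partial_deriv i u x * v x)"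
    by (intro set_integral_add set_integrable_compact \<Omega> continuous_intros c)
  finally show ?thesis by simp
qed

definition div_grad :: "('n::finite \<Rightarrow> 'n \<Rightarrow> real^'n \<Rightarrow> real) \<Rightarrow> (real^'n \<Rightarrow> real) \<Rightarrow> real^'n \<Rightarrow> real" where
  "div_grad a f x = (\<Sum>i\<in>UNIV. partial_deriv i (\<lambda>y. \<Sum>j\<in>UNIV. a i j y * partial_deriv j f y) x)"

lemma Ck_on_div_grad:
  assumes "open \<Omega>" "\<And>i j. Ck_on (Suc k) \<Omega> (a i j)" "Ck_on (Suc (Suc k)) \<Omega> f"
  shows "Ck_on k \<Omega> (div_grad a f)"
  unfolding div_grad_def[abs_def]
  by (intro Ck_on_sum Ck_on_partial_deriv Ck_on_mult assms)

text \<open>Integration by parts in every coordinate. Either function may be the one that vanishes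
  off \<open>K\<close>: \<open>derivative_average_bound\<close> has the bump once as the test
  function \<open>g\<close> and once as the argument \<open>f\<close> of the operator.\<close>

lemma green_first:
  fixes a :: "'n::finite \<Rightarrow> 'n \<Rightarrow> real^'n \<Rightarrow> real"
  assumes \<Omega>: "open \<Omega>" "compact K" "K \<subseteq> \<Omega>"
    and a: "\<And>i j. Ck_on 1 \<Omega> (a i j)" and f: "Ck_on 2 \<Omega> f" and g: "Ck_on 1 \<Omega> g"
    and 0: "(\<forall>x\<in>\<Omega> - K. f x = 0) \<or> (\<forall>x\<in>\<Omega> - K. g x = 0)"
  shows "(LINT x:K|lborel. g x * div_grad a f x) =
    - (LINT x:K|lborel. (\<Sum>i\<in>UNIV. \<Sum>j\<in>UNIV. a i j x * partial_deriv i g x * partial_deriv j f x))"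
proof -
  have f1: "Ck_on 1 \<Omega> (partial_deriv j f)" for j
    using Ck_on_partial_deriv[of 1 \<Omega> f] f by (simp add: numeral_2_eq_2)
  define F where "F i x = (\<Sum>j\<in>UNIV. a i j x * partial_deriv j f x)" for i x
  have F: "Ck_on 1 \<Omega> (F i)" for i
    unfolding F_def by (intro Ck_on_sum Ck_on_mult a f1 \<Omega>)
  have pf0: "partial_deriv j f x = 0" if "\<And>x. x \<in> \<Omega> - K \<Longrightarrow> f x = 0" "x \<in> \<Omega> - K" for j x
    using partial_deriv_cong_open[of "\<Omega> - K" x f "\<lambda>_. 0" j] that
      open_Diff[OF \<Omega>(1) compact_imp_closed[OF \<Omega>(2)]] by auto
  have gF: "g x * F i x = 0" if "x \<in> \<Omega> - K" for i x
    using 0 that pf0[of x] by (auto simp: F_def)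
  have c: "continuous_on K g" "\<And>i. continuous_on K (partial_deriv i g)" "\<And>i. continuous_on K (F i)"
      "\<And>i. continuous_on K (partial_deriv i (F i))"
    using continuous_on_subset[OF _ \<Omega>(3)] Ck_on_imp_continuous_on[OF g] Ck_on_imp_continuous_on[OF F]
      continuous_on_partial_deriv[OF g] continuous_on_partial_deriv[OF F]
    by blast+
  have "(LINT x:K|lborel. g x * div_grad a f x) = (LINT x:K|lborel. (\<Sum>i\<in>UNIV. g x * partial_deriv i (F i) x))"
    by (simp add: div_grad_def F_def[abs_def] sum_distrib_left)
  also have "\<dots> = (\<Sum>i\<in>UNIV. LINT x:K|lborel. g x * partial_deriv i (F i) x)"
    by (intro set_integral_sum set_integrable_compact \<Omega> continuous_intros c) auto
  also have "\<dots> = (\<Sum>i\<in>UNIV. - (LINT x:K|lborel. partial_deriv i g x * F i x))"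
    by (intro sum.cong refl partial_deriv_integration_by_parts[OF \<Omega> g F gF])
  also have "\<dots> = - (\<Sum>i\<in>UNIV. LINT x:K|lborel. partial_deriv i g x * F i x)"
    by (simp add: sum_negf)
  also have "(\<Sum>i\<in>UNIV. LINT x:K|lborel. partial_deriv i g x * F i x) =
      (LINT x:K|lborel. (\<Sum>i\<in>UNIV. partial_deriv i g x * F i x))"
    by (intro set_integral_sum[symmetric] set_integrable_compact \<Omega> continuous_intros c) auto
  finally show ?thesis by (simp add: F_def sum_distrib_left ac_simps)
qed

lemma green_second:
  fixes a :: "'n::finite \<Rightarrow> 'n \<Rightarrow> real^'n \<Rightarrow> real"
  assumes \<Omega>: "open \<Omega>" "compact K" "K \<subseteq> \<Omega>"
    and a: "\<And>i j. Ck_on 1 \<Omega> (a i j)" and sym: "\<And>i j x. x \<in> \<Omega> \<Longrightarrow> a i j x = a j i x"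
    and f: "Ck_on 2 \<Omega> f" and g: "Ck_on 2 \<Omega> g" and 0: "\<And>x. x \<in> \<Omega> - K \<Longrightarrow> g x = 0"
  shows "(LINT x:K|lborel. g x * div_grad a f x) = (LINT x:K|lborel. f x * div_grad a g x)"
proof -
  have f1: "Ck_on 1 \<Omega> f" "Ck_on 1 \<Omega> g"
    using Ck_on_mono[OF f, of 1] Ck_on_mono[OF g, of 1] by auto
  have *: "(\<Sum>i\<in>UNIV. \<Sum>j\<in>UNIV. a i j x * partial_deriv i g x * partial_deriv j f x) =
      (\<Sum>i\<in>UNIV. \<Sum>j\<in>UNIV. a i j x * partial_deriv i f x * partial_deriv j g x)" if "x \<in> \<Omega>" for x
    by (subst sum.swap) (simp add: sym[OF that] ac_simps)
  have "(LINT x:K|lborel. (\<Sum>i\<in>UNIV. \<Sum>j\<in>UNIV. a i j x * partial_deriv i g x * partial_deriv j f x)) =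
      (LINT x:K|lborel. (\<Sum>i\<in>UNIV. \<Sum>j\<in>UNIV. a i j x * partial_deriv i f x * partial_deriv j g x))"
    using * \<Omega> by (intro set_lebesgue_integral_cong) (auto simp: compact_imp_closed)
  then show ?thesis
    using green_first[OF \<Omega> a f f1(2)] green_first[OF \<Omega> a g f1(1)] 0 by auto
qed

section \<open>A local estimate for elliptic operators\<close>

lemma Cauchy_Schwarz_integral:
  fixes f g :: "'a \<Rightarrow> real"
  assumes [measurable]: "f \<in> borel_measurable M" "g \<in> borel_measurable M"
    and f2: "integrable M (\<lambda>x. (f x)\<^sup>2)" and g2: "integrable M (\<lambda>x. (g x)\<^sup>2)"
  shows "integrable M (\<lambda>x. f x * g x)"
    and "(\<integral>x. f x * g x \<partial>M)\<^sup>2 \<le> (\<integral>x. (f x)\<^sup>2 \<partial>M) * (\<integral>x. (g x)\<^sup>2 \<partial>M)"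
proof -
  show int: "integrable M (\<lambda>x. f x * g x)"
  proof (rule Bochner_Integration.integrable_bound[OF Bochner_Integration.integrable_add[OF f2 g2]])
    have "\<bar>f x * g x\<bar> \<le> (f x)\<^sup>2 + (g x)\<^sup>2" for x
      using sum_squares_bound[of "\<bar>f x\<bar>" "\<bar>g x\<bar>"] mult_nonneg_nonneg[of "\<bar>f x\<bar>" "\<bar>g x\<bar>"]
      unfolding abs_mult power2_abs by linarith
    then show "AE x in M. norm (f x * g x) \<le> norm ((f x)\<^sup>2 + (g x)\<^sup>2)" by auto
  qed simp
  define p where "p = (\<integral>x. (f x)\<^sup>2 \<partial>M)"
  define q where "q = (\<integral>x. (g x)\<^sup>2 \<partial>M)"
  define c where "c = (\<integral>x. f x * g x \<partial>M)"
  have expand: "0 \<le> s\<^sup>2 * p + 2 * s * t * c + t\<^sup>2 * q" for s t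
  proof -
    have "0 \<le> (\<integral>x. (s * f x + t * g x)\<^sup>2 \<partial>M)" by simp
    also have "\<dots> = (\<integral>x. s\<^sup>2 * (f x)\<^sup>2 + 2 * s * t * (f x * g x) + t\<^sup>2 * (g x)\<^sup>2 \<partial>M)"
      by (intro Bochner_Integration.integral_cong refl) (simp add: power2_eq_square algebra_simps)
    also have "\<dots> = s\<^sup>2 * p + 2 * s * t * c + t\<^sup>2 * q"
      unfolding p_def q_def c_def using f2 g2 int by simp
    finally show ?thesis .
  qed
  have "p \<ge> 0" "q \<ge> 0" unfolding p_def q_def by simp_all
  have "c\<^sup>2 \<le> p * q"
  proof (cases "p = 0")
    case True
    \<comment> \<open>For \<open>p = 0\<close> the quadratic form is affine in s, so it stays
      nonnegative only if \<open>c\<close> vanishes.\<close>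
    have "c = 0"
    proof (rule ccontr)
      assume "c \<noteq> 0"
      then have "2 * (- (q + 1) / c) * 1 * c = - 2 * (q + 1)" by simp
      then show False
        using expand[of "- (q + 1) / c" 1] True \<open>q \<ge> 0\<close> by simp
    qed
    then show ?thesis using True by simp
  next
    case False
    then have "p > 0" using \<open>p \<ge> 0\<close> by simp
    have "0 \<le> c\<^sup>2 * p + 2 * c * (- p) * c + (- p)\<^sup>2 * q" using expand[of c "- p"] .
    also have "\<dots> = p * (p * q - c\<^sup>2)" by (simp add: power2_eq_square algebra_simps)
    finally show ?thesis using \<open>p > 0\<close> by (simp add: zero_le_mult_iff)
  qed
  then show "(\<integral>x. f x * g x \<partial>M)\<^sup>2 \<le> (\<integral>x. (f x)\<^sup>2 \<partial>M) * (\<integral>x. (g x)\<^sup>2 \<partial>M)" by (simp add: p_def q_def c_def)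
qed

lemma set_integral_affine:
  fixes h :: "real^'n \<Rightarrow> real"
  assumes "t > 0" and [measurable]: "(\<lambda>y. indicator (cball x t) y * h y) \<in> borel_measurable borel"
  shows "(LINT y:cball x t|lborel. h y) = t ^ CARD('n) * (LINT z:cball 0 1|lborel. h (x + t *\<^sub>R z))"
proof -
  have ind: "indicator (cball x t) (x + t *\<^sub>R z) = (indicator (cball 0 1) z :: real)" for z
    using assms(1) by (auto simp: indicator_def dist_norm)
  have "(LINT y:cball x t|lborel. h y) =
      (LINT y|density (distr lborel borel (\<lambda>z. x + t *\<^sub>R z)) (\<lambda>_. ennreal (t ^ CARD('n))). indicator (cball x t) y *\<^sub>R h y)"
    unfolding set_lebesgue_integral_def using assms(1)
    by (subst lborel_affine[of t x]) (simp_all add: ennreal_power)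
  also have "\<dots> = (LINT y|distr lborel borel (\<lambda>z. x + t *\<^sub>R z). t ^ CARD('n) *\<^sub>R (indicator (cball x t) y *\<^sub>R h y))"
    using assms(1) by (subst integral_density) auto
  also have "\<dots> = (LINT z|lborel. t ^ CARD('n) *\<^sub>R (indicator (cball x t) (x + t *\<^sub>R z) *\<^sub>R h (x + t *\<^sub>R z)))"
    by (subst integral_distr) auto
  finally show ?thesis by (simp add: ind set_lebesgue_integral_def)
qed

lemma abs_vec_nth_le_norm: "norm (z::real^'n) \<le> 1 \<Longrightarrow> \<bar>z $ i\<bar> \<le> 1"
  using component_le_norm_cart[of z i] by simp

locale quadratic_bump =
  fixes M :: "'n::finite \<Rightarrow> 'n \<Rightarrow> real" and K0 :: real
  assumes M_sym: "M i j = M j i" and M_ge: "z \<bullet> z \<le> (\<Sum>i\<in>UNIV. \<Sum>j\<in>UNIV. M i j * z $ i * z $ j)"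
    and M_bd: "\<bar>M i j\<bar> \<le> K0"
begin

definition u :: "real^'n \<Rightarrow> real" where "u z = 1 - (\<Sum>i\<in>UNIV. \<Sum>j\<in>UNIV. M i j * z $ i * z $ j)"
definition \<phi> where "\<phi> z = max 0 (u z) ^ 2"
definition \<psi> where "\<psi> z = max 0 (u z) ^ 3"
definition Mz where "Mz i z = (\<Sum>j\<in>UNIV. M i j * z $ j)"

lemma K0_nonneg: "K0 \<ge> 0" using M_bd[of undefined undefined] by linarith

lemma Ck_u: "Ck_on k UNIV u"
  unfolding u_def
  by (intro Ck_on_diff Ck_on_const Ck_on_sum Ck_on_mult Ck_on_bounded_linear bounded_linear_vec_nth open_UNIV)

lemma Ck_\<phi>: "Ck_on 1 UNIV \<phi>" and Ck_\<psi>: "Ck_on 2 UNIV \<psi>"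
  unfolding \<phi>_def \<psi>_def by (intro Ck_on_pospart_power Ck_u; simp)+

lemma Ck_Mz: "Ck_on k UNIV (Mz i)"
  unfolding Mz_def by (intro Ck_on_sum Ck_on_mult Ck_on_const Ck_on_bounded_linear bounded_linear_vec_nth open_UNIV)

lemma partial_u: "partial_deriv k u z = - 2 * Mz k z"
proof -
  have "(u has_derivative (\<lambda>v. - (\<Sum>i\<in>UNIV. \<Sum>j\<in>UNIV. M i j * v $ i * z $ j + M i j * z $ i * v $ j))) (at z)"
    unfolding u_def
    by (auto intro!: derivative_eq_intros bounded_linear_imp_has_derivative[OF bounded_linear_vec_nth]
        simp: algebra_simps sum_negf[symmetric])
  from has_derivative_imp_partial_deriv[OF this, of k]
  have "partial_deriv k u z = - ((\<Sum>i\<in>UNIV. \<Sum>j\<in>UNIV. M i j * axis k 1 $ i * z $ j)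
      + (\<Sum>i\<in>UNIV. \<Sum>j\<in>UNIV. M i j * z $ i * axis k 1 $ j))"
    by (simp add: sum.distrib)
  also have "(\<Sum>i\<in>UNIV. \<Sum>j\<in>UNIV. M i j * axis k 1 $ i * z $ j) = Mz k z"
    unfolding Mz_def by (subst sum.swap) (simp add: axis_def if_distrib[of "\<lambda>x. _ * x"] if_distrib[of "\<lambda>x. x * _"] cong: if_cong)
  also have "(\<Sum>i\<in>UNIV. \<Sum>j\<in>UNIV. M i j * z $ i * axis k 1 $ j) = Mz k z"
    unfolding Mz_def by (simp add: axis_def if_distrib[of "\<lambda>x. _ * x"] M_sym[of _ k] cong: if_cong)
  finally show ?thesis by simp
qed

lemma partial_Mz: "partial_deriv k (Mz i) z = M i k"
proof -
  have "(Mz i has_derivative (\<lambda>v. \<Sum>j\<in>UNIV. M i j * v $ j)) (at z)"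
    unfolding Mz_def
    by (auto intro!: derivative_eq_intros bounded_linear_imp_has_derivative[OF bounded_linear_vec_nth])
  from has_derivative_imp_partial_deriv[OF this, of k]
  show ?thesis by (simp add: axis_def if_distrib[of "\<lambda>x. _ * x"] cong: if_cong)
qed

lemma partial_pospart:
  "partial_deriv k (\<lambda>z. max 0 (u z) ^ Suc (Suc n)) z = - 2 * real (Suc (Suc n)) * Mz k z * max 0 (u z) ^ Suc n"
proof -
  have "(u has_derivative frechet_derivative u (at z)) (at z)"
    using Ck_on_Suc_has_derivative[of 0 UNIV u z] Ck_u[of "Suc 0"] by simp
  from has_derivative_compose[OF this has_real_derivative_pospart_power[of n, unfolded has_field_derivative_def]]
  have "partial_deriv k (\<lambda>z. max 0 (u z) ^ Suc (Suc n)) z =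
      real (Suc (Suc n)) * max 0 (u z) ^ Suc n * partial_deriv k u z"
    by (auto dest!: has_derivative_imp_partial_deriv simp: partial_deriv_def)
  then show ?thesis by (simp add: partial_u algebra_simps)
qed

lemma partial_\<psi>: "partial_deriv k \<psi> z = - 6 * (Mz k z * \<phi> z)"
  using partial_pospart[of k 1 z] by (simp add: \<psi>_def[abs_def] \<phi>_def numeral_2_eq_2 numeral_3_eq_3)

lemma partial_\<phi>: "partial_deriv k \<phi> z = - 4 * (Mz k z * max 0 (u z))"
  using partial_pospart[of k 0 z] by (simp add: \<phi>_def[abs_def] numeral_2_eq_2)

lemma partial_partial_\<psi>:
  "partial_deriv i (partial_deriv j \<psi>) z = - 6 * (M j i * \<phi> z - 4 * Mz j z * Mz i z * max 0 (u z))"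
proof -
  have d: "Mz j differentiable (at z)" "\<phi> differentiable (at z)"
    using Ck_Mz[of 1 j] Ck_\<phi> by simp_all
  then have d2: "(\<lambda>z. Mz j z * \<phi> z) differentiable (at z)" by (rule differentiable_mult)
  have "partial_deriv i (partial_deriv j \<psi>) z = partial_deriv i (\<lambda>z. - 6 * (Mz j z * \<phi> z)) z"
    using partial_\<psi> by presburger
  also have "\<dots> = - 6 * (Mz j z * partial_deriv i \<phi> z + partial_deriv i (Mz j) z * \<phi> z)"
    by (simp only: partial_deriv_cmult[OF d2] partial_deriv_mult[OF d])
  finally show ?thesis by (simp add: partial_\<phi> partial_Mz algebra_simps)
qed

lemma u_le_1: "u z \<le> 1" using M_ge[of z] inner_ge_zero[of z] unfolding u_def by linarith

lemma pospart_bounds: "0 \<le> max 0 (u z)" "max 0 (u z) \<le> 1" using u_le_1[of z] by auto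

lemma \<phi>_bounds: "0 \<le> \<phi> z" "\<phi> z \<le> 1"
  using pospart_bounds[of z] unfolding \<phi>_def by (auto intro: power_le_one)

lemma \<psi>_bounds: "0 \<le> \<psi> z" "\<psi> z \<le> 1"
  using pospart_bounds[of z] unfolding \<psi>_def by (auto intro: power_le_one)

lemma bump_eq_0: "norm z \<ge> 1 \<Longrightarrow> \<phi> z = 0" "norm z \<ge> 1 \<Longrightarrow> \<psi> z = 0"
proof -
  assume "norm z \<ge> 1"
  then have "u z \<le> 0" using M_ge[of z] by (simp add: u_def power2_norm_eq_inner[symmetric])
      (smt (verit) one_le_power)
  then show "\<phi> z = 0" "\<psi> z = 0" by (simp_all add: \<phi>_def \<psi>_def max_def)
qed

lemma Mz_bound: "norm z \<le> 1 \<Longrightarrow> \<bar>Mz i z\<bar> \<le> real CARD('n) * K0"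
proof -
  assume z: "norm z \<le> 1"
  have "\<bar>Mz i z\<bar> \<le> (\<Sum>j\<in>UNIV. \<bar>M i j * z $ j\<bar>)" unfolding Mz_def by (rule sum_abs)
  also have "\<dots> \<le> (\<Sum>j\<in>(UNIV::'n set). K0 * 1)"
    unfolding abs_mult by (intro sum_mono mult_mono M_bd abs_vec_nth_le_norm z K0_nonneg) auto
  finally show ?thesis by simp
qed

lemma partial_\<psi>_bound: "norm z \<le> 1 \<Longrightarrow> \<bar>partial_deriv j \<psi> z\<bar> \<le> 6 * (real CARD('n) * K0)"
  unfolding partial_\<psi> abs_mult using mult_mono[OF Mz_bound[of z j] \<phi>_bounds(2)[of z]] \<phi>_bounds[of z] K0_nonneg
  by simp

lemma partial_partial_\<psi>_bound:
  assumes "norm z \<le> 1"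
  shows "\<bar>partial_deriv i (partial_deriv j \<psi>) z\<bar> \<le> 6 * (K0 + 4 * (real CARD('n) * K0)\<^sup>2)"
proof -
  have "\<bar>M j i * \<phi> z\<bar> \<le> K0 * 1"
    unfolding abs_mult using \<phi>_bounds[of z] by (intro mult_mono M_bd K0_nonneg) auto
  moreover have "\<bar>Mz j z * Mz i z * max 0 (u z)\<bar> \<le> (real CARD('n) * K0) * (real CARD('n) * K0) * 1"
    unfolding abs_mult using pospart_bounds[of z] K0_nonneg
    by (intro mult_mono Mz_bound assms) auto
  moreover have "\<bar>- 6 * (p - 4 * Mz j z * Mz i z * max 0 (u z))\<bar> \<le> 6 * (K0 + 4 * c\<^sup>2)"
    if "\<bar>p\<bar> \<le> K0 * 1" "\<bar>Mz j z * Mz i z * max 0 (u z)\<bar> \<le> c * c * 1" for p c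
    using that by (simp add: power2_eq_square mult.assoc)
  ultimately show ?thesis unfolding partial_partial_\<psi> by blast
qed

text \<open>The form is at most N^2 K0 |z|^2, which is at most 1/2 on this ball, so \<open>u\<close>
  is at least 1/2 there. The summand 1 under the root keeps the radius below 1 even for small
  \<open>K0\<close>.\<close>

lemma \<phi>_lower: 
  assumes "norm z \<le> 1 / sqrt (2 * (1 + real CARD('n)^2 * K0))"
  shows "\<phi> z \<ge> 1 / 4"
proof -
  define N where "N = real CARD('n)"
  have pos: "2 * (1 + N^2 * K0) > 0" using K0_nonneg by (smt (verit) mult_nonneg_nonneg zero_le_power2)
  have "(\<Sum>i\<in>UNIV. \<Sum>j\<in>UNIV. M i j * z $ i * z $ j) \<le> (\<Sum>i\<in>(UNIV::'n set). \<Sum>j\<in>(UNIV::'n set). K0 * (norm z * norm z))"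
  proof (intro sum_mono)
    fix i j
    have "M i j * z $ i * z $ j \<le> \<bar>M i j\<bar> * (\<bar>z $ i\<bar> * \<bar>z $ j\<bar>)"
      by (metis abs_ge_self abs_mult mult.assoc)
    also have "\<dots> \<le> K0 * (norm z * norm z)"
      by (intro mult_mono M_bd component_le_norm_cart K0_nonneg) auto
    finally show "M i j * z $ i * z $ j \<le> K0 * (norm z * norm z)" .
  qed
  also have "\<dots> = N^2 * K0 * (norm z)^2" by (simp add: N_def power2_eq_square)
  also have "\<dots> \<le> (1 + N^2 * K0) * (1 / sqrt (2 * (1 + N^2 * K0)))^2"
    using assms K0_nonneg unfolding N_def by (intro mult_mono power_mono) auto
  also have "\<dots> = 1 / 2"
    using pos by (simp add: power_divide)
  finally have "u z \<ge> 1 / 2" by (simp add: u_def)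
  then have "max 0 (u z) ^ 2 \<ge> (1/2)^2" by (intro power_mono) auto
  then show ?thesis by (simp add: \<phi>_def power2_eq_square)
qed

lemma integral_\<phi>_lower:
  "(LINT z:cball 0 1|lborel. \<phi> z) \<ge> measure lborel (cball (0::real^'n) (1 / sqrt (2 * (1 + real CARD('n)^2 * K0)))) / 4"
proof -
  define \<epsilon> where "\<epsilon> = 1 / sqrt (2 * (1 + real CARD('n)^2 * K0))"
  have "sqrt (2 * (1 + real CARD('n)^2 * K0)) \<ge> 1"
    using K0_nonneg by (simp add: algebra_simps)
  then have "\<epsilon> \<le> 1" unfolding \<epsilon>_def by simp
  have "measure lborel (cball (0::real^'n) \<epsilon>) / 4 = (LINT z|lborel. indicator (cball (0::real^'n) \<epsilon>) z *\<^sub>R (1/4))"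
    by simp
  also have "\<dots> \<le> (LINT z|lborel. indicator (cball 0 1) z *\<^sub>R \<phi> z)"
  proof (rule integral_mono)
    show "integrable lborel (\<lambda>z. indicator (cball (0::real^'n) \<epsilon>) z *\<^sub>R (1/4::real))"
      using set_integrable_compact[of "cball (0::real^'n) \<epsilon>" "\<lambda>_. 1/4::real"] by (simp add: set_integrable_def)
    show "integrable lborel (\<lambda>z. indicator (cball (0::real^'n) 1) z *\<^sub>R \<phi> z)"
      using set_integrable_compact[of "cball (0::real^'n) 1" \<phi>]
        continuous_on_subset[OF Ck_on_imp_continuous_on[OF Ck_\<phi>]] by (simp add: set_integrable_def)
    show "indicator (cball 0 \<epsilon>) z *\<^sub>R (1/4) \<le> indicator (cball 0 1) z *\<^sub>R \<phi> z" for z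
      using \<phi>_lower[of z] \<open>\<epsilon> \<le> 1\<close> \<phi>_bounds(1)[of z] by (auto simp: indicator_def \<epsilon>_def)
  qed
  finally show ?thesis by (simp add: set_lebesgue_integral_def \<epsilon>_def)
qed

end

lemma open_affine_preimage:
  fixes x :: "'a::real_normed_vector"
  assumes "open S"
  shows "open {z. x + t *\<^sub>R z \<in> S}"
proof -
  have "continuous_on UNIV (\<lambda>z. x + t *\<^sub>R z)" by (intro continuous_intros)
  from open_vimage[OF assms this] show ?thesis by (simp add: vimage_def)
qed

lemma norm_le_CARD_cbox:
  fixes z :: "real^'n"
  assumes "z \<in> cbox (- 1) 1"
  shows "norm z \<le> real CARD('n)"
proof -
  have "norm z \<le> (\<Sum>i\<in>UNIV. \<bar>z $ i\<bar>)" by (rule norm_le_l1_cart)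
  also have "\<dots> \<le> (\<Sum>i\<in>(UNIV::'n set). 1)"
    using assms by (intro sum_mono) (simp add: mem_box_cart abs_le_iff minus_le_iff)
  finally show ?thesis by simp
qed

lemma cball_subset_cbox: "cball 0 1 \<subseteq> cbox (- 1) (1::real^'n)"
  using abs_vec_nth_le_norm by (fastforce simp: mem_box_cart abs_le_iff)

lemma integral_cbox_eq_set_integral_cball:
  fixes h :: "real^'n \<Rightarrow> real"
  assumes "continuous_on (cbox (- 1) 1) h" "\<And>z. norm z \<ge> 1 \<Longrightarrow> h z = 0"
  shows "integral (cbox (- 1) 1) h = (LINT z:cball 0 1|lborel. h z)"
proof -
  have "integral (cbox (- 1) 1) h = (LINT z:cbox (- 1) 1|lborel. h z)"
    by (rule set_borel_integral_eq_integral(2)[symmetric]) (intro set_integrable_compact compact_cbox assms(1))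
  also have "\<dots> = (LINT z:cball 0 1|lborel. h z)"
  proof -
    have "indicator (cbox (- 1) 1) z *\<^sub>R h z = indicator (cball 0 1) z *\<^sub>R h z" for z
      using cball_subset_cbox assms(2)[of z] by (cases "norm z \<le> 1") (auto simp: indicator_def)
    then show ?thesis
      unfolding set_lebesgue_integral_def by (intro Bochner_Integration.integral_cong refl)
  qed
  finally show ?thesis .
qed

lemma set_integral_abs_le:
  fixes h :: "'a::euclidean_space \<Rightarrow> real"
  assumes "compact K" "continuous_on K h" "\<And>z. z \<in> K \<Longrightarrow> \<bar>h z\<bar> \<le> B"
  shows "\<bar>LINT z:K|lborel. h z\<bar> \<le> measure lborel K * B"
proof -
  have K: "K \<in> sets borel" by (rule borel_closed[OF compact_imp_closed[OF assms(1)]])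
  have "\<bar>LINT z:K|lborel. h z\<bar> \<le> (LINT z:K|lborel. \<bar>h z\<bar>)"
    using set_integral_norm_bound[OF set_integrable_compact[OF assms(1,2)]] by simp
  also have "\<dots> \<le> (LINT z:K|lborel. B)"
    using assms K by (intro set_integral_mono set_integrable_compact continuous_intros) auto
  also have "\<dots> = measure lborel K * B" 
    using assms(1) K emeasure_compact_finite[OF assms(1)] by (simp add: set_lebesgue_integral_def)
  finally show ?thesis .
qed

lemma has_vector_derivative_line:
  fixes f :: "real^'n \<Rightarrow> real"
  assumes "f differentiable (at (x + t *\<^sub>R z))"
  shows "((\<lambda>t. f (x + t *\<^sub>R z)) has_vector_derivative
    (\<Sum>j\<in>UNIV. z $ j * partial_deriv j f (x + t *\<^sub>R z))) (at t)"
proof -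
  have "((\<lambda>t. x + t *\<^sub>R z) has_derivative (\<lambda>s. s *\<^sub>R z)) (at t)"
    by (auto intro!: derivative_eq_intros)
  from diff_chain_at[OF this assms[unfolded frechet_derivative_works]]
  have "((\<lambda>t. f (x + t *\<^sub>R z)) has_derivative (\<lambda>s. frechet_derivative f (at (x + t *\<^sub>R z)) (s *\<^sub>R z))) (at t)"
    by (simp add: o_def)
  moreover have "frechet_derivative f (at (x + t *\<^sub>R z)) (s *\<^sub>R z) =
      s *\<^sub>R (\<Sum>j\<in>UNIV. z $ j * partial_deriv j f (x + t *\<^sub>R z))" for s
    by (simp add: frechet_derivative_eq_sum_partial_deriv[OF assms] sum_distrib_left mult.assoc)
  ultimately show ?thesis by (simp add: has_vector_derivative_def)
qed

lemma Ck_on_lipschitz_cball: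
  fixes h :: "real^'n \<Rightarrow> real"
  assumes "Ck_on 1 \<Omega> h" "cball x \<rho> \<subseteq> \<Omega>" "y \<in> cball x \<rho>"
    and "\<And>y k. y \<in> cball x \<rho> \<Longrightarrow> \<bar>partial_deriv k h y\<bar> \<le> C"
  shows "\<bar>h y - h x\<bar> \<le> real CARD('n) * C * norm (y - x)"
proof -
  have d: "h differentiable (at y)" if "y \<in> cball x \<rho>" for y
    using Ck_on_imp_differentiable[of 0 \<Omega> h y] assms(1,2) that by auto
  have "x \<in> cball x \<rho>" using assms(3) by (simp add: dist_norm) (meson norm_ge_zero order_trans)
  have "norm (h y - h x) \<le> real CARD('n) * C * norm (y - x)"
  proof (rule differentiable_bound[OF convex_cball _ _ assms(3) \<open>x \<in> cball x \<rho>\<close>])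
    fix z assume z: "z \<in> cball x \<rho>"
    then show "(h has_derivative frechet_derivative h (at z)) (at z within cball x \<rho>)"
      using d[OF z] by (simp add: frechet_derivative_works has_derivative_at_withinI)
    show "onorm (frechet_derivative h (at z)) \<le> real CARD('n) * C"
    proof (rule onorm_le)
      fix v
      have "norm (frechet_derivative h (at z) v) \<le> (\<Sum>i\<in>UNIV. \<bar>v $ i\<bar> * \<bar>partial_deriv i h z\<bar>)"
        using sum_abs[of "\<lambda>i. v $ i * partial_deriv i h z" UNIV]
        by (simp add: frechet_derivative_eq_sum_partial_deriv[OF d[OF z]] abs_mult)
      also have "\<dots> \<le> (\<Sum>i\<in>(UNIV::'n set). norm v * C)"
        by (intro sum_mono mult_mono assms(4) z component_le_norm_cart) auto
      finally show "norm (frechet_derivative h (at z) v) \<le> real CARD('n) * C * norm v"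
        by (simp add: ac_simps)
    qed
  qed
  then show ?thesis by simp
qed

lemma div_grad_expand:
  assumes "open \<Omega>" "z \<in> \<Omega>" "\<And>i j. Ck_on 1 \<Omega> (E i j)" "Ck_on 2 \<Omega> f"
  shows "div_grad E f z = (\<Sum>i\<in>UNIV. \<Sum>j\<in>UNIV.
    E i j z * partial_deriv i (partial_deriv j f) z + partial_deriv i (E i j) z * partial_deriv j f z)"
proof -
  have dE: "E i j differentiable (at z)" for i j
    using Ck_on_imp_differentiable[of 0 \<Omega> "E i j" z] assms by simp
  have df: "partial_deriv j f differentiable (at z)" for j
    using Ck_on_imp_differentiable[OF Ck_on_partial_deriv[of "Suc 0" \<Omega> f j], of z] assms
    by (simp add: numeral_2_eq_2 del: Ck_on.simps)
  show ?thesis unfolding div_grad_def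
    by (intro sum.cong refl) (simp add: partial_deriv_sum differentiable_mult dE df partial_deriv_mult)
qed

lemma div_grad_scale:
  assumes "open \<Omega>" "x + t *\<^sub>R z \<in> \<Omega>" "\<And>i j. Ck_on 1 \<Omega> (a i j)" "Ck_on 2 \<Omega> f"
  shows "div_grad (\<lambda>i j z. a i j (x + t *\<^sub>R z)) (\<lambda>z. f (x + t *\<^sub>R z)) z = t\<^sup>2 * div_grad a f (x + t *\<^sub>R z)"
proof -
  define F where "F i y = (\<Sum>j\<in>UNIV. a i j y * partial_deriv j f y)" for i y
  have f1: "Ck_on 1 \<Omega> (partial_deriv j f)" for j
    using Ck_on_partial_deriv[of 1 \<Omega> f] assms(4) by (simp add: numeral_2_eq_2)
  have F: "Ck_on 1 \<Omega> (F i)" for i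
    unfolding F_def by (intro Ck_on_sum Ck_on_mult assms f1)
  have Fd: "F i differentiable (at y)" if "y \<in> \<Omega>" for i y
    using Ck_on_imp_differentiable[of 0 \<Omega> "F i"] F that by simp
  have fd: "f differentiable (at y)" if "y \<in> \<Omega>" for y
    using Ck_on_imp_differentiable[of 1 \<Omega> f] assms(4) that by (simp add: numeral_2_eq_2)
  have \<Omega>t: "open {z. x + t *\<^sub>R z \<in> \<Omega>}"
    by (rule open_affine_preimage[OF assms(1)])
  have "partial_deriv i (\<lambda>z. \<Sum>j\<in>UNIV. a i j (x + t *\<^sub>R z) * partial_deriv j (\<lambda>z. f (x + t *\<^sub>R z)) z) z
      = t\<^sup>2 * partial_deriv i (F i) (x + t *\<^sub>R z)" for i
  proof -
    have "partial_deriv i (\<lambda>z. \<Sum>j\<in>UNIV. a i j (x + t *\<^sub>R z) * partial_deriv j (\<lambda>z. f (x + t *\<^sub>R z)) z) z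
      = partial_deriv i (\<lambda>z. t * F i (x + t *\<^sub>R z)) z"
      by (rule partial_deriv_cong_open[OF \<Omega>t])
        (use assms(2) in \<open>auto simp: F_def partial_deriv_scale fd sum_distrib_left ac_simps\<close>)
    also have "\<dots> = t * (t * partial_deriv i (F i) (x + t *\<^sub>R z))"
    proof (subst partial_deriv_cmult)
      show "(\<lambda>z. F i (x + t *\<^sub>R z)) differentiable at z"
        by (rule differentiable_chain_at[of "\<lambda>z. x + t *\<^sub>R z" z "F i", unfolded o_def])
          (auto intro!: derivative_intros Fd assms(2))
    qed (simp add: partial_deriv_scale Fd assms(2))
    finally show ?thesis by (simp add: power2_eq_square)
  qed
  then show ?thesis by (simp add: div_grad_def F_def[abs_def] sum_distrib_left)
qed

text \<open>Models the Laplacian in a chart as div (a grad f) / w, with a = sqrt(det g) g^-1 and w =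
  sqrt(det g). The inverse \<open>b\<close> of the matrix \<open>a\<close> is a parameter of its own
  because it defines the ellipsoids of the averages, and its lower bound on compact sets normalises
  them.\<close>

locale elliptic =
  fixes \<Omega> :: "(real^'n) set" and a b :: "'n \<Rightarrow> 'n \<Rightarrow> real^'n \<Rightarrow> real" and w :: "real^'n \<Rightarrow> real"
  assumes open_\<Omega>: "open \<Omega>" and Ck_a: "Ck_on m \<Omega> (a i j)" and Ck_w: "Ck_on m \<Omega> w"
    and b_cont: "continuous_on \<Omega> (b i j)"
    and w_pos: "x \<in> \<Omega> \<Longrightarrow> w x > 0"
    and a_sym: "x \<in> \<Omega> \<Longrightarrow> a i j x = a j i x" and b_sym: "x \<in> \<Omega> \<Longrightarrow> b i j x = b j i x"
    and a_mult_b: "x \<in> \<Omega> \<Longrightarrow> (\<Sum>j\<in>UNIV. a i j x * b j k x) = (if i = k then 1 else 0)"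
    and b_pos: "x \<in> \<Omega> \<Longrightarrow> z \<noteq> 0 \<Longrightarrow> (\<Sum>i\<in>UNIV. \<Sum>j\<in>UNIV. b i j x * z $ i * z $ j) > 0"
begin

definition L :: "(real^'n \<Rightarrow> real) \<Rightarrow> real^'n \<Rightarrow> real" where "L f x = div_grad a f x / w x"

text \<open>Comparison of \<open>a\<close> with its value frozen at \<open>x\<close>: along the averages \<open>\<integral> f (x + t z) \<phi> z dz\<close> of \<open>f\<close> over
  ellipsoids adapted to \<open>a x\<close>, the derivative in \<open>t\<close> only sees \<open>L f\<close> and the oscillation of \<open>a\<close>.\<close>

lemma derivative_average_bound:
  fixes f :: "real^'n \<Rightarrow> real"
  assumes bump: "quadratic_bump M K0"
    and aM: "\<And>i k. (\<Sum>j\<in>UNIV. a i j x * M j k) = (if i = k then \<kappa> else 0)" and \<kappa>: "\<kappa> > 0"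
    and x: "cball x \<rho> \<subseteq> \<Omega>" and t: "0 < t" "t \<le> \<rho>"
    and C1: "\<And>y i j k. y \<in> cball x \<rho> \<Longrightarrow> \<bar>partial_deriv k (a i j) y\<bar> \<le> C1"
    and C2: "\<And>y. y \<in> cball x \<rho> \<Longrightarrow> w y \<le> C2"
    and f: "Ck_on 2 \<Omega> f" and A: "\<And>y. y \<in> cball x \<rho> \<Longrightarrow> \<bar>f y\<bar> \<le> A"
    and B: "\<And>y. y \<in> cball x \<rho> \<Longrightarrow> \<bar>L f y\<bar> \<le> B"
  shows "6 * \<kappa> * \<bar>LINT z:cball 0 1|lborel. (\<Sum>j\<in>UNIV. z $ j * partial_deriv j f (x + t *\<^sub>R z)) * quadratic_bump.\<phi> M z\<bar>
    \<le> measure lborel (cball (0::real^'n) 1) * (t * C2 * B + (real CARD('n))\<^sup>2 *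
        (real CARD('n) * C1 * (6 * (K0 + 4 * (real CARD('n) * K0)\<^sup>2)) + C1 * (6 * (real CARD('n) * K0))) * A)"
proof -
  interpret quadratic_bump M K0 by (rule bump)
  define N where "N = real CARD('n)"
  define V where "V = measure lborel (cball (0::real^'n) 1)"
  define \<Omega>t where "\<Omega>t = {z. x + t *\<^sub>R z \<in> \<Omega>}"
  have \<Omega>t: "open \<Omega>t" unfolding \<Omega>t_def
    by (rule open_affine_preimage[OF open_\<Omega>])
  have in_ball: "x + t *\<^sub>R z \<in> cball x \<rho>" if "norm z \<le> 1" for z
    using t that mult_mono[of t \<rho> "norm z" 1] by (simp add: dist_norm)
  have K: "cball 0 1 \<subseteq> \<Omega>t" using in_ball x by (auto simp: \<Omega>t_def)
  note \<Omega>K = \<Omega>t compact_cball K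
  have aff: "Ck_on k \<Omega>t (\<lambda>z. h (x + t *\<^sub>R z))" if "Ck_on k \<Omega> h" for h :: "real^'n \<Rightarrow> real" and k
    by (rule Ck_on_compose_affine[OF \<Omega>t open_\<Omega> bounded_linear_scaleR_right _ that]) (simp add: \<Omega>t_def)
  define F where "F z = f (x + t *\<^sub>R z)" for z
  define A' where "A' i j z = a i j (x + t *\<^sub>R z)" for i j z
  define E where "E i j z = A' i j z - a i j x" for i j z
  have F2: "Ck_on 2 \<Omega>t F" unfolding F_def using aff[OF f] .
  have F1: "Ck_on 1 \<Omega>t F" using Ck_on_mono[OF F2, of 1] by simp
  have A'1: "Ck_on 1 \<Omega>t (A' i j)" for i j unfolding A'_def by (intro aff Ck_a)
  have E1: "Ck_on 1 \<Omega>t (E i j)" for i j unfolding E_def by (intro Ck_on_diff \<Omega>t A'1 Ck_on_const)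
  have \<psi>2: "Ck_on 2 \<Omega>t \<psi>" using Ck_on_subset[OF Ck_\<psi>] by blast
  have \<psi>1: "Ck_on 1 \<Omega>t \<psi>" using Ck_on_mono[OF \<psi>2, of 1] by simp
  have \<psi>0: "\<forall>z\<in>\<Omega>t - cball 0 1. \<psi> z = 0" using bump_eq_0(2) by auto
  have xx: "x \<in> \<Omega>" using in_ball[of 0] x by (simp add: subset_iff)
  have fd: "f differentiable (at y)" if "y \<in> \<Omega>" for y
    using Ck_on_imp_differentiable[of 1 \<Omega> f] f that by (simp add: numeral_2_eq_2)
  have pF: "partial_deriv j F z = t * partial_deriv j f (x + t *\<^sub>R z)" if "z \<in> \<Omega>t" for j z
    using that unfolding F_def \<Omega>t_def by (intro partial_deriv_scale fd) simp
  have green1: "(LINT z:cball 0 1|lborel. \<psi> z * div_grad A' F z) =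
      - (LINT z:cball 0 1|lborel. (\<Sum>i\<in>UNIV. \<Sum>j\<in>UNIV. A' i j z * partial_deriv i \<psi> z * partial_deriv j F z))"
    by (rule green_first[OF \<Omega>K A'1 F2 \<psi>1]) (use \<psi>0 in blast)
  have green2: "(LINT z:cball 0 1|lborel. F z * div_grad E \<psi> z) =
      - (LINT z:cball 0 1|lborel. (\<Sum>i\<in>UNIV. \<Sum>j\<in>UNIV. E i j z * partial_deriv i F z * partial_deriv j \<psi> z))"
    by (rule green_first[OF \<Omega>K E1 \<psi>2 F1]) (use \<psi>0 in blast)
  define J where "J = (LINT z:cball 0 1|lborel. (\<Sum>j\<in>UNIV. z $ j * partial_deriv j f (x + t *\<^sub>R z)) * \<phi> z)"
  have sum1: "(\<Sum>i\<in>UNIV. \<Sum>j\<in>UNIV. A' i j z * partial_deriv i \<psi> z * partial_deriv j F z)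
      - (\<Sum>i\<in>UNIV. \<Sum>j\<in>UNIV. E i j z * partial_deriv i F z * partial_deriv j \<psi> z)
      = - 6 * \<kappa> * t * ((\<Sum>j\<in>UNIV. z $ j * partial_deriv j f (x + t *\<^sub>R z)) * \<phi> z)" if "z \<in> cball 0 1" for z
  proof -
    have z: "z \<in> \<Omega>t" using that K by blast
    then have zz: "x + t *\<^sub>R z \<in> \<Omega>" by (simp add: \<Omega>t_def)
    have "(\<Sum>i\<in>UNIV. \<Sum>j\<in>UNIV. E i j z * partial_deriv i F z * partial_deriv j \<psi> z)
        = (\<Sum>i\<in>UNIV. \<Sum>j\<in>UNIV. E i j z * partial_deriv i \<psi> z * partial_deriv j F z)"
      by (subst sum.swap) (simp add: E_def A'_def a_sym[OF zz] a_sym[OF xx] ac_simps)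
    then have "(\<Sum>i\<in>UNIV. \<Sum>j\<in>UNIV. A' i j z * partial_deriv i \<psi> z * partial_deriv j F z)
      - (\<Sum>i\<in>UNIV. \<Sum>j\<in>UNIV. E i j z * partial_deriv i F z * partial_deriv j \<psi> z)
      = (\<Sum>i\<in>UNIV. \<Sum>j\<in>UNIV. a i j x * partial_deriv i \<psi> z * partial_deriv j F z)"
      by (simp add: E_def sum_subtractf[symmetric] algebra_simps)
    also have "\<dots> = (\<Sum>j\<in>UNIV. (\<Sum>i\<in>UNIV. a j i x * partial_deriv i \<psi> z) * partial_deriv j F z)"
      by (subst sum.swap) (simp add: sum_distrib_right a_sym[OF xx, of _ ] cong: sum.cong)
    also have "\<dots> = (\<Sum>j\<in>UNIV. (- 6 * \<kappa> * z $ j * \<phi> z) * partial_deriv j F z)"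
    proof (intro sum.cong refl arg_cong2[where f="(*)"])
      fix j
      have "(\<Sum>i\<in>UNIV. a j i x * partial_deriv i \<psi> z) = (\<Sum>i\<in>UNIV. \<Sum>k\<in>UNIV. - 6 * \<phi> z * (a j i x * M i k * z $ k))"
        unfolding partial_\<psi> Mz_def by (simp add: sum_distrib_left sum_distrib_right ac_simps)
      also have "\<dots> = (\<Sum>k\<in>UNIV. - 6 * \<phi> z * ((\<Sum>i\<in>UNIV. a j i x * M i k) * z $ k))"
        by (subst sum.swap) (simp add: sum_distrib_left sum_distrib_right)
      also have "\<dots> = - 6 * \<kappa> * z $ j * \<phi> z"
        unfolding aM by (simp add: if_distrib[of "\<lambda>x. x * _"] if_distrib[of "\<lambda>x. _ * x"] cong: if_cong)
      finally show "(\<Sum>i\<in>UNIV. a j i x * partial_deriv i \<psi> z) = - 6 * \<kappa> * z $ j * \<phi> z" .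
    qed
    finally show ?thesis by (simp add: pF[OF z] sum_distrib_left sum_distrib_right ac_simps)
  qed
  have cont: "continuous_on (cball 0 1) (A' i j)" "continuous_on (cball 0 1) (E i j)"
    "continuous_on (cball 0 1) F" "continuous_on (cball 0 1) \<psi>"
    "continuous_on (cball 0 1) (partial_deriv i F)" "continuous_on (cball 0 1) (partial_deriv i \<psi>)"
    "continuous_on (cball 0 1) (div_grad A' F)" "continuous_on (cball 0 1) (div_grad E \<psi>)" for i j
    using continuous_on_subset[OF _ K] Ck_on_imp_continuous_on[OF A'1] Ck_on_imp_continuous_on[OF E1]
      Ck_on_imp_continuous_on[OF F1] Ck_on_imp_continuous_on[OF \<psi>1] continuous_on_partial_deriv[OF F1]
      continuous_on_partial_deriv[OF \<psi>1]
      Ck_on_imp_continuous_on[OF Ck_on_div_grad[of \<Omega>t 0 A' F]] Ck_on_imp_continuous_on[OF Ck_on_div_grad[of \<Omega>t 0 E \<psi>]]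
      \<Omega>t A'1 E1 F2 \<psi>2 unfolding numeral_2_eq_2 One_nat_def by blast+
  have "- 6 * \<kappa> * t * J = (LINT z:cball 0 1|lborel.
      (\<Sum>i\<in>UNIV. \<Sum>j\<in>UNIV. A' i j z * partial_deriv i \<psi> z * partial_deriv j F z)
      - (\<Sum>i\<in>UNIV. \<Sum>j\<in>UNIV. E i j z * partial_deriv i F z * partial_deriv j \<psi> z))"
    unfolding J_def using sum1
    by (subst set_integral_mult_right[symmetric]) (auto intro!: set_lebesgue_integral_cong)
  also have "\<dots> = (LINT z:cball 0 1|lborel. (\<Sum>i\<in>UNIV. \<Sum>j\<in>UNIV. A' i j z * partial_deriv i \<psi> z * partial_deriv j F z))
      - (LINT z:cball 0 1|lborel. (\<Sum>i\<in>UNIV. \<Sum>j\<in>UNIV. E i j z * partial_deriv i F z * partial_deriv j \<psi> z))"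
    by (intro set_integral_diff set_integrable_compact compact_cball continuous_intros cont)
  finally have J: "6 * \<kappa> * t * J = (LINT z:cball 0 1|lborel. \<psi> z * div_grad A' F z)
      - (LINT z:cball 0 1|lborel. F z * div_grad E \<psi> z)"
    unfolding green1 green2 by simp
  have A0: "A \<ge> 0" using A[OF in_ball[of 0]] by simp
  have C10: "C1 \<ge> 0" using order_trans[OF abs_ge_zero C1[OF in_ball[of 0]]] by simp
  define E0 where "E0 = N\<^sup>2 * (N * C1 * (6 * (K0 + 4 * (N * K0)\<^sup>2)) + C1 * (6 * (N * K0)))"
  have b1: "\<bar>LINT z:cball 0 1|lborel. \<psi> z * div_grad A' F z\<bar> \<le> V * (t\<^sup>2 * (C2 * B))"
    unfolding V_def
  proof (rule set_integral_abs_le)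
    show "continuous_on (cball 0 1) (\<lambda>z. \<psi> z * div_grad A' F z)" by (intro continuous_intros cont)
    fix z :: "real^'n" assume z: "z \<in> cball 0 1"
    then have zz: "x + t *\<^sub>R z \<in> cball x \<rho>" using in_ball by simp
    then have zO: "x + t *\<^sub>R z \<in> \<Omega>" using x by blast
    have "div_grad A' F z = t\<^sup>2 * div_grad a f (x + t *\<^sub>R z)"
      unfolding A'_def[abs_def] F_def[abs_def] by (rule div_grad_scale[OF open_\<Omega> zO Ck_a f])
    also have "\<dots> = t\<^sup>2 * (w (x + t *\<^sub>R z) * L f (x + t *\<^sub>R z))"
      using w_pos[OF zO] by (simp add: L_def)
    finally have "\<bar>div_grad A' F z\<bar> = t\<^sup>2 * (w (x + t *\<^sub>R z) * \<bar>L f (x + t *\<^sub>R z)\<bar>)"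
      using w_pos[OF zO] by (simp add: abs_mult)
    also have "\<dots> \<le> t\<^sup>2 * (C2 * B)"
      using w_pos[OF zO] C2[OF zz] by (intro mult_mono C2 B zz) auto
    finally show "\<bar>\<psi> z * div_grad A' F z\<bar> \<le> t\<^sup>2 * (C2 * B)"
      unfolding abs_mult using mult_mono[of "\<bar>\<psi> z\<bar>" 1] \<psi>_bounds[of z] by fastforce
  qed simp
  have b2: "\<bar>LINT z:cball 0 1|lborel. F z * div_grad E \<psi> z\<bar> \<le> V * (A * (t * E0))"
    unfolding V_def
  proof (rule set_integral_abs_le)
    show "continuous_on (cball 0 1) (\<lambda>z. F z * div_grad E \<psi> z)" by (intro continuous_intros cont)
    fix z :: "real^'n" assume z: "z \<in> cball 0 1"
    then have z1: "norm z \<le> 1" and zt: "z \<in> \<Omega>t" using K by auto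
    then have zz: "x + t *\<^sub>R z \<in> cball x \<rho>" using in_ball by simp
    then have zO: "x + t *\<^sub>R z \<in> \<Omega>" using x by blast
    have Eb: "\<bar>E i j z\<bar> \<le> N * C1 * t" for i j
    proof -
      have "\<bar>E i j z\<bar> \<le> N * C1 * norm (x + t *\<^sub>R z - x)"
        unfolding E_def A'_def N_def by (rule Ck_on_lipschitz_cball[OF Ck_a x zz C1])
      also have "\<dots> \<le> N * C1 * (t * 1)"
        using t z1 C10 by (intro mult_left_mono) (auto simp: N_def intro: mult_left_mono)
      finally show ?thesis by simp
    qed
    have pE: "partial_deriv i (E i j) z = t * partial_deriv i (a i j) (x + t *\<^sub>R z)" for i j
    proof -
      have d: "a i j differentiable at (x + t *\<^sub>R z)"
        using Ck_on_imp_differentiable[OF Ck_a[of "Suc 0" i j] zO] .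
      have d': "A' i j differentiable (at z)"
        using Ck_on_imp_differentiable[of 0 \<Omega>t "A' i j"] A'1 zt by simp
      show ?thesis unfolding E_def
        using partial_deriv_diff[OF d' differentiable_const, of i "a i j x"] partial_deriv_scale[OF d, of i]
        by (simp add: A'_def[abs_def])
    qed
    have "\<bar>div_grad E \<psi> z\<bar> \<le> (\<Sum>i\<in>(UNIV::'n set). \<Sum>j\<in>(UNIV::'n set).
        (N * C1 * t) * (6 * (K0 + 4 * (N * K0)\<^sup>2)) + (t * C1) * (6 * (N * K0)))"
      unfolding div_grad_expand[OF \<Omega>t zt E1 \<psi>2]
    proof (intro order_trans[OF sum_abs] sum_mono order_trans[OF abs_triangle_ineq] add_mono)
      fix i j
      show "\<bar>E i j z * partial_deriv i (partial_deriv j \<psi>) z\<bar> \<le> (N * C1 * t) * (6 * (K0 + 4 * (N * K0)\<^sup>2))"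
        unfolding abs_mult using partial_partial_\<psi>_bound[OF z1] C10 t
        by (intro mult_mono Eb) (auto simp: N_def)
      have "\<bar>partial_deriv i (E i j) z\<bar> \<le> t * C1"
        unfolding pE abs_mult using C1[OF zz] t by (simp add: mult_left_mono)
      then show "\<bar>partial_deriv i (E i j) z * partial_deriv j \<psi> z\<bar> \<le> (t * C1) * (6 * (N * K0))"
        unfolding abs_mult using partial_\<psi>_bound[OF z1] C10 t
        by (intro mult_mono) (auto simp: N_def)
    qed
    also have "\<dots> = t * E0" by (simp add: E0_def N_def power2_eq_square algebra_simps)
    finally show "\<bar>F z * div_grad E \<psi> z\<bar> \<le> A * (t * E0)"
      unfolding abs_mult F_def using A0 by (intro mult_mono A zz) auto
  qed simp
  \<comment> \<open>Both bounds carry a factor t, one as t^2 from the scaling of \<open>L\<close>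
    and one from the oscillation of \<open>a\<close> over a distance t. It cancels against the t on
    the left, which stems from \<open>partial_deriv_scale\<close>.\<close>
  have "6 * \<kappa> * t * \<bar>J\<bar> = \<bar>6 * \<kappa> * t * J\<bar>" using \<kappa> t by (simp add: abs_mult)
  also have "\<dots> \<le> V * (t\<^sup>2 * (C2 * B)) + V * (A * (t * E0))" unfolding J using b1 b2 by linarith
  also have "\<dots> = t * (V * (t * C2 * B + E0 * A))" by (simp add: power2_eq_square algebra_simps)
  finally have "t * (6 * \<kappa> * \<bar>J\<bar>) \<le> t * (V * (t * C2 * B + E0 * A))" by (simp add: ac_simps)
  then have "6 * \<kappa> * \<bar>J\<bar> \<le> V * (t * C2 * B + E0 * A)" using t(1) by simp
  then show ?thesis by (simp add: J_def V_def E0_def N_def)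
qed

end

section \<open>From averages over ellipsoids to pointwise bounds\<close>

context elliptic
begin

text \<open>The average over the ellipsoid shrunk to t = 0 is f x times the integral of
  \<open>\<phi>\<close>. At t = \<rho>/n it is bounded by the L2 norm of f through Cauchy-Schwarz,
  and the mean value theorem together with \<open>derivative_average_bound\<close> controls the
  difference of the two.\<close>

lemma average_estimate:
  fixes f :: "real^'n \<Rightarrow> real"
  assumes bump: "quadratic_bump M K0"
    and aM: "\<And>i k. (\<Sum>j\<in>UNIV. a i j x * M j k) = (if i = k then \<kappa> else 0)" and \<kappa>: "\<kappa> > 0"
    and x: "cball x \<rho> \<subseteq> \<Omega>" and \<rho>: "0 < \<rho>"
    and C1: "\<And>y i j k. y \<in> cball x \<rho> \<Longrightarrow> \<bar>partial_deriv k (a i j) y\<bar> \<le> C1"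
    and C2: "\<And>y. y \<in> cball x \<rho> \<Longrightarrow> w y \<le> C2"
    and f: "Ck_on 2 \<Omega> f" and A: "\<And>y. y \<in> cball x \<rho> \<Longrightarrow> \<bar>f y\<bar> \<le> A"
    and B: "\<And>y. y \<in> cball x \<rho> \<Longrightarrow> \<bar>L f y\<bar> \<le> B"
  shows "\<bar>f x\<bar> * (LINT z:cball 0 1|lborel. quadratic_bump.\<phi> M z) \<le>
    sqrt (measure lborel (cball (0::real^'n) 1)) *
      sqrt (real CARD('n) ^ CARD('n) * (LINT y:cball x \<rho>|lborel. (f y)\<^sup>2) / \<rho> ^ CARD('n)) +
    \<rho> * (measure lborel (cball (0::real^'n) 1) * (\<rho> * C2 * B + (real CARD('n))\<^sup>2 *
        (real CARD('n) * C1 * (6 * (K0 + 4 * (real CARD('n) * K0)\<^sup>2)) + C1 * (6 * (real CARD('n) * K0))) * A))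
        / (6 * \<kappa>)"
proof -
  interpret quadratic_bump M K0 by (rule bump)
  define N where "N = real CARD('n)"
  define V where "V = measure lborel (cball (0::real^'n) 1)"
  define E0 where "E0 = (real CARD('n))\<^sup>2 *
        (real CARD('n) * C1 * (6 * (K0 + 4 * (real CARD('n) * K0)\<^sup>2)) + C1 * (6 * (real CARD('n) * K0)))"
  \<comment> \<open>The derivative under the integral is taken over the cube [-1,1]^n, whose points
    have norm up to \<open>N\<close>; this scale keeps the image of the cube inside
    \<open>cball x \<rho>\<close>.\<close>
  define \<tau> where "\<tau> = \<rho> / N"
  have N1: "N \<ge> 1" unfolding N_def by (simp add: Suc_leI)
  have \<tau>: "0 < \<tau>" "\<tau> \<le> \<rho>" using \<rho> N1 by (auto simp: \<tau>_def field_simps)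
  have V0: "V \<ge> 0" by (simp add: V_def)
  have inb: "x + t *\<^sub>R z \<in> cball x \<rho>" if "0 \<le> t" "t \<le> \<tau>" "z \<in> cbox (- 1) 1" for t z
  proof -
    have "norm (t *\<^sub>R z) \<le> \<tau> * N"
      using that norm_le_CARD_cbox[OF that(3)] by (auto simp: N_def intro!: mult_mono)
    then show ?thesis using N1 by (simp add: \<tau>_def dist_norm)
  qed
  have fd: "f differentiable (at y)" if "y \<in> \<Omega>" for y
    using Ck_on_imp_differentiable[of 1 \<Omega> f] f that by (simp add: numeral_2_eq_2)
  have f1: "Ck_on 1 \<Omega> f" using Ck_on_mono[OF f, of 1] by simp
  have fc: "continuous_on \<Omega> f" by (rule Ck_on_imp_continuous_on[OF f])
  have fpc: "continuous_on \<Omega> (partial_deriv j f)" for j by (rule continuous_on_partial_deriv[OF f1])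
  have \<phi>c: "continuous_on UNIV \<phi>" by (rule Ck_on_imp_continuous_on[OF Ck_\<phi>])
  define I where "I t = integral (cbox (- 1) 1) (\<lambda>z. f (x + t *\<^sub>R z) * \<phi> z)" for t
  define D where "D t z = (\<Sum>j\<in>UNIV. z $ j * partial_deriv j f (x + t *\<^sub>R z)) * \<phi> z" for t z
  have fI: "continuous_on (cbox (- 1) 1) (\<lambda>z. f (x + t *\<^sub>R z) * \<phi> z)" if "0 \<le> t" "t \<le> \<tau>" for t
    using inb[OF that] x
    by (intro continuous_intros continuous_on_compose2[OF fc] continuous_on_subset[OF \<phi>c]) auto
  have Dc: "continuous_on ({0..\<tau>} \<times> cbox (- 1) 1) (\<lambda>(t, z). D t z)"
    unfolding case_prod_beta D_def using inb x
    by (intro continuous_intros continuous_on_compose2[OF fpc] continuous_on_compose2[OF \<phi>c]) auto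
  have "(I has_vector_derivative integral (cbox (- 1) 1) (D t)) (at t within {0..\<tau>})"
    if "t \<in> {0..\<tau>}" for t
    unfolding I_def
  proof (rule leibniz_rule_vector_derivative[OF _ _ Dc that convex_real_interval(5)])
    fix t z assume "t \<in> {0..\<tau>}" "z \<in> cbox (- 1) (1::real^'n)"
    then have "x + t *\<^sub>R z \<in> \<Omega>" using inb[of t z] x by auto
    from has_vector_derivative_mult_left[OF has_vector_derivative_line[OF fd[OF this]], of "\<phi> z"]
    show "((\<lambda>t. f (x + t *\<^sub>R z) * \<phi> z) has_vector_derivative D t z) (at t within {0..\<tau>})"
      unfolding D_def by (rule has_vector_derivative_at_within)
  qed (use fI in \<open>auto intro!: integrable_continuous\<close>)
  then have "\<exists>t\<in>{0<..<\<tau>}. I \<tau> - I 0 = (\<tau> - 0) *\<^sub>R integral (cbox (- 1) 1) (D t)"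
    by (intro mvt_simple) (auto simp: \<tau> has_vector_derivative_def)
  then obtain t where t: "0 < t" "t < \<tau>" and mv: "I \<tau> - I 0 = \<tau> * integral (cbox (- 1) 1) (D t)"
    by auto
  have xt: "continuous_on (cbox (- 1) 1) (D t)"
    unfolding D_def using inb[of t] t x
    by (intro continuous_intros continuous_on_compose2[OF fpc] continuous_on_subset[OF \<phi>c]) auto
  have "integral (cbox (- 1) 1) (D t) = (LINT z:cball 0 1|lborel. D t z)"
    by (rule integral_cbox_eq_set_integral_cball[OF xt]) (simp add: D_def bump_eq_0)
  then have "6 * \<kappa> * \<bar>integral (cbox (- 1) 1) (D t)\<bar> \<le> V * (t * C2 * B + E0 * A)"
    using derivative_average_bound[OF bump aM \<kappa> x t(1) _ C1 C2 f A B] t \<tau>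
    by (simp add: D_def V_def E0_def)
  also have "\<dots> \<le> V * (\<rho> * C2 * B + E0 * A)"
  proof (intro mult_left_mono V0 add_right_mono mult_right_mono)
    have xin: "x \<in> cball x \<rho>" using \<rho> by simp
    show "0 \<le> B" using order_trans[OF abs_ge_zero B[OF xin]] .
    have "0 < w x" using w_pos x xin by blast
    then show "0 \<le> C2" using C2[OF xin] by simp
  qed (use t \<tau> in auto)
  finally have Db: "\<bar>integral (cbox (- 1) 1) (D t)\<bar> \<le> V * (\<rho> * C2 * B + E0 * A) / (6 * \<kappa>)"
    using \<kappa> by (simp add: field_simps)
  have I0: "I 0 = f x * (LINT z:cball 0 1|lborel. \<phi> z)"
    unfolding I_def using \<tau> fI[of 0]
    by (subst integral_cbox_eq_set_integral_cball) (simp_all add: bump_eq_0)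
  have I\<tau>: "I \<tau> = (LINT z:cball 0 1|lborel. f (x + \<tau> *\<^sub>R z) * \<phi> z)"
    unfolding I_def using \<tau> fI[of \<tau>]
    by (subst integral_cbox_eq_set_integral_cball) (simp_all add: bump_eq_0)
  have fc1: "continuous_on (cball 0 1) (\<lambda>z. f (x + \<tau> *\<^sub>R z))"
  proof (intro continuous_intros continuous_on_compose2[OF fc])
    show "(\<lambda>z. x + \<tau> *\<^sub>R z) ` cball 0 1 \<subseteq> \<Omega>"
      using inb[of \<tau>] \<tau>(1) x cball_subset_cbox by (auto simp del: mem_cball)
  qed
  have \<phi>c1: "continuous_on (cball 0 1) \<phi>" using continuous_on_subset[OF \<phi>c] by simp
  have sc: "(indicator (cball 0 1) z * h z)\<^sup>2 = indicator (cball 0 1) z *\<^sub>R (h z)\<^sup>2" for h :: "real^'n \<Rightarrow> real" and z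
    by (simp add: indicator_def)
  have "(I \<tau>)\<^sup>2 = (LINT z|lborel. (indicator (cball 0 1) z * f (x + \<tau> *\<^sub>R z)) * (indicator (cball 0 1) z * \<phi> z))\<^sup>2"
    unfolding I\<tau> set_lebesgue_integral_def
    by (intro arg_cong2[where f=power] refl Bochner_Integration.integral_cong) (simp add: indicator_def)
  also have "\<dots> \<le> (LINT z:cball 0 1|lborel. (f (x + \<tau> *\<^sub>R z))\<^sup>2) * (LINT z:cball 0 1|lborel. (\<phi> z)\<^sup>2)"
  proof -
    have m: "(\<lambda>z. indicator (cball 0 1) z * h z) \<in> borel_measurable lborel"
      "integrable lborel (\<lambda>z. indicator (cball 0 1) z *\<^sub>R (h z)\<^sup>2)" if "continuous_on (cball 0 1) h"
      for h :: "real^'n \<Rightarrow> real"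
      using set_integrable_compact[OF compact_cball that]
        set_integrable_compact[OF compact_cball continuous_on_power[OF that, of 2]]
      by (auto simp: set_integrable_def dest: borel_measurable_integrable)
    show ?thesis
      using Cauchy_Schwarz_integral(2)[of "\<lambda>z. indicator (cball 0 1) z * f (x + \<tau> *\<^sub>R z)" lborel
          "\<lambda>z. indicator (cball 0 1) z * \<phi> z"] m[OF fc1] m[OF \<phi>c1]
      by (simp only: sc[where h="\<lambda>z. f (x + \<tau> *\<^sub>R z)"] sc[where h=\<phi>] set_lebesgue_integral_def)
  qed
  also have "(LINT z:cball 0 1|lborel. (\<phi> z)\<^sup>2) \<le> V"
    using set_integral_abs_le[OF compact_cball continuous_on_power[OF \<phi>c1], of 2 1] power_le_one[OF \<phi>_bounds]
    by (simp add: V_def)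
  also have "(LINT z:cball 0 1|lborel. (f (x + \<tau> *\<^sub>R z))\<^sup>2) \<le> N ^ CARD('n) * (LINT y:cball x \<rho>|lborel. (f y)\<^sup>2) / \<rho> ^ CARD('n)"
  proof -
    have sub: "cball x \<tau> \<subseteq> cball x \<rho>" using \<tau> by (simp add: subset_cball)
    have fcb: "continuous_on (cball x r) (\<lambda>y. (f y)\<^sup>2)" if "r \<le> \<rho>" for r
      using continuous_on_subset[OF fc, of "cball x r"] x subset_cball[OF that, of x]
      by (intro continuous_on_power) blast
    have int: "set_integrable lborel (cball x r) (\<lambda>y. (f y)\<^sup>2)" if "r \<le> \<rho>" for r
      by (rule set_integrable_compact[OF compact_cball fcb[OF that]])
    have "(LINT y:cball x \<tau>|lborel. (f y)\<^sup>2) = \<tau> ^ CARD('n) * (LINT z:cball 0 1|lborel. (f (x + \<tau> *\<^sub>R z))\<^sup>2)"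
      using borel_measurable_integrable[OF int[OF \<tau>(2), unfolded set_integrable_def]]
      by (intro set_integral_affine \<tau>) simp
    moreover have "(LINT y:cball x \<tau>|lborel. (f y)\<^sup>2) \<le> (LINT y:cball x \<rho>|lborel. (f y)\<^sup>2)"
      using int[OF \<tau>(2)] int[OF order_refl] sub unfolding set_integrable_def set_lebesgue_integral_def
      by (intro integral_mono) (auto simp: indicator_def)
    ultimately have "(LINT z:cball 0 1|lborel. (f (x + \<tau> *\<^sub>R z))\<^sup>2) \<le> (LINT y:cball x \<rho>|lborel. (f y)\<^sup>2) / \<tau> ^ CARD('n)"
      using \<tau> by (simp add: field_simps)
    then show ?thesis using N1 \<rho> by (simp add: \<tau>_def power_divide field_simps)
  qed
  finally have I2: "(I \<tau>)\<^sup>2 \<le> N ^ CARD('n) * (LINT y:cball x \<rho>|lborel. (f y)\<^sup>2) / \<rho> ^ CARD('n) * V"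
    using V0 N1 \<rho> by (auto simp: mult_right_mono mult_left_mono set_lebesgue_integral_def)
  then have "\<bar>I \<tau>\<bar> \<le> sqrt V * sqrt (N ^ CARD('n) * (LINT y:cball x \<rho>|lborel. (f y)\<^sup>2) / \<rho> ^ CARD('n))"
    using real_sqrt_le_mono[OF I2]
    unfolding real_sqrt_abs real_sqrt_mult[of _ V] by (simp only: mult.commute[of "sqrt V"])
  moreover have "\<bar>I 0\<bar> \<le> \<bar>I \<tau>\<bar> + \<tau> * \<bar>integral (cbox (- 1) 1) (D t)\<bar>"
  proof -
    have "\<bar>I \<tau> - I 0\<bar> = \<tau> * \<bar>integral (cbox (- 1) 1) (D t)\<bar>"
      unfolding mv using \<tau> by (simp add: abs_mult)
    then show ?thesis by linarith
  qed
  moreover have "\<tau> * \<bar>integral (cbox (- 1) 1) (D t)\<bar> \<le> \<rho> * (V * (\<rho> * C2 * B + E0 * A) / (6 * \<kappa>))"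
    using Db \<tau> \<rho> by (intro mult_mono) auto
  moreover have "\<bar>I 0\<bar> = \<bar>f x\<bar> * (LINT z:cball 0 1|lborel. \<phi> z)"
    using \<phi>_bounds by (simp add: I0 abs_mult set_lebesgue_integral_def)
  ultimately show ?thesis by (simp add: V_def N_def E0_def)
qed

text \<open>The minimum of the form over the compact set of points of \<open>K\<close> and unit
  vectors, extended to all vectors by homogeneity.\<close>

lemma quadratic_form_lower_bound:
  assumes "compact K" "K \<subseteq> \<Omega>"
  obtains m where "m > 0"
    "\<And>x z. x \<in> K \<Longrightarrow> m * (z \<bullet> z) \<le> (\<Sum>i\<in>UNIV. \<Sum>j\<in>UNIV. b i j x * z $ i * z $ j)"
proof -
  define Q where "Q x z = (\<Sum>i\<in>UNIV. \<Sum>j\<in>UNIV. b i j x * z $ i * z $ j)" for x z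
  show thesis
  proof (cases "K = {}")
    case True
    then show thesis using that[of 1] by simp
  next
    case False
    have bc: "continuous_on (K \<times> sphere 0 1) (\<lambda>p. b i j (fst p))" for i j
      using assms(2) by (intro continuous_on_compose2[OF b_cont] continuous_intros) auto
    have "continuous_on (K \<times> sphere 0 1) (\<lambda>p. Q (fst p) (snd p))"
      unfolding Q_def by (intro continuous_intros bc)
    moreover have "compact (K \<times> sphere (0::real^'n) 1)" by (intro compact_Times assms(1) compact_sphere)
    moreover have "axis undefined 1 \<in> sphere (0::real^'n) 1" by simp
    then have "K \<times> sphere (0::real^'n) 1 \<noteq> {}" using False by blast
    ultimately obtain p where p: "p \<in> K \<times> sphere 0 1"
      and min: "\<And>q. q \<in> K \<times> sphere 0 1 \<Longrightarrow> Q (fst p) (snd p) \<le> Q (fst q) (snd q)"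
      using continuous_attains_inf[of "K \<times> sphere 0 1" "\<lambda>p. Q (fst p) (snd p)"] by blast
    define m where "m = Q (fst p) (snd p)"
    have "m > 0" unfolding m_def Q_def using p assms(2) by (intro b_pos) auto
    moreover have "m * (z \<bullet> z) \<le> Q x z" if "x \<in> K" for x z
    proof (cases "z = 0")
      case True
      then show ?thesis by (simp add: Q_def)
    next
      case False
      then have "m \<le> Q x (z /\<^sub>R norm z)" using min[of "(x, z /\<^sub>R norm z)"] that by (simp add: m_def)
      also have "\<dots> = Q x z / (z \<bullet> z)"
        by (simp add: Q_def sum_distrib_left power2_norm_eq_inner[symmetric] power2_eq_square divide_inverse ac_simps)
      finally show ?thesis using False by (simp add: field_simps)
    qed
    ultimately show thesis using that by (auto simp: Q_def)
  qed
qed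

text \<open>\<open>average_estimate\<close> with a constant that serves all x in \<open>K\<close>,
  all \<rho> up to \<open>R\<close> and all f: the quantities that depend on the coefficients are
  bounded by compactness of \<open>K\<close> and of its R-neighbourhood \<open>K'\<close>. The
  factor \<rho> in front of \<open>A\<close> is what later allows the supremum of f to be
  absorbed.\<close>

lemma local_estimate:
  assumes K: "compact K" and R: "0 < R" "\<And>x. x \<in> K \<Longrightarrow> cball x R \<subseteq> \<Omega>"
  obtains C where "C > 0"
    "\<And>x \<rho> f A B. x \<in> K \<Longrightarrow> 0 < \<rho> \<Longrightarrow> \<rho> \<le> R \<Longrightarrow> Ck_on 2 \<Omega> f \<Longrightarrow>
      (\<And>y. y \<in> cball x \<rho> \<Longrightarrow> \<bar>f y\<bar> \<le> A) \<Longrightarrow> (\<And>y. y \<in> cball x \<rho> \<Longrightarrow> \<bar>L f y\<bar> \<le> B) \<Longrightarrow>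
      \<bar>f x\<bar> \<le> C * (\<rho> * A + \<rho>\<^sup>2 * B + sqrt ((LINT y:cball x \<rho>|lborel. (f y)\<^sup>2) / \<rho> ^ CARD('n)))"
proof -
  define K' where "K' = {x + y | x y. x \<in> K \<and> y \<in> cball 0 R}"
  have K': "compact K'" unfolding K'_def by (rule compact_sums[OF K compact_cball])
  have ballK': "cball x \<rho> \<subseteq> K'" if "x \<in> K" "\<rho> \<le> R" for x \<rho>
  proof
    fix y assume "y \<in> cball x \<rho>"
    then have "y = x + (y - x)" "y - x \<in> cball 0 R" using that by (auto simp: dist_norm norm_minus_commute)
    then show "y \<in> K'" unfolding K'_def using that by blast
  qed
  have K'\<Omega>: "K' \<subseteq> \<Omega>"
  proof
    fix y assume "y \<in> K'"
    then obtain x z where "x \<in> K" "norm z \<le> R" "y = x + z" by (auto simp: K'_def)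
    then have "y \<in> cball x R" by (simp add: dist_norm)
    then show "y \<in> \<Omega>" using R(2)[OF \<open>x \<in> K\<close>] by blast
  qed
  have K\<Omega>: "K \<subseteq> \<Omega>" using R by (force simp: subset_iff)
  have bdd: "\<exists>C\<ge>0. \<forall>x\<in>S. h x \<le> C" if "compact S" "continuous_on S h" for S and h :: "real^'n \<Rightarrow> real"
  proof -
    have "bounded (h ` S)" by (intro compact_imp_bounded compact_continuous_image that)
    then obtain C where "\<forall>x\<in>S. \<bar>h x\<bar> \<le> C" by (auto simp: bounded_iff)
    then show ?thesis by (intro exI[of _ "max 0 C"]) (fastforce simp: abs_le_iff)
  qed
  have pac: "continuous_on K' (partial_deriv k (a i j))" for i j k
    by (rule continuous_on_subset[OF continuous_on_partial_deriv[OF Ck_a] K'\<Omega>])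
  have "continuous_on K' (\<lambda>y. \<Sum>i\<in>UNIV. \<Sum>j\<in>UNIV. \<Sum>k\<in>UNIV. \<bar>partial_deriv k (a i j) y\<bar>)"
    by (intro continuous_intros pac)
  from bdd[OF K' this] obtain C1 where C10: "C1 \<ge> 0" and
    C1s: "\<And>y. y \<in> K' \<Longrightarrow> (\<Sum>i\<in>UNIV. \<Sum>j\<in>UNIV. \<Sum>k\<in>UNIV. \<bar>partial_deriv k (a i j) y\<bar>) \<le> C1" by blast
  have C1: "\<bar>partial_deriv k (a i j) y\<bar> \<le> C1" if "y \<in> K'" for i j k y
  proof -
    have "\<bar>partial_deriv k (a i j) y\<bar> \<le> (\<Sum>k\<in>UNIV. \<bar>partial_deriv k (a i j) y\<bar>)"
      by (rule member_le_sum) auto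
    also have "\<dots> \<le> (\<Sum>j\<in>UNIV. \<Sum>k\<in>UNIV. \<bar>partial_deriv k (a i j) y\<bar>)"
      by (rule member_le_sum) (auto intro: sum_nonneg)
    also have "\<dots> \<le> (\<Sum>i\<in>UNIV. \<Sum>j\<in>UNIV. \<Sum>k\<in>UNIV. \<bar>partial_deriv k (a i j) y\<bar>)"
      by (rule member_le_sum[of i UNIV "\<lambda>i. \<Sum>j\<in>UNIV. \<Sum>k\<in>UNIV. \<bar>partial_deriv k (a i j) y\<bar>"])
        (auto intro: sum_nonneg)
    finally show ?thesis using C1s[OF that] by simp
  qed
  obtain C2 where C20: "C2 \<ge> 0" and C2: "\<And>y. y \<in> K' \<Longrightarrow> w y \<le> C2"
    using bdd[OF K' continuous_on_subset[OF Ck_on_imp_continuous_on[OF Ck_w] K'\<Omega>]] by blast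
  have "continuous_on K (\<lambda>y. \<Sum>i\<in>UNIV. \<Sum>j\<in>UNIV. \<bar>b i j y\<bar>)"
    by (intro continuous_intros continuous_on_subset[OF b_cont K\<Omega>])
  from bdd[OF K this] obtain C3 where C30: "C3 \<ge> 0" and
    C3s: "\<And>y. y \<in> K \<Longrightarrow> (\<Sum>i\<in>UNIV. \<Sum>j\<in>UNIV. \<bar>b i j y\<bar>) \<le> C3" by blast
  have C3: "\<bar>b i j y\<bar> \<le> C3" if "y \<in> K" for i j y
  proof -
    have "\<bar>b i j y\<bar> \<le> (\<Sum>j\<in>UNIV. \<bar>b i j y\<bar>)"
      by (rule member_le_sum) auto
    also have "\<dots> \<le> (\<Sum>i\<in>UNIV. \<Sum>j\<in>UNIV. \<bar>b i j y\<bar>)"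
      by (rule member_le_sum[of i UNIV "\<lambda>i. \<Sum>j\<in>UNIV. \<bar>b i j y\<bar>"]) (auto intro: sum_nonneg)
    finally show ?thesis using C3s[OF that] by simp
  qed
  obtain m where m: "m > 0" and
    m_le: "\<And>x z. x \<in> K \<Longrightarrow> m * (z \<bullet> z) \<le> (\<Sum>i\<in>UNIV. \<Sum>j\<in>UNIV. b i j x * z $ i * z $ j)"
    using quadratic_form_lower_bound[OF K K\<Omega>] by blast
  define K0 where "K0 = C3 / m"
  have K00: "K0 \<ge> 0" using C30 m by (simp add: K0_def)
  define V where "V = measure lborel (cball (0::real^'n) 1)"
  have V0: "V \<ge> 0" by (simp add: V_def)
  define c0 where "c0 = measure lborel (cball (0::real^'n) (1 / sqrt (2 * (1 + real CARD('n)^2 * K0)))) / 4"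
  define E0 where "E0 = (real CARD('n))\<^sup>2 *
        (real CARD('n) * C1 * (6 * (K0 + 4 * (real CARD('n) * K0)\<^sup>2)) + C1 * (6 * (real CARD('n) * K0)))"
  have E00: "E0 \<ge> 0" unfolding E0_def using C10 K00 by simp
  have "2 * (1 + real CARD('n)^2 * K0) > 0" using K00 by (smt (verit) mult_nonneg_nonneg zero_le_power2)
  then have c0: "c0 > 0" unfolding c0_def by (simp add: content_cball)
  define C where "C = (sqrt V * sqrt (real CARD('n) ^ CARD('n)) + V * C2 * m + V * E0 * m) / c0 + 1"
  have C0: "C > 0" unfolding C_def using c0 V0 C20 E00 m by (intro add_nonneg_pos) auto
  show thesis
  proof (rule that[OF C0])
    fix x \<rho> f A B
    assume x: "x \<in> K" and \<rho>: "0 < \<rho>" "\<rho> \<le> R" and f: "Ck_on 2 \<Omega> f"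
      and A: "\<And>y. y \<in> cball x \<rho> \<Longrightarrow> \<bar>f y\<bar> \<le> A" and B: "\<And>y. y \<in> cball x \<rho> \<Longrightarrow> \<bar>L f y\<bar> \<le> B"
    have x\<Omega>: "x \<in> \<Omega>" using x K\<Omega> by blast
    \<comment> \<open>Division by the lower bound \<open>m\<close> of the form gives
      \<open>M_ge\<close>; as \<open>b\<close> inverts \<open>a\<close>, the constant \<kappa> of
      the average is then 1/m.\<close>
    define M where "M i j = b i j x / m" for i j
    have bump: "quadratic_bump M K0"
    proof
      show "M i j = M j i" for i j by (simp add: M_def b_sym[OF x\<Omega>, of i j])
      show "\<bar>M i j\<bar> \<le> K0" for i j using C3[OF x, of i j] m by (simp add: M_def K0_def divide_right_mono)
      show "z \<bullet> z \<le> (\<Sum>i\<in>UNIV. \<Sum>j\<in>UNIV. M i j * z $ i * z $ j)" for z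
      proof -
        have "(\<Sum>i\<in>UNIV. \<Sum>j\<in>UNIV. M i j * z $ i * z $ j) = (\<Sum>i\<in>UNIV. \<Sum>j\<in>UNIV. b i j x * z $ i * z $ j) / m"
          by (simp add: M_def sum_divide_distrib)
        then show ?thesis using m_le[OF x, of z] m by (simp add: pos_le_divide_eq mult.commute)
      qed
    qed
    have aM: "(\<Sum>j\<in>UNIV. a i j x * M j k) = (if i = k then 1 / m else 0)" for i k
      using a_mult_b[OF x\<Omega>, of i k] by (simp add: M_def sum_divide_distrib[symmetric])
    have sub: "cball x \<rho> \<subseteq> K'" by (rule ballK'[OF x \<rho>(2)])
    define X where "X = (LINT y:cball x \<rho>|lborel. (f y)\<^sup>2) / \<rho> ^ CARD('n)"
    have X0: "X \<ge> 0" unfolding X_def using \<rho> by (simp add: set_lebesgue_integral_def)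
    have A0: "0 \<le> A" using order_trans[OF abs_ge_zero A[of x]] \<rho> by simp
    have B0: "0 \<le> B" using order_trans[OF abs_ge_zero B[of x]] \<rho> by simp
    have "c0 * \<bar>f x\<bar> \<le> (LINT z:cball 0 1|lborel. quadratic_bump.\<phi> M z) * \<bar>f x\<bar>"
      using quadratic_bump.integral_\<phi>_lower[OF bump] unfolding c0_def by (intro mult_right_mono) auto
    also have "\<dots> \<le> sqrt V * sqrt (real CARD('n) ^ CARD('n) * X) + \<rho> * (V * (\<rho> * C2 * B + E0 * A)) / (6 * (1 / m))"
      using average_estimate[OF bump aM _ _ \<rho>(1) _ _ f A B, of C1 C2] C1 C2 sub K'\<Omega> m
      by (simp add: X_def V_def E0_def mult.commute subset_iff)
    also have "\<dots> = sqrt V * sqrt (real CARD('n) ^ CARD('n)) * sqrt X + (V * C2 * m * (\<rho>\<^sup>2 * B) + V * E0 * m * (\<rho> * A)) / 6"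
      by (simp add: real_sqrt_mult power2_eq_square algebra_simps)
    also have "\<dots> \<le> sqrt V * sqrt (real CARD('n) ^ CARD('n)) * sqrt X + V * C2 * m * (\<rho>\<^sup>2 * B) + V * E0 * m * (\<rho> * A)"
      using V0 C20 E00 m A0 B0 \<rho> by (simp add: field_simps)
    also have "\<dots> \<le> (c0 * C) * (\<rho> * A + \<rho>\<^sup>2 * B + sqrt X)"
    proof -
      have "c0 * C = sqrt V * sqrt (real CARD('n) ^ CARD('n)) + V * C2 * m + V * E0 * m + c0"
        using c0 by (simp add: C_def field_simps)
      then have "sqrt V * sqrt (real CARD('n) ^ CARD('n)) \<le> c0 * C" "V * C2 * m \<le> c0 * C" "V * E0 * m \<le> c0 * C"
        using c0 V0 C20 E00 m by auto
      then have "sqrt V * sqrt (real CARD('n) ^ CARD('n)) * sqrt X \<le> c0 * C * sqrt X"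
        "V * C2 * m * (\<rho>\<^sup>2 * B) \<le> c0 * C * (\<rho>\<^sup>2 * B)" "V * E0 * m * (\<rho> * A) \<le> c0 * C * (\<rho> * A)"
        using X0 A0 B0 \<rho> by (intro mult_right_mono; simp)+
      then show ?thesis by (simp add: distrib_left)
    qed
    finally show "\<bar>f x\<bar> \<le> C * (\<rho> * A + \<rho>\<^sup>2 * B + sqrt ((LINT y:cball x \<rho>|lborel. (f y)\<^sup>2) / \<rho> ^ CARD('n)))"
      using c0 by (simp add: X_def mult.assoc)
  qed
qed

end

section \<open>Iteration of the local estimate\<close>

context elliptic
begin

text \<open>A bound for a function on a ball costs its supremum on a slightly larger ball. The
  weight, which vanishes on the boundary, closes this loop: on a ball whose radius is \<epsilon>
  times the distance to the boundary, the supremum of the function exceeds the weighted one by at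
  most 2^n over the weight at the centre. For small \<epsilon> the term with \<open>F k\<close>
  therefore has coefficient 1/4 and is absorbed, and the term with \<open>F (Suc k)\<close>, which
  stands for \<open>L (F k)\<close>, keeps a coefficient of at most 1/2.\<close>

lemma weighted_sup_step:
  fixes F :: "nat \<Rightarrow> real^'n \<Rightarrow> real"
  defines "n \<equiv> CARD('n)"
  defines "\<omega> \<equiv> \<lambda>y r k. SUP x\<in>ball y r. ((r - dist y x) / r) ^ n * \<bar>F k x\<bar>"
  assumes est: "\<And>x \<rho> f A B. x \<in> ball y r \<Longrightarrow> 0 < \<rho> \<Longrightarrow> \<rho> \<le> R \<Longrightarrow> Ck_on 2 \<Omega> f \<Longrightarrow>
      (\<And>y. y \<in> cball x \<rho> \<Longrightarrow> \<bar>f y\<bar> \<le> A) \<Longrightarrow> (\<And>y. y \<in> cball x \<rho> \<Longrightarrow> \<bar>L f y\<bar> \<le> B) \<Longrightarrow>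
      \<bar>f x\<bar> \<le> C * (\<rho> * A + \<rho>\<^sup>2 * B + sqrt ((LINT y:cball x \<rho>|lborel. (f y)\<^sup>2) / \<rho> ^ n))"
    and C: "C > 0" and \<epsilon>: "0 < \<epsilon>" "\<epsilon> \<le> 1/2" "4 * C * 2 ^ n * \<epsilon> \<le> 1"
    and r: "0 < r" "r \<le> 1" "r \<le> R" and y: "cball y r \<subseteq> \<Omega>"
    and F: "\<And>k. Ck_on 2 \<Omega> (F k)" and LF: "\<And>k x. x \<in> cball y r \<Longrightarrow> L (F k) x = - F (Suc k) x / r\<^sup>2"
    and W: "\<And>k x. x \<in> cball y r \<Longrightarrow> \<bar>F k x\<bar> \<le> W"
  shows "\<omega> y r k \<le> \<omega> y r (Suc k) / 2 + 2 * C * sqrt (1 / \<epsilon> ^ n) * sqrt ((LINT x:cball y r|lborel. (F k x)\<^sup>2) / r ^ n)"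
    and "0 \<le> \<omega> y r k" "\<omega> y r k \<le> W" and "x \<in> ball y r \<Longrightarrow> ((r - dist y x) / r) ^ n * \<bar>F k x\<bar> \<le> \<omega> y r k"
proof -
  define o' where "o' k = \<omega> y r k" for k
  define X where "X = (LINT x:cball y r|lborel. (F k x)\<^sup>2)"
  have le: "((r - dist y x) / r) ^ n * \<bar>F k x\<bar> \<le> W" if "x \<in> ball y r" for x k
  proof -
    have "((r - dist y x) / r) ^ n * \<bar>F k x\<bar> \<le> 1 ^ n * W"
      using that r W[of x k] by (intro mult_mono power_mono) (auto simp: field_simps)
    then show ?thesis by simp
  qed
  have up: "((r - dist y x) / r) ^ n * \<bar>F k x\<bar> \<le> o' k" if "x \<in> ball y r" for x k
    unfolding o'_def \<omega>_def using le that by (intro cSUP_upper bdd_aboveI2[where M=W]) auto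
  have o'0: "0 \<le> o' k" for k using up[of y k] r by simp
  have o'W: "o' k \<le> W" for k unfolding o'_def \<omega>_def using r le by (intro cSUP_least) auto
  have X0: "X \<ge> 0" unfolding X_def by (simp add: set_lebesgue_integral_def)
  define S where "S = sqrt (X / r ^ n)"
  define Ce where "Ce = C * sqrt (1 / \<epsilon> ^ n)"
  have S0: "S \<ge> 0" using X0 r by (simp add: S_def)
  have Ce: "Ce > 0" using C \<epsilon> by (simp add: Ce_def)
  have point: "((r - dist y x) / r) ^ n * \<bar>F k x\<bar> \<le> o' k / 4 + o' (Suc k) / 4 + Ce * S" if x: "x \<in> ball y r" for x
  proof -
    define d where "d = r - dist y x"
    have d: "0 < d" "d \<le> r" using x by (auto simp: d_def)
    define \<rho> where "\<rho> = \<epsilon> * d"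
    have \<rho>: "0 < \<rho>" "\<rho> \<le> d / 2" "\<rho> \<le> \<epsilon> * r" using d \<epsilon> by (auto simp: \<rho>_def intro: mult_left_mono)
    have ball: "y' \<in> ball y r \<and> r - dist y y' \<ge> d / 2" if "y' \<in> cball x \<rho>" for y'
    proof -
      have "dist y y' \<le> dist y x + \<rho>" using that dist_triangle[of y y' x] by simp
      then show ?thesis using d \<rho> by (auto simp: d_def)
    qed
    have sup: "\<bar>F j y'\<bar> \<le> o' j * (2 * r / d) ^ n" if y': "y' \<in> cball x \<rho>" for j y'
    proof -
      define d' where "d' = r - dist y y'"
      have d': "d' \<ge> d / 2" "d' > 0" using ball[OF y'] d by (auto simp: d'_def)
      have "(d / (2 * r)) ^ n * \<bar>F j y'\<bar> \<le> (d' / r) ^ n * \<bar>F j y'\<bar>"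
        using d d' r by (intro mult_right_mono power_mono) (auto simp: field_simps)
      also have "\<dots> \<le> o' j" using up[of y' j] ball[OF y'] by (simp add: d'_def)
      finally have "(d / (2 * r)) ^ n * \<bar>F j y'\<bar> * (2 * r / d) ^ n \<le> o' j * (2 * r / d) ^ n"
        using d r by (intro mult_right_mono) auto
      moreover have "(d / (2 * r)) ^ n * (2 * r / d) ^ n = 1"
        using d r by (simp add: power_mult_distrib[symmetric])
      ultimately show ?thesis by (simp add: ac_simps)
    qed
    have "\<bar>F k x\<bar> \<le> C * (\<rho> * (o' k * (2 * r / d) ^ n) + \<rho>\<^sup>2 * (o' (Suc k) * (2 * r / d) ^ n / r\<^sup>2) +
        sqrt ((LINT y:cball x \<rho>|lborel. (F k y)\<^sup>2) / \<rho> ^ n))"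
    proof (rule est[OF x \<rho>(1) _ F])
      show "\<rho> \<le> R" using \<rho> d r by simp
      show "\<bar>F k y'\<bar> \<le> o' k * (2 * r / d) ^ n" if "y' \<in> cball x \<rho>" for y' by (rule sup[OF that])
      show "\<bar>L (F k) y'\<bar> \<le> o' (Suc k) * (2 * r / d) ^ n / r\<^sup>2" if "y' \<in> cball x \<rho>" for y'
        using sup[OF that, of "Suc k"] LF[of y' k] ball[OF that] r by (simp add: abs_divide divide_right_mono)
    qed
    also have "\<dots> \<le> C * (\<rho> * (o' k * (2 * r / d) ^ n) + \<rho>\<^sup>2 * (o' (Suc k) * (2 * r / d) ^ n / r\<^sup>2) + sqrt (X / \<rho> ^ n))"
    proof -
      have "cball x \<rho> \<subseteq> cball y r" using ball by (fastforce simp: subset_iff)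
      moreover have "set_integrable lborel (cball y r) (\<lambda>y. (F k y)\<^sup>2)"
        using continuous_on_subset[OF Ck_on_imp_continuous_on[OF F] y]
        by (intro set_integrable_compact compact_cball continuous_on_power)
      moreover from this have "set_integrable lborel (cball x \<rho>) (\<lambda>y. (F k y)\<^sup>2)"
        by (rule set_integrable_subset) (use calculation in auto)
      ultimately have "(LINT y:cball x \<rho>|lborel. (F k y)\<^sup>2) \<le> X"
        unfolding X_def set_integrable_def set_lebesgue_integral_def
        by (intro integral_mono) (auto simp: indicator_def)
      then show ?thesis using C \<rho> by (simp add: divide_right_mono)
    qed
    finally have "(d / r) ^ n * \<bar>F k x\<bar> \<le> (d / r) ^ n * (C * (\<rho> * (o' k * (2 * r / d) ^ n) +
        \<rho>\<^sup>2 * (o' (Suc k) * (2 * r / d) ^ n / r\<^sup>2) + sqrt (X / \<rho> ^ n)))"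
      using d r by (intro mult_left_mono) auto
    also have "\<dots> = C * (\<rho> * o' k * ((d / r) ^ n * (2 * r / d) ^ n) +
        (\<rho> / r)\<^sup>2 * o' (Suc k) * ((d / r) ^ n * (2 * r / d) ^ n) + (d / r) ^ n * sqrt (X / \<rho> ^ n))"
      by (simp add: power_divide distrib_left ac_simps)
    also have "(d / r) ^ n * (2 * r / d) ^ n = 2 ^ n"
      using d r by (simp add: power_mult_distrib[symmetric])
    \<comment> \<open>The small radius \<rho> = \<epsilon> d costs a factor (d/r)^(-n/2) in the L2
      term, which the weight (d/r)^n outweighs.\<close>
    also have "(d / r) ^ n * sqrt (X / \<rho> ^ n) \<le> sqrt (1 / \<epsilon> ^ n) * S"
    proof -
      define q where "q = (d / r) ^ n"
      have q: "0 < q" "q \<le> 1" unfolding q_def using d r by (auto intro!: power_le_one)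
      have "\<rho> ^ n = \<epsilon> ^ n * (r ^ n * q)"
        using r by (simp add: \<rho>_def q_def power_mult_distrib power_divide)
      then have "sqrt (X / \<rho> ^ n) = sqrt (1 / \<epsilon> ^ n) * S / sqrt q"
        by (simp add: S_def real_sqrt_divide real_sqrt_mult)
      then have "q * sqrt (X / \<rho> ^ n) = sqrt (1 / \<epsilon> ^ n) * S * (q / sqrt q)" by simp
      also have "q / sqrt q = sqrt q" using q real_div_sqrt by simp
      also have "sqrt (1 / \<epsilon> ^ n) * S * sqrt q \<le> sqrt (1 / \<epsilon> ^ n) * S * 1"
        using q S0 \<epsilon> by (intro mult_left_mono) auto
      finally show ?thesis by (simp add: q_def)
    qed
    finally have "(d / r) ^ n * \<bar>F k x\<bar> \<le> C * (\<rho> * o' k * 2 ^ n + (\<rho> / r)\<^sup>2 * o' (Suc k) * 2 ^ n + sqrt (1 / \<epsilon> ^ n) * S)"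
      using C by simp
    also have "\<dots> = (C * 2 ^ n * \<rho>) * o' k + (C * 2 ^ n * (\<rho> / r)\<^sup>2) * o' (Suc k) + Ce * S"
      by (simp add: Ce_def algebra_simps)
    also have "\<dots> \<le> 1/4 * o' k + 1/4 * o' (Suc k) + Ce * S"
    proof (intro add_mono mult_right_mono o'0 order_refl)
      have "\<rho> \<le> \<epsilon>" using \<rho>(3) r \<epsilon> by (smt (verit) mult_left_le)
      then have "C * 2 ^ n * \<rho> \<le> C * 2 ^ n * \<epsilon>" using C by (intro mult_left_mono) auto
      then show "C * 2 ^ n * \<rho> \<le> 1 / 4" using \<epsilon> by simp
      have "\<rho> / r \<le> \<epsilon>" "0 \<le> \<rho> / r" using \<rho> r by (auto simp: field_simps)
      then have "(\<rho> / r)\<^sup>2 \<le> \<epsilon> * 1" unfolding power2_eq_square using \<epsilon> by (intro mult_mono) auto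
      then have "C * 2 ^ n * (\<rho> / r)\<^sup>2 \<le> C * 2 ^ n * \<epsilon>" using C by (intro mult_left_mono) auto
      then show "C * 2 ^ n * (\<rho> / r)\<^sup>2 \<le> 1 / 4" using \<epsilon> by simp
    qed (rule S0)
    finally show ?thesis by (simp add: d_def)
  qed
  have "o' k \<le> o' k / 4 + o' (Suc k) / 4 + Ce * S"
    unfolding o'_def[of k] \<omega>_def using r point
    by (intro cSUP_least) (auto simp: o'_def \<omega>_def)
  moreover have "Ce * S \<ge> 0" using Ce S0 by simp
  ultimately have "o' k \<le> o' (Suc k) / 2 + 2 * (Ce * S)" using o'0[of "Suc k"] by linarith
  then show "\<omega> y r k \<le> \<omega> y r (Suc k) / 2 + 2 * C * sqrt (1 / \<epsilon> ^ n) * sqrt ((LINT x:cball y r|lborel. (F k x)\<^sup>2) / r ^ n)"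
    by (simp add: o'_def Ce_def S_def X_def mult.assoc)
  show "0 \<le> \<omega> y r k" "\<omega> y r k \<le> W" using o'0 o'W by (auto simp: o'_def)
  show "((r - dist y x) / r) ^ n * \<bar>F k x\<bar> \<le> \<omega> y r k" if "x \<in> ball y r"
    using up[OF that] by (simp add: o'_def)
qed

text \<open>The functions \<open>F k\<close> will be \<open>(- r\<^sup>2 L)\<^sup>k f\<close> for a function \<open>f\<close> of frequencies at most \<open>1/r\<close>, so that
  all of them have comparable norms.\<close>

lemma interior_estimate:
  assumes K: "compact K" and R: "0 < R" "\<And>y. y \<in> K \<Longrightarrow> cball y (2 * R) \<subseteq> \<Omega>"
  obtains C where "C > 0"
    "\<And>y r F W x m. y \<in> K \<Longrightarrow> 0 < r \<Longrightarrow> r \<le> 1 \<Longrightarrow> r \<le> R \<Longrightarrow> (\<And>k. Ck_on 2 \<Omega> (F k)) \<Longrightarrow>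
      (\<And>k x. x \<in> cball y r \<Longrightarrow> L (F k) x = - F (Suc k) x / r\<^sup>2) \<Longrightarrow>
      (\<And>k x. x \<in> cball y r \<Longrightarrow> \<bar>F k x\<bar> \<le> W) \<Longrightarrow> x \<in> cball y (r / 2) \<Longrightarrow>
      \<bar>F 0 x\<bar> \<le> C * ((\<Sum>k<m. (1/2) ^ k * sqrt ((LINT x:cball y r|lborel. (F k x)\<^sup>2) / r ^ CARD('n))) + (1/2) ^ m * W)"
proof -
  define n where "n = CARD('n)"
  \<comment> \<open>The local estimate is applied at every point of a ball around y, not only at y
    in \<open>K\<close>. These points lie in the R-neighbourhood of \<open>K\<close>, and the room 2
    R around y leaves a ball of radius \<open>R\<close> around each of them.\<close>
  define K2 where "K2 = {x + y | x y. x \<in> K \<and> y \<in> cball 0 R}"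
  have K2: "compact K2" unfolding K2_def by (rule compact_sums[OF K compact_cball])
  have K2\<Omega>: "cball x R \<subseteq> \<Omega>" if x: "x \<in> K2" for x
  proof -
    obtain y z where yz: "y \<in> K" "norm z \<le> R" "x = y + z" using x by (auto simp: K2_def)
    have "cball x R \<subseteq> cball y (2 * R)"
    proof
      fix p assume "p \<in> cball x R"
      then show "p \<in> cball y (2 * R)"
        using yz dist_triangle[of y p x] by (simp add: dist_norm)
    qed
    then show ?thesis using R(2)[OF yz(1)] by blast
  qed
  obtain C where C: "C > 0" and est:
    "\<And>x \<rho> f A B. x \<in> K2 \<Longrightarrow> 0 < \<rho> \<Longrightarrow> \<rho> \<le> R \<Longrightarrow> Ck_on 2 \<Omega> f \<Longrightarrow>
      (\<And>y. y \<in> cball x \<rho> \<Longrightarrow> \<bar>f y\<bar> \<le> A) \<Longrightarrow> (\<And>y. y \<in> cball x \<rho> \<Longrightarrow> \<bar>L f y\<bar> \<le> B) \<Longrightarrow>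
      \<bar>f x\<bar> \<le> C * (\<rho> * A + \<rho>\<^sup>2 * B + sqrt ((LINT y:cball x \<rho>|lborel. (f y)\<^sup>2) / \<rho> ^ n))"
    unfolding n_def using local_estimate[OF K2 R(1) K2\<Omega>] by metis
  define \<epsilon> where "\<epsilon> = min (1/2) (1 / (4 * C * 2 ^ n))"
  have \<epsilon>: "0 < \<epsilon>" "\<epsilon> \<le> 1/2" "4 * C * 2 ^ n * \<epsilon> \<le> 1"
    using C by (auto simp: \<epsilon>_def min_def field_simps)
  define C' where "C' = 2 * C * sqrt (1 / \<epsilon> ^ n)"
  have C': "C' > 0" using C \<epsilon> by (simp add: C'_def)
  show thesis
  proof (rule that[of "2 ^ n * (C' + 1)"])
    show "2 ^ n * (C' + 1) > 0" using C' by simp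
    fix y r F W x m
    assume y: "y \<in> K" and r: "0 < r" "r \<le> 1" "r \<le> R" and F: "\<And>k. Ck_on 2 \<Omega> (F k)"
      and LF: "\<And>k x. x \<in> cball y r \<Longrightarrow> L (F k) x = - F (Suc k) x / r\<^sup>2"
      and W: "\<And>k x. x \<in> cball y r \<Longrightarrow> \<bar>F k x\<bar> \<le> W" and x: "x \<in> cball y (r / 2)"
    define \<omega> where "\<omega> k = (SUP x\<in>ball y r. ((r - dist y x) / r) ^ n * \<bar>F k x\<bar>)" for k
    define S where "S k = sqrt ((LINT x:cball y r|lborel. (F k x)\<^sup>2) / r ^ n)" for k
    have inK2: "p \<in> K2" if "p \<in> ball y r" for p
    proof -
      have "p = y + (p - y)" "p - y \<in> cball 0 R" using that r by (auto simp: dist_norm norm_minus_commute)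
      then show ?thesis using y unfolding K2_def by blast
    qed
    have y\<Omega>: "cball y r \<subseteq> \<Omega>" using R(2)[OF y] r R(1) by (auto simp: subset_iff)
    note step = weighted_sup_step[where F=F and y=y and r=r and W=W and R=R and C=C and \<epsilon>=\<epsilon>, OF est[OF inK2, unfolded n_def] C \<epsilon>[unfolded n_def] r y\<Omega> F LF W, folded n_def]
    have S0: "S k \<ge> 0" for k using r by (simp add: S_def set_lebesgue_integral_def)
    \<comment> \<open>Unrolls the step m times. The remainder only involves a crude bound
      \<open>W\<close> that is uniform in k, and a large m makes it negligible.\<close>
    have "\<omega> 0 \<le> (\<Sum>k<m. (1/2) ^ k * (C' * S k)) + (1/2) ^ m * \<omega> m"
    proof (induction m)
      case (Suc m)
      have "\<omega> m \<le> \<omega> (Suc m) / 2 + C' * S m" using step(1)[of m] unfolding \<omega>_def C'_def S_def .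
      then have "(1/2) ^ m * \<omega> m \<le> (1/2) ^ m * (\<omega> (Suc m) / 2 + C' * S m)" by (intro mult_left_mono) auto
      with Suc show ?case by (simp add: algebra_simps)
    qed simp
    also have "\<dots> \<le> C' * (\<Sum>k<m. (1/2) ^ k * S k) + (1/2) ^ m * W"
    proof -
      have "\<omega> m \<le> W" using step(3)[of m] unfolding \<omega>_def .
      then have "(1/2) ^ m * \<omega> m \<le> (1/2) ^ m * W" by (intro mult_left_mono) auto
      moreover have "(\<Sum>k<m. (1/2) ^ k * (C' * S k)) = C' * (\<Sum>k<m. (1/2) ^ k * S k)"
        unfolding sum_distrib_left by (intro sum.cong refl) simp
      ultimately show ?thesis by simp
    qed
    also have "\<dots> \<le> (C' + 1) * ((\<Sum>k<m. (1/2) ^ k * S k) + (1/2) ^ m * W)"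
    proof -
      have "W \<ge> 0" using order_trans[OF abs_ge_zero W[of y 0]] r by simp
      moreover have "(\<Sum>k<m. (1/2) ^ k * S k) \<ge> 0" using S0 by (intro sum_nonneg) simp
      ultimately show ?thesis using C' by (simp add: algebra_simps)
    qed
    finally have \<omega>0: "\<omega> 0 \<le> (C' + 1) * ((\<Sum>k<m. (1/2) ^ k * S k) + (1/2) ^ m * W)" .
    have "(1/2) ^ n * \<bar>F 0 x\<bar> \<le> ((r - dist y x) / r) ^ n * \<bar>F 0 x\<bar>"
    proof (intro mult_right_mono power_mono)
      have "r / 2 \<le> r - dist y x" using x by simp
      then show "1 / 2 \<le> (r - dist y x) / r" using r by (simp add: pos_le_divide_eq)
    qed auto
    also have "\<dots> \<le> \<omega> 0"
    proof -
      have "dist y x \<le> r / 2" using x by simp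
      then have "dist y x < r" using r(1) by linarith
      then have "x \<in> ball y r" by simp
      then show ?thesis unfolding \<omega>_def n_def
        by (intro weighted_sup_step(4)[where F=F and y=y and r=r and W=W and R=R and C=C and \<epsilon>=\<epsilon>,
              OF est[OF inK2, unfolded n_def] C \<epsilon>[unfolded n_def] r y\<Omega> F LF W])
    qed
    finally have "2 ^ n * ((1/2) ^ n * \<bar>F 0 x\<bar>) \<le> 2 ^ n * \<omega> 0" by (intro mult_left_mono) auto
    moreover have "(2::real) ^ n * ((1/2) ^ n * \<bar>F 0 x\<bar>) = \<bar>F 0 x\<bar>"
      unfolding mult.assoc[symmetric] power_mult_distrib[symmetric] by simp
    ultimately have "\<bar>F 0 x\<bar> \<le> 2 ^ n * \<omega> 0" by simp
    also have "\<dots> \<le> 2 ^ n * ((C' + 1) * ((\<Sum>k<m. (1/2) ^ k * S k) + (1/2) ^ m * W))"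
      using \<omega>0 by (intro mult_left_mono) auto
    finally show "\<bar>F 0 x\<bar> \<le> 2 ^ n * (C' + 1) * ((\<Sum>k<m. (1/2) ^ k * sqrt ((LINT x:cball y r|lborel. (F k x)\<^sup>2) / r ^ CARD('n))) + (1/2) ^ m * W)"
      by (simp add: S_def n_def mult.assoc)
  qed
qed

end

section \<open>Change of variables for arbitrary finite index types\<close>

text \<open>The library states the change of variables formula for well-ordered index types only; it is
  transported along a bijection with an initial segment of the natural numbers.\<close>

typedef ('n::finite) ord_index = "{..<CARD('n)}"
  by (intro exI[of _ 0]) simp

instance ord_index :: (finite) finite
proof
  show "finite (UNIV :: 'a ord_index set)"
    by (rule finite_imageD[of Rep_ord_index])
      (auto simp: inj_on_def Rep_ord_index_inject intro!: finite_subset[OF _ finite_lessThan[of "CARD('a)"]]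
        Rep_ord_index[unfolded lessThan_iff])
qed

instantiation ord_index :: (finite) wellorder
begin

definition less_eq_ord_index :: "'a ord_index \<Rightarrow> 'a ord_index \<Rightarrow> bool" where
  "less_eq_ord_index i j \<longleftrightarrow> Rep_ord_index i \<le> Rep_ord_index j"

definition less_ord_index :: "'a ord_index \<Rightarrow> 'a ord_index \<Rightarrow> bool" where
  "less_ord_index i j \<longleftrightarrow> Rep_ord_index i < Rep_ord_index j"

instance
proof
  fix P :: "'a ord_index \<Rightarrow> bool" and i
  assume *: "\<And>x. (\<And>y. y < x \<Longrightarrow> P y) \<Longrightarrow> P x"
  show "P i"
    by (induction "Rep_ord_index i" arbitrary: i rule: less_induct) (auto intro: * simp: less_ord_index_def)
qed (auto simp: less_eq_ord_index_def less_ord_index_def Rep_ord_index_inject)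

end

lemma card_ord_index: "CARD('n::finite ord_index) = CARD('n)"
  using type_definition.card[OF type_definition_ord_index] by simp

definition of_ord_index :: "'n::finite ord_index \<Rightarrow> 'n" where
  "of_ord_index = (SOME h. bij h)"

lemma bij_of_ord_index: "bij (of_ord_index :: 'n::finite ord_index \<Rightarrow> 'n)"
proof -
  have "\<exists>h :: 'n ord_index \<Rightarrow> 'n. bij_betw h UNIV UNIV"
    by (rule finite_same_card_bij) (auto simp: card_ord_index)
  then show ?thesis unfolding of_ord_index_def by (rule someI_ex)
qed

definition vec_ord :: "real^'n \<Rightarrow> real^('n::finite ord_index)" where
  "vec_ord v = (\<chi> k. v $ of_ord_index k)"

definition vec_unord :: "real^('n::finite ord_index) \<Rightarrow> real^'n" where
  "vec_unord u = (\<chi> i. u $ inv of_ord_index i)"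

lemma vec_ord_unord[simp]: "vec_ord (vec_unord u) = u" "vec_unord (vec_ord v) = v"
  using bij_of_ord_index[where 'n='b] bij_of_ord_index[where 'n='a]
  by (auto simp: vec_ord_def vec_unord_def vec_eq_iff bij_is_inj bij_is_surj surj_f_inv_f)

lemma bounded_linear_vec_ord: "bounded_linear vec_ord" and bounded_linear_vec_unord: "bounded_linear vec_unord"
  unfolding linear_conv_bounded_linear[symmetric]
  by (auto intro!: linearI simp: vec_ord_def vec_unord_def vec_eq_iff)

lemma borel_measurable_vec_ord[measurable]: "vec_ord \<in> borel_measurable borel"
  and borel_measurable_vec_unord[measurable]: "vec_unord \<in> borel_measurable borel"
  by (intro borel_measurable_continuous_onI linear_continuous_on bounded_linear_vec_ord bounded_linear_vec_unord)+

lemma prod_Basis_vec: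
  fixes v :: "real^'n" and f :: "real \<Rightarrow> 'c::comm_monoid_mult"
  shows "(\<Prod>b\<in>Basis. f (v \<bullet> b)) = (\<Prod>i\<in>UNIV. f (v $ i))"
proof -
  have B: "(Basis :: (real^'n) set) = (\<lambda>i. axis i 1) ` UNIV" by (auto simp: Basis_vec_def)
  have inj: "inj (\<lambda>i::'n. axis i (1::real))" by (auto simp: inj_on_def axis_eq_axis)
  show ?thesis unfolding B prod.reindex[OF inj] by (simp add: inner_axis)
qed

lemma lborel_vec_ord: "distr lborel borel vec_ord = (lborel :: (real^('n::finite ord_index)) measure)"
proof (rule lborel_eqI[symmetric])
  fix l u :: "real^'n ord_index"
  assume le: "\<And>b. b \<in> Basis \<Longrightarrow> l \<bullet> b \<le> u \<bullet> b"
  have le': "l $ k \<le> u $ k" for k using le[of "axis k 1"] by (simp add: inner_axis)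
  have "vec_ord -` box l u = box (vec_unord l) (vec_unord u)"
    using bij_of_ord_index[where 'n='n]
    by (auto simp: mem_box_cart vec_ord_def vec_unord_def)
      (metis bij_inv_eq_iff)+
  then have "emeasure (distr lborel borel vec_ord) (box l u) = emeasure lborel (box (vec_unord l) (vec_unord u))"
    by (simp add: emeasure_distr)
  also have "\<dots> = (\<Prod>b\<in>Basis. (vec_unord u - vec_unord l) \<bullet> b)"
    by (rule emeasure_lborel_box) (auto simp: Basis_vec_def inner_axis vec_unord_def le')
  also have "\<dots> = (\<Prod>i\<in>UNIV. (u - l) $ inv of_ord_index i)"
    using prod_Basis_vec[of "\<lambda>x. x" "vec_unord u - vec_unord l"] by (simp add: vec_unord_def)
  also have "\<dots> = (\<Prod>k\<in>UNIV. (u - l) $ k)"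
    using prod.reindex_bij_betw[OF bij_imp_bij_inv[OF bij_of_ord_index], of "\<lambda>k. (u - l) $ k"] by simp
  also have "\<dots> = (\<Prod>b\<in>Basis. (u - l) \<bullet> b)" using prod_Basis_vec[of "\<lambda>x. x" "u - l"] by simp
  finally show "emeasure (distr lborel borel vec_ord) (box l u) = (\<Prod>b\<in>Basis. (u - l) \<bullet> b)" .
qed simp

lemma permutes_UNIV_iff_bij: "p permutes UNIV \<longleftrightarrow> bij p"
  using bij_imp_permutes[of p UNIV] permutes_bij[of p UNIV] by auto

text \<open>Conjugation by \<open>h\<close> maps transpositions to transpositions, and the induction
  builds the permutation from them.\<close>

lemma sign_conjugate:
  fixes h :: "'a::finite \<Rightarrow> 'b::finite"
  assumes "bij h" "p permutes UNIV"
  shows "sign (h \<circ> p \<circ> inv h) = sign p"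
  using assms(2) finite_class.finite_UNIV
proof (induction rule: permutes_induct)
  case id
  have "h \<circ> id \<circ> inv h = id" using assms(1) by (simp add: surj_iff[symmetric] bij_is_surj)
  then show ?case by simp
next
  case (swap a b p)
  have "bij p" using swap.hyps by (simp add: permutes_bij)
  have perm: "permutation q" if "bij q" for q :: "'c::finite \<Rightarrow> 'c"
    unfolding permutation_permutes using that permutes_UNIV_iff_bij finite_class.finite_UNIV by blast
  have conj: "h \<circ> Transposition.transpose a b \<circ> inv h = Transposition.transpose (h a) (h b)"
  proof
    fix y
    obtain x where "y = h x" using assms(1) by (metis bij_pointE)
    then show "(h \<circ> Transposition.transpose a b \<circ> inv h) y = Transposition.transpose (h a) (h b) y"
      using assms(1) by (auto simp: Transposition.transpose_def bij_is_inj inj_eq)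
  qed
  have "h \<circ> (Transposition.transpose a b \<circ> p) \<circ> inv h =
      (h \<circ> Transposition.transpose a b \<circ> inv h) \<circ> (h \<circ> p \<circ> inv h)"
    using assms(1) by (auto simp: fun_eq_iff bij_is_inj)
  also have "\<dots> = Transposition.transpose (h a) (h b) \<circ> (h \<circ> p \<circ> inv h)" unfolding conj ..
  finally have "sign (h \<circ> (Transposition.transpose a b \<circ> p) \<circ> inv h) =
      sign (Transposition.transpose (h a) (h b)) * sign (h \<circ> p \<circ> inv h)"
    using assms(1) \<open>bij p\<close> by (simp add: sign_compose perm bij_comp bij_imp_bij_inv)
  also have "\<dots> = sign (Transposition.transpose a b) * sign p"
    by (simp only: swap.IH sign_swap_id inj_eq[OF bij_is_inj[OF assms(1)]])
  also have "\<dots> = sign (Transposition.transpose a b \<circ> p)"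
    using \<open>bij p\<close> by (simp add: sign_compose perm)
  finally show ?case .
qed

lemma det_reindex:
  fixes A :: "real^'b^'b" and h :: "'a::finite \<Rightarrow> 'b::finite"
  assumes "bij h"
  shows "det (\<chi> k l. A $ h k $ h l) = det A"
proof -
  have inj: "inj h" and surj: "surj h" using assms by (auto simp: bij_def)
  have "det A = (\<Sum>q | q permutes UNIV. of_int (sign q) * (\<Prod>i\<in>UNIV. A $ i $ q i))"
    by (simp add: det_def)
  also have "\<dots> = (\<Sum>p | p permutes UNIV. of_int (sign (h \<circ> p \<circ> inv h)) * (\<Prod>i\<in>UNIV. A $ i $ (h \<circ> p \<circ> inv h) i))"
  proof (rule sum.reindex_bij_witness[where i="\<lambda>p. h \<circ> p \<circ> inv h" and j="\<lambda>q. inv h \<circ> q \<circ> h"])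
    show "h \<circ> (inv h \<circ> q \<circ> h) \<circ> inv h = q" for q
      using surj by (auto simp: fun_eq_iff surj_f_inv_f)
    show "inv h \<circ> (h \<circ> p \<circ> inv h) \<circ> h = p" for p
      using inj by (auto simp: fun_eq_iff)
    show "inv h \<circ> q \<circ> h \<in> {p. p permutes UNIV}" if "q \<in> {q. q permutes UNIV}" for q
      using that assms by (auto simp: permutes_UNIV_iff_bij intro!: bij_comp bij_imp_bij_inv)
    show "h \<circ> p \<circ> inv h \<in> {q. q permutes UNIV}" if "p \<in> {p. p permutes UNIV}" for p
      using that assms by (auto simp: permutes_UNIV_iff_bij intro!: bij_comp bij_imp_bij_inv)
    show "of_int (sign (h \<circ> (inv h \<circ> q \<circ> h) \<circ> inv h)) * (\<Prod>i\<in>UNIV. A $ i $ (h \<circ> (inv h \<circ> q \<circ> h) \<circ> inv h) i)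
        = of_int (sign q) * (\<Prod>i\<in>UNIV. A $ i $ q i)" for q
      using surj by (simp add: o_def surj_f_inv_f)
  qed
  also have "\<dots> = (\<Sum>p | p permutes UNIV. of_int (sign p) * (\<Prod>k\<in>UNIV. A $ h k $ h (p k)))"
  proof (intro sum.cong refl)
    fix p :: "'a \<Rightarrow> 'a" assume "p \<in> {p. p permutes UNIV}"
    moreover have "(\<Prod>i\<in>UNIV. A $ i $ (h \<circ> p \<circ> inv h) i) = (\<Prod>k\<in>UNIV. A $ h k $ h (p k))"
      using prod.reindex_bij_betw[OF assms, of "\<lambda>i. A $ i $ (h \<circ> p \<circ> inv h) i"] inj by simp
    ultimately show "of_int (sign (h \<circ> p \<circ> inv h)) * (\<Prod>i\<in>UNIV. A $ i $ (h \<circ> p \<circ> inv h) i) =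
        of_int (sign p) * (\<Prod>k\<in>UNIV. A $ h k $ h (p k))"
      by (simp add: sign_conjugate[OF assms])
  qed
  finally show ?thesis by (simp add: det_def)
qed

text \<open>By the formula for the Henstock-Kurzweil integral, one side equals a given real r
  exactly if the other does. Letting r range over all reals also settles the case of an infinite
  integral.\<close>

lemma nn_integral_change_of_variables_wellorder:
  fixes f :: "real^'n::{finite,wellorder} \<Rightarrow> real" and g h :: "real^'n::_ \<Rightarrow> real^'n::_"
  assumes g: "\<And>x. x \<in> S \<Longrightarrow> (g has_derivative g' x) (at x within S)"
    and h: "\<And>y. y \<in> T \<Longrightarrow> (h has_derivative h' y) (at y within T)"
    and f: "\<And>y. y \<in> T \<Longrightarrow> 0 \<le> f y"
    and gh: "\<And>x. x \<in> S \<Longrightarrow> g x \<in> T \<and> h (g x) = x" "\<And>y. y \<in> T \<Longrightarrow> h y \<in> S \<and> g (h y) = y"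
      "\<And>y. y \<in> T \<Longrightarrow> h' y \<circ> g' (h y) = id"
    and meas: "(\<lambda>y. indicator T y * f y) \<in> borel_measurable borel"
      "(\<lambda>x. indicator S x * (\<bar>det (matrix (g' x))\<bar> * f (g x))) \<in> borel_measurable borel"
  shows "(\<integral>\<^sup>+y. ennreal (indicator T y * f y) \<partial>lborel) =
    (\<integral>\<^sup>+x. ennreal (indicator S x * (\<bar>det (matrix (g' x))\<bar> * f (g x))) \<partial>lborel)"
proof -
  define F1 where "F1 y = indicator T y * f y" for y
  define F2 where "F2 x = indicator S x * (\<bar>det (matrix (g' x))\<bar> * f (g x))" for x
  have nn: "0 \<le> F1 y" "0 \<le> F2 y" for y using f gh(1) by (auto simp: F1_def F2_def indicator_def)
  have m: "F1 \<in> borel_measurable borel" "F2 \<in> borel_measurable borel"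
    using meas unfolding F1_def F2_def by auto
  have i: "F1 = (\<lambda>y. if y \<in> T then f y else 0)" "F2 = (\<lambda>x. if x \<in> S then \<bar>det (matrix (g' x))\<bar> * f (g x) else 0)"
    by (auto simp: F1_def F2_def indicator_def)
  have "(F2 has_integral r) UNIV \<longleftrightarrow> (F1 has_integral r) UNIV" for r
    unfolding i has_integral_restrict_UNIV by (rule cov_invertible_nonneg_eq[OF g h f gh])
  moreover have "(F has_integral r) UNIV \<longleftrightarrow> (\<integral>\<^sup>+x. ennreal (F x) \<partial>lborel) = ennreal r \<and> 0 \<le> r"
    if "F \<in> borel_measurable borel" "\<And>x. 0 \<le> F x" for F :: "real^'n::_ \<Rightarrow> real" and r
    using has_integral_iff_nn_integral_lebesgue[of F r] that
    by (auto simp: nn_integral_completion intro: measurable_completion)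
  ultimately have *: "(\<integral>\<^sup>+x. ennreal (F2 x) \<partial>lborel) = ennreal r \<and> 0 \<le> r \<longleftrightarrow>
      (\<integral>\<^sup>+x. ennreal (F1 x) \<partial>lborel) = ennreal r \<and> 0 \<le> r" for r
    using m nn by metis
  have "(\<integral>\<^sup>+x. ennreal (F1 x) \<partial>lborel) = (\<integral>\<^sup>+x. ennreal (F2 x) \<partial>lborel)"
  proof (cases "\<integral>\<^sup>+x. ennreal (F1 x) \<partial>lborel")
    case (real r)
    then show ?thesis using *[of r] by simp
  next
    case top
    then show ?thesis using * by (cases "\<integral>\<^sup>+x. ennreal (F2 x) \<partial>lborel") auto
  qed
  then show ?thesis by (simp add: F1_def F2_def)
qed

text \<open>Relabelling the coordinates by \<open>vec_ord\<close> preserves \<open>lborel\<close>,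
  and relabelling the rows and columns of a matrix by the same bijection preserves its
  determinant.\<close>

theorem nn_integral_change_of_variables:
  fixes f :: "real^'n \<Rightarrow> real" and g h :: "real^'n \<Rightarrow> real^'n"
  assumes g: "\<And>x. x \<in> S \<Longrightarrow> (g has_derivative g' x) (at x within S)"
    and h: "\<And>y. y \<in> T \<Longrightarrow> (h has_derivative h' y) (at y within T)"
    and f: "\<And>y. y \<in> T \<Longrightarrow> 0 \<le> f y"
    and gh: "\<And>x. x \<in> S \<Longrightarrow> g x \<in> T \<and> h (g x) = x" "\<And>y. y \<in> T \<Longrightarrow> h y \<in> S \<and> g (h y) = y"
      "\<And>y. y \<in> T \<Longrightarrow> h' y \<circ> g' (h y) = id"
    and meas[measurable]: "(\<lambda>y. indicator T y * f y) \<in> borel_measurable borel"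
      "(\<lambda>x. indicator S x * (\<bar>det (matrix (g' x))\<bar> * f (g x))) \<in> borel_measurable borel"
  shows "(\<integral>\<^sup>+y. ennreal (indicator T y * f y) \<partial>lborel) =
    (\<integral>\<^sup>+x. ennreal (indicator S x * (\<bar>det (matrix (g' x))\<bar> * f (g x))) \<partial>lborel)"
proof -
  note lin = bounded_linear_vec_ord bounded_linear_vec_unord
  have ind: "indicator (vec_ord ` X) u = (indicator X (vec_unord u) :: real)" for X :: "(real^'n) set" and u
    by (auto simp: indicator_def image_iff) (metis vec_ord_unord(1))
  have transport: "(\<integral>\<^sup>+v. ennreal (F v) \<partial>lborel) = (\<integral>\<^sup>+u. ennreal (F (vec_unord u)) \<partial>lborel)"
    if [measurable]: "F \<in> borel_measurable borel" for F :: "real^'n \<Rightarrow> real"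
    unfolding lborel_vec_ord[symmetric] by (subst nn_integral_distr) simp_all
  have der: "((\<lambda>u. vec_ord (k (vec_unord u))) has_derivative (\<lambda>v. vec_ord (k' (vec_unord v)))) (at u within vec_ord ` X)"
    if "(k has_derivative k') (at (vec_unord u) within X)" for k k' :: "real^'n \<Rightarrow> real^'n" and u X
  proof -
    have "vec_unord ` vec_ord ` X = X" by (auto simp: image_image)
    then show ?thesis
      using that bounded_linear.has_derivative[OF lin(1)
          has_derivative_in_compose[OF bounded_linear_imp_has_derivative[OF lin(2)], of k k' u "vec_ord ` X"]]
      by simp
  qed
  have det: "det (matrix (\<lambda>v. vec_ord (k' (vec_unord v)))) = det (matrix k')" for k' :: "real^'n \<Rightarrow> real^'n"
  proof -
    have "vec_unord (axis l 1) = (axis (of_ord_index l) 1 :: real^'n)" for l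
      using bij_of_ord_index[where 'n='n]
      by (auto simp: vec_unord_def axis_def vec_eq_iff bij_is_inj bij_is_surj surj_f_inv_f)
    then have "matrix (\<lambda>v. vec_ord (k' (vec_unord v))) = (\<chi> k l. matrix k' $ of_ord_index k $ of_ord_index l)"
      by (simp add: matrix_def vec_ord_def)
    then show ?thesis using det_reindex[OF bij_of_ord_index] by metis
  qed
  have "(\<integral>\<^sup>+y. ennreal (indicator T y * f y) \<partial>lborel) =
      (\<integral>\<^sup>+u. ennreal (indicator (vec_ord ` T) u * f (vec_unord u)) \<partial>lborel)"
    unfolding ind by (rule transport) simp
  also have "\<dots> = (\<integral>\<^sup>+u. ennreal (indicator (vec_ord ` S) u *
      (\<bar>det (matrix (\<lambda>v. vec_ord (g' (vec_unord u) (vec_unord v))))\<bar> * f (vec_unord (vec_ord (g (vec_unord u)))))) \<partial>lborel)"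
  proof (rule nn_integral_change_of_variables_wellorder)
    show "((\<lambda>u. vec_ord (g (vec_unord u))) has_derivative (\<lambda>v. vec_ord (g' (vec_unord u) (vec_unord v))))
        (at u within vec_ord ` S)" if "u \<in> vec_ord ` S" for u
      by (rule der) (use that g in auto)
    show "((\<lambda>u. vec_ord (h (vec_unord u))) has_derivative (\<lambda>v. vec_ord (h' (vec_unord u) (vec_unord v))))
        (at u within vec_ord ` T)" if "u \<in> vec_ord ` T" for u
      by (rule der) (use that h in auto)
    show "(\<lambda>v. vec_ord (h' (vec_unord y) (vec_unord v))) \<circ> (\<lambda>v. vec_ord (g' (vec_unord (vec_ord (h (vec_unord y)))) (vec_unord v))) = id"
      if "y \<in> vec_ord ` T" for y
      using that gh(3) by (auto simp: fun_eq_iff)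
    show "(\<lambda>y. indicator (vec_ord ` T) y * f (vec_unord y)) \<in> borel_measurable borel"
      unfolding ind by measurable
    show "(\<lambda>u. indicator (vec_ord ` S) u * (\<bar>det (matrix (\<lambda>v. vec_ord (g' (vec_unord u) (vec_unord v))))\<bar> *
        f (vec_unord (vec_ord (g (vec_unord u)))))) \<in> borel_measurable borel"
      unfolding ind det vec_ord_unord by measurable
  qed (use f gh in auto)
  also have "\<dots> = (\<integral>\<^sup>+x. ennreal (indicator S x * (\<bar>det (matrix (g' x))\<bar> * f (g x))) \<partial>lborel)"
    unfolding ind det vec_ord_unord by (rule transport[symmetric]) simp
  finally show ?thesis .
qed

section \<open>The Riemannian volume\<close>

text \<open>The segment from the identity to \<open>A\<close> consists of positive definite, hence
  invertible matrices, so the determinant cannot change its sign along it.\<close>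

lemma det_pos_if_positive_definite:
  fixes A :: "real^'n^'n"
  assumes pos: "\<And>v. v \<noteq> 0 \<Longrightarrow> v \<bullet> (A *v v) > 0"
  shows "det A > 0"
proof (rule ccontr)
  assume neg: "\<not> det A > 0"
  define H where "H t = (1 - t) *\<^sub>R mat 1 + t *\<^sub>R A" for t :: real
  have nz: "det (H t) \<noteq> 0" if "0 \<le> t" "t \<le> 1" for t
  proof
    assume "det (H t) = 0"
    then obtain v where v: "v \<noteq> 0" "H t *v v = 0"
      using invertible_det_nz[of "H t"] invertible_left_inverse[of "H t"] matrix_left_invertible_ker[of "H t"] by blast
    have "v \<bullet> (H t *v v) = (1 - t) * (v \<bullet> v) + t * (v \<bullet> (A *v v))"
      by (simp add: H_def matrix_vector_mult_add_rdistrib scaleR_matrix_vector_assoc[symmetric] inner_add_right)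
    moreover have "\<dots> > 0"
    proof (cases "t = 0")
      case False
      have "0 \<le> (1 - t) * (v \<bullet> v)" using that by simp
      moreover have "0 < t * (v \<bullet> (A *v v))" using that False pos[OF v(1)] by simp
      ultimately show ?thesis by linarith
    qed (use v in simp)
    ultimately show False using v by simp
  qed
  have Hij: "continuous_on {0..1} (\<lambda>t. H t $ i $ j)" for i j
    unfolding H_def by (cases "i = j") (auto simp: mat_def intro!: continuous_intros)
  have "continuous_on {0..1} (\<lambda>t. det (H t))"
    unfolding det_def by (intro continuous_intros Hij)
  moreover have "det (H 0) = 1" "det (H 1) = det A" by (simp_all add: H_def)
  ultimately obtain t where "0 \<le> t" "t \<le> 1" "det (H t) = 0"
    using IVT2'[of "\<lambda>t. det (H t)" 1 0 0] neg by auto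
  with nz show False by blast
qed

context smooth_manifold
begin

lemma chart_inv_map: "c \<in> \<A> \<Longrightarrow> p \<in> chart_dom c \<Longrightarrow> chart_inv c (chart_map c p) = p"
  using chart_homeo by (simp add: homeomorphism_def)

lemma chart_map_inv: "c \<in> \<A> \<Longrightarrow> y \<in> chart_img c \<Longrightarrow> chart_map c (chart_inv c y) = y"
  using homeomorphism_apply2[OF chart_homeo] .

lemma chart_inv_in_dom: "c \<in> \<A> \<Longrightarrow> y \<in> chart_img c \<Longrightarrow> chart_inv c y \<in> chart_dom c"
  using chart_homeo homeomorphism_image2 by blast

lemma continuous_on_chart_map: "c \<in> \<A> \<Longrightarrow> continuous_on (chart_dom c) (chart_map c)"
  using chart_homeo homeomorphism_cont1 by blast

lemma continuous_on_chart_inv: "c \<in> \<A> \<Longrightarrow> continuous_on (chart_img c) (chart_inv c)"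
  using chart_homeo homeomorphism_cont2 by blast

lemma chart_image_eq: "c \<in> \<A> \<Longrightarrow> B \<subseteq> chart_dom c \<Longrightarrow> chart_map c ` B = {y \<in> chart_img c. chart_inv c y \<in> B}"
  using chart_inv_map[of c] chart_map_inv[of c] by (auto simp: subset_iff)

lemma open_chart_image:
  assumes "c \<in> \<A>" "open B" "B \<subseteq> chart_dom c"
  shows "open (chart_map c ` B)"
proof -
  have "open (chart_inv c -` B \<inter> chart_img c)"
    using continuous_on_open_vimage[OF open_img[OF assms(1)]] continuous_on_chart_inv[OF assms(1)] assms(2) by blast
  also have "chart_inv c -` B \<inter> chart_img c = chart_map c ` B"
    unfolding chart_image_eq[OF assms(1,3)] by auto
  finally show ?thesis .
qed

lemma open_chart_inv_image:
  assumes "c \<in> \<A>" "open W" "W \<subseteq> chart_img c"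
  shows "open (chart_inv c ` W)"
proof -
  have "chart_inv c ` W = chart_dom c \<inter> chart_map c -` W"
    using assms chart_inv_map[OF assms(1)] chart_map_inv[OF assms(1)] chart_inv_in_dom[OF assms(1)]
    by (force simp: image_iff)
  moreover have "open (chart_map c -` W \<inter> chart_dom c)"
    using continuous_on_open_vimage[OF open_dom[OF assms(1)]] continuous_on_chart_map[OF assms(1)] assms(2) by blast
  ultimately show ?thesis by (simp add: Int_commute)
qed

lemma transition_apply: "c \<in> \<A> \<Longrightarrow> p \<in> chart_dom c \<Longrightarrow> transition c d (chart_map c p) = chart_map d p"
  by (simp add: transition_def chart_inv_map)

lemma open_overlap: "c \<in> \<A> \<Longrightarrow> d \<in> \<A> \<Longrightarrow> open (chart_map c ` (chart_dom c \<inter> chart_dom d))"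
  by (rule open_chart_image) (auto simp: open_dom)

lemma Ck_transition:
  "c \<in> \<A> \<Longrightarrow> d \<in> \<A> \<Longrightarrow> Ck_on k (chart_map c ` (chart_dom c \<inter> chart_dom d)) (transition c d)"
  using transition_smooth by (simp add: smooth_on_def)

lemma transition_has_derivative:
  "c \<in> \<A> \<Longrightarrow> d \<in> \<A> \<Longrightarrow> p \<in> chart_dom c \<inter> chart_dom d \<Longrightarrow>
    (transition c d has_derivative frechet_derivative (transition c d) (at (chart_map c p))) (at (chart_map c p))"
  by (rule Ck_on_Suc_has_derivative[OF Ck_transition[of c d "Suc 0"]]) auto

lemma transition_derivative_inverse:
  assumes c: "c \<in> \<A>" "d \<in> \<A>" and p: "p \<in> chart_dom c \<inter> chart_dom d"
  shows "frechet_derivative (transition d c) (at (chart_map d p)) \<circ>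
    frechet_derivative (transition c d) (at (chart_map c p)) = id"
proof -
  define U where "U = chart_map c ` (chart_dom c \<inter> chart_dom d)"
  have U: "open U" "chart_map c p \<in> U" using open_overlap[OF c] p by (auto simp: U_def)
  have "(transition d c has_derivative frechet_derivative (transition d c) (at (chart_map d p)))
      (at (transition c d (chart_map c p)))"
    using transition_has_derivative[OF c(2,1)] p transition_apply[OF c(1), of p d] by (simp add: Int_commute)
  from diff_chain_at[OF transition_has_derivative[OF c p] this]
  have "(transition d c \<circ> transition c d has_derivative frechet_derivative (transition d c) (at (chart_map d p)) \<circ>
    frechet_derivative (transition c d) (at (chart_map c p))) (at (chart_map c p))" .
  moreover have "(transition d c \<circ> transition c d has_derivative id) (at (chart_map c p))"
  proof (rule has_derivative_transform_within_open[OF _ U])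
    show "(id has_derivative id) (at (chart_map c p))" using has_derivative_id by (simp add: id_def)
    show "id y = (transition d c \<circ> transition c d) y" if "y \<in> U" for y
      using that c by (auto simp: U_def transition_apply)
  qed
  ultimately show ?thesis using has_derivative_unique by blast
qed

text \<open>Off the image of the chart, \<open>chart_inv\<close> has unspecified values and might
  fail to be measurable. A constant value there makes the map Borel on the whole space, so that a
  measure can be pushed forward along it.\<close>

definition chart_inv_total :: "('m, 'n) chart \<Rightarrow> real^'n \<Rightarrow> 'm" where
  "chart_inv_total c y = (if y \<in> chart_img c then chart_inv c y else undefined)"

lemma chart_inv_total_measurable[measurable]:
  assumes c: "c \<in> \<A>"
  shows "chart_inv_total c \<in> borel_measurable borel"
proof (rule borel_measurableI)
  fix S :: "'m set" assume "open S"
  then have "open (chart_inv c -` S \<inter> chart_img c)"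
    using continuous_on_open_vimage[OF open_img[OF c]] continuous_on_chart_inv[OF c] by blast
  moreover have "chart_inv_total c -` S \<inter> space borel =
      (chart_inv c -` S \<inter> chart_img c) \<union> (if undefined \<in> S then - chart_img c else {})"
    by (auto simp: chart_inv_total_def split: if_splits)
  moreover have "chart_img c \<in> sets borel" using open_img[OF c] by simp
  ultimately show "chart_inv_total c -` S \<inter> space borel \<in> sets borel" by auto
qed

lemma chart_image_borel:
  assumes c: "c \<in> \<A>" and B: "B \<in> sets borel" "B \<subseteq> chart_dom c"
  shows "chart_map c ` B \<in> sets borel"
proof -
  have "chart_map c ` B = chart_img c \<inter> (chart_inv_total c -` B \<inter> space borel)"
    unfolding chart_image_eq[OF c B(2)] by (auto simp: chart_inv_total_def)
  moreover have "chart_inv_total c -` B \<inter> space borel \<in> sets borel"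
    using measurable_sets[OF chart_inv_total_measurable[OF c] B(1)] .
  moreover have "chart_img c \<in> sets borel" using open_img[OF c] by simp
  ultimately show ?thesis by auto
qed

end

context riemannian_manifold
begin

definition gm :: "('m, 'n) chart \<Rightarrow> real^'n \<Rightarrow> real^'n^'n" where "gm c y = G c (chart_inv c y)"
definition dens :: "('m, 'n) chart \<Rightarrow> real^'n \<Rightarrow> real" where "dens c y = sqrt (det (gm c y))"

lemma gm_pos: "c \<in> \<A> \<Longrightarrow> y \<in> chart_img c \<Longrightarrow> v \<noteq> 0 \<Longrightarrow> v \<bullet> (gm c y *v v) > 0"
  unfolding gm_def using metric_pos chart_inv_in_dom by blast

lemma det_gm_pos: "c \<in> \<A> \<Longrightarrow> y \<in> chart_img c \<Longrightarrow> det (gm c y) > 0"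
  by (rule det_pos_if_positive_definite) (rule gm_pos)

lemma dens_pos: "c \<in> \<A> \<Longrightarrow> y \<in> chart_img c \<Longrightarrow> dens c y > 0"
  using det_gm_pos by (simp add: dens_def)

lemma Ck_gm: "c \<in> \<A> \<Longrightarrow> Ck_on k (chart_img c) (\<lambda>y. gm c y $ i $ j)"
  using metric_smooth[of c] unfolding gm_def
  by (intro Ck_on_vec_nth open_img) (auto simp: smooth_on_def o_def)

lemma Ck_dens: "c \<in> \<A> \<Longrightarrow> Ck_on k (chart_img c) (dens c)"
  unfolding dens_def using det_gm_pos by (intro Ck_on_sqrt Ck_on_det Ck_gm open_img) auto

lemma continuous_on_dens: "c \<in> \<A> \<Longrightarrow> continuous_on (chart_img c) (dens c)"
  using Ck_on_imp_continuous_on[OF Ck_dens] .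

lemma measurable_dens[measurable]:
  assumes "c \<in> \<A>"
  shows "(\<lambda>y. indicator (chart_img c) y * dens c y) \<in> borel_measurable borel"
  using borel_measurable_continuous_on_indicator[OF _ continuous_on_dens[OF assms]] open_img[OF assms] by simp

lemma dens_transition:
  assumes c: "c \<in> \<A>" "d \<in> \<A>" and p: "p \<in> chart_dom c \<inter> chart_dom d"
  shows "dens c (chart_map c p) =
    \<bar>det (matrix (frechet_derivative (transition c d) (at (chart_map c p))))\<bar> * dens d (chart_map d p)"
proof -
  define J where "J = matrix (frechet_derivative (transition c d) (at (chart_map c p)))"
  have "det (G c p) = (det J)\<^sup>2 * det (G d p)"
    using metric_transform[OF c p J_def] by (simp add: det_mul power2_eq_square)
  moreover have "dens c (chart_map c p) = sqrt (det (G c p))" "dens d (chart_map d p) = sqrt (det (G d p))"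
    using c p by (auto simp: dens_def gm_def chart_inv_map)
  ultimately show ?thesis by (simp add: real_sqrt_mult J_def)
qed

definition chart_measure :: "('m, 'n) chart \<Rightarrow> 'm measure" where
  "chart_measure c =
    distr (density lborel (\<lambda>y. ennreal (indicator (chart_img c) y * dens c y))) borel (chart_inv_total c)"

lemma sets_chart_measure[simp, measurable_cong]: "sets (chart_measure c) = sets borel"
  by (simp add: chart_measure_def)

lemma emeasure_chart_measure:
  assumes c: "c \<in> \<A>" and B: "B \<in> sets borel"
  shows "emeasure (chart_measure c) B = 
    (\<integral>\<^sup>+y. ennreal (indicator (chart_map c ` (B \<inter> chart_dom c)) y * dens c y) \<partial>lborel)"
proof -
  have [measurable]: "chart_inv_total c \<in> borel_measurable borel" using chart_inv_total_measurable[OF c] .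
  have [measurable]: "B \<in> sets borel" by fact
  note [measurable] = measurable_dens[OF c]
  have "emeasure (chart_measure c) B =
      (\<integral>\<^sup>+y. ennreal (indicator (chart_img c) y * dens c y) * indicator (chart_inv_total c -` B) y \<partial>lborel)"
    unfolding chart_measure_def using measurable_sets[OF chart_inv_total_measurable[OF c] B]
    by (subst emeasure_distr) (auto simp: emeasure_density)
  also have "\<dots> = (\<integral>\<^sup>+y. ennreal (indicator (chart_map c ` (B \<inter> chart_dom c)) y * dens c y) \<partial>lborel)"
  proof (rule nn_integral_cong)
    fix y
    have "y \<in> chart_map c ` (B \<inter> chart_dom c) \<longleftrightarrow> y \<in> chart_img c \<and> chart_inv_total c y \<in> B"
      using chart_image_eq[OF c, of "B \<inter> chart_dom c"] chart_inv_in_dom[OF c] by (auto simp: chart_inv_total_def)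
    then show "ennreal (indicator (chart_img c) y * dens c y) * indicator (chart_inv_total c -` B) y =
        ennreal (indicator (chart_map c ` (B \<inter> chart_dom c)) y * dens c y)"
      by (simp add: indicator_def)
  qed
  finally show ?thesis .
qed

lemma chart_measure_dom: "c \<in> \<A> \<Longrightarrow> B \<in> sets borel \<Longrightarrow> 
  emeasure (chart_measure c) (B \<inter> chart_dom c) = emeasure (chart_measure c) B"
  using open_dom[of c] by (subst (1 2) emeasure_chart_measure) (auto simp: Int_assoc)

text \<open>Change of variables along the transition map: its Jacobian determinant is exactly the
  factor by which the densities differ (\<open>dens_transition\<close>).\<close>

lemma chart_measure_consistent:
  assumes c: "c \<in> \<A>" "d \<in> \<A>" and B: "B \<in> sets borel" "B \<subseteq> chart_dom c \<inter> chart_dom d"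
  shows "emeasure (chart_measure c) B = emeasure (chart_measure d) B"
proof -
  have Bc: "B \<inter> chart_dom c = B" "B \<inter> chart_dom d = B" using B by auto
  have borel: "chart_map c ` B \<in> sets borel" "chart_map d ` B \<in> sets borel"
    using chart_image_borel[OF _ B(1)] c B(2) by auto
  have sub: "chart_map c ` B \<subseteq> chart_img c" "chart_map d ` B \<subseteq> chart_img d" using B(2) by auto
  have m: "(\<lambda>y. indicator (chart_map e ` B) y * dens e y) \<in> borel_measurable borel"
    if "e \<in> \<A>" "chart_map e ` B \<in> sets borel" "chart_map e ` B \<subseteq> chart_img e" for e
    using borel_measurable_continuous_on_indicator[OF that(2) continuous_on_subset[OF continuous_on_dens[OF that(1)] that(3)]]
    by simp
  have dens_eq: "indicator (chart_map c ` B) x * (\<bar>det (matrix (frechet_derivative (transition c d) (at x)))\<bar> * dens d (transition c d x))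
      = indicator (chart_map c ` B) x * dens c x" for x
  proof (cases "x \<in> chart_map c ` B")
    case True
    then obtain p where "p \<in> B" "x = chart_map c p" by auto
    moreover from this have "p \<in> chart_dom c \<inter> chart_dom d" using B(2) by blast
    ultimately show ?thesis using dens_transition[OF c, of p] transition_apply[OF c(1), of p d] by simp
  qed simp
  have "(\<integral>\<^sup>+y. ennreal (indicator (chart_map d ` B) y * dens d y) \<partial>lborel) =
      (\<integral>\<^sup>+x. ennreal (indicator (chart_map c ` B) x *
        (\<bar>det (matrix (frechet_derivative (transition c d) (at x)))\<bar> * dens d (transition c d x))) \<partial>lborel)"
  proof (rule nn_integral_change_of_variables)
    show "(transition c d has_derivative frechet_derivative (transition c d) (at x)) (at x within chart_map c ` B)"
      if "x \<in> chart_map c ` B" for x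
      using that transition_has_derivative[OF c] B(2) by (auto intro: has_derivative_at_withinI)
    show "(transition d c has_derivative frechet_derivative (transition d c) (at y)) (at y within chart_map d ` B)"
      if "y \<in> chart_map d ` B" for y
      using that transition_has_derivative[OF c(2,1)] B(2) by (auto intro: has_derivative_at_withinI)
    show "transition c d x \<in> chart_map d ` B \<and> transition d c (transition c d x) = x" if "x \<in> chart_map c ` B" for x
      using that B(2) c by (auto simp: transition_apply subset_iff)
    show "transition d c y \<in> chart_map c ` B \<and> transition c d (transition d c y) = y" if "y \<in> chart_map d ` B" for y
      using that B(2) c by (auto simp: transition_apply subset_iff)
    show "frechet_derivative (transition d c) (at y) \<circ> frechet_derivative (transition c d) (at (transition d c y)) = id"
      if y: "y \<in> chart_map d ` B" for y
    proof -
      obtain p where p: "p \<in> B" "y = chart_map d p" using y by auto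
      then have "p \<in> chart_dom c \<inter> chart_dom d" using B(2) by blast
      then show ?thesis
        using transition_derivative_inverse[OF c, of p] p transition_apply[OF c(2), of p c] by simp
    qed
    show "0 \<le> dens d y" if "y \<in> chart_map d ` B" for y
      using that sub dens_pos[OF c(2), of y] by auto
    show "(\<lambda>x. indicator (chart_map c ` B) x * (\<bar>det (matrix (frechet_derivative (transition c d) (at x)))\<bar> *
        dens d (transition c d x))) \<in> borel_measurable borel"
      unfolding dens_eq by (rule m[OF c(1) borel(1) sub(1)])
  qed (rule m[OF c(2) borel(2) sub(2)])
  then show ?thesis
    unfolding dens_eq by (simp add: emeasure_chart_measure[OF c(1) B(1)] emeasure_chart_measure[OF c(2) B(1)] Bc)
qed

definition is_volume :: "'m measure \<Rightarrow> bool" where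
  "is_volume V \<longleftrightarrow> sets V = sets borel \<and>
    (\<forall>c\<in>\<A>. \<forall>B\<in>sets borel. B \<subseteq> chart_dom c \<longrightarrow> emeasure V B = emeasure (chart_measure c) B)"

lemma riemannian_volume_eq_The: "riemannian_volume \<A> G = (THE V. is_volume V)"
proof -
  have "(\<integral>\<^sup>+x\<in>chart_map c ` B. ennreal (sqrt (det (G c (chart_inv c x)))) \<partial>lborel) = emeasure (chart_measure c) B"
    if "c \<in> \<A>" "B \<in> sets borel" "B \<subseteq> chart_dom c" for c B
  proof -
    have "B \<inter> chart_dom c = B" using that by auto
    then show ?thesis using that
      by (simp add: emeasure_chart_measure dens_def gm_def)
        (intro nn_integral_cong, simp add: indicator_def)
  qed
  then show ?thesis unfolding riemannian_volume_def is_volume_def by (metis (no_types, lifting))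
qed

lemma countable_chart_cover:
  "\<exists>(D :: nat \<Rightarrow> 'm set) f. disjoint_family D \<and> (\<Union>i. D i) = UNIV \<and>
    (\<forall>i. f i \<in> \<A> \<and> D i \<in> sets borel \<and> D i \<subseteq> chart_dom (f i))"
proof -
  obtain C where C: "C \<subseteq> chart_dom ` \<A>" "countable C" "\<Union>C = UNIV"
    using Lindelof[of "chart_dom ` \<A>"] open_dom charts_cover by (metis imageE)
  have "C \<noteq> {}" using C(3) by auto
  define U where "U = from_nat_into C"
  have U: "U i \<in> C" for i unfolding U_def by (rule from_nat_into[OF \<open>C \<noteq> {}\<close>])
  have "range U = C" unfolding U_def by (rule range_from_nat_into[OF \<open>C \<noteq> {}\<close> C(2)])
  then have "(\<Union>i. U i) = UNIV" using C(3) by simp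
  moreover have "\<forall>i. \<exists>c. c \<in> \<A> \<and> chart_dom c = U i" using U C(1) by (metis imageE subsetD)
  then obtain f where f: "\<And>i. f i \<in> \<A>" "\<And>i. chart_dom (f i) = U i" by metis
  moreover have "U i \<in> sets borel" for i using open_dom[OF f(1)[of i]] f(2)[of i] by simp
  ultimately show ?thesis
    using UN_disjointed_eq[of U] disjoint_family_disjointed[of U] disjointed_subset[of U]
      sets.range_disjointed_sets[of U borel]
    by (intro exI[of _ "disjointed U"] exI[of _ f]) (auto simp: image_subset_iff)
qed

text \<open>Cut the manifold into countably many disjoint Borel pieces, each inside one chart, and
  add up the chart measures of the pieces. Consistency of the chart measures shows that the result
  is right in every chart, and countable additivity over the pieces forces uniqueness. This gives
  meaning to the definite description in \<open>riemannian_volume\<close>.\<close>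

lemma ex1_is_volume: "\<exists>!V. is_volume V"
proof -
  obtain D :: "nat \<Rightarrow> 'm set" and f where D': "disjoint_family D" "(\<Union>i. D i) = UNIV"
    and f: "\<And>i. f i \<in> \<A>" and D'': "\<And>i. D i \<in> sets borel" "\<And>i. D i \<subseteq> chart_dom (f i)"
    using countable_chart_cover by metis
  note D = D'' D'
  have split: "emeasure M B = (\<Sum>i. emeasure M (B \<inter> D i))" if "sets M = sets borel" "B \<in> sets borel" for M :: "'m measure" and B
  proof -
    have "(\<Sum>i. emeasure M (B \<inter> D i)) = emeasure M (\<Union>i. B \<inter> D i)"
    proof (rule suminf_emeasure)
      show "range (\<lambda>i. B \<inter> D i) \<subseteq> sets M" unfolding that(1) using D(1) that(2) by blast
      show "disjoint_family (\<lambda>i. B \<inter> D i)" using D(3) unfolding disjoint_family_on_def by blast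
    qed
    also have "(\<Union>i. B \<inter> D i) = B" unfolding Int_UN_distrib[symmetric] D(4) by simp
    finally show ?thesis ..
  qed
  define V where "V = measure_of UNIV (sets borel) (\<lambda>B. \<Sum>i. emeasure (chart_measure (f i)) (B \<inter> D i))"
  have "sets (borel :: 'm measure) = sigma_sets UNIV (sets borel)"
    using sets.sigma_sets_eq[of "borel :: 'm measure"] by simp
  then have sV: "sets V = sets borel" unfolding V_def by simp
  have eV: "emeasure V B = (\<Sum>i. emeasure (chart_measure (f i)) (B \<inter> D i))" if "B \<in> sets borel" for B
    unfolding V_def
  proof (rule emeasure_measure_of_sigma)
    show "sigma_algebra UNIV (sets (borel :: 'm measure))"
      using sets.sigma_algebra_axioms[of "borel :: 'm measure"] by simp
    show "positive (sets borel) (\<lambda>B. \<Sum>i. emeasure (chart_measure (f i)) (B \<inter> D i))"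
      by (simp add: positive_def)
    show "countably_additive (sets borel) (\<lambda>B. \<Sum>i. emeasure (chart_measure (f i)) (B \<inter> D i))"
    proof (rule countably_additiveI)
      fix A :: "nat \<Rightarrow> 'm set"
      assume A: "range A \<subseteq> sets borel" "disjoint_family A" "\<Union> (range A) \<in> sets borel"
      have "(\<Sum>j. emeasure (chart_measure (f i)) (A j \<inter> D i)) = emeasure (chart_measure (f i)) (\<Union> (range A) \<inter> D i)" for i
      proof -
        have "(\<Sum>j. emeasure (chart_measure (f i)) (A j \<inter> D i)) = emeasure (chart_measure (f i)) (\<Union>j. A j \<inter> D i)"
        proof (rule suminf_emeasure)
          show "range (\<lambda>j. A j \<inter> D i) \<subseteq> sets (chart_measure (f i))" using A(1) D(1) by auto
          show "disjoint_family (\<lambda>j. A j \<inter> D i)" using A(2) unfolding disjoint_family_on_def by blast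
        qed
        then show ?thesis by simp
      qed
      \<comment> \<open>The two infinite sums are exchanged as integrals over counting
        measures.\<close>
      then show "(\<Sum>j. \<Sum>i. emeasure (chart_measure (f i)) (A j \<inter> D i)) = (\<Sum>i. emeasure (chart_measure (f i)) (\<Union> (range A) \<inter> D i))"
        by (subst nn_integral_count_space_nat[symmetric], subst nn_integral_count_space_nat[symmetric])
          (simp add: nn_integral_count_space_nat[symmetric] pair_sigma_finite.Fubini'[OF pair_sigma_finite.intro] 
            sigma_finite_measure_count_space)
    qed
  qed fact
  have volV: "is_volume V"
    unfolding is_volume_def
  proof (intro conjI ballI impI sV)
    fix c B assume c: "c \<in> \<A>" and B: "B \<in> sets borel" "B \<subseteq> chart_dom c"
    have "emeasure V B = (\<Sum>i. emeasure (chart_measure (f i)) (B \<inter> D i))" by (rule eV[OF B(1)])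
    also have "\<dots> = (\<Sum>i. emeasure (chart_measure c) (B \<inter> D i))"
      using c f B D(1) by (intro suminf_cong chart_measure_consistent) (auto dest: subsetD[OF D(2)])
    also have "\<dots> = emeasure (chart_measure c) B" using B by (intro split[symmetric]) simp_all
    finally show "emeasure V B = emeasure (chart_measure c) B" .
  qed
  have "W = V" if W: "is_volume W" for W
  proof (rule measure_eqI)
    show s: "sets W = sets V" using W sV by (simp add: is_volume_def)
    fix B assume "B \<in> sets W"
    then have B: "B \<in> sets borel" using s sV by simp
    have "emeasure W (B \<inter> D i) = emeasure V (B \<inter> D i)" for i
      using W volV f D B unfolding is_volume_def
      by (metis inf.coboundedI2 sets.Int)
    then show "emeasure W B = emeasure V B" using split[of W B] split[of V B] W B sV
      by (simp add: is_volume_def)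
  qed
  with volV show ?thesis by blast
qed

abbreviation vol :: "'m measure" where "vol \<equiv> riemannian_volume \<A> G"

lemma is_volume_vol: "is_volume vol"
  unfolding riemannian_volume_eq_The by (rule theI'[OF ex1_is_volume])

lemma sets_vol[simp, measurable_cong]: "sets vol = sets borel"
  using is_volume_vol by (simp add: is_volume_def)

lemma space_vol[simp]: "space vol = UNIV"
  using sets_eq_imp_space_eq[OF sets_vol] by simp

lemma density_vol_chart:
  assumes c: "c \<in> \<A>"
  shows "density vol (indicator (chart_dom c)) = chart_measure c"
proof (rule measure_eqI)
  fix B assume "B \<in> sets (density vol (indicator (chart_dom c)))"
  then have B: "B \<in> sets borel" by simp
  have o: "chart_dom c \<in> sets borel" using open_dom[OF c] by simp
  then have "emeasure (density vol (indicator (chart_dom c))) B = emeasure vol (B \<inter> chart_dom c)"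
  proof -
    have "emeasure (density vol (indicator (chart_dom c))) B = (\<integral>\<^sup>+p. indicator (chart_dom c) p * indicator B p \<partial>vol)"
      using B o by (intro emeasure_density) auto
    also have "\<dots> = (\<integral>\<^sup>+p. indicator (B \<inter> chart_dom c) p \<partial>vol)"
      by (intro nn_integral_cong) (auto split: split_indicator)
    also have "\<dots> = emeasure vol (B \<inter> chart_dom c)" using B o by (intro nn_integral_indicator) auto
    finally show ?thesis .
  qed
  also have "\<dots> = emeasure (chart_measure c) (B \<inter> chart_dom c)"
    using is_volume_vol c B o by (simp add: is_volume_def)
  also have "\<dots> = emeasure (chart_measure c) B" by (rule chart_measure_dom[OF c B])
  finally show "emeasure (density vol (indicator (chart_dom c))) B = emeasure (chart_measure c) B" .
qed simp

lemma
  fixes f :: "'m \<Rightarrow> real"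
  assumes c: "c \<in> \<A>" and f[measurable]: "f \<in> borel_measurable borel" and 0: "\<And>p. p \<notin> chart_dom c \<Longrightarrow> f p = 0"
  shows integral_vol_chart: "(\<integral>p. f p \<partial>vol) = (LINT y:chart_img c|lborel. f (chart_inv c y) * dens c y)"
    and integrable_vol_chart: "integrable vol f \<longleftrightarrow> set_integrable lborel (chart_img c) (\<lambda>y. f (chart_inv c y) * dens c y)"
proof -
  have [measurable]: "chart_inv_total c \<in> borel_measurable borel" using chart_inv_total_measurable[OF c] .
  have [measurable]: "chart_dom c \<in> sets borel" using open_dom[OF c] by simp
  note [measurable] = measurable_dens[OF c]
  have nn: "0 \<le> indicator (chart_img c) y * dens c y" for y
    using less_imp_le[OF dens_pos[OF c, of y]] by (simp add: indicator_def)
  have eq: "(indicator (chart_img c) y * dens c y) *\<^sub>R f (chart_inv_total c y) =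
      indicator (chart_img c) y *\<^sub>R (f (chart_inv c y) * dens c y)" for y
    by (simp add: indicator_def chart_inv_total_def)
  have ind: "f p = indicator (chart_dom c) p *\<^sub>R f p" for p using 0[of p] by (auto simp: indicator_def)
  have dv: "density vol (\<lambda>p. ennreal (indicator (chart_dom c) p)) = chart_measure c"
    using density_vol_chart[OF c] by (simp add: ennreal_indicator)
  have "(\<integral>p. f p \<partial>vol) = (\<integral>p. indicator (chart_dom c) p *\<^sub>R f p \<partial>vol)" using ind by presburger
  also have "\<dots> = (\<integral>p. f p \<partial>chart_measure c)"
    unfolding dv[symmetric] by (rule integral_density[symmetric]) auto
  also have "\<dots> = (\<integral>y. (indicator (chart_img c) y * dens c y) *\<^sub>R f (chart_inv_total c y) \<partial>lborel)"
    unfolding chart_measure_def using nn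
    by (subst integral_distr, simp, simp, subst integral_density) auto
  finally show "(\<integral>p. f p \<partial>vol) = (LINT y:chart_img c|lborel. f (chart_inv c y) * dens c y)"
    unfolding eq set_lebesgue_integral_def .
  have "integrable vol f \<longleftrightarrow> integrable vol (\<lambda>p. indicator (chart_dom c) p *\<^sub>R f p)" using ind by presburger
  also have "\<dots> \<longleftrightarrow> integrable (chart_measure c) f"
    unfolding dv[symmetric] by (rule integrable_density[symmetric]) auto
  also have "\<dots> \<longleftrightarrow> integrable lborel (\<lambda>y. (indicator (chart_img c) y * dens c y) *\<^sub>R f (chart_inv_total c y))"
    unfolding chart_measure_def using nn
    by (subst integrable_distr_eq, simp, simp, subst integrable_density) auto
  finally show "integrable vol f \<longleftrightarrow> set_integrable lborel (chart_img c) (\<lambda>y. f (chart_inv c y) * dens c y)"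
    unfolding eq set_integrable_def .
qed

end

section \<open>The Laplacian in an arbitrary chart\<close>

definition grad :: "(real^'n \<Rightarrow> real) \<Rightarrow> real^'n \<Rightarrow> real^'n" where
  "grad f y = (\<chi> i. partial_deriv i f y)"

lemma grad_compose:
  fixes f :: "real^'m \<Rightarrow> real" and T :: "real^'n \<Rightarrow> real^'m"
  assumes "f differentiable (at (T y))" "(T has_derivative T') (at y)"
  shows "grad (\<lambda>y. f (T y)) y = transpose (matrix T') *v grad f (T y)"
proof -
  have "((\<lambda>y. f (T y)) has_derivative (\<lambda>v. frechet_derivative f (at (T y)) (T' v))) (at y)"
    using diff_chain_at[OF assms(2) assms(1)[unfolded frechet_derivative_works]] by (simp add: o_def)
  then have "partial_deriv i (\<lambda>y. f (T y)) y = (\<Sum>k\<in>UNIV. T' (axis i 1) $ k * partial_deriv k f (T y))" for i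
    by (simp add: has_derivative_imp_partial_deriv frechet_derivative_eq_sum_partial_deriv[OF assms(1)])
  then show ?thesis
    by (simp add: grad_def vec_eq_iff matrix_vector_mult_def transpose_def matrix_def)
qed

context smooth_manifold
begin

lemma compact_chart_inv_image: "c \<in> \<A> \<Longrightarrow> compact K \<Longrightarrow> K \<subseteq> chart_img c \<Longrightarrow> compact (chart_inv c ` K)"
  using compact_continuous_image continuous_on_subset[OF continuous_on_chart_inv] by blast

lemma chart_inv_image_iff:
  assumes "c \<in> \<A>" "K \<subseteq> chart_img c" "y \<in> chart_img c"
  shows "chart_inv c y \<in> chart_inv c ` K \<longleftrightarrow> y \<in> K"
proof
  assume "chart_inv c y \<in> chart_inv c ` K"
  then obtain z where "z \<in> K" "chart_inv c y = chart_inv c z" by auto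
  then show "y \<in> K"
    using chart_map_inv[OF assms(1,3)] chart_map_inv[OF assms(1), of z] assms(2) by auto
qed simp

lemma chart_map_chart_inv_image:
  assumes "c \<in> \<A>" "K \<subseteq> chart_img c" "p \<in> chart_inv c ` K"
  shows "chart_map c p \<in> K" "p \<in> chart_dom c"
  using assms chart_map_inv[OF assms(1)] chart_inv_in_dom[OF assms(1)] by (auto simp: subset_iff)

lemma smooth_function_Ck: "smooth_function \<A> f \<Longrightarrow> c \<in> \<A> \<Longrightarrow> Ck_on k (chart_img c) (f \<circ> chart_inv c)"
  by (simp add: smooth_function_def smooth_on_def)

lemma chart_at: "chart_at \<A> p \<in> \<A>" "p \<in> chart_dom (chart_at \<A> p)"
proof -
  have "\<exists>c. c \<in> \<A> \<and> p \<in> chart_dom c" using charts_cover by blast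
  from someI_ex[OF this] show "chart_at \<A> p \<in> \<A>" "p \<in> chart_dom (chart_at \<A> p)"
    unfolding chart_at_def by auto
qed

end

context riemannian_manifold
begin

definition ac :: "('m, 'n) chart \<Rightarrow> 'n \<Rightarrow> 'n \<Rightarrow> real^'n \<Rightarrow> real" where
  "ac c i j y = dens c y * matrix_inv (gm c y) $ i $ j"

definition bc :: "('m, 'n) chart \<Rightarrow> 'n \<Rightarrow> 'n \<Rightarrow> real^'n \<Rightarrow> real" where
  "bc c i j y = gm c y $ i $ j / dens c y"

lemma Ck_ac: "c \<in> \<A> \<Longrightarrow> Ck_on k (chart_img c) (ac c i j)"
  unfolding ac_def using det_gm_pos[of c]
  by (intro Ck_on_mult Ck_dens Ck_on_matrix_inv Ck_gm open_img) (auto simp: less_imp_neq[symmetric])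

lemma gm_sym: "c \<in> \<A> \<Longrightarrow> y \<in> chart_img c \<Longrightarrow> gm c y $ i $ j = gm c y $ j $ i"
  using arg_cong[OF metric_sym[OF _ chart_inv_in_dom, of c y], of "\<lambda>A. A $ i $ j"]
  by (simp add: gm_def transpose_def)

lemma matrix_inv_gm_sym:
  assumes "c \<in> \<A>" "y \<in> chart_img c"
  shows "matrix_inv (gm c y) $ i $ j = matrix_inv (gm c y) $ j $ i"
proof -
  have d: "det (gm c y) \<noteq> 0" using det_gm_pos[OF assms] by simp
  have t: "transpose (gm c y) = gm c y"
    unfolding gm_def using metric_sym[OF assms(1) chart_inv_in_dom[OF assms]] .
  have "transpose (matrix_inv (gm c y)) ** gm c y = mat 1"
    using arg_cong[OF matrix_inv_mult[OF d], of transpose] by (simp add: matrix_transpose_mul t transpose_mat)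
  then have "transpose (matrix_inv (gm c y)) ** gm c y ** matrix_inv (gm c y) = matrix_inv (gm c y)" by simp
  then have "transpose (matrix_inv (gm c y)) = matrix_inv (gm c y)"
    by (simp add: matrix_mul_assoc[symmetric] matrix_inv_mult[OF d])
  from arg_cong[OF this, of "\<lambda>A. A $ j $ i"] show ?thesis by (simp add: transpose_def)
qed

lemma elliptic_chart:
  assumes c: "c \<in> \<A>"
  shows "elliptic (chart_img c) (ac c) (bc c) (dens c)"
proof
  show "continuous_on (chart_img c) (bc c i j)" for i j
    unfolding bc_def[abs_def] using dens_pos[OF c]
    by (intro continuous_intros continuous_on_dens c Ck_on_imp_continuous_on[OF Ck_gm]) (auto simp: less_imp_neq[symmetric])
  show "ac c i j x = ac c j i x" if "x \<in> chart_img c" for i j x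
    unfolding ac_def using matrix_inv_gm_sym[OF c that] by metis
  show "bc c i j x = bc c j i x" if "x \<in> chart_img c" for i j x
    unfolding bc_def using gm_sym[OF c that] by metis
  show "(\<Sum>j\<in>UNIV. ac c i j x * bc c j k x) = (if i = k then 1 else 0)" if x: "x \<in> chart_img c" for i k x
  proof -
    have d: "det (gm c x) \<noteq> 0" using det_gm_pos[OF c x] by simp
    have "(\<Sum>j\<in>UNIV. ac c i j x * bc c j k x) = (matrix_inv (gm c x) ** gm c x) $ i $ k"
      using dens_pos[OF c x] by (simp add: ac_def bc_def matrix_matrix_mult_def)
    then show ?thesis by (simp add: mult_matrix_inv[OF d] mat_def)
  qed
  show "(\<Sum>i\<in>UNIV. \<Sum>j\<in>UNIV. bc c i j x * z $ i * z $ j) > 0" if x: "x \<in> chart_img c" and z: "z \<noteq> 0" for x z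
  proof -
    have "(\<Sum>i\<in>UNIV. \<Sum>j\<in>UNIV. bc c i j x * z $ i * z $ j) = z \<bullet> (gm c x *v z) / dens c x"
      by (simp add: bc_def inner_vec_def matrix_vector_mult_def sum_distrib_left sum_divide_distrib ac_simps)
    then show ?thesis using gm_pos[OF c x z] dens_pos[OF c x] by simp
  qed
qed (use c open_img Ck_ac Ck_dens dens_pos in auto)

definition lap :: "('m, 'n) chart \<Rightarrow> (real^'n \<Rightarrow> real) \<Rightarrow> real^'n \<Rightarrow> real" where
  "lap c f y = div_grad (ac c) f y / dens c y"

lemma laplace_chart_eq: "laplace_chart G c f y = lap c (f \<circ> chart_inv c) y"
  by (simp add: laplace_chart_def lap_def div_grad_def ac_def gm_def[symmetric] dens_def[symmetric]
      sum_distrib_left sum_divide_distrib mult.assoc)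

definition grad_inner :: "('m, 'n) chart \<Rightarrow> (real^'n \<Rightarrow> real) \<Rightarrow> (real^'n \<Rightarrow> real) \<Rightarrow> real^'n \<Rightarrow> real" where
  "grad_inner c u v y = grad u y \<bullet> (matrix_inv (gm c y) *v grad v y)"

lemma sum_ac_eq_grad_inner:
  "(\<Sum>i\<in>UNIV. \<Sum>j\<in>UNIV. ac c i j y * partial_deriv i u y * partial_deriv j v y) = dens c y * grad_inner c u v y"
  by (simp add: ac_def grad_inner_def grad_def inner_vec_def matrix_vector_mult_def sum_distrib_left ac_simps)

lemma det_transition_nonzero:
  assumes c: "c \<in> \<A>" "d \<in> \<A>" and p: "p \<in> chart_dom c \<inter> chart_dom d"
  shows "det (matrix (frechet_derivative (transition c d) (at (chart_map c p)))) \<noteq> 0"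
  using dens_transition[OF assms] dens_pos[OF c(1), of "chart_map c p"] p by auto

text \<open>Differentials pull back by J^T, where \<open>J\<close> is the Jacobian of the
  transition, and the metric matrices satisfy G_c = J^T G_d J. Hence \<open>J\<close> maps the
  gradient of v in the chart c, here \<open>z\<close>, to its gradient in the chart d, and the
  pairing with the differential of u is preserved.\<close>

lemma grad_inner_transition:
  assumes c: "c \<in> \<A>" "d \<in> \<A>" and p: "p \<in> chart_dom c \<inter> chart_dom d"
    and u: "u differentiable (at (chart_map d p))" and v: "v differentiable (at (chart_map d p))"
  shows "grad_inner c (\<lambda>y. u (transition c d y)) (\<lambda>y. v (transition c d y)) (chart_map c p) =
    grad_inner d u v (chart_map d p)"
proof -
  define J where "J = matrix (frechet_derivative (transition c d) (at (chart_map c p)))"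
  define x where "x = chart_map c p"
  have T: "transition c d x = chart_map d p" using transition_apply[OF c(1)] p by (simp add: x_def)
  have G: "gm c x = transpose J ** gm d (chart_map d p) ** J"
    using metric_transform[OF c p J_def] c p by (simp add: gm_def x_def chart_inv_map)
  have detJ: "det J \<noteq> 0" unfolding J_def by (rule det_transition_nonzero[OF c p])
  have dc: "det (gm c x) \<noteq> 0" using det_gm_pos[OF c(1), of x] p by (simp add: x_def)
  have dd: "det (gm d (chart_map d p)) \<noteq> 0" using det_gm_pos[OF c(2), of "chart_map d p"] p by simp
  have gu: "grad (\<lambda>y. u (transition c d y)) x = transpose J *v grad u (chart_map d p)"
    using grad_compose[of u "transition c d" x] transition_has_derivative[OF c p] u T
    by (simp add: x_def J_def)
  have gv: "grad (\<lambda>y. v (transition c d y)) x = transpose J *v grad v (chart_map d p)"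
    using grad_compose[of v "transition c d" x] transition_has_derivative[OF c p] v T
    by (simp add: x_def J_def)
  define z where "z = matrix_inv (gm c x) *v (transpose J *v grad v (chart_map d p))"
  have "gm c x *v z = transpose J *v grad v (chart_map d p)"
    by (simp add: z_def matrix_vector_mul_assoc matrix_mul_assoc matrix_inv_mult[OF dc])
  then have "transpose J *v (gm d (chart_map d p) *v (J *v z)) = transpose J *v grad v (chart_map d p)"
    unfolding G by (simp add: matrix_vector_mul_assoc matrix_mul_assoc)
  moreover have "det (transpose J) \<noteq> 0" using detJ by (simp add: det_transpose)
  ultimately have "gm d (chart_map d p) *v (J *v z) = grad v (chart_map d p)"
    using mult_matrix_inv[of "transpose J"] by (metis matrix_vector_mul_assoc matrix_vector_mul_lid)
  then have "J *v z = matrix_inv (gm d (chart_map d p)) *v grad v (chart_map d p)"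
    using mult_matrix_inv[OF dd] by (metis matrix_vector_mul_assoc matrix_vector_mul_lid)
  moreover have "(transpose J *v grad u (chart_map d p)) \<bullet> z = grad u (chart_map d p) \<bullet> (J *v z)"
    by (metis dot_lmul_matrix transpose_matrix_vector)
  ultimately show ?thesis
    unfolding grad_inner_def by (fold x_def) (simp add: gu gv z_def)
qed

lemma
  fixes k :: "real^'n \<Rightarrow> real"
  assumes c: "c \<in> \<A>" and K: "compact K" "K \<subseteq> chart_img c" and k: "continuous_on K k"
  shows integral_vol_compact: "(\<integral>p. indicator (chart_inv c ` K) p * k (chart_map c p) \<partial>vol) = (LINT y:K|lborel. k y * dens c y)"
    and integrable_vol_compact: "integrable vol (\<lambda>p. indicator (chart_inv c ` K) p * k (chart_map c p))"
    and measurable_vol_compact: "(\<lambda>p. indicator (chart_inv c ` K) p * k (chart_map c p)) \<in> borel_measurable borel"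
proof -
  define f where "f p = indicator (chart_inv c ` K) p * k (chart_map c p)" for p
  have cK: "chart_inv c ` K \<in> sets borel"
    using compact_chart_inv_image[OF c K] by (simp add: compact_imp_closed)
  have "continuous_on (chart_inv c ` K) (\<lambda>p. k (chart_map c p))"
    using chart_map_chart_inv_image[OF c K(2)]
    by (intro continuous_on_compose2[OF k] continuous_on_subset[OF continuous_on_chart_map[OF c]]) auto
  from borel_measurable_continuous_on_indicator[OF cK this]
  have f: "f \<in> borel_measurable borel" by (simp add: f_def[abs_def])
  have f0: "f p = 0" if "p \<notin> chart_dom c" for p
    using that chart_map_chart_inv_image(2)[OF c K(2)] by (auto simp: f_def indicator_def)
  have eq: "indicator (chart_img c) y *\<^sub>R (f (chart_inv c y) * dens c y) = indicator K y *\<^sub>R (k y * dens c y)" for y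
    using chart_inv_image_iff[OF c K(2), of y] chart_map_inv[OF c, of y] K(2)
    by (auto simp: f_def indicator_def)
  have "(\<integral>p. f p \<partial>vol) = (LINT y:K|lborel. k y * dens c y)"
    by (subst integral_vol_chart[OF c f f0]) (auto simp only: set_lebesgue_integral_def eq)
  then show "(\<integral>p. indicator (chart_inv c ` K) p * k (chart_map c p) \<partial>vol) = (LINT y:K|lborel. k y * dens c y)"
    by (simp add: f_def)
  have "set_integrable lborel K (\<lambda>y. k y * dens c y)"
    by (intro set_integrable_compact K continuous_intros k continuous_on_subset[OF continuous_on_dens[OF c]])
  then have "integrable vol f"
    by (subst integrable_vol_chart[OF c f f0]) (auto simp only: set_integrable_def eq)
  then show "integrable vol (\<lambda>p. indicator (chart_inv c ` K) p * k (chart_map c p))" by (simp add: f_def[abs_def])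
  show "(\<lambda>p. indicator (chart_inv c ` K) p * k (chart_map c p)) \<in> borel_measurable borel"
    using f by (simp add: f_def[abs_def])
qed

text \<open>Green's first identity; the density of the volume cancels the division by
  \<open>dens\<close> in \<open>lap\<close>. Both sides are integrals over the manifold, so that
  they can be compared between charts.\<close>

lemma weak_laplacian:
  assumes c: "c \<in> \<A>" and \<Omega>: "open \<Omega>" "\<Omega> \<subseteq> chart_img c" and K: "compact K" "K \<subseteq> \<Omega>"
    and f: "Ck_on 2 \<Omega> f" and g: "Ck_on 1 \<Omega> g" and 0: "\<And>y. y \<in> \<Omega> - K \<Longrightarrow> g y = 0"
  shows "(\<integral>p. indicator (chart_inv c ` K) p * (g (chart_map c p) * lap c f (chart_map c p)) \<partial>vol) =
    - (\<integral>p. indicator (chart_inv c ` K) p * grad_inner c g f (chart_map c p) \<partial>vol)"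
proof -
  have KO: "K \<subseteq> chart_img c" using K \<Omega> by blast
  have dne: "dens c y \<noteq> 0" if "y \<in> chart_img c" for y using dens_pos[OF c that] by simp
  have a: "Ck_on 1 \<Omega> (ac c i j)" for i j by (rule Ck_on_subset[OF Ck_ac[OF c] \<Omega>(2)])
  have f1: "Ck_on 1 \<Omega> f" using Ck_on_mono[OF f, of 1] by simp
  have cont: "continuous_on K g" "continuous_on K (div_grad (ac c) f)" "continuous_on K (dens c)"
    "continuous_on K (partial_deriv i g)" "continuous_on K (partial_deriv i f)" "continuous_on K (ac c i j)" for i j
    using continuous_on_subset[OF _ K(2)] continuous_on_subset[OF continuous_on_dens[OF c] KO]
      Ck_on_imp_continuous_on[OF g] Ck_on_imp_continuous_on[OF a]
      continuous_on_partial_deriv[OF g] continuous_on_partial_deriv[OF f1]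
      Ck_on_imp_continuous_on[OF Ck_on_div_grad[of \<Omega> 0 "ac c" f]] \<Omega>(1) a f
    unfolding numeral_2_eq_2 One_nat_def by blast+
  have lapc: "continuous_on K (lap c f)" unfolding lap_def using cont dne KO by (intro continuous_intros) auto
  have gi: "grad_inner c g f y = (\<Sum>i\<in>UNIV. \<Sum>j\<in>UNIV. ac c i j y * partial_deriv i g y * partial_deriv j f y) / dens c y"
    if "y \<in> K" for y using sum_ac_eq_grad_inner[of c y g f] dne[of y] that KO by auto
  have "continuous_on K (\<lambda>y. (\<Sum>i\<in>UNIV. \<Sum>j\<in>UNIV. ac c i j y * partial_deriv i g y * partial_deriv j f y) / dens c y)"
    using dne KO by (intro continuous_intros cont) auto
  then have gic: "continuous_on K (grad_inner c g f)" by (simp cong: continuous_on_cong add: gi)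
  have cl: "K \<in> sets lborel" using K(1) by (simp add: compact_imp_closed)
  have "(\<integral>p. indicator (chart_inv c ` K) p * (g (chart_map c p) * lap c f (chart_map c p)) \<partial>vol) =
      (LINT y:K|lborel. g y * lap c f y * dens c y)"
    by (rule integral_vol_compact[OF c K(1) KO]) (intro continuous_intros cont lapc)
  also have "\<dots> = (LINT y:K|lborel. g y * div_grad (ac c) f y)"
    using dne KO cl by (intro set_lebesgue_integral_cong) (auto simp: lap_def)
  also have "\<dots> = - (LINT y:K|lborel. (\<Sum>i\<in>UNIV. \<Sum>j\<in>UNIV. ac c i j y * partial_deriv i g y * partial_deriv j f y))"
    using 0 by (intro green_first[OF \<Omega>(1) K a f g]) auto
  also have "(LINT y:K|lborel. (\<Sum>i\<in>UNIV. \<Sum>j\<in>UNIV. ac c i j y * partial_deriv i g y * partial_deriv j f y)) =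
      (LINT y:K|lborel. grad_inner c g f y * dens c y)"
    using cl by (intro set_lebesgue_integral_cong) (auto simp: sum_ac_eq_grad_inner)
  also have "\<dots> = (\<integral>p. indicator (chart_inv c ` K) p * grad_inner c g f (chart_map c p) \<partial>vol)"
    by (rule integral_vol_compact[OF c K(1) KO gic, symmetric])
  finally show ?thesis .
qed

text \<open>Testing against bump functions: the weak form only involves first derivatives.\<close>

lemma lap_chart_le:
  assumes c: "c \<in> \<A>" "d \<in> \<A>" and p0: "p0 \<in> chart_dom c \<inter> chart_dom d" and f: "smooth_function \<A> f"
  shows "lap c (f \<circ> chart_inv c) (chart_map c p0) \<le> lap d (f \<circ> chart_inv d) (chart_map d p0)"
proof (rule ccontr)
  assume contra: "\<not> ?thesis"
  define O' where "O' = chart_dom c \<inter> chart_dom d"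
  define \<Omega> where "\<Omega> e = chart_map e ` O'" for e :: "('m, 'n) chart"
  have \<Omega>c: "open (\<Omega> c)" "\<Omega> c \<subseteq> chart_img c" using open_overlap[OF c] by (auto simp: \<Omega>_def O'_def)
  have \<Omega>d: "open (\<Omega> d)" "\<Omega> d \<subseteq> chart_img d"
    using open_overlap[OF c(2,1)] by (auto simp: \<Omega>_def O'_def Int_commute)
  define fe where "fe e = f \<circ> chart_inv e" for e :: "('m, 'n) chart"
  have fe: "Ck_on k (chart_img e) (fe e)" if "e \<in> \<A>" for k e unfolding fe_def by (rule smooth_function_Ck[OF f that])
  have lapc: "continuous_on (chart_img e) (lap e (fe e))" if "e \<in> \<A>" for e
  proof -
    have "continuous_on (chart_img e) (div_grad (ac e) (fe e))"
      by (rule Ck_on_imp_continuous_on[OF Ck_on_div_grad[OF open_img[OF that] Ck_ac[OF that] fe[OF that], of 0]])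
    then show ?thesis unfolding lap_def using dens_pos[OF that] continuous_on_dens[OF that]
      by (intro continuous_intros) (auto simp: less_imp_neq[symmetric])
  qed
  define T where "T = transition c d"
  have T_in: "T y \<in> \<Omega> d" "chart_inv d (T y) = chart_inv c y" "chart_inv c y \<in> O'" if "y \<in> \<Omega> c" for y
    using that c by (auto simp: \<Omega>_def O'_def T_def transition_apply chart_inv_map)
  have T_cont: "continuous_on (\<Omega> c) T"
    unfolding T_def \<Omega>_def O'_def by (rule Ck_on_imp_continuous_on[OF Ck_transition[OF c]])
  define h where "h y = lap c (fe c) y - lap d (fe d) (T y)" for y
  have hc: "continuous_on (\<Omega> c) h"
    unfolding h_def using T_in \<Omega>d \<Omega>c(2)
    by (intro continuous_intros continuous_on_subset[OF lapc[OF c(1)]] continuous_on_compose2[OF lapc[OF c(2)] T_cont]) blast+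
  define x0 where "x0 = chart_map c p0"
  have x0: "x0 \<in> \<Omega> c" using p0 by (simp add: x0_def \<Omega>_def O'_def)
  \<comment> \<open>If the two Laplacians differed at the point, their difference h would be
    positive on a closed ball \<open>K\<close>. The test function g is positive inside this ball,
    while the equality of the weak forms makes the integral of g h vanish.\<close>
  have "h x0 > 0" using contra p0 c by (simp add: h_def fe_def x0_def T_def transition_apply)
  then have "open ((h -` {0<..}) \<inter> \<Omega> c)" "x0 \<in> h -` {0<..} \<inter> \<Omega> c"
    using continuous_on_open_vimage[OF \<Omega>c(1), of h] hc x0 open_greaterThan by blast+
  then obtain \<rho> where \<rho>: "\<rho> > 0" "cball x0 \<rho> \<subseteq> h -` {0<..} \<inter> \<Omega> c"
    by (meson open_contains_cball)
  define K where "K = cball x0 \<rho>"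
  have K: "compact K" "K \<subseteq> \<Omega> c" and hK: "\<And>y. y \<in> K \<Longrightarrow> h y > 0" using \<rho> by (auto simp: K_def)
  define g where "g y = max 0 (\<rho>\<^sup>2 - (y - x0) \<bullet> (y - x0)) ^ 2" for y :: "real^'n"
  have gC: "Ck_on 1 UNIV g"
    unfolding g_def inner_vec_def inner_real_def
    by (intro Ck_on_pospart_power Ck_on_diff Ck_on_sum Ck_on_mult Ck_on_const
        Ck_on_vec_nth Ck_on_bounded_linear bounded_linear_ident open_UNIV) simp
  have g0: "g y = 0" if "y \<notin> K" for y
  proof -
    have "\<rho> < norm (y - x0)" using that by (simp add: K_def dist_norm norm_minus_commute)
    then have "\<rho>\<^sup>2 < (norm (y - x0))\<^sup>2" using \<rho>(1) by (intro power_strict_mono) auto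
    then show ?thesis by (simp add: g_def power2_norm_eq_inner max_def)
  qed
  have gnn: "g y \<ge> 0" for y by (simp add: g_def)
  define gd where "gd = (\<lambda>y. g (transition d c y))"
  define Kd where "Kd = T ` K"
  have Kd: "compact Kd" "Kd \<subseteq> \<Omega> d"
    using K T_in continuous_on_subset[OF T_cont K(2)] by (auto simp: Kd_def intro: compact_continuous_image)
  have inv_eq: "chart_inv d ` Kd = chart_inv c ` K"
    using T_in K(2) unfolding Kd_def image_image by (intro image_cong) auto
  have td: "transition d c y \<in> \<Omega> c" "T (transition d c y) = y" if "y \<in> \<Omega> d" for y
    using that c by (auto simp: \<Omega>_def O'_def T_def transition_apply)
  have gdC: "Ck_on 1 (\<Omega> d) gd"
    unfolding gd_def using Ck_transition[OF c(2,1)]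
    by (intro Ck_on_compose[OF \<Omega>d(1) open_UNIV _ gC]) (simp_all add: \<Omega>_def O'_def Int_commute)
  have gd0: "gd y = 0" if "y \<in> \<Omega> d - Kd" for y
  proof -
    have "transition d c y \<notin> K" using that td(2)[of y] unfolding Kd_def by (metis DiffD1 DiffD2 imageI)
    then show ?thesis by (simp add: gd_def g0)
  qed
  have wc: "(\<integral>p. indicator (chart_inv c ` K) p * (g (chart_map c p) * lap c (fe c) (chart_map c p)) \<partial>vol) =
    - (\<integral>p. indicator (chart_inv c ` K) p * grad_inner c g (fe c) (chart_map c p) \<partial>vol)"
    by (rule weak_laplacian[OF c(1) \<Omega>c K Ck_on_subset[OF fe[OF c(1)] \<Omega>c(2)] Ck_on_subset[OF gC]]) (auto simp: g0)
  have wd: "(\<integral>p. indicator (chart_inv c ` K) p * (gd (chart_map d p) * lap d (fe d) (chart_map d p)) \<partial>vol) =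
    - (\<integral>p. indicator (chart_inv c ` K) p * grad_inner d gd (fe d) (chart_map d p) \<partial>vol)"
    unfolding inv_eq[symmetric]
    by (rule weak_laplacian[OF c(2) \<Omega>d Kd Ck_on_subset[OF fe[OF c(2)] \<Omega>d(2)] gdC gd0])
  have in_O': "p \<in> O'" "chart_map c p \<in> K" if "p \<in> chart_inv c ` K" for p
    using that T_in(3) K(2) chart_map_chart_inv_image[OF c(1) _ that] \<Omega>c(2) by auto
  have "grad_inner c g (fe c) (chart_map c p) = grad_inner d gd (fe d) (chart_map d p)" if p: "p \<in> O'" for p
  proof -
    have pO: "p \<in> chart_dom c \<inter> chart_dom d" using p by (simp add: O'_def)
    have y: "chart_map c p \<in> \<Omega> c" "chart_map d p \<in> \<Omega> d" using p by (auto simp: \<Omega>_def)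
    have "grad_inner d gd (fe d) (chart_map d p) =
        grad_inner c (\<lambda>y. gd (transition c d y)) (\<lambda>y. fe d (transition c d y)) (chart_map c p)"
    proof (rule grad_inner_transition[OF c pO, symmetric])
      show "gd differentiable at (chart_map d p)"
        using Ck_on_imp_differentiable[of 0 "\<Omega> d" gd] gdC y by simp
      show "fe d differentiable at (chart_map d p)"
        using Ck_on_imp_differentiable[OF fe[OF c(2), of "Suc 0"]] y \<Omega>d(2) by blast
    qed
    moreover have "partial_deriv i (\<lambda>y. gd (transition c d y)) (chart_map c p) = partial_deriv i g (chart_map c p)" for i
      by (rule partial_deriv_cong_open[OF \<Omega>c(1) y(1)])
        (use c in \<open>auto simp: gd_def \<Omega>_def O'_def transition_apply\<close>)
    moreover have "partial_deriv i (\<lambda>y. fe d (transition c d y)) (chart_map c p) = partial_deriv i (fe c) (chart_map c p)" for i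
      by (rule partial_deriv_cong_open[OF \<Omega>c(1) y(1)])
        (use c in \<open>auto simp: fe_def \<Omega>_def O'_def transition_apply chart_inv_map\<close>)
    ultimately show ?thesis by (simp add: grad_inner_def grad_def)
  qed
  then have "(\<integral>p. indicator (chart_inv c ` K) p * grad_inner c g (fe c) (chart_map c p) \<partial>vol) =
      (\<integral>p. indicator (chart_inv c ` K) p * grad_inner d gd (fe d) (chart_map d p) \<partial>vol)"
    using in_O' by (intro Bochner_Integration.integral_cong refl) (auto simp: indicator_def)
  then have eq: "(\<integral>p. indicator (chart_inv c ` K) p * (g (chart_map c p) * lap c (fe c) (chart_map c p)) \<partial>vol) =
      (\<integral>p. indicator (chart_inv c ` K) p * (gd (chart_map d p) * lap d (fe d) (chart_map d p)) \<partial>vol)"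
    using wc wd by simp
  have KO: "K \<subseteq> chart_img c" using K \<Omega>c by blast
  have gcK: "continuous_on K g" using continuous_on_subset[OF Ck_on_imp_continuous_on[OF gC]] by simp
  have cK: "continuous_on K (\<lambda>y. g y * lap c (fe c) y)" "continuous_on K (\<lambda>y. g y * lap d (fe d) (T y))" "continuous_on K h"
    using continuous_on_subset[OF lapc[OF c(1)] KO] continuous_on_subset[OF hc K(2)] gcK
      continuous_on_compose2[OF lapc[OF c(2)] continuous_on_subset[OF T_cont K(2)]] T_in(1) K(2) \<Omega>d(2)
    by (auto intro!: continuous_intros)
  have "(\<integral>p. indicator (chart_inv c ` K) p * (gd (chart_map d p) * lap d (fe d) (chart_map d p)) \<partial>vol) =
      (\<integral>p. indicator (chart_inv c ` K) p * (g (chart_map c p) * lap d (fe d) (T (chart_map c p))) \<partial>vol)"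
    using in_O' c by (intro Bochner_Integration.integral_cong refl)
      (auto simp: indicator_def gd_def T_def transition_apply O'_def)
  with eq have "(LINT y:K|lborel. g y * lap c (fe c) y * dens c y) = (LINT y:K|lborel. g y * lap d (fe d) (T y) * dens c y)"
    using integral_vol_compact[OF c(1) K(1) KO cK(1)] integral_vol_compact[OF c(1) K(1) KO cK(2)] by simp
  moreover have dc: "continuous_on K (dens c)" by (rule continuous_on_subset[OF continuous_on_dens[OF c(1)] KO])
  ultimately have "(LINT y:K|lborel. g y * lap c (fe c) y * dens c y - g y * lap d (fe d) (T y) * dens c y) = 0"
    by (subst set_integral_diff) (auto intro!: set_integrable_compact K(1) continuous_intros cK)
  then have zero: "(LINT y:K|lborel. g y * h y * dens c y) = 0"
    by (simp add: h_def algebra_simps)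
  have int: "set_integrable lborel K (\<lambda>y. g y * h y * dens c y)"
    by (intro set_integrable_compact K(1) continuous_intros gcK cK dc)
  have pos: "0 \<le> g y * h y * dens c y" if "y \<in> K" for y
    using gnn[of y] hK[OF that] dens_pos[OF c(1), of y] that KO by auto
  have "AE y in lborel. indicator K y *\<^sub>R (g y * h y * dens c y) = 0"
    using int zero pos unfolding set_integrable_def set_lebesgue_integral_def
    by (subst integral_nonneg_eq_0_iff_AE[symmetric]) (auto simp: indicator_def)
  then have "AE y in lborel. y \<notin> ball x0 \<rho>"
  proof (rule AE_mp, intro AE_I2 impI notI)
    fix y assume 0: "indicator K y *\<^sub>R (g y * h y * dens c y) = 0" and y: "y \<in> ball x0 \<rho>"
    then have yK: "y \<in> K" by (simp add: K_def)
    have "(norm (y - x0))\<^sup>2 < \<rho>\<^sup>2" using y by (intro power_strict_mono) (auto simp: dist_norm norm_minus_commute)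
    then have "g y > 0" by (simp add: g_def power2_norm_eq_inner)
    then show False using 0 yK hK[OF yK] dens_pos[OF c(1), of y] KO by auto
  qed
  then have "emeasure lborel (ball x0 \<rho>) = 0"
    using AE_iff_null_sets[of "ball x0 \<rho>" lborel] by auto
  then show False
    using content_ball_pos[OF \<rho>(1), of x0] by (simp add: measure_def)
qed

text \<open>The inequality \<open>lap_chart_le\<close>, used in both directions between c and the
  chosen chart, frees the eigenvalue equation from that choice.\<close>

theorem laplacian_eq_lap:
  assumes c: "c \<in> \<A>" and p: "p \<in> chart_dom c" and f: "smooth_function \<A> f"
  shows "laplacian \<A> G f p = lap c (f \<circ> chart_inv c) (chart_map c p)"
  using lap_chart_le[OF c chart_at(1)[of p], of p f] lap_chart_le[OF chart_at(1)[of p] c, of p f] p f chart_at(2)[of p]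
  by (simp add: laplacian_def laplace_chart_eq Let_def)

end

section \<open>Lattice coverings\<close>

definition lattice :: "real \<Rightarrow> (real^'n) set" where
  "lattice h = {y. \<forall>i. \<exists>k::int. y $ i = h * of_int k}"

lemma lattice_card_le:
  fixes x :: "real^'n"
  assumes h: "h > 0"
  shows "finite {y \<in> lattice h. dist x y \<le> \<rho>}"
    and "card {y \<in> lattice h. dist x y \<le> \<rho>} \<le> (nat \<lfloor>2 * (\<rho> / h)\<rfloor> + 1) ^ CARD('n)"
proof -
  define S where "S i = {\<lceil>x $ i / h - \<rho> / h\<rceil>..\<lfloor>x $ i / h + \<rho> / h\<rfloor>}" for i
  define F where "F y = (\<lambda>i. \<lfloor>y $ i / h\<rfloor>)" for y :: "real^'n"
  have coord: "y $ i = h * of_int (F y i)" if y: "y \<in> lattice h" for y i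
  proof -
    obtain k :: int where "y $ i = h * of_int k" using y by (auto simp: lattice_def)
    then show ?thesis using h by (simp add: F_def)
  qed
  have inj: "inj_on F {y \<in> lattice h. dist x y \<le> \<rho>}"
    by (rule inj_onI) (auto simp: vec_eq_iff coord)
  have sub: "F ` {y \<in> lattice h. dist x y \<le> \<rho>} \<subseteq> PiE UNIV S"
  proof clarify
    fix y assume y: "y \<in> lattice h" "dist x y \<le> \<rho>"
    have "F y i \<in> S i" for i
    proof -
      have "\<bar>x $ i - y $ i\<bar> \<le> \<rho>"
        using component_le_norm_cart[of "x - y" i] y(2) by (simp add: dist_norm)
      then have "\<bar>x $ i / h - of_int (F y i)\<bar> \<le> \<rho> / h"
        using h coord[OF y(1), of i] by (simp add: field_simps abs_le_iff)
      then show ?thesis unfolding S_def by (simp add: ceiling_le_iff le_floor_iff abs_le_iff)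
    qed
    then show "F y \<in> PiE UNIV S" by auto
  qed
  have finP: "finite (PiE UNIV S)" by (rule finite_PiE) (auto simp: S_def)
  show "finite {y \<in> lattice h. dist x y \<le> \<rho>}"
    using finite_imageD[OF finite_subset[OF sub finP] inj] .
  have "card {y \<in> lattice h. dist x y \<le> \<rho>} \<le> card (PiE UNIV S)"
    by (rule card_inj_on_le[OF inj sub finP])
  also have "\<dots> = (\<Prod>i\<in>UNIV. card (S i))" by (rule card_PiE) simp
  also have "\<dots> \<le> (\<Prod>i\<in>(UNIV::'n set). nat \<lfloor>2 * (\<rho> / h)\<rfloor> + 1)"
  proof (rule prod_mono, safe)
    fix i
    have "\<lfloor>x $ i / h + \<rho> / h\<rfloor> - \<lceil>x $ i / h - \<rho> / h\<rceil> \<le> \<lfloor>2 * (\<rho> / h)\<rfloor>"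
      by linarith
    then show "card (S i) \<le> nat \<lfloor>2 * (\<rho> / h)\<rfloor> + 1" by (simp add: S_def)
  qed
  finally show "card {y \<in> lattice h. dist x y \<le> \<rho>} \<le> (nat \<lfloor>2 * (\<rho> / h)\<rfloor> + 1) ^ CARD('n)" by simp
qed

lemma lattice_near:
  fixes x :: "real^'n"
  assumes h: "h > 0"
  obtains y where "y \<in> lattice h" "dist y x \<le> real CARD('n) * h"
proof -
  define y :: "real^'n" where "y = (\<chi> i. h * of_int \<lfloor>x $ i / h\<rfloor>)"
  have "\<bar>(y - x) $ i\<bar> \<le> h" for i
  proof -
    have "of_int \<lfloor>x $ i / h\<rfloor> \<le> x $ i / h" "x $ i / h \<le> of_int \<lfloor>x $ i / h\<rfloor> + 1" by linarith+
    note this[THEN mult_left_mono, OF less_imp_le[OF h]]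
    moreover have "h * (x $ i / h) = x $ i" using h by simp
    ultimately have "h * of_int \<lfloor>x $ i / h\<rfloor> \<le> x $ i" "x $ i \<le> h * of_int \<lfloor>x $ i / h\<rfloor> + h"
      by (simp_all only: distrib_left mult_1_right)
    then show ?thesis using h by (simp add: y_def abs_le_iff)
  qed
  then have "(\<Sum>i\<in>UNIV. \<bar>(y - x) $ i\<bar>) \<le> (\<Sum>i\<in>(UNIV::'n set). h)" by (intro sum_mono)
  then have "dist y x \<le> real CARD('n) * h"
    using norm_le_l1_cart[of "y - x"] by (simp add: dist_norm)
  moreover have "y \<in> lattice h" by (auto simp: y_def lattice_def)
  ultimately show thesis using that by blast
qed

text \<open>The mesh r/(4n) puts a lattice point within r/4 of every point; the radius 2 R, with R
  to spare, keeps those that belong to points of \<open>ball x0 R\<close> when r is at most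
  R.\<close>

definition centres :: "real^'n \<Rightarrow> real \<Rightarrow> real \<Rightarrow> (real^'n) set" where
  "centres x0 R r = {y \<in> lattice (r / (4 * real CARD('n))). dist x0 y \<le> 2 * R}"

text \<open>Bounds the number of centres in a ball of radius 2 r: in each coordinate an interval of
  length 4 r contains at most 16 n + 1 multiples of r/(4n).\<close>

definition overlap :: "'n::finite itself \<Rightarrow> nat" where
  "overlap _ = (16 * CARD('n) + 1) ^ CARD('n)"

lemma finite_centres: "r > 0 \<Longrightarrow> finite (centres x0 R r)"
  unfolding centres_def by (rule lattice_card_le) simp

lemma card_centres_near:
  fixes x :: "real^'n"
  assumes "r > 0"
  shows "card {y \<in> centres x0 R r. dist x y \<le> 2 * r} \<le> overlap TYPE('n)"
proof -
  define h where "h = r / (4 * real CARD('n))"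
  have h: "h > 0" using assms by (simp add: h_def)
  have "card {y \<in> centres x0 R r. dist x y \<le> 2 * r} \<le> card {y \<in> lattice h. dist x y \<le> 2 * r}"
    by (intro card_mono lattice_card_le h) (auto simp: centres_def h_def)
  also have "\<dots> \<le> (nat \<lfloor>2 * (2 * r / h)\<rfloor> + 1) ^ CARD('n)" by (rule lattice_card_le[OF h])
  also have "2 * (2 * r / h) = real (16 * CARD('n))" using assms by (simp add: h_def)
  also have "nat \<lfloor>real (16 * CARD('n))\<rfloor> = 16 * CARD('n)" by linarith
  finally show ?thesis by (simp add: overlap_def)
qed

lemma centres_cover:
  fixes x :: "real^'n"
  assumes "0 < r" "r \<le> R" "x \<in> ball x0 R"
  obtains y where "y \<in> centres x0 R r" "dist y x \<le> r / 4"
proof -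
  have h: "r / (4 * real CARD('n)) > 0" using assms by simp
  obtain y where y: "y \<in> lattice (r / (4 * real CARD('n)))" "dist y x \<le> real CARD('n) * (r / (4 * real CARD('n)))"
    using lattice_near[OF h] by blast
  have d: "dist y x \<le> r / 4" using y(2) by simp
  have "dist x0 y \<le> 2 * R" using dist_triangle[of x0 y x] d assms by (simp add: dist_commute)
  then show thesis using that y(1) d by (auto simp: centres_def)
qed

lemma sum_integral_overlap:
  fixes h :: "real^'n \<Rightarrow> real"
  assumes "finite Y" "\<And>x. card {y \<in> Y. dist x y \<le> r} \<le> N" "compact K" "\<And>y. y \<in> Y \<Longrightarrow> cball y r \<subseteq> K"
    and "continuous_on K h" "\<And>x. x \<in> K \<Longrightarrow> h x \<ge> 0"
  shows "(\<Sum>y\<in>Y. LINT x:cball y r|lborel. h x) \<le> real N * (LINT x:K|lborel. h x)"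
proof -
  have int: "set_integrable lborel (cball y r) h" if "y \<in> Y" for y
    by (intro set_integrable_compact compact_cball continuous_on_subset[OF assms(5)] assms(4) that)
  have intK: "set_integrable lborel K h" by (intro set_integrable_compact assms)
  have "(\<Sum>y\<in>Y. LINT x:cball y r|lborel. h x) = (LINT x|lborel. (\<Sum>y\<in>Y. indicator (cball y r) x *\<^sub>R h x))"
    unfolding set_lebesgue_integral_def using int
    by (subst Bochner_Integration.integral_sum) (auto simp: set_integrable_def)
  also have "\<dots> \<le> (LINT x|lborel. real N * (indicator K x *\<^sub>R h x))"
  proof (rule integral_mono)
    show "integrable lborel (\<lambda>x. \<Sum>y\<in>Y. indicator (cball y r) x *\<^sub>R h x)"
      using int by (intro Bochner_Integration.integrable_sum) (auto simp: set_integrable_def)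
    show "integrable lborel (\<lambda>x. real N * (indicator K x *\<^sub>R h x))"
      using intK by (intro integrable_mult_right) (simp add: set_integrable_def)
    fix x
    have "(\<Sum>y\<in>Y. indicator (cball y r) x *\<^sub>R h x) = real (card {y \<in> Y. dist x y \<le> r}) * h x"
    proof -
      have "(\<Sum>y\<in>Y. indicator (cball y r) x *\<^sub>R h x) = (\<Sum>y\<in>{y \<in> Y. dist x y \<le> r}. h x)"
        using assms(1) by (intro sum.mono_neutral_cong_right) (auto simp: indicator_def dist_commute)
      then show ?thesis by simp
    qed
    also have "\<dots> \<le> real N * (indicator K x *\<^sub>R h x)"
    proof (cases "x \<in> K")
      case True
      then show ?thesis using assms(2)[of x] assms(6) by (simp add: mult_right_mono)
    next
      case False
      then have "{y \<in> Y. dist x y \<le> r} = {}" using assms(4) by (auto simp: subset_iff dist_commute)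
      then have "card {y \<in> Y. dist x y \<le> r} = 0" by (simp only: card.empty)
      then show ?thesis using False by simp
    qed
    finally show "(\<Sum>y\<in>Y. indicator (cball y r) x *\<^sub>R h x) \<le> real N * (indicator K x *\<^sub>R h x)" .
  qed
  finally show ?thesis by (simp add: set_lebesgue_integral_def)
qed

section \<open>Eigenfunctions in coordinate patches\<close>

lemma div_grad_sum:
  assumes "open \<Omega>" "x \<in> \<Omega>" "\<And>i j. Ck_on 1 \<Omega> (a i j)" "\<And>j. j \<in> J \<Longrightarrow> Ck_on 2 \<Omega> (f j)"
  shows "div_grad a (\<lambda>y. \<Sum>j\<in>J. c j * f j y) x = (\<Sum>j\<in>J. c j * div_grad a (f j) x)"
proof -
  have fd: "f j differentiable (at y)" if "j \<in> J" "y \<in> \<Omega>" for j y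
    using Ck_on_imp_differentiable[of 1 \<Omega> "f j"] assms(4) that by (simp add: numeral_2_eq_2)
  have f1: "Ck_on 1 \<Omega> (partial_deriv i (f j))" if "j \<in> J" for i j
    using Ck_on_partial_deriv[of 1 \<Omega> "f j"] assms(4)[OF that] by (simp add: numeral_2_eq_2)
  define F where "F j i y = (\<Sum>l\<in>UNIV. a i l y * partial_deriv l (f j) y)" for j i y
  have F: "F j i differentiable (at x)" if "j \<in> J" for j i
  proof -
    have "Ck_on 1 \<Omega> (F j i)" unfolding F_def by (intro Ck_on_sum Ck_on_mult assms f1 that)
    then show ?thesis using Ck_on_imp_differentiable[of 0 \<Omega>] assms(2) by simp
  qed
  have "partial_deriv i (\<lambda>y. \<Sum>l\<in>UNIV. a i l y * partial_deriv l (\<lambda>y. \<Sum>j\<in>J. c j * f j y) y) x =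
      (\<Sum>j\<in>J. c j * partial_deriv i (F j i) x)" for i
  proof -
    have "partial_deriv i (\<lambda>y. \<Sum>l\<in>UNIV. a i l y * partial_deriv l (\<lambda>y. \<Sum>j\<in>J. c j * f j y) y) x =
      partial_deriv i (\<lambda>y. \<Sum>j\<in>J. c j * F j i y) x"
    proof (rule partial_deriv_cong_open[OF assms(1,2)])
      fix y assume y: "y \<in> \<Omega>"
      have "partial_deriv l (\<lambda>y. \<Sum>j\<in>J. c j * f j y) y = (\<Sum>j\<in>J. c j * partial_deriv l (f j) y)" for l
        using fd y by (subst partial_deriv_sum) (auto simp: partial_deriv_cmult)
      then show "(\<Sum>l\<in>UNIV. a i l y * partial_deriv l (\<lambda>y. \<Sum>j\<in>J. c j * f j y) y) = (\<Sum>j\<in>J. c j * F j i y)"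
        unfolding F_def sum_distrib_left by (subst sum.swap) (simp add: sum_distrib_left ac_simps)
    qed
    then show ?thesis using F by (subst (asm) partial_deriv_sum) (auto simp: partial_deriv_cmult)
  qed
  then show ?thesis
    unfolding div_grad_def by (simp add: F_def[abs_def] sum_distrib_left) (rule sum.swap)
qed

text \<open>The set \<open>P\<close> consists of coordinate patches, given by chart, centre and
  radius. The factor 4 is room for the local estimates: the centres of cells lie within 2 R of
  \<open>x0\<close>, and the interior estimate asks for a ball of radius 2 R around each of them
  inside the chart.\<close>

locale eigenbasis_manifold = riemannian_manifold \<A> G
  for \<A> :: "('m::{second_countable_topology, t2_space}, 'n::finite) chart set" and G +
  fixes e :: "nat \<Rightarrow> 'm \<Rightarrow> real" and ev :: "nat \<Rightarrow> real"
    and P :: "(('m, 'n) chart \<times> (real^'n) \<times> real) set"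
  assumes compact_UNIV: "compact (UNIV :: 'm set)"
    and eigenbasis: "laplace_eigenbasis \<A> G e ev"
    and finite_P: "finite P"
    and patch: "(c, x0, R) \<in> P \<Longrightarrow> c \<in> \<A> \<and> 0 < R \<and> cball x0 (4 * R) \<subseteq> chart_img c"
    and patches_cover: "\<exists>(c, x0, R) \<in> P. p \<in> chart_inv c ` ball x0 R"

lemma (in riemannian_manifold) ex_patches:
  assumes "compact (UNIV :: 'm set)"
  shows "\<exists>P. finite P \<and> (\<forall>(c, x0, R) \<in> P. c \<in> \<A> \<and> 0 < R \<and> cball x0 (4 * R) \<subseteq> chart_img c) \<and>
    (\<forall>p. \<exists>(c, x0, R) \<in> P. p \<in> chart_inv c ` ball x0 R)"
proof -
  define Q where "Q = {(c, x0 :: real^'n, R). c \<in> \<A> \<and> 0 < R \<and> cball x0 (4 * R) \<subseteq> chart_img c}"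
  define U where "U = (\<lambda>(c :: ('m, 'n) chart, x0, R). chart_inv c ` ball x0 R)"
  have "\<exists>q\<in>Q. p \<in> U q" for p
  proof -
    obtain c where c: "c \<in> \<A>" "p \<in> chart_dom c" using charts_cover by blast
    define x where "x = chart_map c p"
    have "x \<in> chart_img c" using c by (simp add: x_def)
    then obtain r where r: "r > 0" "cball x r \<subseteq> chart_img c"
      using open_img[OF c(1)] open_contains_cball by blast
    have "(c, x, r / 4) \<in> Q" using c r by (simp add: Q_def)
    moreover have "p \<in> U (c, x, r / 4)"
      using r chart_inv_map[OF c] unfolding U_def x_def by (auto intro!: rev_image_eqI[of "chart_map c p"])
    ultimately show ?thesis by blast
  qed
  moreover have "open (U q)" if "q \<in> Q" for q
  proof -
    obtain c x R where q: "q = (c, x, R)" by (cases q)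
    have "ball x R \<subseteq> cball x (4 * R)" using that q by (auto simp: Q_def)
    then show ?thesis using that q unfolding U_def Q_def by (auto intro!: open_chart_inv_image)
  qed
  ultimately obtain P where "P \<subseteq> Q" "finite P" "UNIV \<subseteq> (\<Union>q\<in>P. U q)"
    using compactE_image[OF assms, of Q U] by (metis UNIV_I UN_iff subsetI)
  moreover have "\<exists>(c, x0, R) \<in> P. p \<in> chart_inv c ` ball x0 R" for p
  proof -
    obtain q where "q \<in> P" "p \<in> U q" using \<open>UNIV \<subseteq> (\<Union>q\<in>P. U q)\<close> by blast
    then show ?thesis by (intro bexI[of _ q]) (auto simp: U_def)
  qed
  ultimately show ?thesis by (intro exI[of _ P]) (auto simp: Q_def)
qed

context eigenbasis_manifold
begin

lemma e_smooth: "smooth_function \<A> (e j)"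
  using eigenbasis by (simp add: laplace_eigenbasis_def)

lemma Ck_e: "c \<in> \<A> \<Longrightarrow> Ck_on k (chart_img c) (\<lambda>y. e j (chart_inv c y))"
  using smooth_function_Ck[OF e_smooth[of j]] by (simp add: o_def)

lemma lap_e:
  assumes "c \<in> \<A>" "y \<in> chart_img c"
  shows "lap c (\<lambda>y. e j (chart_inv c y)) y = - (ev j)\<^sup>2 * e j (chart_inv c y)"
  using laplacian_eq_lap[OF assms(1) chart_inv_in_dom[OF assms] e_smooth[of j]] eigenbasis
  unfolding laplace_eigenbasis_def
  by (simp add: chart_map_inv[OF assms] o_def) (metis minus_equation_iff)

lemma ev_nonneg: "ev j \<ge> 0"
proof (cases "j = 0")
  case False
  have "ev 1 \<le> ev j"
  proof (rule nat_induct_at_least[of 1 j])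
    show "1 \<le> j" using False by simp
    show "ev 1 \<le> ev (Suc i)" if "1 \<le> i" "ev 1 \<le> ev i" for i
      using eigenbasis that unfolding laplace_eigenbasis_def by (meson order_trans)
  qed simp
  then show ?thesis using eigenbasis by (simp add: laplace_eigenbasis_def)
qed (use eigenbasis in \<open>simp add: laplace_eigenbasis_def\<close>)

lemma continuous_e: "continuous_on UNIV (e j)"
proof (intro continuous_at_imp_continuous_on ballI)
  fix p :: 'm
  obtain c where c: "c \<in> \<A>" "p \<in> chart_dom c" using charts_cover by blast
  have "continuous_on (chart_dom c) (\<lambda>p. e j (chart_inv c (chart_map c p)))"
    by (rule continuous_on_compose2[OF Ck_on_imp_continuous_on[OF Ck_e[OF c(1), of 0]] continuous_on_chart_map[OF c(1)]]) auto
  then have "continuous_on (chart_dom c) (e j)"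
    by (rule continuous_on_eq) (simp add: chart_inv_map[OF c(1)])
  then show "isCont (e j) p" using continuous_on_eq_continuous_at[OF open_dom[OF c(1)]] c(2) by blast
qed

lemma measurable_e[measurable]: "e j \<in> borel_measurable borel"
  by (rule borel_measurable_continuous_onI[OF continuous_e])

lemma emeasure_vol_finite: "emeasure vol UNIV < \<infinity>"
proof -
  have fin: "emeasure vol (chart_inv c ` cball x0 R) < \<infinity>" if "(c, x0, R) \<in> P" for c x0 R
  proof -
    have c: "c \<in> \<A>" "cball x0 R \<subseteq> chart_img c" using patch[OF that] by (auto simp: subset_iff)
    have K: "chart_inv c ` cball x0 R \<in> sets borel"
      using compact_chart_inv_image[OF c(1) _ c(2)] by (simp add: compact_imp_closed)
    have "integrable vol (\<lambda>p. indicator (chart_inv c ` cball x0 R) p * (1::real))"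
      using integrable_vol_compact[OF c(1) compact_cball c(2), of "\<lambda>_. 1"] by simp
    then show ?thesis using K by (simp add: integrable_indicator_iff)
  qed
  have borel: "chart_inv c ` cball x0 R \<in> sets borel" if "(c, x0, R) \<in> P" for c x0 R
  proof -
    have c: "c \<in> \<A>" "cball x0 R \<subseteq> chart_img c" using patch[OF that] by (auto simp: subset_iff)
    then show ?thesis using compact_chart_inv_image[OF c(1) compact_cball c(2)] by (simp add: compact_imp_closed)
  qed
  have "emeasure vol UNIV \<le> emeasure vol (\<Union>(c, x0, R) \<in> P. chart_inv c ` cball x0 R)"
  proof (rule emeasure_mono)
    show "UNIV \<subseteq> (\<Union>(c, x0, R) \<in> P. chart_inv c ` cball x0 R)"
    proof
      fix p
      obtain c x0 R where "(c, x0, R) \<in> P" "p \<in> chart_inv c ` ball x0 R" using patches_cover[of p] by blast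
      then show "p \<in> (\<Union>(c, x0, R) \<in> P. chart_inv c ` cball x0 R)"
        using ball_subset_cball by (intro UN_I[of "(c, x0, R)"]) auto
    qed
    show "(\<Union>(c, x0, R) \<in> P. chart_inv c ` cball x0 R) \<in> sets vol"
      using finite_P borel by (auto intro!: sets.finite_UN)
  qed
  also have "\<dots> \<le> (\<Sum>(c, x0, R) \<in> P. emeasure vol (chart_inv c ` cball x0 R))"
  proof -
    have "(\<lambda>q. case q of (c, x0, R) \<Rightarrow> chart_inv c ` cball x0 R) ` P \<subseteq> sets vol"
      using borel by auto
    from emeasure_subadditive_finite[OF finite_P this] show ?thesis by (simp add: case_prod_beta)
  qed
  also have "\<dots> < \<infinity>" using fin finite_P by (auto simp: ennreal_sum_less_top less_top[symmetric])
  finally show ?thesis .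
qed

lemma finite_measure_vol: "finite_measure vol"
  using emeasure_vol_finite by (intro finite_measureI) simp

lemma continuous_bounded:
  assumes "continuous_on UNIV (f :: 'm \<Rightarrow> real)"
  obtains W where "W \<ge> 0" "\<And>p. \<bar>f p\<bar> \<le> W"
proof -
  have "bounded (range f)" by (intro compact_imp_bounded compact_continuous_image assms compact_UNIV)
  then obtain W where "\<And>p. \<bar>f p\<bar> \<le> W" by (auto simp: bounded_iff)
  moreover from this[of undefined] have "W \<ge> 0" by linarith
  ultimately show thesis using that by blast
qed

lemma integrable_continuous_finite_measure:
  assumes "finite_measure M" "sets M = sets borel" "continuous_on UNIV (f :: 'm \<Rightarrow> real)"
  shows "integrable M f"
proof -
  interpret finite_measure M by fact
  obtain W where W: "\<And>p. \<bar>f p\<bar> \<le> W" using continuous_bounded[OF assms(3)] by blast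
  show ?thesis
  proof (rule integrable_const_bound[where B=W])
    show "f \<in> borel_measurable M"
      unfolding measurable_cong_sets[OF assms(2) refl] by (rule borel_measurable_continuous_onI[OF assms(3)])
  qed (use W in simp)
qed

lemma e_orthonormal: "(\<integral>p. e i p * e j p \<partial>vol) = (if i = j then 1 else 0)"
  using eigenbasis by (simp add: laplace_eigenbasis_def complete_orthonormal_basis_def)

lemma continuous_combination: "continuous_on UNIV (\<lambda>p. \<Sum>j\<in>J. a j * e j p)"
  by (intro continuous_intros continuous_e)

lemma integral_combination_square:
  assumes "finite J"
  shows "(\<integral>p. (\<Sum>j\<in>J. a j * e j p)\<^sup>2 \<partial>vol) = (\<Sum>j\<in>J. (a j)\<^sup>2)"
proof -
  have int: "integrable vol (\<lambda>p. a i * a j * (e i p * e j p))" for i j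
    by (intro integrable_continuous_finite_measure finite_measure_vol continuous_intros continuous_e) simp
  have "(\<integral>p. (\<Sum>j\<in>J. a j * e j p)\<^sup>2 \<partial>vol) = (\<integral>p. (\<Sum>i\<in>J. \<Sum>j\<in>J. a i * a j * (e i p * e j p)) \<partial>vol)"
    by (simp add: power2_eq_square sum_product ac_simps)
  also have "\<dots> = (\<Sum>i\<in>J. \<Sum>j\<in>J. \<integral>p. a i * a j * (e i p * e j p) \<partial>vol)"
    by (subst Bochner_Integration.integral_sum, intro Bochner_Integration.integrable_sum int)
      (intro sum.cong refl Bochner_Integration.integral_sum int)
  also have "\<dots> = (\<Sum>i\<in>J. \<Sum>j\<in>J. a i * a j * (if i = j then 1 else 0))"
    by (simp add: e_orthonormal)
  also have "\<dots> = (\<Sum>j\<in>J. (a j)\<^sup>2)"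
    using assms by (simp add: if_distrib[of "\<lambda>x. _ * x"] power2_eq_square cong: if_cong)
  finally show ?thesis .
qed

end

section \<open>The upper bound\<close>

lemma sum_half_powers: "(\<Sum>k<M. (1/2::real) ^ k) = 2 - 2 * (1/2) ^ M"
  by (induction M) simp_all

text \<open>Cauchy-Schwarz for the weights (1/2)^k, whose total is at most 2 for every number of
  terms.\<close>

lemma weighted_sum_square_le:
  "(\<Sum>k<M. (1/2) ^ k * t k)\<^sup>2 \<le> 2 * (\<Sum>k<M. (1/2) ^ k * (t k)\<^sup>2)" for t :: "nat \<Rightarrow> real"
proof -
  have "(\<Sum>k<M. (1/2) ^ k * t k)\<^sup>2 = (\<Sum>k<M. sqrt ((1/2) ^ k) * (sqrt ((1/2) ^ k) * t k))\<^sup>2"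
    by (simp add: mult.assoc[symmetric] real_sqrt_mult_self)
  also have "\<dots> \<le> (\<Sum>k<M. (sqrt ((1/2) ^ k))\<^sup>2) * (\<Sum>k<M. (sqrt ((1/2) ^ k) * t k)\<^sup>2)"
    by (rule Cauchy_Schwarz_ineq_sum)
  also have "\<dots> = (\<Sum>k<M. (1/2) ^ k) * (\<Sum>k<M. (1/2) ^ k * (t k)\<^sup>2)"
    by (simp add: power_mult_distrib)
  also have "\<dots> \<le> 2 * (\<Sum>k<M. (1/2) ^ k * (t k)\<^sup>2)"
  proof (rule mult_right_mono)
    show "(\<Sum>k<M. (1/2::real) ^ k) \<le> 2" by (simp add: sum_half_powers)
  qed (auto intro: sum_nonneg)
  finally show ?thesis .
qed

context eigenbasis_manifold
begin

text \<open>The largest scale in use: up to it the enlarged cells stay inside their charts. The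
  entry 1 provides the bound r \<le> 1 of \<open>interior_estimate\<close>.\<close>

definition rad :: real where "rad = Min (insert 1 ((\<lambda>q. snd (snd q)) ` P))"

lemma rad: "0 < rad" "rad \<le> 1" "(c, x0, R) \<in> P \<Longrightarrow> rad \<le> R"
proof -
  have fin: "finite (insert 1 ((\<lambda>q. snd (snd q)) ` P))" using finite_P by simp
  show "0 < rad" unfolding rad_def using fin patch by (subst Min_gr_iff) auto
  show "rad \<le> 1" unfolding rad_def using fin by (intro Min_le) auto
  show "rad \<le> R" if "(c, x0, R) \<in> P"
    unfolding rad_def using fin that by (intro Min_le) (auto intro!: rev_image_eqI)
qed

lemma centres_subset:
  assumes "(c, x0, R) \<in> P" "y \<in> centres x0 R r"
  shows "cball y (2 * R) \<subseteq> chart_img c" "r \<le> R \<Longrightarrow> cball y r \<subseteq> cball x0 (3 * R)"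
proof -
  have y: "dist x0 y \<le> 2 * R" using assms(2) by (simp add: centres_def)
  have "cball y (2 * R) \<subseteq> cball x0 (4 * R)"
  proof
    fix z assume "z \<in> cball y (2 * R)"
    then show "z \<in> cball x0 (4 * R)" using y dist_triangle[of x0 z y] by simp
  qed
  then show "cball y (2 * R) \<subseteq> chart_img c" using patch[OF assms(1)] by blast
  assume r: "r \<le> R"
  show "cball y r \<subseteq> cball x0 (3 * R)"
  proof
    fix z assume "z \<in> cball y r"
    then show "z \<in> cball x0 (3 * R)" using y r dist_triangle[of x0 z y] by simp
  qed
qed

text \<open>The functions \<open>F k\<close> with coefficients a_j (\<lambda>_j r)^(2k) satisfy
  \<open>L (F k) = - F (Suc k) / r^2\<close>, and \<lambda>_j r \<le> 1 keeps their L2 norms below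
  that of the given combination. The interior estimate bounds the combination on each half ball by
  the norms of the \<open>F k\<close> on the full ball; their squares, summed over all centres, cost
  the bounded overlap. The error \<epsilon> takes up the remainder of the iteration.\<close>

lemma patch_cell_bound:
  assumes q: "(c, x0, R) \<in> P"
  shows "\<exists>C>0. \<forall>r J a \<epsilon>. 0 < r \<and> r \<le> rad \<and> finite J \<and> (\<forall>j\<in>J. ev j * r \<le> 1) \<and> 0 < \<epsilon> \<longrightarrow>
    (\<exists>s. (\<forall>y\<in>centres x0 R r. 0 \<le> s y \<and> (\<forall>p\<in>chart_inv c ` ball y (r / 2). \<bar>\<Sum>j\<in>J. a j * e j p\<bar> \<le> s y)) \<and>
      (\<Sum>y\<in>centres x0 R r. (s y)\<^sup>2) \<le> C / r ^ CARD('n) * (\<Sum>j\<in>J. (a j)\<^sup>2) + \<epsilon>)"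
proof -
  have c: "c \<in> \<A>" and R: "0 < R" and sub4: "cball x0 (4 * R) \<subseteq> chart_img c" using patch[OF q] by auto
  interpret elliptic "chart_img c" "ac c" "bc c" "dens c" by (rule elliptic_chart[OF c])
  have L: "L f x = lap c f x" for f x by (simp add: L_def lap_def)
  define K3 where "K3 = cball x0 (3 * R)"
  have K3: "compact K3" "K3 \<subseteq> chart_img c" using sub4 R by (auto simp: K3_def subset_iff)
  have ball: "cball y (2 * R) \<subseteq> chart_img c" if "y \<in> cball x0 (2 * R)" for y
  proof
    fix z assume "z \<in> cball y (2 * R)"
    then have "z \<in> cball x0 (4 * R)" using that dist_triangle[of x0 z y] by simp
    then show "z \<in> chart_img c" using sub4 by blast
  qed
  obtain C0 where C0: "C0 > 0" and interior:
    "\<And>y r F W x m. y \<in> cball x0 (2 * R) \<Longrightarrow> 0 < r \<Longrightarrow> r \<le> 1 \<Longrightarrow> r \<le> R \<Longrightarrow> (\<And>k. Ck_on 2 (chart_img c) (F k)) \<Longrightarrow>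
      (\<And>k x. x \<in> cball y r \<Longrightarrow> L (F k) x = - F (Suc k) x / r\<^sup>2) \<Longrightarrow>
      (\<And>k x. x \<in> cball y r \<Longrightarrow> \<bar>F k x\<bar> \<le> W) \<Longrightarrow> x \<in> cball y (r / 2) \<Longrightarrow>
      \<bar>F 0 x\<bar> \<le> C0 * ((\<Sum>k<m. (1/2) ^ k * sqrt ((LINT x:cball y r|lborel. (F k x)\<^sup>2) / r ^ CARD('n))) + (1/2) ^ m * W)"
  proof (rule interior_estimate[OF compact_cball[of x0 "2 * R"] R], erule ball, goal_cases)
    case (1 C)
    show ?case by (rule 1(1), fact 1(2), fact 1(3))
  qed
  have dc: "continuous_on K3 (dens c)" by (rule continuous_on_subset[OF continuous_on_dens[OF c] K3(2)])
  have "x0 \<in> K3" using R by (simp add: K3_def)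
  then obtain z where z: "z \<in> K3" "\<And>y. y \<in> K3 \<Longrightarrow> dens c z \<le> dens c y"
    using continuous_attains_inf[OF K3(1) _ dc] by blast
  define m where "m = dens c z"
  have m: "m > 0" "\<And>y. y \<in> K3 \<Longrightarrow> m \<le> dens c y" using z dens_pos[OF c, of z] K3(2) by (auto simp: m_def)
  define N where "N = real (overlap TYPE('n))"
  have N0: "N > 0" by (simp add: N_def overlap_def)
  define C where "C = 8 * C0\<^sup>2 * N / m"
  have Cpos: "C > 0" using C0 N0 m by (simp add: C_def)
  show ?thesis
  proof (intro exI[of _ C] conjI Cpos allI impI, elim conjE)
    fix r \<epsilon> :: real and J and a :: "nat \<Rightarrow> real"
    assume r: "0 < r" "r \<le> rad" and J: "finite J" "\<forall>j\<in>J. ev j * r \<le> 1" and \<epsilon>: "0 < \<epsilon>"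
    have rR: "r \<le> R" "r \<le> 1" using r(2) rad(2) rad(3)[OF q] by auto
    define n where "n = CARD('n)"
    define b where "b k j = a j * (ev j * r) ^ (2 * k)" for k :: nat and j
    define f where "f k p = (\<Sum>j\<in>J. b k j * e j p)" for k p
    define F where "F k y = f k (chart_inv c y)" for k y
    have b_le: "\<bar>b k j\<bar> \<le> \<bar>a j\<bar>" if "j \<in> J" for k j
    proof -
      have "(ev j * r) ^ (2 * k) \<le> 1" using J(2) that ev_nonneg[of j] r by (intro power_le_one) auto
      moreover have "0 \<le> (ev j * r) ^ (2 * k)" using ev_nonneg[of j] r by simp
      ultimately show ?thesis unfolding b_def abs_mult by (simp add: mult_left_le)
    qed
    have FC: "Ck_on 2 (chart_img c) (F k)" for k
      unfolding F_def f_def by (intro Ck_on_sum Ck_on_mult Ck_on_const Ck_e c open_img)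
    have LF: "L (F k) x = - F (Suc k) x / r\<^sup>2" if x: "x \<in> chart_img c" for k x
    proof -
      have "div_grad (ac c) (F k) x = (\<Sum>j\<in>J. b k j * div_grad (ac c) (\<lambda>y. e j (chart_inv c y)) x)"
        unfolding F_def f_def by (rule div_grad_sum[OF open_img[OF c] x Ck_ac[OF c] Ck_e[OF c]])
      then have "L (F k) x = (\<Sum>j\<in>J. b k j * lap c (\<lambda>y. e j (chart_inv c y)) x)"
        by (simp add: L_def lap_def sum_divide_distrib)
      also have "\<dots> = (\<Sum>j\<in>J. - (b (Suc k) j * e j (chart_inv c x)) / r\<^sup>2)"
        using r by (intro sum.cong refl) (simp add: lap_e[OF c x] b_def power_mult_distrib power2_eq_square)
      finally show ?thesis by (simp add: F_def f_def sum_negf sum_divide_distrib[symmetric])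
    qed
    obtain W where W: "W \<ge> 0" "\<And>p. \<bar>\<Sum>j\<in>J. \<bar>a j\<bar> * \<bar>e j p\<bar>\<bar> \<le> W"
    proof -
      have "continuous_on UNIV (\<lambda>p. \<Sum>j\<in>J. \<bar>a j\<bar> * \<bar>e j p\<bar>)" by (intro continuous_intros continuous_e)
      then show thesis using continuous_bounded that by blast
    qed
    have FW: "\<bar>F k y\<bar> \<le> W" for k y
    proof -
      have "\<bar>F k y\<bar> \<le> (\<Sum>j\<in>J. \<bar>b k j * e j (chart_inv c y)\<bar>)" unfolding F_def f_def by (rule sum_abs)
      also have "\<dots> \<le> (\<Sum>j\<in>J. \<bar>a j\<bar> * \<bar>e j (chart_inv c y)\<bar>)"
        unfolding abs_mult by (intro sum_mono mult_right_mono b_le) auto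
      also have "\<dots> \<le> W" using W(2)[of "chart_inv c y"] by linarith
      finally show ?thesis .
    qed
    define Y where "Y = centres x0 R r"
    have finY: "finite Y" unfolding Y_def by (rule finite_centres[OF r(1)])
    define T where "T k y = (LINT x:cball y r|lborel. (F k x)\<^sup>2)" for k y
    have T0: "T k y \<ge> 0" for k y by (simp add: T_def set_lebesgue_integral_def)
    define S where "S = (\<Sum>j\<in>J. (a j)\<^sup>2)"
    have FcK: "continuous_on K3 (F k)" for k
      by (rule continuous_on_subset[OF Ck_on_imp_continuous_on[OF FC] K3(2)])
    have sumT: "(\<Sum>y\<in>Y. T k y) \<le> N / m * S" for k
    proof -
      have int1: "set_integrable lborel K3 (\<lambda>x. (F k x)\<^sup>2)" "set_integrable lborel K3 (\<lambda>x. (F k x)\<^sup>2 * dens c x)"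
        by (intro set_integrable_compact K3 continuous_intros FcK dc)+
      have "card {y \<in> Y. dist x y \<le> r} \<le> overlap TYPE('n)" for x
      proof -
        have "card {y \<in> Y. dist x y \<le> r} \<le> card {y \<in> Y. dist x y \<le> 2 * r}"
          using finY r by (intro card_mono) auto
        then show ?thesis using card_centres_near[OF r(1), of x0 R x] by (simp add: Y_def)
      qed
      then have "(\<Sum>y\<in>Y. T k y) \<le> N * (LINT x:K3|lborel. (F k x)\<^sup>2)"
        unfolding T_def N_def using centres_subset(2)[OF q _ rR(1)]
        by (intro sum_integral_overlap finY K3 continuous_intros FcK) (auto simp: Y_def K3_def)
      also have "m * (LINT x:K3|lborel. (F k x)\<^sup>2) \<le> (LINT x:K3|lborel. (F k x)\<^sup>2 * dens c x)"
        unfolding set_integral_mult_right[symmetric] using int1 m(2)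
        by (intro set_integral_mono) (auto intro: set_integrable_mult_right simp: mult.commute mult_right_mono)
      then have "(LINT x:K3|lborel. (F k x)\<^sup>2) \<le> (LINT x:K3|lborel. (F k x)\<^sup>2 * dens c x) / m"
        using m(1) by (simp add: field_simps)
      also have "(LINT x:K3|lborel. (F k x)\<^sup>2 * dens c x) =
          (\<integral>p. indicator (chart_inv c ` K3) p * (F k (chart_map c p))\<^sup>2 \<partial>vol)"
        by (rule integral_vol_compact[OF c K3, symmetric]) (intro continuous_intros FcK)
      also have "\<dots> \<le> (\<integral>p. (f k p)\<^sup>2 \<partial>vol)"
      proof (rule integral_mono)
        show "integrable vol (\<lambda>p. indicator (chart_inv c ` K3) p * (F k (chart_map c p))\<^sup>2)"
          by (rule integrable_vol_compact[OF c K3]) (intro continuous_intros FcK)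
        show "integrable vol (\<lambda>p. (f k p)\<^sup>2)"
          unfolding f_def by (intro integrable_continuous_finite_measure finite_measure_vol continuous_intros continuous_e) simp
        show "indicator (chart_inv c ` K3) p * (F k (chart_map c p))\<^sup>2 \<le> (f k p)\<^sup>2" for p
          using chart_map_chart_inv_image(2)[OF c K3(2), of p] chart_inv_map[OF c, of p]
          by (cases "p \<in> chart_inv c ` K3") (auto simp: F_def)
      qed
      also have "\<dots> = (\<Sum>j\<in>J. (b k j)\<^sup>2)" unfolding f_def by (rule integral_combination_square[OF J(1)])
      also have "\<dots> \<le> S" unfolding S_def using b_le by (intro sum_mono) (simp add: abs_le_square_iff)
      finally show ?thesis using N0 m by (simp add: divide_right_mono mult_left_mono)
    qed
    \<comment> \<open>The bound \<open>W\<close> is not controlled by the L2 norm of the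
      combination, so the number of iterations depends on the combination and on the number of
      cells; the constant \<open>C\<close> does not.\<close>
    obtain M where M: "(1/2) ^ M < \<epsilon> / (2 * C0\<^sup>2 * W\<^sup>2 * real (card Y) + 1)"
    proof -
      have "0 < \<epsilon> / (2 * C0\<^sup>2 * W\<^sup>2 * real (card Y) + 1)"
        using \<epsilon> by (intro divide_pos_pos add_nonneg_pos) auto
      then show thesis using real_arch_pow_inv[of _ "1/2"] that by force
    qed
    define s where "s y = C0 * ((\<Sum>k<M. (1/2) ^ k * sqrt (T k y / r ^ n)) + (1/2) ^ M * W)" for y
    have s0: "s y \<ge> 0" for y unfolding s_def using C0 T0 r W(1)
      by (intro mult_nonneg_nonneg add_nonneg_nonneg sum_nonneg) auto
    have sup: "\<bar>\<Sum>j\<in>J. a j * e j p\<bar> \<le> s y" if y: "y \<in> Y" and p: "p \<in> chart_inv c ` ball y (r / 2)" for y p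
    proof -
      obtain x where x: "x \<in> ball y (r / 2)" "p = chart_inv c x" using p by auto
      have yc: "y \<in> cball x0 (2 * R)" using y by (simp add: Y_def centres_def)
      have yr: "cball y r \<subseteq> chart_img c" using ball[OF yc] rR R by (auto simp: subset_iff)
      have "\<bar>F 0 x\<bar> \<le> C0 * ((\<Sum>k<M. (1/2) ^ k * sqrt ((LINT x:cball y r|lborel. (F k x)\<^sup>2) / r ^ CARD('n))) + (1/2) ^ M * W)"
      proof (rule interior[where F=F and W=W, OF yc r(1) rR(2,1)])
        show "Ck_on 2 (chart_img c) (F k)" for k by (rule FC)
        show "L (F k) x = - F (Suc k) x / r\<^sup>2" if "x \<in> cball y r" for k x using LF yr that by blast
        show "\<bar>F k x\<bar> \<le> W" for k x by (rule FW)
        show "x \<in> cball y (r / 2)" using x(1) by simp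
      qed
      then show ?thesis by (simp add: F_def f_def b_def s_def T_def n_def x(2))
    qed
    have s2: "(s y)\<^sup>2 \<le> 4 * C0\<^sup>2 / r ^ n * (\<Sum>k<M. (1/2) ^ k * T k y) + 2 * C0\<^sup>2 * ((1/2) ^ M * W\<^sup>2)" for y
    proof -
      define A where "A = (\<Sum>k<M. (1/2) ^ k * sqrt (T k y / r ^ n))"
      have "A\<^sup>2 \<le> 2 * (\<Sum>k<M. (1/2) ^ k * (sqrt (T k y / r ^ n))\<^sup>2)" unfolding A_def by (rule weighted_sum_square_le)
      also have "\<dots> = 2 / r ^ n * (\<Sum>k<M. (1/2) ^ k * T k y)"
        using T0 r by (simp add: sum_distrib_left)
      finally have A2: "A\<^sup>2 \<le> 2 / r ^ n * (\<Sum>k<M. (1/2) ^ k * T k y)" .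
      have "((1/2::real) ^ M)\<^sup>2 \<le> (1/2) ^ M"
        unfolding power2_eq_square by (intro mult_left_le power_le_one) auto
      then have W2: "((1/2) ^ M * W)\<^sup>2 \<le> (1/2) ^ M * W\<^sup>2"
        unfolding power_mult_distrib by (intro mult_right_mono) auto
      have "(s y)\<^sup>2 = C0\<^sup>2 * (A + (1/2) ^ M * W)\<^sup>2" by (simp add: s_def A_def power_mult_distrib)
      also have "\<dots> \<le> C0\<^sup>2 * (2 * A\<^sup>2 + 2 * ((1/2) ^ M * W)\<^sup>2)"
        using sum_squares_bound[of A "(1/2) ^ M * W"] by (intro mult_left_mono) (auto simp: power2_sum)
      also have "\<dots> \<le> C0\<^sup>2 * (2 * (2 / r ^ n * (\<Sum>k<M. (1/2) ^ k * T k y)) + 2 * ((1/2) ^ M * W\<^sup>2))"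
        using A2 W2 by (intro mult_left_mono add_mono) auto
      finally show ?thesis by (simp add: algebra_simps)
    qed
    have "(\<Sum>y\<in>Y. (s y)\<^sup>2) \<le> (\<Sum>y\<in>Y. 4 * C0\<^sup>2 / r ^ n * (\<Sum>k<M. (1/2) ^ k * T k y) + 2 * C0\<^sup>2 * ((1/2) ^ M * W\<^sup>2))"
      by (intro sum_mono s2)
    also have "\<dots> = 4 * C0\<^sup>2 / r ^ n * (\<Sum>k<M. (1/2) ^ k * (\<Sum>y\<in>Y. T k y)) + 2 * C0\<^sup>2 * W\<^sup>2 * real (card Y) * (1/2) ^ M"
    proof -
      have "(\<Sum>y\<in>Y. \<Sum>k<M. (1/2) ^ k * T k y) = (\<Sum>k<M. (1/2) ^ k * (\<Sum>y\<in>Y. T k y))"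
        by (subst sum.swap) (simp add: sum_distrib_left)
      then have "(\<Sum>y\<in>Y. 4 * C0\<^sup>2 / r ^ n * (\<Sum>k<M. (1/2) ^ k * T k y)) =
          4 * C0\<^sup>2 / r ^ n * (\<Sum>k<M. (1/2) ^ k * (\<Sum>y\<in>Y. T k y))"
        by (simp only: sum_distrib_left[symmetric])
      then show ?thesis by (simp add: sum.distrib)
    qed
    also have "\<dots> \<le> 4 * C0\<^sup>2 / r ^ n * (2 * (N / m * S)) + \<epsilon>"
    proof (intro add_mono mult_left_mono)
      have S0: "0 \<le> N / m * S" using N0 m by (simp add: S_def sum_nonneg)
      have "(\<Sum>k<M. (1/2) ^ k * (\<Sum>y\<in>Y. T k y)) \<le> (\<Sum>k<M. (1/2) ^ k * (N / m * S))"
        by (intro sum_mono mult_left_mono sumT) auto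
      also have "\<dots> = (\<Sum>k<M. (1/2) ^ k) * (N / m * S)" by (simp only: sum_distrib_right)
      also have "\<dots> \<le> 2 * (N / m * S)"
        using S0 by (intro mult_right_mono) (auto simp: sum_half_powers)
      finally show "(\<Sum>k<M. (1/2) ^ k * (\<Sum>y\<in>Y. T k y)) \<le> 2 * (N / m * S)" .
      have "2 * C0\<^sup>2 * W\<^sup>2 * real (card Y) * (1/2) ^ M \<le> (2 * C0\<^sup>2 * W\<^sup>2 * real (card Y) + 1) * (1/2) ^ M"
        by (intro mult_right_mono) auto
      also have "\<dots> \<le> \<epsilon>"
      proof -
        have "0 < 2 * C0\<^sup>2 * W\<^sup>2 * real (card Y) + 1" by (intro add_nonneg_pos) auto
        then show ?thesis using M by (simp add: pos_less_divide_eq mult.commute)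
      qed
      finally show "2 * C0\<^sup>2 * W\<^sup>2 * real (card Y) * (1/2) ^ M \<le> \<epsilon>" .
    qed (use r in auto)
    also have "\<dots> = C / r ^ n * S + \<epsilon>" by (simp add: C_def mult_ac)
    finally show "\<exists>s. (\<forall>y\<in>centres x0 R r. 0 \<le> s y \<and> (\<forall>p\<in>chart_inv c ` ball y (r / 2). \<bar>\<Sum>j\<in>J. a j * e j p\<bar> \<le> s y)) \<and>
      (\<Sum>y\<in>centres x0 R r. (s y)\<^sup>2) \<le> C / r ^ CARD('n) * (\<Sum>j\<in>J. (a j)\<^sup>2) + \<epsilon>"
      using sup s0 by (intro exI[of _ s]) (auto simp: Y_def S_def n_def)
  qed
qed

section \<open>Cells at scale r on the whole manifold\<close>

definition cells :: "real \<Rightarrow> ((('m, 'n) chart \<times> (real^'n) \<times> real) \<times> (real^'n)) set" where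
  "cells r = (SIGMA q : P. centres (fst (snd q)) (snd (snd q)) r)"

text \<open>The radius is r/2 because the interior estimate on a ball of radius r bounds functions
  on its half. Since every point is within r/4 of a centre, some cell contains, in coordinates, the
  whole ball of radius r/4 around it; the comparison with the distance relies on this.\<close>

definition cell :: "real \<Rightarrow> (('m, 'n) chart \<times> (real^'n) \<times> real) \<times> (real^'n) \<Rightarrow> 'm set" where
  "cell r = (\<lambda>(q, y). chart_inv (fst q) ` ball y (r / 2))"

definition cell_sum :: "'m measure \<Rightarrow> real \<Rightarrow> real" where
  "cell_sum M r = (\<Sum>\<kappa>\<in>cells r. (measure M (cell r \<kappa>))\<^sup>2)"

lemma finite_cells: "r > 0 \<Longrightarrow> finite (cells r)"
  unfolding cells_def using finite_P finite_centres by (intro finite_SigmaI) auto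

lemma cell_open:
  assumes "\<kappa> \<in> cells r" "r \<le> rad" "r > 0"
  shows "open (cell r \<kappa>)"
proof -
  obtain c x0 R y where \<kappa>: "\<kappa> = ((c, x0, R), y)" by (cases \<kappa>) auto
  have q: "(c, x0, R) \<in> P" "y \<in> centres x0 R r" using assms(1) by (auto simp: \<kappa> cells_def)
  have "ball y (r / 2) \<subseteq> cball y (2 * R)" using rad(3)[OF q(1)] assms by (auto simp: subset_iff)
  then show ?thesis
    using open_chart_inv_image[of c "ball y (r / 2)"] patch[OF q(1)] centres_subset(1)[OF q]
    by (auto simp: \<kappa> cell_def)
qed

lemma cells_cover:
  assumes "0 < r" "r \<le> rad"
  obtains c x0 R y x where "((c, x0, R), y) \<in> cells r" "(c, x0, R) \<in> P" "x \<in> ball x0 R" "p = chart_inv c x" "dist y x \<le> r / 4"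
proof -
  obtain c x0 R where q: "(c, x0, R) \<in> P" "p \<in> chart_inv c ` ball x0 R" using patches_cover[of p] by blast
  then obtain x where x: "x \<in> ball x0 R" "p = chart_inv c x" by auto
  obtain y where "y \<in> centres x0 R r" "dist y x \<le> r / 4"
    using centres_cover[OF assms(1) _ x(1)] rad(3)[OF q(1)] assms(2) by (metis order_trans)
  then show thesis using that[of c x0 R y x] q(1) x by (simp add: cells_def)
qed

lemma cell_bound:
  "\<exists>C>0. \<forall>r J a \<epsilon>. 0 < r \<and> r \<le> rad \<and> finite J \<and> (\<forall>j\<in>J. ev j * r \<le> 1) \<and> 0 < \<epsilon> \<longrightarrow>
    (\<exists>s. (\<forall>\<kappa>\<in>cells r. 0 \<le> s \<kappa> \<and> (\<forall>p\<in>cell r \<kappa>. \<bar>\<Sum>j\<in>J. a j * e j p\<bar> \<le> s \<kappa>)) \<and>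
      (\<Sum>\<kappa>\<in>cells r. (s \<kappa>)\<^sup>2) \<le> C / r ^ CARD('n) * (\<Sum>j\<in>J. (a j)\<^sup>2) + \<epsilon>)"
proof -
  define good where "good q C \<longleftrightarrow> C > 0 \<and> (\<forall>r J a \<epsilon>. 0 < r \<and> r \<le> rad \<and> finite J \<and> (\<forall>j\<in>J. ev j * r \<le> 1) \<and> 0 < \<epsilon> \<longrightarrow>
    (\<exists>s. (\<forall>y\<in>centres (fst (snd q)) (snd (snd q)) r. 0 \<le> s y \<and>
        (\<forall>p\<in>chart_inv (fst q) ` ball y (r / 2). \<bar>\<Sum>j\<in>J. a j * e j p\<bar> \<le> s y)) \<and>
      (\<Sum>y\<in>centres (fst (snd q)) (snd (snd q)) r. (s y)\<^sup>2) \<le> C / r ^ CARD('n) * (\<Sum>j\<in>J. (a j)\<^sup>2) + \<epsilon>))"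
    for q :: "('m, 'n) chart \<times> (real^'n) \<times> real" and C
  have "\<exists>C. good q C" if "q \<in> P" for q
    using patch_cell_bound[of "fst q" "fst (snd q)" "snd (snd q)"] that unfolding good_def by simp
  then obtain C where C: "\<And>q. q \<in> P \<Longrightarrow> good q (C q)" by metis
  have Cq: "C q > 0" if "q \<in> P" for q using C[OF that] by (simp add: good_def)
  show ?thesis
  proof (intro exI[of _ "1 + (\<Sum>q\<in>P. C q)"] conjI allI impI)
    have "0 \<le> (\<Sum>q\<in>P. C q)" using Cq by (intro sum_nonneg) (auto intro: less_imp_le)
    then show "0 < 1 + (\<Sum>q\<in>P. C q)" by simp
    fix r \<epsilon> :: real and J and a :: "nat \<Rightarrow> real"
    assume *: "0 < r \<and> r \<le> rad \<and> finite J \<and> (\<forall>j\<in>J. ev j * r \<le> 1) \<and> 0 < \<epsilon>"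
    define \<epsilon>' where "\<epsilon>' = \<epsilon> / (real (card P) + 1)"
    have \<epsilon>': "\<epsilon>' > 0" "real (card P) * \<epsilon>' \<le> \<epsilon>" using * by (auto simp: \<epsilon>'_def field_simps)
    define \<Phi> where "\<Phi> q s \<longleftrightarrow> (\<forall>y\<in>centres (fst (snd q)) (snd (snd q)) r. 0 \<le> s y \<and>
        (\<forall>p\<in>chart_inv (fst q) ` ball y (r / 2). \<bar>\<Sum>j\<in>J. a j * e j p\<bar> \<le> s y)) \<and>
      (\<Sum>y\<in>centres (fst (snd q)) (snd (snd q)) r. (s y)\<^sup>2) \<le> C q / r ^ CARD('n) * (\<Sum>j\<in>J. (a j)\<^sup>2) + \<epsilon>'"
      for q :: "('m, 'n) chart \<times> (real^'n) \<times> real" and s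
    have "\<exists>s. \<Phi> q s" if "q \<in> P" for q
      using C[OF that] * \<epsilon>'(1) unfolding good_def \<Phi>_def by blast
    then obtain s where s': "\<And>q. q \<in> P \<Longrightarrow> \<Phi> q (s q)" by metis
    note s = s'[unfolded \<Phi>_def]
    define S where "S = (\<Sum>j\<in>J. (a j)\<^sup>2)"
    have S0: "S \<ge> 0" by (simp add: S_def sum_nonneg)
    have "(\<Sum>\<kappa>\<in>cells r. (case \<kappa> of (q, y) \<Rightarrow> s q y)\<^sup>2) = (\<Sum>q\<in>P. \<Sum>y\<in>centres (fst (snd q)) (snd (snd q)) r. (s q y)\<^sup>2)"
      unfolding cells_def using finite_P finite_centres *
      by (subst sum.Sigma) (auto intro!: sum.cong)
    also have "\<dots> \<le> (\<Sum>q\<in>P. C q / r ^ CARD('n) * S + \<epsilon>')" using s by (intro sum_mono) (simp add: S_def)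
    also have "\<dots> = (\<Sum>q\<in>P. C q) / r ^ CARD('n) * S + real (card P) * \<epsilon>'"
      by (simp add: sum.distrib sum_distrib_right sum_divide_distrib)
    also have "\<dots> \<le> (1 + (\<Sum>q\<in>P. C q)) / r ^ CARD('n) * S + \<epsilon>"
      using \<epsilon>'(2) * S0 by (intro add_mono mult_right_mono divide_right_mono) auto
    finally show "\<exists>s. (\<forall>\<kappa>\<in>cells r. 0 \<le> s \<kappa> \<and> (\<forall>p\<in>cell r \<kappa>. \<bar>\<Sum>j\<in>J. a j * e j p\<bar> \<le> s \<kappa>)) \<and>
      (\<Sum>\<kappa>\<in>cells r. (s \<kappa>)\<^sup>2) \<le> (1 + (\<Sum>q\<in>P. C q)) / r ^ CARD('n) * (\<Sum>j\<in>J. (a j)\<^sup>2) + \<epsilon>"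
      using s by (intro exI[of _ "\<lambda>(q, y). s q y"]) (auto simp: cells_def cell_def S_def)
  qed
qed

text \<open>The combination is dominated by the sum of its cell bounds times the indicators of the
  cells. Integration against \<open>M\<close> and Cauchy-Schwarz over the cells separate the squares
  of the bounds from \<open>cell_sum\<close>.\<close>

lemma integral_combination_bound:
  obtains C where "C > 0"
    "\<And>M r J a. finite_measure M \<Longrightarrow> sets M = sets borel \<Longrightarrow> 0 < r \<Longrightarrow> r \<le> rad \<Longrightarrow> finite J \<Longrightarrow>
      (\<And>j. j \<in> J \<Longrightarrow> ev j * r \<le> 1) \<Longrightarrow>
      (\<integral>p. (\<Sum>j\<in>J. a j * e j p) \<partial>M)\<^sup>2 \<le> C / r ^ CARD('n) * (\<Sum>j\<in>J. (a j)\<^sup>2) * cell_sum M r"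
proof -
  obtain C where C: "C > 0" and s: "\<And>r J a \<epsilon>. 0 < r \<and> r \<le> rad \<and> finite J \<and> (\<forall>j\<in>J. ev j * r \<le> 1) \<and> 0 < \<epsilon> \<longrightarrow>
    (\<exists>s. (\<forall>\<kappa>\<in>cells r. 0 \<le> s \<kappa> \<and> (\<forall>p\<in>cell r \<kappa>. \<bar>\<Sum>j\<in>J. a j * e j p\<bar> \<le> s \<kappa>)) \<and>
      (\<Sum>\<kappa>\<in>cells r. (s \<kappa>)\<^sup>2) \<le> C / r ^ CARD('n) * (\<Sum>j\<in>J. (a j)\<^sup>2) + \<epsilon>)"
    using cell_bound by blast
  show thesis
  proof (rule that[OF C])
    fix M :: "'m measure" and r :: real and J and a :: "nat \<Rightarrow> real"
    assume M: "finite_measure M" "sets M = sets borel" and r: "0 < r" "r \<le> rad" and J: "finite J"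
      "\<And>j. j \<in> J \<Longrightarrow> ev j * r \<le> 1"
    interpret finite_measure M by (rule M(1))
    define f where "f p = (\<Sum>j\<in>J. a j * e j p)" for p
    define D where "D = cell_sum M r"
    define X where "X = C / r ^ CARD('n) * (\<Sum>j\<in>J. (a j)\<^sup>2)"
    have D0: "D \<ge> 0" by (simp add: D_def cell_sum_def sum_nonneg)
    have fi: "integrable M f" unfolding f_def by (rule integrable_continuous_finite_measure[OF M continuous_combination])
    have cs: "cell r \<kappa> \<in> sets M" if "\<kappa> \<in> cells r" for \<kappa> using cell_open[OF that r(2,1)] M(2) by simp
    have est: "(\<integral>p. f p \<partial>M)\<^sup>2 \<le> (X + \<epsilon>) * D" if \<epsilon>: "\<epsilon> > 0" for \<epsilon>
    proof -
      have "\<exists>t. (\<forall>\<kappa>\<in>cells r. 0 \<le> t \<kappa> \<and> (\<forall>p\<in>cell r \<kappa>. \<bar>f p\<bar> \<le> t \<kappa>)) \<and> (\<Sum>\<kappa>\<in>cells r. (t \<kappa>)\<^sup>2) \<le> X + \<epsilon>"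
        using s[of r J \<epsilon> a] r J \<epsilon> unfolding f_def X_def by simp
      then obtain t where t: "\<And>\<kappa>. \<kappa> \<in> cells r \<Longrightarrow> 0 \<le> t \<kappa>" "\<And>\<kappa> p. \<kappa> \<in> cells r \<Longrightarrow> p \<in> cell r \<kappa> \<Longrightarrow> \<bar>f p\<bar> \<le> t \<kappa>"
        and t2: "(\<Sum>\<kappa>\<in>cells r. (t \<kappa>)\<^sup>2) \<le> X + \<epsilon>"
        by blast
      have ineq: "\<bar>f p\<bar> \<le> (\<Sum>\<kappa>\<in>cells r. t \<kappa> * indicator (cell r \<kappa>) p)" for p
      proof -
        obtain c x0 R y x where k: "((c, x0, R), y) \<in> cells r" and x: "p = chart_inv c x" "dist y x \<le> r / 4"
        proof (rule cells_cover[OF r, of p], goal_cases)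
          case (1 c x0 R y x)
          show ?case by (rule 1(1), fact 1(2), fact 1(5), fact 1(6))
        qed
        have "p \<in> cell r ((c, x0, R), y)" using x r by (auto simp: cell_def)
        then have "\<bar>f p\<bar> \<le> t ((c, x0, R), y) * indicator (cell r ((c, x0, R), y)) p" using t(2)[OF k] by simp
        also have "\<dots> \<le> (\<Sum>\<kappa>\<in>cells r. t \<kappa> * indicator (cell r \<kappa>) p)"
          using finite_cells[OF r(1)] k t(1) by (intro member_le_sum) auto
        finally show ?thesis .
      qed
      have "\<bar>\<integral>p. f p \<partial>M\<bar> \<le> (\<integral>p. \<bar>f p\<bar> \<partial>M)" using integral_norm_bound[of M f] by simp
      also have "\<dots> \<le> (\<integral>p. (\<Sum>\<kappa>\<in>cells r. t \<kappa> * indicator (cell r \<kappa>) p) \<partial>M)"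
        using cs fi ineq by (intro integral_mono Bochner_Integration.integrable_sum integrable_mult_right integrable_abs)
          (auto simp: integrable_indicator_iff less_top[symmetric])
      also have "\<dots> = (\<Sum>\<kappa>\<in>cells r. t \<kappa> * measure M (cell r \<kappa>))"
        using cs by (subst Bochner_Integration.integral_sum)
          (auto simp: integrable_indicator_iff less_top[symmetric] intro!: sum.cong)
      finally have le: "\<bar>\<integral>p. f p \<partial>M\<bar> \<le> (\<Sum>\<kappa>\<in>cells r. t \<kappa> * measure M (cell r \<kappa>))" .
      have "(\<integral>p. f p \<partial>M)\<^sup>2 \<le> (\<Sum>\<kappa>\<in>cells r. t \<kappa> * measure M (cell r \<kappa>))\<^sup>2"
        using power_mono[OF le abs_ge_zero, of 2] by simp
      also have "\<dots> \<le> (\<Sum>\<kappa>\<in>cells r. (t \<kappa>)\<^sup>2) * (\<Sum>\<kappa>\<in>cells r. (measure M (cell r \<kappa>))\<^sup>2)"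
        by (rule Cauchy_Schwarz_ineq_sum)
      also have "\<dots> \<le> (X + \<epsilon>) * D"
        using t2 D0 unfolding D_def cell_sum_def by (intro mult_right_mono) auto
      finally show ?thesis .
    qed
    \<comment> \<open>The error \<delta>/(D+1) contributes at most \<delta> after multiplication by
      \<open>D\<close>, which may be 0.\<close>
    have "(\<integral>p. f p \<partial>M)\<^sup>2 \<le> X * D + \<delta>" if "\<delta> > 0" for \<delta>
    proof -
      have "(\<integral>p. f p \<partial>M)\<^sup>2 \<le> (X + \<delta> / (D + 1)) * D" using D0 that by (intro est) auto
      also have "\<dots> \<le> X * D + \<delta>" using D0 that by (simp add: field_simps)
      finally show ?thesis .
    qed
    then show "(\<integral>p. (\<Sum>j\<in>J. a j * e j p) \<partial>M)\<^sup>2 \<le> C / r ^ CARD('n) * (\<Sum>j\<in>J. (a j)\<^sup>2) * cell_sum M r"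
      using field_le_epsilon unfolding X_def D_def f_def by blast
  qed
qed

text \<open>With the coefficients a_j = \<integral> e_j dM, the integral of the combination equals
  the sum S to be bounded, so the previous estimate reads S^2 \<le> C r^(-n) S D and one factor S
  cancels.\<close>

lemma spectral_upper_bound:
  obtains C where "C > 0"
    "\<And>M r J. finite_measure M \<Longrightarrow> sets M = sets borel \<Longrightarrow> 0 < r \<Longrightarrow> r \<le> rad \<Longrightarrow> finite J \<Longrightarrow>
      (\<And>j. j \<in> J \<Longrightarrow> ev j * r \<le> 1) \<Longrightarrow> (\<Sum>j\<in>J. (\<integral>p. e j p \<partial>M)\<^sup>2) \<le> C / r ^ CARD('n) * cell_sum M r"
proof -
  obtain C where C: "C > 0" and est: "\<And>M r J a. finite_measure M \<Longrightarrow> sets M = sets borel \<Longrightarrow> 0 < r \<Longrightarrow> r \<le> rad \<Longrightarrow> finite J \<Longrightarrow>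
      (\<And>j. j \<in> J \<Longrightarrow> ev j * r \<le> 1) \<Longrightarrow>
      (\<integral>p. (\<Sum>j\<in>J. a j * e j p) \<partial>M)\<^sup>2 \<le> C / r ^ CARD('n) * (\<Sum>j\<in>J. (a j)\<^sup>2) * cell_sum M r"
  proof (rule integral_combination_bound, goal_cases)
    case (1 C)
    show ?case by (rule 1(1), fact 1(2), fact 1(3))
  qed
  show thesis
  proof (rule that[OF C])
    fix M :: "'m measure" and r :: real and J assume M: "finite_measure M" "sets M = sets borel" and r: "0 < r" "r \<le> rad" and J: "finite J"
      "\<And>j. j \<in> J \<Longrightarrow> ev j * r \<le> 1"
    define S where "S = (\<Sum>j\<in>J. (\<integral>p. e j p \<partial>M)\<^sup>2)"
    have S0: "S \<ge> 0" by (simp add: S_def sum_nonneg)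
    have "(\<integral>p. (\<Sum>j\<in>J. (\<integral>p. e j p \<partial>M) * e j p) \<partial>M) = S"
      unfolding S_def by (subst Bochner_Integration.integral_sum)
        (auto intro!: integrable_mult_right integrable_continuous_finite_measure[OF M] continuous_e simp: power2_eq_square)
    then have "S\<^sup>2 \<le> C / r ^ CARD('n) * S * cell_sum M r"
      using est[OF M r J, of "\<lambda>j. \<integral>p. e j p \<partial>M"] by (simp add: S_def)
    then have *: "S * S \<le> S * (C / r ^ CARD('n) * cell_sum M r)" by (simp add: power2_eq_square ac_simps)
    have "0 \<le> C / r ^ CARD('n) * cell_sum M r" using C r by (simp add: cell_sum_def sum_nonneg)
    then show "(\<Sum>j\<in>J. (\<integral>p. e j p \<partial>M)\<^sup>2) \<le> C / r ^ CARD('n) * cell_sum M r"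
      using mult_left_le_imp_le[OF *] S0 unfolding S_def[symmetric] by (cases "S = 0") auto
  qed
qed

end

section \<open>Test functions\<close>

text \<open>Test functions at scale \<open>r\<close> centred at \<open>y\<close> are treated as functions of \<open>(z, y, r)\<close> with
  \<open>z = (x - y) / r\<close>. They stay smooth down to \<open>r = 0\<close>, so that all bounds that are uniform in \<open>y\<close> and
  \<open>r\<close> follow from compactness.\<close>

definition scaled_deriv ::
  "'n::finite \<Rightarrow> ((real^'n) \<times> (real^'n) \<times> real \<Rightarrow> real) \<Rightarrow> (real^'n) \<times> (real^'n) \<times> real \<Rightarrow> real" where
  "scaled_deriv i h Q = frechet_derivative h (at Q) (axis i 1, 0, 0)"

definition unscale :: "(real^'n) \<times> (real^'n) \<times> real \<Rightarrow> real^'n" where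
  "unscale Q = fst (snd Q) + snd (snd Q) *\<^sub>R fst Q"

lemma Ck_scaled_deriv: "Ck_on (Suc k) U h \<Longrightarrow> Ck_on k U (scaled_deriv i h)"
  unfolding scaled_deriv_def by simp

lemma Ck_unscale: "Ck_on k UNIV unscale"
  unfolding unscale_def
  by (intro Ck_on_add Ck_on_bounded_bilinear[OF _ bounded_bilinear_scaleR] Ck_on_bounded_linear open_UNIV
      bounded_linear_fst bounded_linear_compose[OF bounded_linear_fst bounded_linear_snd]
      bounded_linear_compose[OF bounded_linear_snd bounded_linear_snd])

lemma scaled_deriv_eq_0:
  assumes "open V" "Q \<in> V" "\<And>Q. Q \<in> V \<Longrightarrow> h Q = 0"
  shows "scaled_deriv i h Q = 0"
proof -
  have "(h has_derivative (\<lambda>_. 0)) (at Q)"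
    by (rule has_derivative_transform_within_open[OF has_derivative_const assms(1,2)]) (simp add: assms(3))
  then show ?thesis unfolding scaled_deriv_def using frechet_derivative_at by metis
qed

lemma partial_deriv_slice:
  fixes F :: "(real^'n) \<times> (real^'n) \<times> real \<Rightarrow> real"
  assumes "F differentiable (at ((1/r) *\<^sub>R (x - y), y, r))"
  shows "partial_deriv i (\<lambda>x. F ((1/r) *\<^sub>R (x - y), y, r)) x = (1/r) * scaled_deriv i F ((1/r) *\<^sub>R (x - y), y, r)"
proof -
  have "((\<lambda>x. ((1/r) *\<^sub>R (x - y), y, r)) has_derivative (\<lambda>v. ((1/r) *\<^sub>R v, 0, 0))) (at x)"
    by (auto intro!: derivative_eq_intros simp: fun_eq_iff zero_prod_def)
  from diff_chain_at[OF this assms[unfolded frechet_derivative_works]]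
  have "((\<lambda>x. F ((1/r) *\<^sub>R (x - y), y, r)) has_derivative
      (\<lambda>v. frechet_derivative F (at ((1/r) *\<^sub>R (x - y), y, r)) ((1/r) *\<^sub>R v, 0, 0))) (at x)"
    by (simp add: o_def)
  from has_derivative_imp_partial_deriv[OF this, of i]
  have "partial_deriv i (\<lambda>x. F ((1/r) *\<^sub>R (x - y), y, r)) x =
      frechet_derivative F (at ((1/r) *\<^sub>R (x - y), y, r)) ((1/r) *\<^sub>R (axis i 1, 0, 0))" by simp
  moreover have "linear (frechet_derivative F (at ((1/r) *\<^sub>R (x - y), y, r)))"
    using assms linear_frechet_derivative by blast
  ultimately show ?thesis unfolding scaled_deriv_def by (simp only: linear_scale real_scaleR_def)
qed

text \<open>The exponent makes the bump of class C^(2m+2), so that m applications of a second-order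
  operator still leave a C^2 function.\<close>

definition bump :: "nat \<Rightarrow> real^'n \<Rightarrow> real" where
  "bump m z = max 0 (1 - z \<bullet> z) ^ (2 * m + 3)"

lemma bump_nonneg: "bump m z \<ge> 0"
  by (simp add: bump_def)

lemma bump_eq_0: "norm z \<ge> 1 \<Longrightarrow> bump m z = 0"
proof -
  assume "norm z \<ge> 1"
  then have "1 \<le> (norm z)\<^sup>2" by simp
  then show ?thesis by (simp add: bump_def power2_norm_eq_inner max_def)
qed

lemma bump_ge: "norm z \<le> 1/2 \<Longrightarrow> bump m z \<ge> (3/4) ^ (2 * m + 3)"
proof -
  assume "norm z \<le> 1/2"
  then have "(norm z)\<^sup>2 \<le> (1/2)\<^sup>2" by (intro power_mono) auto
  then have "z \<bullet> z \<le> 1/4" by (simp add: power2_norm_eq_inner power_divide)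
  then have "3/4 \<le> max 0 (1 - z \<bullet> z)" unfolding le_max_iff_disj by linarith
  then show ?thesis unfolding bump_def by (rule power_mono) simp
qed

lemma continuous_bump: "continuous_on S (bump m)"
  unfolding bump_def by (intro continuous_intros)

context eigenbasis_manifold
begin

text \<open>The function g is (1 - r^2 \<Delta>)^m applied to the bump. Green's second identity
  moves the operator onto the eigenfunction \<open>e j\<close>, which produces the factor. In the
  variables (z, y, r) a derivative in x is 1/r times one in z, so r^2 \<Delta> has coefficients that
  stay smooth at r = 0, and the bound for g comes from the compact set \<open>Kc\<close>.\<close>

lemma test_function:
  assumes q: "(c, x0, R) \<in> P"
  shows "\<exists>C>0. \<forall>y r. y \<in> cball x0 (2 * R) \<and> 0 < r \<and> r \<le> R / 4 \<longrightarrow>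
    (\<exists>g. continuous_on (cball y r) g \<and> (\<forall>x\<in>cball y r. \<bar>g x\<bar> \<le> C) \<and>
      (\<forall>j. (LINT x:cball y r|lborel. g x * e j (chart_inv c x) * dens c x) = (1 + r\<^sup>2 * (ev j)\<^sup>2) ^ m *
        (LINT x:cball y r|lborel. bump m ((1/r) *\<^sub>R (x - y)) * e j (chart_inv c x) * dens c x)))"
proof -
  have c: "c \<in> \<A>" and R: "0 < R" and sub4: "cball x0 (4 * R) \<subseteq> chart_img c" using patch[OF q] by auto
  \<comment> \<open>An open neighbourhood of the compact parameter set \<open>Kc\<close>; it
    includes negative r, so that r = 0 is an interior value. The radii give |r z| < R, hence y + r z
    within 4 R of \<open>x0\<close>.\<close>
  define U where "U = ball (0::real^'n) 2 \<times> ball x0 (3 * R) \<times> ball (0::real) (R / 2)"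
  have U: "open U" unfolding U_def by (intro open_Times open_ball)
  have unscale_U: "unscale Q \<in> chart_img c" if Q: "Q \<in> U" for Q
  proof -
    have "norm (fst Q) < 2" "dist x0 (fst (snd Q)) < 3 * R" "\<bar>snd (snd Q)\<bar> < R / 2"
      using Q by (auto simp: U_def)
    then have "norm (snd (snd Q) *\<^sub>R fst Q) \<le> R / 2 * 2" unfolding norm_scaleR by (intro mult_mono) auto
    then have "dist (fst (snd Q)) (unscale Q) \<le> R" by (simp add: unscale_def dist_norm)
    then have "unscale Q \<in> cball x0 (4 * R)"
      using dist_triangle[of x0 "unscale Q" "fst (snd Q)"] \<open>dist x0 (fst (snd Q)) < 3 * R\<close> by simp
    then show ?thesis using sub4 by blast
  qed
  define A where "A i j Q = ac c i j (unscale Q)" for i j Q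
  define W where "W Q = dens c (unscale Q)" for Q
  have CkA: "Ck_on k U (A i j)" for k i j unfolding A_def
    by (rule Ck_on_compose[OF U open_img[OF c] Ck_on_subset[OF Ck_unscale] Ck_ac[OF c]]) (use unscale_U in auto)
  have CkW: "Ck_on k U W" for k unfolding W_def
    by (rule Ck_on_compose[OF U open_img[OF c] Ck_on_subset[OF Ck_unscale] Ck_dens[OF c]]) (use unscale_U in auto)
  have W0: "W Q \<noteq> 0" if "Q \<in> U" for Q using dens_pos[OF c unscale_U[OF that]] by (simp add: W_def)
  define flux where "flux h i Q = (\<Sum>j\<in>UNIV. A i j Q * scaled_deriv j h Q)" for h i Q
  define step where "step h Q = h Q - (\<Sum>i\<in>UNIV. scaled_deriv i (flux h i) Q) / W Q" for h Q
  define h where "h k = (step ^^ k) (\<lambda>Q. bump m (fst Q))" for k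
  have h_Suc: "h (Suc k) = step (h k)" for k by (simp add: h_def)
  have Ck_flux: "Ck_on k U (flux f i)" if "Ck_on (Suc k) U f" for k f i
    unfolding flux_def by (intro Ck_on_sum Ck_on_mult U CkA Ck_scaled_deriv that)
  have Ck_step: "Ck_on k U (step f)" if "Ck_on (Suc (Suc k)) U f" for k f
    unfolding step_def
    by (intro Ck_on_diff Ck_on_divide Ck_on_sum U CkW W0 Ck_scaled_deriv Ck_flux that Ck_on_Suc_imp[OF Ck_on_Suc_imp[OF that]])
  \<comment> \<open>Each step costs two of the 2 m + 2 derivatives with which the bump
    starts.\<close>
  have Ck_h: "Ck_on (2 * (m - k) + 2) U (h k)" if "k \<le> m" for k
    using that
  proof (induction k)
    case 0
    have "Ck_on (2 * m + 2) UNIV (\<lambda>Q::(real^'n) \<times> (real^'n) \<times> real. bump m (fst Q))"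
      unfolding bump_def inner_vec_def inner_real_def
      by (intro Ck_on_pospart_power Ck_on_diff Ck_on_sum Ck_on_mult Ck_on_const Ck_on_bounded_linear open_UNIV
          bounded_linear_compose[OF bounded_linear_vec_nth bounded_linear_fst]) simp
    from Ck_on_subset[OF this subset_UNIV[of U]] show ?case by (simp add: h_def del: Ck_on.simps)
  next
    case (Suc k)
    then have "2 * (m - k) + 2 = Suc (Suc (2 * (m - Suc k) + 2))" by simp
    moreover have "Ck_on (2 * (m - k) + 2) U (h k)" by (rule Suc.IH[OF Suc_leD[OF Suc.prems]])
    ultimately have "Ck_on (Suc (Suc (2 * (m - Suc k) + 2))) U (h k)" by (simp only:)
    from Ck_step[OF this] show ?case unfolding h_Suc .
  qed
  have h_0: "h k Q = 0" if "Q \<in> U \<inter> {Q. 1 < norm (fst Q)}" for k Q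
    using that
  proof (induction k arbitrary: Q)
    case 0
    then show ?case by (simp add: h_def bump_eq_0)
  next
    case (Suc k)
    have V: "open (U \<inter> {Q. 1 < norm (fst Q)})"
      by (intro open_Int U open_Collect_less continuous_intros)
    have "flux (h k) i Q = 0" if "Q \<in> U \<inter> {Q. 1 < norm (fst Q)}" for i Q
      unfolding flux_def using scaled_deriv_eq_0[OF V that Suc.IH] by simp
    then have "scaled_deriv i (flux (h k) i) Q = 0" for i
      using scaled_deriv_eq_0[OF V Suc.prems] by blast
    then show ?case unfolding h_Suc step_def using Suc.IH[OF Suc.prems] by simp
  qed
  define Kc where "Kc = cball (0::real^'n) 1 \<times> cball x0 (2 * R) \<times> {0..R / 4}"
  have "compact Kc" unfolding Kc_def by (intro compact_Times compact_cball compact_Icc)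
  moreover have "Kc \<subseteq> U" using R by (auto simp: Kc_def U_def)
  then have "continuous_on Kc (h m)"
    using continuous_on_subset[OF Ck_on_imp_continuous_on[OF Ck_h[OF order_refl]]] by blast
  ultimately have "bounded (h m ` Kc)" by (intro compact_imp_bounded compact_continuous_image)
  then obtain C where C: "\<And>Q. Q \<in> Kc \<Longrightarrow> \<bar>h m Q\<bar> \<le> C" by (auto simp: bounded_iff)
  show ?thesis
  proof (intro exI[of _ "max C 1"] conjI allI impI, simp, elim conjE)
    fix y r assume y: "y \<in> cball x0 (2 * R)" and r: "0 < r" "r \<le> R / 4"
    define Q where "Q x = ((1/r) *\<^sub>R (x - y), y, r)" for x
    define \<Omega> where "\<Omega> = ball y (2 * r)"
    define K where "K = cball y r"
    have \<Omega>: "open \<Omega>" "compact K" "K \<subseteq> \<Omega>" using r by (auto simp: \<Omega>_def K_def)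
    have QU: "Q x \<in> U" if "x \<in> \<Omega>" for x
    proof -
      have "norm ((1/r) *\<^sub>R (x - y)) = norm (x - y) / r" using r by simp
      also have "\<dots> < 2" using that r by (simp add: \<Omega>_def dist_norm norm_minus_commute pos_divide_less_eq)
      finally show ?thesis using y r R by (simp add: Q_def U_def)
    qed
    have unQ: "unscale (Q x) = x" for x using r by (simp add: unscale_def Q_def)
    have \<Omega>img: "\<Omega> \<subseteq> chart_img c" using unscale_U[OF QU] unQ by auto
    define g where "g k x = h k (Q x)" for k x
    have Ck_slice: "Ck_on k \<Omega> (\<lambda>x. F (Q x))" if "Ck_on k U F" for F :: "(real^'n) \<times> (real^'n) \<times> real \<Rightarrow> real" and k
    proof -
      have "Q x = (- (1/r) *\<^sub>R y, y, r) + ((1/r) *\<^sub>R x, 0, 0)" for x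
        by (simp add: Q_def scaleR_diff_right)
      moreover have "bounded_linear (\<lambda>x::real^'n. ((1/r) *\<^sub>R x, 0::real^'n, 0::real))"
        by (intro bounded_linear_Pair bounded_linear_scaleR_right bounded_linear_zero)
      ultimately show ?thesis
        using Ck_on_compose_affine[OF \<Omega>(1) U _ _ that, of "\<lambda>x. ((1/r) *\<^sub>R x, 0, 0)" "(- (1/r) *\<^sub>R y, y, r)"] QU
        by simp
    qed
    have slice: "partial_deriv i (\<lambda>x. F (Q x)) x = (1/r) * scaled_deriv i F (Q x)"
      if "Ck_on 1 U F" "x \<in> \<Omega>" for F i x
      unfolding Q_def
      by (rule partial_deriv_slice) (use that QU[OF that(2)] in \<open>simp add: Q_def\<close>)
    have Ckg: "Ck_on 2 \<Omega> (g k)" if "k \<le> m" for k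
      unfolding g_def by (rule Ck_slice[OF Ck_on_mono[OF Ck_h[OF that]]]) simp
    have g_Suc: "g (Suc k) x = g k x - r\<^sup>2 * (div_grad (ac c) (g k) x / dens c x)" if k: "k < m" and x: "x \<in> \<Omega>" for k x
    proof -
      have h2: "Ck_on 2 U (h k)" using k by (intro Ck_on_mono[OF Ck_h]) auto
      have f1: "Ck_on 1 U (flux (h k) i)" for i using Ck_flux[of 1 "h k" i] h2 by (simp add: numeral_2_eq_2)
      have "partial_deriv i (\<lambda>x. \<Sum>j\<in>UNIV. ac c i j x * partial_deriv j (g k) x) x =
          (1/r) * ((1/r) * scaled_deriv i (flux (h k) i) (Q x))" for i
      proof -
        have "partial_deriv i (\<lambda>x. \<Sum>j\<in>UNIV. ac c i j x * partial_deriv j (g k) x) x =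
            partial_deriv i (\<lambda>x. (1/r) * flux (h k) i (Q x)) x"
        proof (rule partial_deriv_cong_open[OF \<Omega>(1) x])
          fix x assume x: "x \<in> \<Omega>"
          have "partial_deriv j (g k) x = (1/r) * scaled_deriv j (h k) (Q x)" for j
            unfolding g_def using Ck_on_mono[OF h2, of 1] by (intro slice x) simp
          then show "(\<Sum>j\<in>UNIV. ac c i j x * partial_deriv j (g k) x) = (1/r) * flux (h k) i (Q x)"
            by (simp add: flux_def A_def unQ sum_distrib_left ac_simps)
        qed
        also have "\<dots> = (1/r) * partial_deriv i (\<lambda>x. flux (h k) i (Q x)) x"
          using Ck_on_imp_differentiable[of 0 \<Omega>] Ck_slice[OF f1[of i]] x by (intro partial_deriv_cmult) simp
        finally show ?thesis using slice[OF f1 x] by simp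
      qed
      then have "div_grad (ac c) (g k) x = (1/r)\<^sup>2 * (\<Sum>i\<in>UNIV. scaled_deriv i (flux (h k) i) (Q x))"
        by (simp add: div_grad_def sum_distrib_left power2_eq_square mult.assoc)
      then have "r\<^sup>2 * div_grad (ac c) (g k) x = (\<Sum>i\<in>UNIV. scaled_deriv i (flux (h k) i) (Q x))"
        using r by (simp add: power_divide)
      then show ?thesis by (simp add: g_def h_Suc step_def W_def unQ)
    qed
    have g0: "g k x = 0" if "x \<in> \<Omega> - K" for k x
    proof -
      have "1 < norm ((1/r) *\<^sub>R (x - y))" using that r by (auto simp: K_def dist_norm norm_minus_commute)
      then show ?thesis unfolding g_def using QU[of x] that by (intro h_0) (auto simp: Q_def)
    qed
    have cont: "continuous_on K (g k)" "continuous_on K (div_grad (ac c) (g k))" if "k \<le> m" for k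
      using continuous_on_subset[OF Ck_on_imp_continuous_on[OF Ckg[OF that]] \<Omega>(3)]
        continuous_on_subset[OF Ck_on_imp_continuous_on[OF Ck_on_div_grad[of \<Omega> 0 "ac c" "g k"]] \<Omega>(3)]
        \<Omega>(1) Ck_on_subset[OF Ck_ac[OF c] \<Omega>img] Ckg[OF that] by (auto simp: numeral_2_eq_2 simp del: Ck_on.simps)
    have Kimg: "K \<subseteq> chart_img c" using \<Omega>(3) \<Omega>img by blast
    have dc: "continuous_on K (dens c)" by (rule continuous_on_subset[OF continuous_on_dens[OF c] Kimg])
    define I where "I k j = (LINT x:K|lborel. g k x * e j (chart_inv c x) * dens c x)" for k j
    have I_Suc: "I (Suc k) j = (1 + r\<^sup>2 * (ev j)\<^sup>2) * I k j" if k: "k < m" for k j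
    proof -
      define E where "E x = e j (chart_inv c x)" for x
      have CkE: "Ck_on 2 \<Omega> E" unfolding E_def by (rule Ck_on_subset[OF Ck_e[OF c] \<Omega>img])
      have Ec: "continuous_on K E" using continuous_on_subset[OF Ck_on_imp_continuous_on[OF CkE] \<Omega>(3)] .
      have dE: "div_grad (ac c) E x = - (ev j)\<^sup>2 * E x * dens c x" if "x \<in> K" for x
        using lap_e[OF c, of x j] dens_pos[OF c, of x] that Kimg
        by (auto simp: lap_def E_def[abs_def] field_simps)
      note gc = cont[OF less_imp_le[OF k]]
      have Kb: "K \<in> sets lborel" using \<Omega>(2) by (simp add: compact_imp_closed)
      have green: "(LINT x:K|lborel. g k x * div_grad (ac c) E x) = (LINT x:K|lborel. E x * div_grad (ac c) (g k) x)"
      proof (rule green_second[OF \<Omega>])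
        show "ac c i l x = ac c l i x" if "x \<in> \<Omega>" for i l x
          unfolding ac_def using matrix_inv_gm_sym[OF c, of x i l] that \<Omega>img by auto
      qed (use Ck_on_subset[OF Ck_ac[OF c] \<Omega>img] CkE Ckg k g0 in auto)
      have "I (Suc k) j = (LINT x:K|lborel. g k x * E x * dens c x - r\<^sup>2 * (E x * div_grad (ac c) (g k) x))"
        unfolding I_def E_def[symmetric]
      proof (rule set_lebesgue_integral_cong[OF Kb], safe)
        fix x assume x: "x \<in> K"
        then have "dens c x \<noteq> 0" using dens_pos[OF c, of x] Kimg by auto
        moreover have "x \<in> \<Omega>" using x \<Omega>(3) by blast
        ultimately show "g (Suc k) x * E x * dens c x = g k x * E x * dens c x - r\<^sup>2 * (E x * div_grad (ac c) (g k) x)"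
          by (simp add: g_Suc[OF k] field_simps)
      qed
      also have "\<dots> = I k j - r\<^sup>2 * (LINT x:K|lborel. E x * div_grad (ac c) (g k) x)"
        unfolding I_def E_def[symmetric] set_integral_mult_right[symmetric]
        by (intro set_integral_diff set_integrable_compact \<Omega>(2) continuous_intros gc Ec dc)
      also have "(LINT x:K|lborel. E x * div_grad (ac c) (g k) x) = (LINT x:K|lborel. - (ev j)\<^sup>2 * (g k x * E x * dens c x))"
        unfolding green[symmetric] by (intro set_lebesgue_integral_cong Kb) (auto simp: dE)
      also have "\<dots> = - (ev j)\<^sup>2 * I k j" unfolding I_def E_def[symmetric] by (rule set_integral_mult_right)
      finally show ?thesis by (simp add: algebra_simps)
    qed
    have "k \<le> m \<Longrightarrow> I k j = (1 + r\<^sup>2 * (ev j)\<^sup>2) ^ k * I 0 j" for k j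
      by (induction k) (auto simp: I_Suc)
    then have Im: "I m j = (1 + r\<^sup>2 * (ev j)\<^sup>2) ^ m * I 0 j" for j by blast
    have "g 0 x = bump m ((1/r) *\<^sub>R (x - y))" for x by (simp add: g_def h_def Q_def)
    moreover have "\<bar>g m x\<bar> \<le> max C 1" if "x \<in> K" for x
    proof -
      have "Q x \<in> Kc" using that y r by (auto simp: Q_def Kc_def K_def dist_norm norm_minus_commute)
      from C[OF this] show ?thesis by (simp add: g_def)
    qed
    ultimately show "\<exists>g. continuous_on (cball y r) g \<and> (\<forall>x\<in>cball y r. \<bar>g x\<bar> \<le> max C 1) \<and>
      (\<forall>j. (LINT x:cball y r|lborel. g x * e j (chart_inv c x) * dens c x) = (1 + r\<^sup>2 * (ev j)\<^sup>2) ^ m *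
        (LINT x:cball y r|lborel. bump m ((1/r) *\<^sub>R (x - y)) * e j (chart_inv c x) * dens c x))"
      using cont(1)[OF order_refl] Im by (intro exI[of _ "g m"]) (auto simp: I_def K_def)
  qed
qed

end

section \<open>Pointwise convergence of eigenfunction expansions\<close>

text \<open>On the shell between 2^i and 2^(i+1) the denominator is at least 2^(i k) and the sum of
  the numerators at most A 2^((i+1) q). The contributions form a geometric series of ratio 2^(q-k),
  which converges as q < k.\<close>

lemma dyadic_tail_bound:
  fixes l a :: "nat \<Rightarrow> real"
  assumes "finite J" and a: "\<And>j. a j \<ge> 0" and A: "A \<ge> 0" and qk: "q < real k"
    and le: "\<And>i::nat. (\<Sum>j | j \<in> J \<and> l j \<le> 2 ^ i. a j) \<le> A * (2 ^ i) powr q"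
  shows "(\<Sum>j | j \<in> J \<and> 1 < l j. a j / l j ^ k) \<le> A * (2 powr q / (1 - 2 powr (q - real k)))"
proof -
  define x where "x = 2 powr (q - real k)"
  have x: "0 < x" "x < 1" using qk unfolding x_def by (auto simp: powr_less_one)
  have T: "(\<Sum>j | j \<in> J \<and> 1 < l j \<and> l j \<le> 2 ^ I. a j / l j ^ k) \<le> (\<Sum>i<I. A * 2 powr q * x ^ i)" for I :: nat
  proof (induction I)
    case 0
    have "{j. j \<in> J \<and> 1 < l j \<and> l j \<le> 2 ^ 0} = {}" by auto
    then show ?case by (simp only: sum.empty) simp
  next
    case (Suc I)
    have "{j. j \<in> J \<and> 1 < l j \<and> l j \<le> 2 ^ Suc I} =
        {j. j \<in> J \<and> 1 < l j \<and> l j \<le> 2 ^ I} \<union> {j. j \<in> J \<and> 2 ^ I < l j \<and> l j \<le> 2 ^ Suc I}"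
    proof -
      have "(1::real) \<le> 2 ^ I" "(2::real) ^ I \<le> 2 ^ Suc I" by simp_all
      then have "l j \<le> 2 ^ Suc I \<and> 1 < l j \<longleftrightarrow> 1 < l j \<and> l j \<le> 2 ^ I \<or> 2 ^ I < l j \<and> l j \<le> 2 ^ Suc I" for j
        by linarith
      then show ?thesis by blast
    qed
    then have "(\<Sum>j | j \<in> J \<and> 1 < l j \<and> l j \<le> 2 ^ Suc I. a j / l j ^ k) =
        (\<Sum>j | j \<in> J \<and> 1 < l j \<and> l j \<le> 2 ^ I. a j / l j ^ k) +
        (\<Sum>j | j \<in> J \<and> 2 ^ I < l j \<and> l j \<le> 2 ^ Suc I. a j / l j ^ k)"
      using assms(1) by (simp only:) (subst sum.union_disjoint, auto)
    also have "(\<Sum>j | j \<in> J \<and> 2 ^ I < l j \<and> l j \<le> 2 ^ Suc I. a j / l j ^ k) \<le> A * 2 powr q * x ^ I"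
    proof -
      have "(\<Sum>j | j \<in> J \<and> 2 ^ I < l j \<and> l j \<le> 2 ^ Suc I. a j / l j ^ k) \<le>
          (\<Sum>j | j \<in> J \<and> 2 ^ I < l j \<and> l j \<le> 2 ^ Suc I. a j / (2 ^ I) ^ k)"
      proof (rule sum_mono)
        fix j assume j: "j \<in> {j. j \<in> J \<and> 2 ^ I < l j \<and> l j \<le> 2 ^ Suc I}"
        then have "(2 ^ I) ^ k \<le> l j ^ k" by (intro power_mono) auto
        moreover have "0 < (2 ^ I :: real) ^ k" by simp
        ultimately show "a j / l j ^ k \<le> a j / (2 ^ I) ^ k" using a[of j]
          by (intro divide_left_mono mult_pos_pos) linarith+
      qed
      also have "\<dots> \<le> (\<Sum>j | j \<in> J \<and> l j \<le> 2 ^ Suc I. a j / (2 ^ I) ^ k)"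
        using assms(1) a by (intro sum_mono2) auto
      also have "\<dots> = (\<Sum>j | j \<in> J \<and> l j \<le> 2 ^ Suc I. a j) / (2 ^ I) ^ k" by (simp add: sum_divide_distrib)
      also have "\<dots> \<le> A * (2 ^ Suc I) powr q / (2 ^ I) ^ k" by (intro divide_right_mono le) simp
      also have "\<dots> = A * 2 powr q * x ^ I"
      proof -
        have "(2 ^ Suc I) powr q = 2 powr q * (2 powr q) ^ I"
          by (simp add: powr_mult powr_power powr_realpow[symmetric] powr_powr mult.commute)
        moreover have "x ^ I = (2 powr q) ^ I / (2 ^ I) ^ k"
          by (simp add: x_def powr_diff powr_realpow power_divide power_mult[symmetric] mult.commute)
        ultimately show ?thesis by simp
      qed
      finally show ?thesis .
    qed
    finally show ?case using Suc by simp
  qed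
  obtain I where I: "\<forall>j\<in>J. l j \<le> 2 ^ I"
  proof -
    obtain b where b: "\<forall>j\<in>J. l j \<le> b" using assms(1) by (meson bdd_above_finite bdd_above_def finite_imageI imageI)
    obtain I :: nat where "b < 2 ^ I" using real_arch_pow[of 2 b] by auto
    then show thesis using b that by (meson less_imp_le order_trans)
  qed
  then have "{j. j \<in> J \<and> 1 < l j} = {j. j \<in> J \<and> 1 < l j \<and> l j \<le> 2 ^ I}" by auto
  then have "(\<Sum>j | j \<in> J \<and> 1 < l j. a j / l j ^ k) \<le> (\<Sum>i<I. A * 2 powr q * x ^ i)" using T[of I] by simp
  also have "\<dots> = A * 2 powr q * (\<Sum>i<I. x ^ i)" by (simp add: sum_distrib_left)
  also have "\<dots> \<le> A * 2 powr q * (1 / (1 - x))"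
  proof (rule mult_left_mono)
    have "(\<Sum>i<I. x ^ i) = (1 - x ^ I) / (1 - x)" using x by (simp add: sum_gp_strict)
    also have "\<dots> \<le> 1 / (1 - x)" using x by (intro divide_right_mono) auto
    finally show "(\<Sum>i<I. x ^ i) \<le> 1 / (1 - x)" .
  qed (use A in simp)
  finally show ?thesis by (simp add: x_def)
qed

context eigenbasis_manifold
begin

text \<open>A nonempty open set has positive volume, since in a chart its image contains a ball on
  which the density is positive.\<close>

lemma continuous_AE_eq_0:
  assumes f: "continuous_on UNIV (f :: 'm \<Rightarrow> real)" and ae: "AE p in vol. f p = 0"
  shows "f p = 0"
proof (rule ccontr)
  assume "f p \<noteq> 0"
  obtain c where c: "c \<in> \<A>" "p \<in> chart_dom c" using charts_cover by blast
  define Z where "Z = (f -` (- {0})) \<inter> chart_dom c"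
  have Z: "open Z" "p \<in> Z" "Z \<subseteq> chart_dom c"
    using f c open_dom[OF c(1)] \<open>f p \<noteq> 0\<close> unfolding Z_def
    by (auto intro!: open_Int open_vimage)
  have "AE p in vol. p \<notin> Z" using ae by (rule AE_mp) (auto simp: Z_def)
  then have "emeasure vol Z = 0"
    using AE_iff_null_sets[of Z vol] Z(1) by auto
  then have "emeasure (chart_measure c) Z = 0"
    using is_volume_vol c Z unfolding is_volume_def by auto
  then have "(\<integral>\<^sup>+y. ennreal (indicator (chart_map c ` Z) y * dens c y) \<partial>lborel) = 0"
    using emeasure_chart_measure[OF c(1), of Z] Z by (simp add: Int_absorb2)
  moreover have op: "open (chart_map c ` Z)" by (rule open_chart_image[OF c(1) Z(1,3)])
  have "(\<lambda>y. indicator (chart_map c ` Z) y * dens c y) \<in> borel_measurable borel"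
    using borel_measurable_continuous_on_indicator[OF _ continuous_on_subset[OF continuous_on_dens[OF c(1)]], of "chart_map c ` Z"] op Z(3)
    by auto
  ultimately have "AE y in lborel. ennreal (indicator (chart_map c ` Z) y * dens c y) = 0"
    by (subst (asm) nn_integral_0_iff_AE) auto
  then have "AE y in lborel. y \<notin> chart_map c ` Z"
  proof (rule AE_mp, intro AE_I2 impI notI)
    fix y assume y: "ennreal (indicator (chart_map c ` Z) y * dens c y) = 0" "y \<in> chart_map c ` Z"
    then have "dens c y > 0" using Z(3) by (intro dens_pos[OF c(1)]) auto
    then show False using y by simp
  qed
  then have null: "chart_map c ` Z \<in> null_sets lborel"
    using AE_iff_null_sets[of "chart_map c ` Z" lborel] op by auto
  obtain \<rho> where \<rho>: "\<rho> > 0" "ball (chart_map c p) \<rho> \<subseteq> chart_map c ` Z"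
    using op Z(2) open_contains_ball by blast
  have "ball (chart_map c p) \<rho> \<in> null_sets lborel"
    by (rule null_sets_subset[OF null _ \<rho>(2)]) simp
  then show False using content_ball_pos[OF \<rho>(1), of "chart_map c p"] by (simp add: measure_def null_sets_def)
qed

lemma integrable_mult_e:
  fixes H :: "'m \<Rightarrow> real"
  assumes "H \<in> borel_measurable borel" "integrable vol (\<lambda>p. (H p)\<^sup>2)"
  shows "integrable vol (\<lambda>p. H p * e j p)"
  using assms integrable_continuous_finite_measure[OF finite_measure_vol sets_vol continuous_on_power[OF continuous_e]]
  by (intro Cauchy_Schwarz_integral) auto

text \<open>Stated for Borel functions, because it is applied to sums of the dual functions of
  \<open>dual_tent\<close>, of which measurability and boundedness are recorded.\<close>

lemma bessel:
  fixes H :: "'m \<Rightarrow> real"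
  assumes "H \<in> borel_measurable borel" "integrable vol (\<lambda>p. (H p)\<^sup>2)"
  shows "(\<Sum>j<N. (\<integral>p. H p * e j p \<partial>vol)\<^sup>2) \<le> (\<integral>p. (H p)\<^sup>2 \<partial>vol)"
proof -
  define g where "g j = (\<integral>p. H p * e j p \<partial>vol)" for j
  define S where "S p = (\<Sum>j<N. g j * e j p)" for p
  have S2: "(\<integral>p. (S p)\<^sup>2 \<partial>vol) = (\<Sum>j<N. (g j)\<^sup>2)" unfolding S_def by (rule integral_combination_square) simp
  have iS: "integrable vol (\<lambda>p. (S p)\<^sup>2)"
    unfolding S_def by (intro integrable_continuous_finite_measure finite_measure_vol continuous_intros continuous_e) simp
  have iGe: "integrable vol (\<lambda>p. g j * (H p * e j p))" for j
    using integrable_mult_e[OF assms] by simp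
  have GS_eq: "H p * S p = (\<Sum>j<N. g j * (H p * e j p))" for p
    by (simp add: S_def sum_distrib_left ac_simps)
  have iGS: "integrable vol (\<lambda>p. H p * S p)" unfolding GS_eq by (intro Bochner_Integration.integrable_sum iGe)
  have GS: "(\<integral>p. H p * S p \<partial>vol) = (\<Sum>j<N. (g j)\<^sup>2)"
    unfolding GS_eq using iGe
    by (subst Bochner_Integration.integral_sum) (auto simp: g_def power2_eq_square)
  have "0 \<le> (\<integral>p. (H p - S p)\<^sup>2 \<partial>vol)" by simp
  also have "\<dots> = (\<integral>p. (H p)\<^sup>2 - 2 * (H p * S p) + (S p)\<^sup>2 \<partial>vol)"
    by (intro Bochner_Integration.integral_cong refl) (simp add: power2_diff)
  also have "\<dots> = (\<integral>p. (H p)\<^sup>2 \<partial>vol) - 2 * (\<Sum>j<N. (g j)\<^sup>2) + (\<Sum>j<N. (g j)\<^sup>2)"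
    using assms(2) iGS iS by (simp add: GS S2)
  finally show ?thesis by (simp add: g_def)
qed

text \<open>Cauchy-Schwarz with the weights v bounds the square of a block of the expansion by a
  block of the series in \<open>B1\<close> times \<open>B2\<close>, uniformly in the point. The
  partial sums therefore converge uniformly, and uniform convergence passes to the integral against
  any finite measure.\<close>

lemma expansion_converges:
  fixes H :: "'m \<Rightarrow> real" and v :: "nat \<Rightarrow> real"
  assumes H: "continuous_on UNIV H"
    and v: "\<And>j. v j > 0" and B1: "\<And>N. (\<Sum>j<N. (\<integral>p. H p * e j p \<partial>vol)\<^sup>2 * v j) \<le> B1"
    and B2: "\<And>N p. (\<Sum>j<N. (e j p)\<^sup>2 / v j) \<le> B2"
    and M: "finite_measure M" "sets M = sets borel"
  shows "(\<lambda>N. \<Sum>j<N. (\<integral>p. H p * e j p \<partial>vol) * (\<integral>p. e j p \<partial>M)) \<longlonglongrightarrow> (\<integral>p. H p \<partial>M)"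
proof -
  define g where "g j = (\<integral>p. H p * e j p \<partial>vol)" for j
  define S where "S N p = (\<Sum>j<N. g j * e j p)" for N p
  have Sc: "continuous_on UNIV (S N)" for N unfolding S_def by (rule continuous_combination)
  have "summable (\<lambda>j. (g j)\<^sup>2 * v j)"
  proof (rule bounded_imp_summable[of _ B1])
    show "(\<Sum>j\<le>n. (g j)\<^sup>2 * v j) \<le> B1" for n
      using B1[of "Suc n"] by (simp only: g_def lessThan_Suc_atMost)
  qed (use v in \<open>simp add: less_imp_le\<close>)
  then have tail: "\<exists>N. \<forall>m\<ge>N. \<forall>n. \<bar>\<Sum>j=m..<n. (g j)\<^sup>2 * v j\<bar> < \<epsilon>" if "\<epsilon> > 0" for \<epsilon>
    using that unfolding summable_Cauchy by simp
  have B20: "B2 \<ge> 0" using B2[where N=0] by simp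
  have diff: "S n p - S m p = (\<Sum>j=m..<n. g j * e j p)" if "m \<le> n" for m n p
    unfolding S_def using sum_diff_nat_ivl[of 0 m n "\<lambda>j. g j * e j p"] that by (simp add: atLeast0LessThan)
  have sq: "(S n p - S m p)\<^sup>2 \<le> (\<Sum>j=m..<n. (g j)\<^sup>2 * v j) * B2" if "m \<le> n" for m n p
  proof -
    have "(S n p - S m p)\<^sup>2 = (\<Sum>j=m..<n. (g j * sqrt (v j)) * (e j p / sqrt (v j)))\<^sup>2"
      unfolding diff[OF that] by (intro arg_cong2[where f=power] sum.cong refl) (simp add: less_imp_neq[OF v, symmetric])
    also have "\<dots> \<le> (\<Sum>j=m..<n. (g j * sqrt (v j))\<^sup>2) * (\<Sum>j=m..<n. (e j p / sqrt (v j))\<^sup>2)"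
      by (rule Cauchy_Schwarz_ineq_sum)
    also have "\<dots> = (\<Sum>j=m..<n. (g j)\<^sup>2 * v j) * (\<Sum>j=m..<n. (e j p)\<^sup>2 / v j)"
      using v by (simp add: power_mult_distrib power_divide less_imp_le)
    also have "\<dots> \<le> (\<Sum>j=m..<n. (g j)\<^sup>2 * v j) * B2"
    proof (rule mult_left_mono)
      have "(\<Sum>j=m..<n. (e j p)\<^sup>2 / v j) \<le> (\<Sum>j<n. (e j p)\<^sup>2 / v j)"
        using v by (intro sum_mono2) (auto simp: less_imp_le)
      then show "(\<Sum>j=m..<n. (e j p)\<^sup>2 / v j) \<le> B2" using B2[of p n] by simp
      show "0 \<le> (\<Sum>j=m..<n. (g j)\<^sup>2 * v j)" using v by (intro sum_nonneg) (simp add: less_imp_le)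
    qed
    finally show ?thesis .
  qed
  have "uniformly_Cauchy_on UNIV S"
  proof (rule uniformly_Cauchy_onI')
    fix \<epsilon> :: real assume \<epsilon>: "\<epsilon> > 0"
    have "\<epsilon>\<^sup>2 / (B2 + 1) > 0" using \<epsilon> B20 by simp
    from tail[OF this] obtain N where N: "\<And>m n. m \<ge> N \<Longrightarrow> \<bar>\<Sum>j=m..<n. (g j)\<^sup>2 * v j\<bar> < \<epsilon>\<^sup>2 / (B2 + 1)" by blast
    show "\<exists>N. \<forall>p\<in>UNIV. \<forall>m\<ge>N. \<forall>n>m. dist (S m p) (S n p) < \<epsilon>"
    proof (intro exI[of _ N] ballI allI impI)
      fix p m n assume mn: "N \<le> m" "m < n"
      have "(S n p - S m p)\<^sup>2 \<le> (\<Sum>j=m..<n. (g j)\<^sup>2 * v j) * B2" using mn by (intro sq) simp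
      also have "\<dots> \<le> \<epsilon>\<^sup>2 / (B2 + 1) * B2" using N[OF mn(1), of n] B20 by (intro mult_right_mono) auto
      also have "\<dots> < \<epsilon>\<^sup>2" using B20 \<epsilon> by (simp add: field_simps)
      finally have "\<bar>S n p - S m p\<bar> < \<epsilon>" using \<epsilon>
        by (intro power2_less_imp_less[of _ \<epsilon>]) auto
      then show "dist (S m p) (S n p) < \<epsilon>" by (simp add: dist_real_def abs_minus_commute)
    qed
  qed
  then obtain h where h: "uniform_limit UNIV S h sequentially"
    using Cauchy_uniformly_convergent uniformly_convergent_on_def by blast
  have hc: "continuous_on UNIV h"
    by (rule uniform_limit_theorem[OF _ h]) (simp_all add: Sc)
  have conv: "(\<lambda>N. \<integral>p. S N p \<partial>M') \<longlonglongrightarrow> (\<integral>p. h p \<partial>M')"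
    and conv2: "(\<lambda>N. \<integral>p. (h p - S N p)\<^sup>2 \<partial>M') \<longlonglongrightarrow> 0"
    if M': "finite_measure M'" "sets M' = sets borel" for M'
  proof -
    interpret finite_measure M' by (rule M'(1))
    have iS: "integrable M' (S N)" for N by (rule integrable_continuous_finite_measure[OF M' Sc])
    have ih: "integrable M' h" by (rule integrable_continuous_finite_measure[OF M' hc])
    have i2: "integrable M' (\<lambda>p. (h p - S N p)\<^sup>2)" for N
      by (rule integrable_continuous_finite_measure[OF M']) (intro continuous_intros hc Sc)
    define m where "m = measure M' (space M')"
    have m0: "m \<ge> 0" by (simp add: m_def)
    have near: "\<forall>\<^sub>F N in sequentially. \<forall>p. \<bar>h p - S N p\<bar> < \<delta>" if "\<delta> > 0" for \<delta>
      using uniform_limitD[OF h that] by (simp add: dist_real_def abs_minus_commute)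
    show "(\<lambda>N. \<integral>p. S N p \<partial>M') \<longlonglongrightarrow> (\<integral>p. h p \<partial>M')"
    proof (rule tendstoI)
      fix \<epsilon> :: real assume \<epsilon>: "\<epsilon> > 0"
      have pos: "\<epsilon> / (m + 1) > 0" using \<epsilon> by (simp add: m_def add_nonneg_pos)
      show "\<forall>\<^sub>F N in sequentially. dist (\<integral>p. S N p \<partial>M') (\<integral>p. h p \<partial>M') < \<epsilon>"
        using near[OF pos]
      proof eventually_elim
        case (elim N)
        have "dist (\<integral>p. S N p \<partial>M') (\<integral>p. h p \<partial>M') = \<bar>\<integral>p. S N p - h p \<partial>M'\<bar>"
          using iS ih by (simp add: dist_real_def)
        also have "\<dots> \<le> (\<integral>p. \<bar>S N p - h p\<bar> \<partial>M')" using integral_norm_bound[of M' "\<lambda>p. S N p - h p"] by simp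
        also have "\<dots> \<le> (\<integral>p. \<epsilon> / (m + 1) \<partial>M')"
          using elim iS ih by (intro integral_mono integrable_abs) (auto simp: abs_minus_commute less_imp_le)
        also have "\<dots> = m * (\<epsilon> / (m + 1))" by (simp add: m_def)
        also have "\<dots> < \<epsilon>" using \<epsilon> m0 by (simp add: pos_divide_less_eq distrib_left mult.commute)
        finally show ?case .
      qed
    qed
    show "(\<lambda>N. \<integral>p. (h p - S N p)\<^sup>2 \<partial>M') \<longlonglongrightarrow> 0"
    proof (rule tendstoI)
      fix \<epsilon> :: real assume \<epsilon>: "\<epsilon> > 0"
      have pos: "sqrt (\<epsilon> / (m + 1)) > 0" using \<epsilon> by (simp add: m_def add_nonneg_pos)
      show "\<forall>\<^sub>F N in sequentially. dist (\<integral>p. (h p - S N p)\<^sup>2 \<partial>M') 0 < \<epsilon>"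
        using near[OF pos]
      proof eventually_elim
        case (elim N)
        have "(h p - S N p)\<^sup>2 \<le> \<epsilon> / (m + 1)" for p
          using power_mono[OF less_imp_le[OF elim[rule_format, of p]] abs_ge_zero, of 2] \<epsilon>
          by (simp add: m_def add_nonneg_pos)
        then have "(\<integral>p. (h p - S N p)\<^sup>2 \<partial>M') \<le> (\<integral>p. \<epsilon> / (m + 1) \<partial>M')"
          using i2 by (intro integral_mono) auto
        also have "\<dots> = m * (\<epsilon> / (m + 1))" by (simp add: m_def)
        also have "\<dots> < \<epsilon>" using \<epsilon> m0 by (simp add: pos_divide_less_eq distrib_left mult.commute)
        finally show ?case by simp
      qed
    qed
  qed
  \<comment> \<open>The uniform limit is also the limit in L2 of the volume, so by completeness of
    the basis it agrees with \<open>H\<close> almost everywhere, and by continuity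
    everywhere.\<close>
  have "h p = H p" for p
  proof -
    have iG: "integrable vol (\<lambda>p. (H p)\<^sup>2)"
      by (intro integrable_continuous_finite_measure finite_measure_vol continuous_intros H) simp
    have Gm: "H \<in> borel_measurable vol"
      using borel_measurable_continuous_onI[OF H] by (simp add: measurable_cong_sets[OF sets_vol refl])
    have L2: "(\<lambda>N. \<integral>p. (H p - S N p)\<^sup>2 \<partial>vol) \<longlonglongrightarrow> 0"
      using eigenbasis Gm iG unfolding laplace_eigenbasis_def complete_orthonormal_basis_def S_def g_def by blast
    define D where "D = (\<integral>p. (h p - H p)\<^sup>2 \<partial>vol)"
    have i: "integrable vol (\<lambda>p. (h p - H p)\<^sup>2)" "integrable vol (\<lambda>p. (h p - S N p)\<^sup>2)" "integrable vol (\<lambda>p. (H p - S N p)\<^sup>2)" for N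
      by (intro integrable_continuous_finite_measure finite_measure_vol continuous_intros H hc Sc; simp)+
    have "D \<le> 2 * (\<integral>p. (h p - S N p)\<^sup>2 \<partial>vol) + 2 * (\<integral>p. (H p - S N p)\<^sup>2 \<partial>vol)" for N
    proof -
      have "D \<le> (\<integral>p. 2 * (h p - S N p)\<^sup>2 + 2 * (H p - S N p)\<^sup>2 \<partial>vol)"
        unfolding D_def
      proof (intro integral_mono i Bochner_Integration.integrable_add integrable_mult_right)
        fix p
        show "(h p - H p)\<^sup>2 \<le> 2 * (h p - S N p)\<^sup>2 + 2 * (H p - S N p)\<^sup>2"
          using zero_le_power2[of "(h p - S N p) + (H p - S N p)"] by (simp add: power2_eq_square algebra_simps)
      qed
      then show ?thesis using i by simp
    qed
    moreover have "(\<lambda>N. 2 * (\<integral>p. (h p - S N p)\<^sup>2 \<partial>vol) + 2 * (\<integral>p. (H p - S N p)\<^sup>2 \<partial>vol)) \<longlonglongrightarrow> 2 * 0 + 2 * 0"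
      by (intro tendsto_intros conv2[OF finite_measure_vol sets_vol] L2)
    ultimately have "D \<le> 0" using LIMSEQ_le_const[of _ _ D] by (metis (no_types, lifting) add_0 mult_zero_right)
    moreover have "D \<ge> 0" by (simp add: D_def)
    ultimately have "D = 0" by simp
    then have "AE p in vol. (h p - H p)\<^sup>2 = 0"
      unfolding D_def using i(1) by (subst (asm) integral_nonneg_eq_0_iff_AE) auto
    then have "AE p in vol. h p - H p = 0" by simp
    then have "h p - H p = 0" by (intro continuous_AE_eq_0[of "\<lambda>p. h p - H p"] continuous_intros hc H)
    then show ?thesis by simp
  qed
  then have "h = H" by auto
  moreover have "(\<integral>p. S N p \<partial>M) = (\<Sum>j<N. g j * (\<integral>p. e j p \<partial>M))" for N
    unfolding S_def by (subst Bochner_Integration.integral_sum)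
      (auto intro!: integrable_mult_right integrable_continuous_finite_measure[OF M] continuous_e)
  ultimately show ?thesis using conv[OF M] by (simp add: g_def)
qed

end

section \<open>The lower spectral bound\<close>

context eigenbasis_manifold
begin

section \<open>Test functions transplanted to the manifold\<close>

definition tent_dom :: "real \<Rightarrow> (('m, 'n) chart \<times> (real^'n) \<times> real) \<times> (real^'n) \<Rightarrow> 'm set" where
  "tent_dom r = (\<lambda>(q, y). chart_inv (fst q) ` cball y r)"

text \<open>The indicator extends the bump by zero; outside the domain of the chart
  \<open>chart_map\<close> has no meaning, and the bump of its values could be anything.\<close>

definition tent :: "nat \<Rightarrow> real \<Rightarrow> (('m, 'n) chart \<times> (real^'n) \<times> real) \<times> (real^'n) \<Rightarrow> 'm \<Rightarrow> real" where
  "tent m r \<kappa> p = indicator (tent_dom r \<kappa>) p * bump m ((1/r) *\<^sub>R (chart_map (fst (fst \<kappa>)) p - snd \<kappa>))"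

lemma cellsE:
  assumes "\<kappa> \<in> cells r" "r \<le> rad"
  obtains c x0 R y where "\<kappa> = ((c, x0, R), y)" "(c, x0, R) \<in> P" "c \<in> \<A>" "y \<in> centres x0 R r" "y \<in> cball x0 (2 * R)"
    "cball y r \<subseteq> chart_img c" "cball y r \<subseteq> cball x0 (3 * R)" "r \<le> R"
proof -
  obtain c x0 R y where k: "\<kappa> = ((c, x0, R), y)" "(c, x0, R) \<in> P" "y \<in> centres x0 R r"
    using assms(1) unfolding cells_def by auto
  have R: "r \<le> R" using rad(3)[OF k(2)] assms(2) by simp
  have c: "c \<in> \<A>" "cball x0 (4 * R) \<subseteq> chart_img c" "0 < R" using patch[OF k(2)] by auto
  have "cball y r \<subseteq> cball x0 (3 * R)" by (rule centres_subset(2)[OF k(2,3) R])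
  moreover have "cball x0 (3 * R) \<subseteq> cball x0 (4 * R)" using c(3) by auto
  ultimately show thesis
    using that[OF k(1,2) c(1) k(3) _ _ _ R] k(3) c(2) by (auto simp: centres_def)
qed

lemma tent_nonneg: "tent m r \<kappa> p \<ge> 0"
  by (simp add: tent_def bump_nonneg)

lemma compact_tent_dom:
  assumes "\<kappa> \<in> cells r" "r \<le> rad"
  shows "compact (tent_dom r \<kappa>)"
  by (rule cellsE[OF assms]) (auto simp: tent_dom_def intro!: compact_chart_inv_image)

text \<open>Glued from two open sets: the domain of the chart, where the indicator makes no
  difference since the bump vanishes off the ball, and the complement of \<open>tent_dom\<close>,
  which is open because a compact set is closed in a Hausdorff space.\<close>

lemma continuous_tent:
  assumes \<kappa>: "\<kappa> \<in> cells r" and r: "r \<le> rad" "0 < r"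
  shows "continuous_on UNIV (tent m r \<kappa>)"
proof -
  obtain c x0 R y where k: "\<kappa> = ((c, x0, R), y)" "(c, x0, R) \<in> P" "c \<in> \<A>" "cball y r \<subseteq> chart_img c"
    using cellsE[OF \<kappa> r(1)] by metis
  have td: "tent_dom r \<kappa> = chart_inv c ` cball y r" by (simp add: tent_dom_def k)
  have "closed (tent_dom r \<kappa>)" using compact_tent_dom[OF \<kappa> r(1)] by (rule compact_imp_closed)
  then have op: "open (- tent_dom r \<kappa>)" by (simp add: open_closed)
  have eq: "tent m r \<kappa> p = bump m ((1/r) *\<^sub>R (chart_map c p - y))" if "p \<in> chart_dom c" for p
  proof (cases "p \<in> tent_dom r \<kappa>")
    case False
    then have "chart_map c p \<notin> cball y r"
      using chart_inv_map[OF k(3) that] unfolding td by (metis imageI)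
    then have "norm ((1/r) *\<^sub>R (chart_map c p - y)) \<ge> 1"
      using r by (simp only: norm_scaleR) (simp add: dist_norm norm_minus_commute field_simps)
    then show ?thesis using False by (simp add: tent_def bump_eq_0)
  qed (simp add: tent_def k)
  have "continuous_on (chart_dom c) (\<lambda>p. bump m ((1/r) *\<^sub>R (chart_map c p - y)))"
    by (rule continuous_on_compose2[OF continuous_bump[of UNIV]])
      (auto intro!: continuous_intros continuous_on_chart_map k)
  then have 1: "continuous_on (chart_dom c) (tent m r \<kappa>)"
    by (rule continuous_on_cong[THEN iffD1, rotated 2]) (auto simp: eq)
  have 2: "continuous_on (- tent_dom r \<kappa>) (tent m r \<kappa>)"
    by (rule continuous_on_cong[THEN iffD2, OF refl _ continuous_on_const[of _ 0]]) (simp add: tent_def)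
  have "tent_dom r \<kappa> \<subseteq> chart_dom c" using k(3,4) chart_inv_in_dom unfolding td by blast
  then have "UNIV = chart_dom c \<union> - tent_dom r \<kappa>" by blast
  then show ?thesis using continuous_on_open_Un[OF open_dom[OF k(3)] op 1 2] by simp
qed

lemma tent_ge:
  assumes \<kappa>: "\<kappa> \<in> cells r" and r: "r \<le> rad" "0 < r" and p: "p \<in> cell r \<kappa>"
  shows "tent m r \<kappa> p \<ge> (3/4) ^ (2 * m + 3)"
proof -
  obtain c x0 R y where k: "\<kappa> = ((c, x0, R), y)" "(c, x0, R) \<in> P" "c \<in> \<A>" "cball y r \<subseteq> chart_img c"
    using cellsE[OF \<kappa> r(1)] by metis
  obtain x where x: "x \<in> ball y (r/2)" "p = chart_inv c x" using p unfolding cell_def k by auto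
  have xb: "x \<in> cball y r" using x(1) r by auto
  then have cx: "chart_map c p = x" using k(4) x(2) chart_map_inv[OF k(3)] by auto
  have "p \<in> tent_dom r \<kappa>" using xb x(2) by (auto simp: tent_dom_def k)
  moreover have "norm ((1/r) *\<^sub>R (x - y)) \<le> 1/2"
    using x(1) r by (simp only: norm_scaleR) (simp add: dist_norm norm_minus_commute field_simps)
  ultimately show ?thesis using bump_ge[of "(1/r) *\<^sub>R (x - y)" m] by (simp add: tent_def k cx)
qed

text \<open>Here \<open>h\<close> plays the role of (1 - r^2 \<Delta>)^m applied to the tent: its
  coefficients are those of the tent times the multiplier, and it is bounded independently of r. The
  bound r \<le> rad/4 is inherited from \<open>test_function\<close>.\<close>

lemma dual_tent:
  obtains C where "C > 0" "\<And>r \<kappa>. 0 < r \<Longrightarrow> r \<le> rad / 4 \<Longrightarrow> \<kappa> \<in> cells r \<Longrightarrow>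
    \<exists>h. h \<in> borel_measurable borel \<and> (\<forall>p. \<bar>h p\<bar> \<le> C * indicator (tent_dom r \<kappa>) p) \<and>
      (\<forall>j. (\<integral>p. h p * e j p \<partial>vol) = (1 + r\<^sup>2 * (ev j)\<^sup>2) ^ m * (\<integral>p. tent m r \<kappa> p * e j p \<partial>vol))"
proof -
  define Q where "Q q C \<longleftrightarrow> (C :: real) > 0 \<and> (\<forall>y r. y \<in> cball (fst (snd q)) (2 * snd (snd q)) \<and> 0 < r \<and> r \<le> snd (snd q) / 4 \<longrightarrow>
    (\<exists>g. continuous_on (cball y r) g \<and> (\<forall>x\<in>cball y r. \<bar>g x\<bar> \<le> C) \<and>
      (\<forall>j. (LINT x:cball y r|lborel. g x * e j (chart_inv (fst q) x) * dens (fst q) x) = (1 + r\<^sup>2 * (ev j)\<^sup>2) ^ m *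
        (LINT x:cball y r|lborel. bump m ((1/r) *\<^sub>R (x - y)) * e j (chart_inv (fst q) x) * dens (fst q) x))))" for q C
  have "\<forall>q\<in>P. \<exists>C. Q q C" unfolding Q_def using test_function by fastforce
  then obtain C where C: "\<And>q. q \<in> P \<Longrightarrow> Q q (C q)" by metis
  define D where "D = 1 + (\<Sum>q\<in>P. C q)"
  have C0: "q \<in> P \<Longrightarrow> C q > 0" for q using C unfolding Q_def by blast
  have CD: "C q \<le> D" if "q \<in> P" for q
    using member_le_sum[of q P C] that C0 finite_P by (force simp: D_def less_imp_le)
  show thesis
  proof (rule that[of D])
    show "D > 0" unfolding D_def using C0 by (intro add_pos_nonneg sum_nonneg) (auto simp: less_imp_le)
    fix r \<kappa> assume r: "0 < r" "r \<le> rad / 4" and \<kappa>: "\<kappa> \<in> cells r"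
    have r': "r \<le> rad" using r rad(1) by linarith
    obtain c x0 R y where k: "\<kappa> = ((c, x0, R), y)" "(c, x0, R) \<in> P" "c \<in> \<A>" "y \<in> cball x0 (2 * R)" "cball y r \<subseteq> chart_img c"
      using cellsE[OF \<kappa> r'] by metis
    have rR: "r \<le> R / 4" using r rad(3)[OF k(2)] by linarith
    obtain g where g: "continuous_on (cball y r) g" "\<And>x. x \<in> cball y r \<Longrightarrow> \<bar>g x\<bar> \<le> C (c, x0, R)"
      "\<And>j. (LINT x:cball y r|lborel. g x * e j (chart_inv c x) * dens c x) = (1 + r\<^sup>2 * (ev j)\<^sup>2) ^ m *
        (LINT x:cball y r|lborel. bump m ((1/r) *\<^sub>R (x - y)) * e j (chart_inv c x) * dens c x)"
      using C[OF k(2), unfolded Q_def, THEN conjunct2, rule_format, of y r] k(4) r(1) rR unfolding fst_conv snd_conv by blast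
    have td: "tent_dom r \<kappa> = chart_inv c ` cball y r" by (simp add: tent_dom_def k)
    define h where "h p = indicator (tent_dom r \<kappa>) p * g (chart_map c p)" for p
    have ce: "continuous_on (cball y r) (\<lambda>x. e j (chart_inv c x))" for j
      by (rule continuous_on_compose2[OF continuous_e continuous_on_subset[OF continuous_on_chart_inv[OF k(3)] k(5)]]) simp
    have ext: "indicator (tent_dom r \<kappa>) p * k (chart_map c p) * e j p =
        indicator (chart_inv c ` cball y r) p * (k (chart_map c p) * e j (chart_inv c (chart_map c p)))" for p j k
      using chart_map_chart_inv_image(2)[OF k(3,5), of p] chart_inv_map[OF k(3), of p]
      by (cases "p \<in> tent_dom r \<kappa>") (auto simp: td)
    have int: "(\<integral>p. indicator (tent_dom r \<kappa>) p * k (chart_map c p) * e j p \<partial>vol) =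
        (LINT x:cball y r|lborel. k x * e j (chart_inv c x) * dens c x)" if "continuous_on (cball y r) k" for k j
      unfolding ext using integral_vol_compact[OF k(3) compact_cball k(5) continuous_on_mult[OF that ce[of j]]]
      by (simp add: td)
    show "\<exists>h. h \<in> borel_measurable borel \<and> (\<forall>p. \<bar>h p\<bar> \<le> D * indicator (tent_dom r \<kappa>) p) \<and>
      (\<forall>j. (\<integral>p. h p * e j p \<partial>vol) = (1 + r\<^sup>2 * (ev j)\<^sup>2) ^ m * (\<integral>p. tent m r \<kappa> p * e j p \<partial>vol))"
    proof (intro exI[of _ h] conjI allI)
      show "h \<in> borel_measurable borel"
        unfolding h_def[abs_def] td by (rule measurable_vol_compact[OF k(3) compact_cball k(5) g(1)])
      show "\<bar>h p\<bar> \<le> D * indicator (tent_dom r \<kappa>) p" for p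
        using g(2)[of "chart_map c p"] CD[OF k(2)] chart_map_chart_inv_image(1)[OF k(3,5), of p]
        by (cases "p \<in> tent_dom r \<kappa>") (auto simp: h_def td)
      show "(\<integral>p. h p * e j p \<partial>vol) = (1 + r\<^sup>2 * (ev j)\<^sup>2) ^ m * (\<integral>p. tent m r \<kappa> p * e j p \<partial>vol)" for j
      proof -
        have "continuous_on (cball y r) (\<lambda>x. bump m ((1/r) *\<^sub>R (x - y)))"
          by (rule continuous_on_compose2[OF continuous_bump[of UNIV]]) (auto intro!: continuous_intros)
        from int[OF this] int[OF g(1)] g(3)[of j] show ?thesis by (simp add: h_def tent_def k)
      qed
    qed
  qed
qed

lemma tent_dom_borel: "\<kappa> \<in> cells r \<Longrightarrow> r \<le> rad \<Longrightarrow> tent_dom r \<kappa> \<in> sets borel"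
  by (intro borel_closed compact_imp_closed compact_tent_dom)

lemma measure_tent_dom:
  obtains C where "C > 0" "\<And>r \<kappa>. 0 < r \<Longrightarrow> r \<le> rad \<Longrightarrow> \<kappa> \<in> cells r \<Longrightarrow> measure vol (tent_dom r \<kappa>) \<le> C * r ^ CARD('n)"
proof -
  have "\<forall>q\<in>P. \<exists>W>0. \<forall>x\<in>cball (fst (snd q)) (3 * snd (snd q)). dens (fst q) x \<le> W"
  proof
    fix q assume "q \<in> P"
    then obtain c x0 R where q: "q = (c, x0, R)" "(c, x0, R) \<in> P" by (cases q) auto
    have c: "c \<in> \<A>" "cball x0 (4 * R) \<subseteq> chart_img c" "0 < R" using patch[OF q(2)] by auto
    have "cball x0 (3 * R) \<subseteq> chart_img c" using c(2,3) by auto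
    then have "compact (dens c ` cball x0 (3 * R))"
      by (intro compact_continuous_image continuous_on_subset[OF continuous_on_dens[OF c(1)]]) auto
    then obtain b where b: "\<forall>x\<in>dens c ` cball x0 (3 * R). norm x \<le> b"
      using compact_imp_bounded bounded_iff by blast
    then have "\<forall>x\<in>cball x0 (3 * R). dens c x \<le> max 1 b" by (force simp: max_def)
    then show "\<exists>W>0. \<forall>x\<in>cball (fst (snd q)) (3 * snd (snd q)). dens (fst q) x \<le> W"
      unfolding q by (intro exI[of _ "max 1 b"]) auto
  qed
  then obtain W where W: "\<And>q. q \<in> P \<Longrightarrow> W q > 0"
    "\<And>q x. q \<in> P \<Longrightarrow> x \<in> cball (fst (snd q)) (3 * snd (snd q)) \<Longrightarrow> dens (fst q) x \<le> W q" by metis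
  define D where "D = 1 + (\<Sum>q\<in>P. W q)"
  have WD: "W q \<le> D" if "q \<in> P" for q
    using member_le_sum[of q P W] that W(1) finite_P by (force simp: D_def less_imp_le)
  have D0: "D > 0" unfolding D_def using W(1) by (intro add_pos_nonneg sum_nonneg) (auto simp: less_imp_le)
  show thesis
  proof (rule that[of "D * unit_ball_vol (real CARD('n))"])
    show "D * unit_ball_vol (real CARD('n)) > 0" using D0 unit_ball_vol_pos[of "real CARD('n)"] by (intro mult_pos_pos) auto
    fix r \<kappa> assume r: "0 < r" "r \<le> rad" and \<kappa>: "\<kappa> \<in> cells r"
    obtain c x0 R y where k: "\<kappa> = ((c, x0, R), y)" "(c, x0, R) \<in> P" "c \<in> \<A>" "cball y r \<subseteq> chart_img c" "cball y r \<subseteq> cball x0 (3 * R)"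
      using cellsE[OF \<kappa> r(2)] by metis
    have td: "tent_dom r \<kappa> = chart_inv c ` cball y r" by (simp add: tent_dom_def k)
    have "measure vol (tent_dom r \<kappa>) = (\<integral>p. indicator (chart_inv c ` cball y r) p * 1 \<partial>vol)"
      using tent_dom_borel[OF \<kappa> r(2)] by (simp add: td)
    also have "\<dots> = (LINT x:cball y r|lborel. 1 * dens c x)"
      using integral_vol_compact[OF k(3) compact_cball k(4), of "\<lambda>_. 1"] by simp
    also have "\<dots> \<le> (LINT x:cball y r|lborel. D)"
    proof (rule set_integral_mono)
      show "set_integrable lborel (cball y r) (\<lambda>x. 1 * dens c x)"
        by (intro set_integrable_compact compact_cball) (auto intro: continuous_on_subset[OF continuous_on_dens[OF k(3)] k(4)])
      show "set_integrable lborel (cball y r) (\<lambda>x. D)" by (intro set_integrable_compact) auto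
      show "1 * dens c x \<le> D" if "x \<in> cball y r" for x
        using W(2)[OF k(2), of x] WD[OF k(2)] k(5) that by auto
    qed
    also have "\<dots> = D * measure lborel (cball y r)" using set_integral_const[of "cball y r" lborel D] emeasure_lborel_cball_finite[of y r] by simp
    also have "measure lborel (cball y r) = unit_ball_vol (real CARD('n)) * r ^ CARD('n)"
      using content_cball[of r y] r by simp
    finally show "measure vol (tent_dom r \<kappa>) \<le> D * unit_ball_vol (real CARD('n)) * r ^ CARD('n)" by simp
  qed
qed

lemma card_tent_dom:
  assumes r: "0 < r" "r \<le> rad"
  shows "card {\<kappa> \<in> cells r. p \<in> tent_dom r \<kappa>} \<le> card P * overlap TYPE('n)"
proof -
  let ?S = "SIGMA q : P. {y \<in> centres (fst (snd q)) (snd (snd q)) r. dist (chart_map (fst q) p) y \<le> 2 * r}"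
  have fin1: "finite {y \<in> centres x0 R r. Q y}" for x0 :: "real^'n" and R Q
    by (rule finite_subset[OF _ finite_centres[OF r(1)]]) auto
  have fin: "finite ?S" by (intro finite_SigmaI finite_P fin1)
  have "{\<kappa> \<in> cells r. p \<in> tent_dom r \<kappa>} \<subseteq> ?S"
  proof
    fix \<kappa> assume "\<kappa> \<in> {\<kappa> \<in> cells r. p \<in> tent_dom r \<kappa>}"
    then have \<kappa>: "\<kappa> \<in> cells r" "p \<in> tent_dom r \<kappa>" by auto
    obtain c x0 R y where k: "\<kappa> = ((c, x0, R), y)" "(c, x0, R) \<in> P" "c \<in> \<A>" "y \<in> centres x0 R r" "cball y r \<subseteq> chart_img c"
      using cellsE[OF \<kappa>(1) r(2)] by metis
    have "chart_map c p \<in> cball y r"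
      using \<kappa>(2) chart_map_chart_inv_image(1)[OF k(3,5)] by (auto simp: tent_dom_def k)
    then have "dist (chart_map c p) y \<le> 2 * r" using r by (simp add: dist_commute)
    then show "\<kappa> \<in> ?S" using k(2,4) by (auto simp: k(1))
  qed
  then have "card {\<kappa> \<in> cells r. p \<in> tent_dom r \<kappa>} \<le> card ?S" by (rule card_mono[OF fin])
  also have "\<dots> = (\<Sum>q\<in>P. card {y \<in> centres (fst (snd q)) (snd (snd q)) r. dist (chart_map (fst q) p) y \<le> 2 * r})"
    by (intro card_SigmaI ballI finite_P fin1)
  also have "\<dots> \<le> (\<Sum>q\<in>P. overlap TYPE('n))" by (intro sum_mono card_centres_near r)
  finally show ?thesis by simp
qed

lemma cell_subset_tent_dom: "r > 0 \<Longrightarrow> cell r \<kappa> \<subseteq> tent_dom r \<kappa>"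
  by (cases \<kappa>) (auto simp: cell_def tent_dom_def)

text \<open>For a Dirac measure \<open>cell_sum\<close> counts the cells that contain the point: at
  least one because the cells cover, and boundedly many by the overlap bound. Thus Dirac measures
  behave like r^0.\<close>

lemma cell_sum_return:
  assumes r: "0 < r" "r \<le> rad"
  shows "1 \<le> cell_sum (return borel p) r" "cell_sum (return borel p) r \<le> real (card P * overlap TYPE('n))"
proof -
  have "cell_sum (return borel p) r = (\<Sum>\<kappa>\<in>cells r. indicator {\<kappa>. p \<in> cell r \<kappa>} \<kappa>)"
    unfolding cell_sum_def
  proof (rule sum.cong[OF refl])
    fix \<kappa> assume "\<kappa> \<in> cells r"
    then have "cell r \<kappa> \<in> sets borel" using r by (intro borel_open cell_open)
    then show "(measure (return borel p) (cell r \<kappa>))\<^sup>2 = (indicator {\<kappa>. p \<in> cell r \<kappa>} \<kappa> :: real)"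
      by (simp add: measure_return split: split_indicator)
  qed
  also have "\<dots> = real (card {\<kappa> \<in> cells r. p \<in> cell r \<kappa>})"
    using finite_cells[OF r(1)] by (simp add: indicator_def sum_of_bool_eq Int_def)
  finally have eq: "cell_sum (return borel p) r = real (card {\<kappa> \<in> cells r. p \<in> cell r \<kappa>})" .
  obtain c x0 R y x where x: "((c, x0, R), y) \<in> cells r" "p = chart_inv c x" "dist y x \<le> r / 4"
    by (rule cells_cover[OF r, of p])
  have "p \<in> cell r ((c, x0, R), y)" using x r by (auto simp: cell_def)
  then have "{\<kappa> \<in> cells r. p \<in> cell r \<kappa>} \<noteq> {}" using x(1) by blast
  then have "card {\<kappa> \<in> cells r. p \<in> cell r \<kappa>} > 0" using finite_cells[OF r(1)] by (simp add: card_gt_0_iff)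
  then show "1 \<le> cell_sum (return borel p) r" unfolding eq by simp
  have "card {\<kappa> \<in> cells r. p \<in> cell r \<kappa>} \<le> card {\<kappa> \<in> cells r. p \<in> tent_dom r \<kappa>}"
  proof (rule card_mono)
    show "finite {\<kappa> \<in> cells r. p \<in> tent_dom r \<kappa>}" using finite_cells[OF r(1)] by simp
    show "{\<kappa> \<in> cells r. p \<in> cell r \<kappa>} \<subseteq> {\<kappa> \<in> cells r. p \<in> tent_dom r \<kappa>}"
      using cell_subset_tent_dom[OF r(1)] by blast
  qed
  also note card_tent_dom[OF r, of p]
  finally show "cell_sum (return borel p) r \<le> real (card P * overlap TYPE('n))" unfolding eq by linarith
qed

text \<open>The upper bound at the scales r/2^i shows that the squares over \<lambda>_j r \<le> 2^i
  sum to at most a constant times 2^(i n). Since k exceeds n, the dyadic sum converges.\<close>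

lemma spectral_tail_bound:
  assumes k: "CARD('n) < k"
  obtains C where "C > 0"
    "\<And>M r J A. finite_measure M \<Longrightarrow> sets M = sets borel \<Longrightarrow> 0 < r \<Longrightarrow> r \<le> rad \<Longrightarrow> finite J \<Longrightarrow>
      (\<And>\<rho>. 0 < \<rho> \<Longrightarrow> \<rho> \<le> r \<Longrightarrow> cell_sum M \<rho> \<le> A) \<Longrightarrow>
      (\<Sum>(j::nat) | j \<in> J \<and> 1 < ev j * r. (\<integral>p. e j p \<partial>M)\<^sup>2 / (ev j * r) ^ k) \<le> C * A / r ^ CARD('n)"
proof -
  obtain C where C: "C > 0"
    "\<And>M r J. finite_measure M \<Longrightarrow> sets M = sets borel \<Longrightarrow> 0 < r \<Longrightarrow> r \<le> rad \<Longrightarrow> finite J \<Longrightarrow>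
      (\<And>j. j \<in> J \<Longrightarrow> ev j * r \<le> 1) \<Longrightarrow> (\<Sum>j\<in>J. (\<integral>p. e j p \<partial>M)\<^sup>2) \<le> C / r ^ CARD('n) * cell_sum M r"
  proof (rule spectral_upper_bound, goal_cases)
    case (1 C) show ?case by (rule 1(1), fact 1(2), fact 1(3))
  qed
  define q where "q = real CARD('n)"
  have x: "1 - 2 powr (q - real k) > 0" using k by (simp add: q_def powr_less_one)
  define D where "D = C * (2 powr q / (1 - 2 powr (q - real k)))"
  show thesis
  proof (rule that[of D])
    show "D > 0" using C(1) x by (simp add: D_def)
    fix M :: "'m measure" and r A :: real and J :: "nat set"
    assume M: "finite_measure M" "sets M = sets borel" and r: "0 < r" "r \<le> rad" and J: "finite J"
      and A: "\<And>\<rho>. 0 < \<rho> \<Longrightarrow> \<rho> \<le> r \<Longrightarrow> cell_sum M \<rho> \<le> A"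
    have A0: "0 \<le> A" using A[of r] r sum_nonneg[of "cells r" "\<lambda>\<kappa>. (measure M (cell r \<kappa>))\<^sup>2"] by (simp add: cell_sum_def)
    have "(\<Sum>j | j \<in> J \<and> 1 < ev j * r. (\<integral>p. e j p \<partial>M)\<^sup>2 / (ev j * r) ^ k) \<le>
      (C * A / r ^ CARD('n)) * (2 powr q / (1 - 2 powr (q - real k)))"
    proof (rule dyadic_tail_bound[OF J])
      show "0 \<le> C * A / r ^ CARD('n)" using C(1) A0 r by simp
      show "q < real k" using k by (simp add: q_def)
      fix i :: nat
      define \<rho> where "\<rho> = r / 2 ^ i"
      have \<rho>: "0 < \<rho>" "\<rho> \<le> r" using r by (auto simp: \<rho>_def divide_le_eq mult_le_cancel_left1)
      have "(\<Sum>j | j \<in> J \<and> ev j * r \<le> 2 ^ i. (\<integral>p. e j p \<partial>M)\<^sup>2) \<le> C / \<rho> ^ CARD('n) * cell_sum M \<rho>"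
      proof (rule C(2)[OF M \<rho>(1)])
        show "\<rho> \<le> rad" using \<rho>(2) r(2) by linarith
        show "finite {j \<in> J. ev j * r \<le> 2 ^ i}" using J by simp
        show "ev j * \<rho> \<le> 1" if "j \<in> {j \<in> J. ev j * r \<le> 2 ^ i}" for j using that by (simp add: \<rho>_def divide_le_eq)
      qed
      also have "\<dots> \<le> C / \<rho> ^ CARD('n) * A" using A[OF \<rho>] C(1) \<rho>(1) by (intro mult_left_mono) auto
      also have "\<dots> = C * A / r ^ CARD('n) * (2 ^ i) powr q"
        by (simp add: \<rho>_def q_def powr_realpow power_divide)
      finally show "(\<Sum>j | j \<in> J \<and> ev j * r \<le> 2 ^ i. (\<integral>p. e j p \<partial>M)\<^sup>2) \<le> C * A / r ^ CARD('n) * (2 ^ i) powr q" .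
    qed simp
    then show "(\<Sum>j | j \<in> J \<and> 1 < ev j * r. (\<integral>p. e j p \<partial>M)\<^sup>2 / (ev j * r) ^ k) \<le> D * A / r ^ CARD('n)"
      by (simp add: D_def mult_ac)
  qed
qed

lemma return_point:
  "finite_measure (return borel (p :: 'm))" "sets (return borel p) = sets borel" "(\<integral>q. e j q \<partial>return borel p) = e j p"
  using prob_space.finite_measure[OF prob_space_return[of p borel]]
  by (simp_all add: integral_return)

text \<open>Below the threshold 1/\<rho> the weight is replaced by 1, above it 1 + r^2 \<lambda>^2
  by r^2 \<lambda>^2. The scales \<rho> and r are kept apart because the threshold is later chosen
  well above 1/r, which makes the second sum small.\<close>

lemma weighted_sum_split:
  fixes b :: "nat \<Rightarrow> real"
  assumes J: "finite J" and b: "\<And>j. b j \<ge> 0" and pos: "\<rho> > 0" "r > 0"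
  shows "(\<Sum>j\<in>J. b j / (1 + r\<^sup>2 * (ev j)\<^sup>2) ^ (2 * m)) \<le>
    (\<Sum>j | j \<in> J \<and> ev j * \<rho> \<le> 1. b j) + (\<Sum>j | j \<in> J \<and> 1 < ev j * \<rho>. b j / (ev j * r) ^ (4 * m))"
proof -
  have "(\<Sum>j\<in>J. b j / (1 + r\<^sup>2 * (ev j)\<^sup>2) ^ (2 * m)) \<le>
      (\<Sum>j\<in>J. (if ev j * \<rho> \<le> 1 then b j else 0) + (if 1 < ev j * \<rho> then b j / (ev j * r) ^ (4 * m) else 0))"
  proof (rule sum_mono)
    fix j
    show "b j / (1 + r\<^sup>2 * (ev j)\<^sup>2) ^ (2 * m) \<le>
      (if ev j * \<rho> \<le> 1 then b j else 0) + (if 1 < ev j * \<rho> then b j / (ev j * r) ^ (4 * m) else 0)"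
    proof (cases "ev j * \<rho> \<le> 1")
      case True
      have "1 \<le> (1 + r\<^sup>2 * (ev j)\<^sup>2) ^ (2 * m)" by (rule one_le_power) simp
      from divide_left_mono[OF this b[of j]] less_le_trans[OF zero_less_one this]
      show ?thesis using True by simp
    next
      case False
      then have "ev j * \<rho> > 0" by linarith
      then have evr: "ev j * r > 0" using pos by (simp add: zero_less_mult_iff)
      have "(ev j * r) ^ (4 * m) = ((ev j * r)\<^sup>2) ^ (2 * m)" by (simp add: power_mult[symmetric])
      also have "\<dots> \<le> (1 + r\<^sup>2 * (ev j)\<^sup>2) ^ (2 * m)" by (rule power_mono) (simp_all add: power_mult_distrib)
      finally have le: "(ev j * r) ^ (4 * m) \<le> (1 + r\<^sup>2 * (ev j)\<^sup>2) ^ (2 * m)" .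
      have "0 < (ev j * r) ^ (4 * m)" using evr by simp
      then have "b j / (1 + r\<^sup>2 * (ev j)\<^sup>2) ^ (2 * m) \<le> b j / (ev j * r) ^ (4 * m)"
        using le by (intro divide_left_mono mult_pos_pos b) linarith+
      then show ?thesis using False by simp
    qed
  qed
  also have "\<dots> = (\<Sum>j | j \<in> J \<and> ev j * \<rho> \<le> 1. b j) + (\<Sum>j | j \<in> J \<and> 1 < ev j * \<rho>. b j / (ev j * r) ^ (4 * m))"
    unfolding sum.distrib sum.inter_filter[OF J] ..
  finally show ?thesis .
qed

text \<open>Provides the hypothesis \<open>B2\<close> of \<open>expansion_converges\<close>, by
  applying the low and high frequency bounds to the Dirac measure at p. The bound may depend on r,
  as it only serves convergence.\<close>

lemma pointwise_bound:
  assumes k: "CARD('n) < 4 * m" and r: "0 < r" "r \<le> rad"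
  obtains B where "\<And>N p. (\<Sum>j<N. (e j p)\<^sup>2 / (1 + r\<^sup>2 * (ev j)\<^sup>2) ^ (2 * m)) \<le> B"
proof -
  define A where "A = real (card P * overlap TYPE('n))"
  obtain C where C: "C > 0"
    "\<And>M r J. finite_measure M \<Longrightarrow> sets M = sets borel \<Longrightarrow> 0 < r \<Longrightarrow> r \<le> rad \<Longrightarrow> finite J \<Longrightarrow>
      (\<And>j. j \<in> J \<Longrightarrow> ev j * r \<le> 1) \<Longrightarrow> (\<Sum>j\<in>J. (\<integral>p. e j p \<partial>M)\<^sup>2) \<le> C / r ^ CARD('n) * cell_sum M r"
  proof (rule spectral_upper_bound, goal_cases)
    case (1 C) show ?case by (rule 1(1), fact 1(2), fact 1(3))
  qed
  obtain D where D: "D > 0"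
    "\<And>M r J A. finite_measure M \<Longrightarrow> sets M = sets borel \<Longrightarrow> 0 < r \<Longrightarrow> r \<le> rad \<Longrightarrow> finite J \<Longrightarrow>
      (\<And>\<rho>. 0 < \<rho> \<Longrightarrow> \<rho> \<le> r \<Longrightarrow> cell_sum M \<rho> \<le> A) \<Longrightarrow>
      (\<Sum>j | j \<in> J \<and> 1 < ev j * r. (\<integral>p. e j p \<partial>M)\<^sup>2 / (ev j * r) ^ (4 * m)) \<le> D * A / r ^ CARD('n)"
  proof (rule spectral_tail_bound[OF k], goal_cases)
    case (1 C) show ?case by (rule 1(1), fact 1(2), fact 1(3))
  qed
  show thesis
  proof (rule that[of "C / r ^ CARD('n) * A + D * A / r ^ CARD('n)"])
    fix N :: nat and p :: 'm
    define M where "M = return borel p"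
    have M: "finite_measure M" "sets M = sets borel" and ej: "\<And>j. (\<integral>q. e j q \<partial>M) = e j p"
      unfolding M_def by (rule return_point)+
    have cs: "cell_sum M \<rho> \<le> A" if "0 < \<rho>" "\<rho> \<le> r" for \<rho>
      using cell_sum_return(2)[of \<rho> p] that r by (simp add: M_def A_def)
    have "(\<Sum>j<N. (e j p)\<^sup>2 / (1 + r\<^sup>2 * (ev j)\<^sup>2) ^ (2 * m)) \<le>
        (\<Sum>j | j \<in> {..<N} \<and> ev j * r \<le> 1. (e j p)\<^sup>2) + (\<Sum>j | j \<in> {..<N} \<and> 1 < ev j * r. (e j p)\<^sup>2 / (ev j * r) ^ (4 * m))"
      by (rule weighted_sum_split) (use r in auto)
    also have "\<dots> \<le> C / r ^ CARD('n) * A + D * A / r ^ CARD('n)"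
    proof (rule add_mono)
      have "(\<Sum>j | j \<in> {..<N} \<and> ev j * r \<le> 1. (\<integral>q. e j q \<partial>M)\<^sup>2) \<le> C / r ^ CARD('n) * cell_sum M r"
        by (rule C(2)[OF M r]) auto
      also have "\<dots> \<le> C / r ^ CARD('n) * A" using cs[of r] C(1) r by (intro mult_left_mono) auto
      finally show "(\<Sum>j | j \<in> {..<N} \<and> ev j * r \<le> 1. (e j p)\<^sup>2) \<le> C / r ^ CARD('n) * A" by (simp only: ej)
      show "(\<Sum>j | j \<in> {..<N} \<and> 1 < ev j * r. (e j p)\<^sup>2 / (ev j * r) ^ (4 * m)) \<le> D * A / r ^ CARD('n)"
        using D(2)[OF M r finite_lessThan cs] by (simp only: ej)
    qed
    finally show "(\<Sum>j<N. (e j p)\<^sup>2 / (1 + r\<^sup>2 * (ev j)\<^sup>2) ^ (2 * m)) \<le> C / r ^ CARD('n) * A + D * A / r ^ CARD('n)" .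
  qed
qed

text \<open>With D for \<open>cell_sum M r\<close>, the function \<open>T\<close> has integral at
  least a D, where a is the least value of a tent on its cell. Expanding \<open>T\<close> and
  applying Cauchy-Schwarz bounds that integral by the root of C r^n D B. In the resulting inequality
  (a D)^2 \<le> C r^n D B one factor D cancels.\<close>

lemma spectral_lower_bound:
  assumes k: "CARD('n) < 4 * m"
  obtains C where "C > 0"
    "\<And>M r B. finite_measure M \<Longrightarrow> sets M = sets borel \<Longrightarrow> 0 < r \<Longrightarrow> r \<le> rad / 4 \<Longrightarrow>
      (\<And>N. (\<Sum>j<N. (\<integral>p. e j p \<partial>M)\<^sup>2 / (1 + r\<^sup>2 * (ev j)\<^sup>2) ^ (2 * m)) \<le> B) \<Longrightarrow>
      cell_sum M r \<le> C * r ^ CARD('n) * B"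
proof -
  obtain Cd where Cd: "Cd > 0" "\<And>r \<kappa>. 0 < r \<Longrightarrow> r \<le> rad / 4 \<Longrightarrow> \<kappa> \<in> cells r \<Longrightarrow>
    \<exists>h. h \<in> borel_measurable borel \<and> (\<forall>p. \<bar>h p\<bar> \<le> Cd * indicator (tent_dom r \<kappa>) p) \<and>
      (\<forall>j. (\<integral>p. h p * e j p \<partial>vol) = (1 + r\<^sup>2 * (ev j)\<^sup>2) ^ m * (\<integral>p. tent m r \<kappa> p * e j p \<partial>vol))"
  proof (rule dual_tent[of m], goal_cases)
    case (1 C) show ?case by (rule 1(1), fact 1(2), fact 1(3))
  qed
  obtain Cv where Cv: "Cv > 0" "\<And>r \<kappa>. 0 < r \<Longrightarrow> r \<le> rad \<Longrightarrow> \<kappa> \<in> cells r \<Longrightarrow> measure vol (tent_dom r \<kappa>) \<le> Cv * r ^ CARD('n)"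
  proof (rule measure_tent_dom, goal_cases)
    case (1 C) show ?case by (rule 1(1), fact 1(2), fact 1(3))
  qed
  define N0 where "N0 = real (card P * overlap TYPE('n)) + 1"
  define a where "a = (3/4 :: real) ^ (2 * m + 3)"
  have a: "a > 0" by (simp add: a_def)
  have N0: "N0 > 0" by (simp add: N0_def add_nonneg_pos)
  define D where "D = N0 * Cd\<^sup>2 * Cv / a\<^sup>2"
  show thesis
  proof (rule that[of D])
    show "D > 0" using Cd(1) Cv(1) N0 a by (simp add: D_def)
    fix M :: "'m measure" and r B :: real
    assume M: "finite_measure M" "sets M = sets borel" and r: "0 < r" "r \<le> rad / 4"
      and B: "\<And>N. (\<Sum>j<N. (\<integral>p. e j p \<partial>M)\<^sup>2 / (1 + r\<^sup>2 * (ev j)\<^sup>2) ^ (2 * m)) \<le> B"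
    interpret M: finite_measure M by (rule M(1))
    interpret V: finite_measure vol by (rule finite_measure_vol)
    have r': "r \<le> rad" using r rad(1) by linarith
    define \<mu> where "\<mu> j = (\<integral>p. e j p \<partial>M)" for j
    define t where "t \<kappa> = measure M (cell r \<kappa>)" for \<kappa>
    have t0: "t \<kappa> \<ge> 0" for \<kappa> by (simp add: t_def)
    define v where "v j = (1 + r\<^sup>2 * (ev j)\<^sup>2) ^ (2 * m)" for j
    have v: "v j > 0" for j unfolding v_def by (rule zero_less_power) (simp add: add_pos_nonneg)
    have "\<forall>\<kappa>\<in>cells r. \<exists>h. h \<in> borel_measurable borel \<and> (\<forall>p. \<bar>h p\<bar> \<le> Cd * indicator (tent_dom r \<kappa>) p) \<and>
      (\<forall>j. (\<integral>p. h p * e j p \<partial>vol) = (1 + r\<^sup>2 * (ev j)\<^sup>2) ^ m * (\<integral>p. tent m r \<kappa> p * e j p \<partial>vol))"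
      using Cd(2)[OF r] by blast
    from bchoice[OF this] obtain h where hm: "\<And>\<kappa>. \<kappa> \<in> cells r \<Longrightarrow> h \<kappa> \<in> borel_measurable borel"
      and hb: "\<And>\<kappa> p. \<kappa> \<in> cells r \<Longrightarrow> \<bar>h \<kappa> p\<bar> \<le> Cd * indicator (tent_dom r \<kappa>) p"
      and he: "\<And>\<kappa> j. \<kappa> \<in> cells r \<Longrightarrow> (\<integral>p. h \<kappa> p * e j p \<partial>vol) = (1 + r\<^sup>2 * (ev j)\<^sup>2) ^ m * (\<integral>p. tent m r \<kappa> p * e j p \<partial>vol)"
      by blast
    define T where "T p = (\<Sum>\<kappa>\<in>cells r. t \<kappa> * tent m r \<kappa> p)" for p
    define H where "H p = (\<Sum>\<kappa>\<in>cells r. t \<kappa> * h \<kappa> p)" for p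
    have T: "continuous_on UNIV T"
      unfolding T_def by (intro continuous_intros continuous_tent r' r)
    have Hm: "H \<in> borel_measurable borel"
      unfolding H_def by (intro borel_measurable_sum borel_measurable_times borel_measurable_const hm)
    \<comment> \<open>At most \<open>N0\<close> of the dual functions are nonzero at p, so squaring
      their sum costs no more than this factor.\<close>
    have H2: "(H p)\<^sup>2 \<le> N0 * Cd\<^sup>2 * (\<Sum>\<kappa>\<in>cells r. (t \<kappa>)\<^sup>2 * indicator (tent_dom r \<kappa>) p)" for p
    proof -
      let ?S = "{\<kappa> \<in> cells r. p \<in> tent_dom r \<kappa>}"
      have "H p = (\<Sum>\<kappa>\<in>?S. t \<kappa> * h \<kappa> p)"
        unfolding H_def
      proof (rule sum.mono_neutral_right)
        show "\<forall>\<kappa>\<in>cells r - ?S. t \<kappa> * h \<kappa> p = 0"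
        proof
          fix \<kappa> assume "\<kappa> \<in> cells r - ?S"
          then have "h \<kappa> p = 0" using hb[of \<kappa> p] by simp
          then show "t \<kappa> * h \<kappa> p = 0" by simp
        qed
      qed (use finite_cells[OF r(1)] in auto)
      then have "(H p)\<^sup>2 \<le> (\<Sum>\<kappa>\<in>?S. (t \<kappa>)\<^sup>2) * (\<Sum>\<kappa>\<in>?S. (h \<kappa> p)\<^sup>2)"
        using Cauchy_Schwarz_ineq_sum[of t "\<lambda>\<kappa>. h \<kappa> p" ?S] by simp
      also have "\<dots> \<le> (\<Sum>\<kappa>\<in>?S. (t \<kappa>)\<^sup>2) * (N0 * Cd\<^sup>2)"
      proof (intro mult_left_mono sum_nonneg zero_le_power2)
        have "(\<Sum>\<kappa>\<in>?S. (h \<kappa> p)\<^sup>2) \<le> (\<Sum>\<kappa>\<in>?S. Cd\<^sup>2)"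
        proof (rule sum_mono)
          fix \<kappa> assume "\<kappa> \<in> ?S"
          then have "\<bar>h \<kappa> p\<bar> \<le> Cd" using hb[of \<kappa> p] by simp
          then show "(h \<kappa> p)\<^sup>2 \<le> Cd\<^sup>2" by (simp add: abs_le_square_iff[symmetric])
        qed
        also have "\<dots> = real (card ?S) * Cd\<^sup>2" by simp
        also have "\<dots> \<le> N0 * Cd\<^sup>2"
          using card_tent_dom[OF r(1) r', of p] by (intro mult_right_mono) (auto simp: N0_def simp flip: of_nat_mult of_nat_Suc)
        finally show "(\<Sum>\<kappa>\<in>?S. (h \<kappa> p)\<^sup>2) \<le> N0 * Cd\<^sup>2" .
      qed
      also have "(\<Sum>\<kappa>\<in>?S. (t \<kappa>)\<^sup>2) = (\<Sum>\<kappa>\<in>cells r. (t \<kappa>)\<^sup>2 * indicator (tent_dom r \<kappa>) p)"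
        using finite_cells[OF r(1)] by (simp add: sum.inter_filter indicator_def of_bool_def if_distrib cong: if_cong)
      finally show ?thesis by (simp add: mult_ac)
    qed
    have it: "integrable vol (\<lambda>p. (t \<kappa>)\<^sup>2 * indicator (tent_dom r \<kappa>) p)" if "\<kappa> \<in> cells r" for \<kappa>
      using tent_dom_borel[OF that r'] V.emeasure_finite[of "tent_dom r \<kappa>"]
      by (intro integrable_mult_right integrable_real_indicator) (auto simp: less_top[symmetric])
    have iS: "integrable vol (\<lambda>p. N0 * Cd\<^sup>2 * (\<Sum>\<kappa>\<in>cells r. (t \<kappa>)\<^sup>2 * indicator (tent_dom r \<kappa>) p))"
      by (intro integrable_mult_right Bochner_Integration.integrable_sum it)
    have Hm': "H \<in> borel_measurable vol" using Hm by (simp add: measurable_cong_sets[OF sets_vol refl])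
    have iH: "integrable vol (\<lambda>p. (H p)\<^sup>2)"
    proof (rule Bochner_Integration.integrable_bound[OF iS _ AE_I2])
      show "(\<lambda>p. (H p)\<^sup>2) \<in> borel_measurable vol" using Hm' by simp
      show "norm ((H p)\<^sup>2) \<le> norm (N0 * Cd\<^sup>2 * (\<Sum>\<kappa>\<in>cells r. (t \<kappa>)\<^sup>2 * indicator (tent_dom r \<kappa>) p))" for p
        using order_trans[OF H2[of p] abs_ge_self] by (simp only: real_norm_def abs_power2)
    qed
    have cs: "cell_sum M r = (\<Sum>\<kappa>\<in>cells r. (t \<kappa>)\<^sup>2)" by (simp add: cell_sum_def t_def)
    have "(\<integral>p. (H p)\<^sup>2 \<partial>vol) \<le> (\<integral>p. N0 * Cd\<^sup>2 * (\<Sum>\<kappa>\<in>cells r. (t \<kappa>)\<^sup>2 * indicator (tent_dom r \<kappa>) p) \<partial>vol)"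
      by (intro integral_mono iH iS H2)
    also have "\<dots> = N0 * Cd\<^sup>2 * (\<Sum>\<kappa>\<in>cells r. (t \<kappa>)\<^sup>2 * measure vol (tent_dom r \<kappa>))"
    proof -
      have "(\<integral>p. (\<Sum>\<kappa>\<in>cells r. (t \<kappa>)\<^sup>2 * indicator (tent_dom r \<kappa>) p) \<partial>vol) = (\<Sum>\<kappa>\<in>cells r. \<integral>p. (t \<kappa>)\<^sup>2 * indicator (tent_dom r \<kappa>) p \<partial>vol)"
        by (intro Bochner_Integration.integral_sum it)
      also have "\<dots> = (\<Sum>\<kappa>\<in>cells r. (t \<kappa>)\<^sup>2 * measure vol (tent_dom r \<kappa>))"
      proof (rule sum.cong[OF refl])
        fix \<kappa> assume "\<kappa> \<in> cells r"
        then have "tent_dom r \<kappa> \<in> sets vol" using tent_dom_borel[OF _ r'] by simp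
        then show "(\<integral>p. (t \<kappa>)\<^sup>2 * indicator (tent_dom r \<kappa>) p \<partial>vol) = (t \<kappa>)\<^sup>2 * measure vol (tent_dom r \<kappa>)" by simp
      qed
      finally show ?thesis by simp
    qed
    also have "\<dots> \<le> N0 * Cd\<^sup>2 * (\<Sum>\<kappa>\<in>cells r. (t \<kappa>)\<^sup>2 * (Cv * r ^ CARD('n)))"
      using N0 by (intro mult_left_mono sum_mono Cv(2) r r') auto
    also have "\<dots> = N0 * Cd\<^sup>2 * Cv * r ^ CARD('n) * cell_sum M r" unfolding cs sum_distrib_right[symmetric] by (simp add: mult_ac)
    finally have IH: "(\<integral>p. (H p)\<^sup>2 \<partial>vol) \<le> N0 * Cd\<^sup>2 * Cv * r ^ CARD('n) * cell_sum M r" .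
    define g where "g j = (\<integral>p. T p * e j p \<partial>vol)" for j
    have gH: "(\<integral>p. H p * e j p \<partial>vol) = (1 + r\<^sup>2 * (ev j)\<^sup>2) ^ m * g j" for j
    proof -
      have ih: "integrable vol (\<lambda>p. t \<kappa> * (h \<kappa> p * e j p))" if \<kappa>: "\<kappa> \<in> cells r" for \<kappa>
      proof (intro integrable_mult_right integrable_mult_e hm[OF \<kappa>])
        show "integrable vol (\<lambda>p. (h \<kappa> p)\<^sup>2)"
        proof (rule V.integrable_const_bound[of _ "Cd\<^sup>2"])
          show "AE p in vol. norm ((h \<kappa> p)\<^sup>2) \<le> Cd\<^sup>2"
          proof (rule AE_I2)
            fix p
            have "\<bar>h \<kappa> p\<bar> \<le> Cd" using hb[OF \<kappa>, of p] Cd(1) by (auto split: split_indicator_asm)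
            then show "norm ((h \<kappa> p)\<^sup>2) \<le> Cd\<^sup>2" by (simp add: abs_le_square_iff[symmetric])
          qed
          show "(\<lambda>p. (h \<kappa> p)\<^sup>2) \<in> borel_measurable vol"
            using hm[OF \<kappa>] by (simp add: measurable_cong_sets[OF sets_vol refl])
        qed
      qed
      have itt: "integrable vol (\<lambda>p. t \<kappa> * (tent m r \<kappa> p * e j p))" if \<kappa>: "\<kappa> \<in> cells r" for \<kappa>
        by (intro integrable_continuous_finite_measure finite_measure_vol sets_vol continuous_intros continuous_e continuous_tent \<kappa> r r')
      have "(\<integral>p. H p * e j p \<partial>vol) = (\<integral>p. (\<Sum>\<kappa>\<in>cells r. t \<kappa> * (h \<kappa> p * e j p)) \<partial>vol)"
        by (simp add: H_def sum_distrib_right mult.assoc)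
      also have "\<dots> = (\<Sum>\<kappa>\<in>cells r. t \<kappa> * (\<integral>p. h \<kappa> p * e j p \<partial>vol))"
        using ih by (subst Bochner_Integration.integral_sum) auto
      also have "\<dots> = (1 + r\<^sup>2 * (ev j)\<^sup>2) ^ m * (\<Sum>\<kappa>\<in>cells r. t \<kappa> * (\<integral>p. tent m r \<kappa> p * e j p \<partial>vol))"
        unfolding sum_distrib_left by (intro sum.cong refl) (simp only: he mult.left_commute)
      also have "(\<Sum>\<kappa>\<in>cells r. t \<kappa> * (\<integral>p. tent m r \<kappa> p * e j p \<partial>vol)) = (\<integral>p. (\<Sum>\<kappa>\<in>cells r. t \<kappa> * (tent m r \<kappa> p * e j p)) \<partial>vol)"
        using itt by (subst Bochner_Integration.integral_sum) auto
      also have "\<dots> = g j" by (simp add: g_def T_def sum_distrib_right mult.assoc)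
      finally show ?thesis .
    qed
    have B1: "(\<Sum>j<N. (g j)\<^sup>2 * v j) \<le> N0 * Cd\<^sup>2 * Cv * r ^ CARD('n) * cell_sum M r" for N
    proof -
      have "(\<Sum>j<N. (g j)\<^sup>2 * v j) = (\<Sum>j<N. (\<integral>p. H p * e j p \<partial>vol)\<^sup>2)"
        by (simp add: gH v_def power_mult_distrib power_mult[symmetric] mult.commute)
      also have "\<dots> \<le> (\<integral>p. (H p)\<^sup>2 \<partial>vol)" by (rule bessel[OF Hm iH])
      finally show ?thesis using IH by linarith
    qed
    obtain B2 where B2: "\<And>N p. (\<Sum>j<N. (e j p)\<^sup>2 / v j) \<le> B2"
    proof (rule pointwise_bound[OF k r(1) r'], goal_cases)
      case (1 B) show ?case by (rule 1(1)) (unfold v_def, fact 1(2))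
    qed
    have conv: "(\<lambda>N. \<Sum>j<N. g j * \<mu> j) \<longlonglongrightarrow> (\<integral>p. T p \<partial>M)"
      unfolding g_def \<mu>_def
      by (rule expansion_converges[OF T v _ B2 M]) (rule B1[unfolded g_def])
    have B0: "0 \<le> B" using B[of 0] by simp
    define X where "X = N0 * Cd\<^sup>2 * Cv * r ^ CARD('n) * cell_sum M r"
    have cs0: "cell_sum M r \<ge> 0" by (simp add: cs sum_nonneg)
    have X0: "X \<ge> 0" using N0 Cv(1) r cs0 by (simp add: X_def)
    have part: "(\<Sum>j<N. g j * \<mu> j) \<le> sqrt (X * B)" for N
    proof (rule real_le_rsqrt)
      have "(\<Sum>j<N. g j * \<mu> j)\<^sup>2 = (\<Sum>j<N. (g j * sqrt (v j)) * (\<mu> j / sqrt (v j)))\<^sup>2"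
        by (intro arg_cong2[where f=power] sum.cong refl) (simp add: less_imp_neq[OF v, symmetric])
      also have "\<dots> \<le> (\<Sum>j<N. (g j * sqrt (v j))\<^sup>2) * (\<Sum>j<N. (\<mu> j / sqrt (v j))\<^sup>2)"
        by (rule Cauchy_Schwarz_ineq_sum)
      also have "\<dots> = (\<Sum>j<N. (g j)\<^sup>2 * v j) * (\<Sum>j<N. (\<mu> j)\<^sup>2 / v j)"
        using v by (simp add: power_mult_distrib power_divide less_imp_le)
      also have "\<dots> \<le> X * B"
      proof (rule mult_mono)
        show "(\<Sum>j<N. (g j)\<^sup>2 * v j) \<le> X" unfolding X_def by (rule B1)
        show "(\<Sum>j<N. (\<mu> j)\<^sup>2 / v j) \<le> B" unfolding v_def \<mu>_def by (rule B)
        show "0 \<le> (\<Sum>j<N. (\<mu> j)\<^sup>2 / v j)" using v by (intro sum_nonneg) (simp add: less_imp_le)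
      qed (rule X0)
      finally show "(\<Sum>j<N. g j * \<mu> j)\<^sup>2 \<le> X * B" .
    qed
    have "(\<integral>p. T p \<partial>M) \<le> sqrt (X * B)" by (rule LIMSEQ_le_const2[OF conv]) (use part in blast)
    moreover have "a * cell_sum M r \<le> (\<integral>p. T p \<partial>M)"
    proof -
      have im: "integrable M (\<lambda>p. t \<kappa> * tent m r \<kappa> p)" if "\<kappa> \<in> cells r" for \<kappa>
        by (intro integrable_continuous_finite_measure M continuous_intros continuous_tent that r r')
      have "(\<integral>p. T p \<partial>M) = (\<Sum>\<kappa>\<in>cells r. t \<kappa> * (\<integral>p. tent m r \<kappa> p \<partial>M))"
        unfolding T_def using im by (subst Bochner_Integration.integral_sum) auto
      moreover have "(\<Sum>\<kappa>\<in>cells r. t \<kappa> * (a * t \<kappa>)) \<le> (\<Sum>\<kappa>\<in>cells r. t \<kappa> * (\<integral>p. tent m r \<kappa> p \<partial>M))"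
      proof (intro sum_mono mult_left_mono t0)
        fix \<kappa> assume \<kappa>: "\<kappa> \<in> cells r"
        have cb: "cell r \<kappa> \<in> sets M" using r r' \<kappa> M(2) cell_open borel_open by metis
        have "a * t \<kappa> = (\<integral>p. a * indicator (cell r \<kappa>) p \<partial>M)" using cb by (simp add: t_def)
        also have "\<dots> \<le> (\<integral>p. tent m r \<kappa> p \<partial>M)"
        proof (rule integral_mono)
          show "integrable M (\<lambda>p. a * indicator (cell r \<kappa>) p)" using cb M.emeasure_finite[of "cell r \<kappa>"]
            by (intro integrable_mult_right integrable_real_indicator) (auto simp: less_top[symmetric])
          show "integrable M (tent m r \<kappa>)" by (intro integrable_continuous_finite_measure M continuous_tent \<kappa> r r')
          show "a * indicator (cell r \<kappa>) p \<le> tent m r \<kappa> p" for p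
            using tent_ge[OF \<kappa> r' r(1), of p m] tent_nonneg[of m r \<kappa> p] by (auto simp: a_def split: split_indicator)
        qed
        finally show "a * t \<kappa> \<le> (\<integral>p. tent m r \<kappa> p \<partial>M)" .
      qed
      moreover have "(\<Sum>\<kappa>\<in>cells r. t \<kappa> * (a * t \<kappa>)) = a * cell_sum M r"
        by (simp add: cs sum_distrib_left power2_eq_square mult_ac)
      ultimately show ?thesis by simp
    qed
    ultimately have "a * cell_sum M r \<le> sqrt (X * B)" by linarith
    then have "(a * cell_sum M r)\<^sup>2 \<le> X * B"
      using a cs0 X0 B0 by (metis abs_of_nonneg mult_nonneg_nonneg less_imp_le real_sqrt_abs real_sqrt_le_iff)
    then have sq: "a\<^sup>2 * cell_sum M r * cell_sum M r \<le> (N0 * Cd\<^sup>2 * Cv * r ^ CARD('n) * B) * cell_sum M r"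
      by (simp add: X_def power2_eq_square mult_ac)
    show "cell_sum M r \<le> D * r ^ CARD('n) * B"
    proof (cases "cell_sum M r = 0")
      case True
      then show ?thesis using N0 Cv(1) r B0 by (simp add: D_def)
    next
      case False
      then have "a\<^sup>2 * cell_sum M r \<le> N0 * Cd\<^sup>2 * Cv * r ^ CARD('n) * B" using sq cs0 by (simp add: mult_le_cancel_right)
      then show ?thesis using a by (simp add: D_def field_simps)
    qed
  qed
qed

end

section \<open>Two-sided bounds\<close>

context eigenbasis_manifold
begin

definition coeff_sum :: "'m measure \<Rightarrow> real \<Rightarrow> real" where
  "coeff_sum M L = (\<Sum>j | ev j \<le> L. (\<integral>p. e j p \<partial>M)\<^sup>2)"

lemma measure_vol_pos: "measure vol UNIV > 0"
proof -
  interpret V: finite_measure vol by (rule finite_measure_vol)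
  have "measure vol UNIV \<noteq> 0"
  proof
    assume "measure vol UNIV = 0"
    then have "emeasure vol (space vol) = 0" by (simp add: V.emeasure_eq_measure)
    then have "AE p in vol. False" by (subst AE_iff_measurable[OF sets.top]) auto
    then have "AE p in vol. (1::real) = 0" by simp
    then show False using continuous_AE_eq_0[of "\<lambda>_. 1"] by auto
  qed
  then show ?thesis by (simp add: zero_less_measure_iff)
qed

lemma integral_sum_e_square: "finite J \<Longrightarrow> (\<integral>p. (\<Sum>j\<in>J. (e j p)\<^sup>2) \<partial>vol) = real (card J)"
  using e_orthonormal
  by (subst Bochner_Integration.integral_sum)
    (auto simp: power2_eq_square intro!: integrable_continuous_finite_measure finite_measure_vol continuous_intros continuous_e)

text \<open>The upper bound for Dirac measures bounds the sum of the e_j(p)^2 over a finite set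
  \<open>J\<close> of such indices independently of \<open>J\<close> and p. Integrating over p
  bounds the number of elements of \<open>J\<close> by orthonormality. Without finiteness the sums
  and cardinalities over this set would take the default value 0.\<close>

lemma finite_ev: "finite {j. ev j \<le> L}"
proof -
  obtain C where C: "C > 0"
    "\<And>M r J. finite_measure M \<Longrightarrow> sets M = sets borel \<Longrightarrow> 0 < r \<Longrightarrow> r \<le> rad \<Longrightarrow> finite J \<Longrightarrow>
      (\<And>j. j \<in> J \<Longrightarrow> ev j * r \<le> 1) \<Longrightarrow> (\<Sum>j\<in>J. (\<integral>p. e j p \<partial>M)\<^sup>2) \<le> C / r ^ CARD('n) * cell_sum M r"
  proof (rule spectral_upper_bound, goal_cases)
    case (1 C) show ?case by (rule 1(1), fact 1(2), fact 1(3))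
  qed
  define r where "r = min rad (1 / max 1 L)"
  have r: "0 < r" "r \<le> rad" using rad(1) by (auto simp: r_def)
  define A where "A = C / r ^ CARD('n) * real (card P * overlap TYPE('n))"
  have card: "real (card J) \<le> A * measure vol UNIV" if J: "finite J" "J \<subseteq> {j. ev j \<le> L}" for J
  proof -
    have ev1: "ev j * r \<le> 1" if "j \<in> J" for j
    proof -
      have "ev j * r \<le> max 1 L * (1 / max 1 L)"
        using J(2) that ev_nonneg r by (intro mult_mono) (auto simp: r_def)
      then show ?thesis by (simp split: if_splits)
    qed
    have "(\<Sum>j\<in>J. (e j p)\<^sup>2) \<le> A" for p
    proof -
      define M where "M = return borel p"
      have M: "finite_measure M" "sets M = sets borel" and ej: "\<And>j. (\<integral>q. e j q \<partial>M) = e j p"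
        unfolding M_def by (rule return_point)+
      have "(\<Sum>j\<in>J. (\<integral>q. e j q \<partial>M)\<^sup>2) \<le> C / r ^ CARD('n) * cell_sum M r"
        by (rule C(2)[OF M r J(1) ev1])
      also have "\<dots> \<le> A" unfolding A_def M_def using C(1) r by (intro mult_left_mono cell_sum_return) auto
      finally show ?thesis by (simp only: ej)
    qed
    then have "(\<integral>p. (\<Sum>j\<in>J. (e j p)\<^sup>2) \<partial>vol) \<le> (\<integral>p. A \<partial>vol)"
      by (intro integral_mono integrable_continuous_finite_measure finite_measure_vol continuous_intros continuous_e) auto
    then show ?thesis using integral_sum_e_square[OF J(1)] by (simp add: mult.commute)
  qed
  show ?thesis
  proof (rule ccontr)
    assume "infinite {j. ev j \<le> L}"
    obtain n where n: "A * measure vol UNIV < real n" using reals_Archimedean2 by blast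
    obtain J where "finite J" "card J = n" "J \<subseteq> {j. ev j \<le> L}"
      using infinite_arbitrarily_large[OF \<open>infinite {j. ev j \<le> L}\<close>] by blast
    then show False using card[of J] n by simp
  qed
qed

lemma spectral_two_sided:
  assumes s: "0 \<le> s" "s \<le> real CARD('n)" and pos: "0 < c1" "0 < C1" "0 < \<rho>0"
  obtains c C L0 where "c > 0" "C > 0" "L0 \<ge> 1"
    "\<And>M L. finite_measure M \<Longrightarrow> sets M = sets borel \<Longrightarrow>
      (\<And>r. 0 < r \<Longrightarrow> r \<le> \<rho>0 \<Longrightarrow> c1 * r powr s \<le> cell_sum M r \<and> cell_sum M r \<le> C1 * r powr s) \<Longrightarrow> L0 \<le> L \<Longrightarrow>
      c * L powr (real CARD('n) - s) \<le> coeff_sum M L \<and> coeff_sum M L \<le> C * L powr (real CARD('n) - s)"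
proof -
  define n where "n = CARD('n)"
  \<comment> \<open>The order m of the test functions is taken to be n, so that the weights decay
    with the exponent 4 n, beyond the exponent n that the dyadic sums require.\<close>
  have n: "n < 4 * n" "n \<ge> 1" using zero_less_card_finite[where 'a='n] by (auto simp: n_def)
  obtain Cu where Cu: "Cu > 0"
    "\<And>M r J. finite_measure M \<Longrightarrow> sets M = sets borel \<Longrightarrow> 0 < r \<Longrightarrow> r \<le> rad \<Longrightarrow> finite J \<Longrightarrow>
      (\<And>j. j \<in> J \<Longrightarrow> ev j * r \<le> 1) \<Longrightarrow> (\<Sum>j\<in>J. (\<integral>p. e j p \<partial>M)\<^sup>2) \<le> Cu / r ^ n * cell_sum M r"
  proof (rule spectral_upper_bound, goal_cases)
    case (1 C) show ?case by (rule 1(1), fact 1(2), unfold n_def, fact 1(3))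
  qed
  obtain D where D: "D > 0"
    "\<And>M r J A. finite_measure M \<Longrightarrow> sets M = sets borel \<Longrightarrow> 0 < r \<Longrightarrow> r \<le> rad \<Longrightarrow> finite J \<Longrightarrow>
      (\<And>\<rho>. 0 < \<rho> \<Longrightarrow> \<rho> \<le> r \<Longrightarrow> cell_sum M \<rho> \<le> A) \<Longrightarrow>
      (\<Sum>j | j \<in> J \<and> 1 < ev j * r. (\<integral>p. e j p \<partial>M)\<^sup>2 / (ev j * r) ^ (4 * n)) \<le> D * A / r ^ n"
  proof (rule spectral_tail_bound[of "4 * n"], goal_cases)
    case 1 show ?case using n(1) by (simp add: n_def)
  next
    case (2 C) show ?case by (rule 2(1), fact 2(2), unfold n_def, rule 2(3)[unfolded n_def])
  qed
  obtain E where E: "E > 0"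
    "\<And>M r B. finite_measure M \<Longrightarrow> sets M = sets borel \<Longrightarrow> 0 < r \<Longrightarrow> r \<le> rad / 4 \<Longrightarrow>
      (\<And>N. (\<Sum>j<N. (\<integral>p. e j p \<partial>M)\<^sup>2 / (1 + r\<^sup>2 * (ev j)\<^sup>2) ^ (2 * n)) \<le> B) \<Longrightarrow>
      cell_sum M r \<le> E * r ^ n * B"
  proof (rule spectral_lower_bound[of n], goal_cases)
    case 1 show ?case using n(1) by (simp add: n_def)
  next
    case (2 C) show ?case by (rule 2(1), fact 2(2), unfold n_def, rule 2(3)[unfolded n_def])
  qed
  \<comment> \<open>Chosen so that the high frequencies take at most half of the main term: they
    contribute 2 D C1 E K^(-4n) at twice their size, the main term is c1 K^(s-n), and K K^(-4n)
    \<le> K^(s-n) because 1 - 4n \<le> s - n.\<close>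
  define K where "K = max 1 (2 * D * C1 * E / c1)"
  have K: "K \<ge> 1" "2 * D * C1 * E \<le> c1 * K" using pos by (auto simp: K_def field_simps max_def)
  define c where "c = c1 * K powr (s - real n) / (2 * E)"
  define L0 where "L0 = Max {1, 4 * K / rad, K / \<rho>0}"
  have L0: "1 \<le> L0" "4 * K / rad \<le> L0" "K / \<rho>0 \<le> L0" by (auto simp: L0_def)
  show thesis
  proof (rule that[of c "Cu * C1" L0])
    show "c > 0" using pos K E(1) by (simp add: c_def)
    show "Cu * C1 > 0" using Cu pos by simp
    show "L0 \<ge> 1" by (rule L0)
    fix M :: "'m measure" and L :: real
    assume M: "finite_measure M" "sets M = sets borel"
      and cs: "\<And>r. 0 < r \<Longrightarrow> r \<le> \<rho>0 \<Longrightarrow> c1 * r powr s \<le> cell_sum M r \<and> cell_sum M r \<le> C1 * r powr s"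
      and L: "L0 \<le> L"
    have Lpos: "L > 0" using L L0 by linarith
    \<comment> \<open>The frequencies are split at L = 1/\<rho>, while the cells have the larger
      size r. Above L the weight (\<lambda>_j r)^(-4n) equals K^(-4n) (\<lambda>_j \<rho>)^(-4n),
      which is the source of the gain in K.\<close>
    define \<rho> r where "\<rho> = 1 / L" and "r = K / L"
    have \<rho>r: "0 < \<rho>" "\<rho> \<le> r" "0 < r" using Lpos K by (auto simp: \<rho>_def r_def divide_right_mono)
    have "4 * K / rad \<le> L" "K / \<rho>0 \<le> L" using L L0 by linarith+
    then have r4: "r \<le> rad / 4" "r \<le> \<rho>0" using Lpos rad(1) pos by (auto simp: r_def field_simps)
    have \<rho>1: "\<rho> \<le> rad" "\<rho> \<le> \<rho>0" using r4 \<rho>r rad(1) by linarith+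
    define X where "X = L powr (real n - s)"
    have X0: "X > 0" using Lpos by (simp add: X_def)
    have \<rho>X: "\<rho> powr s / \<rho> ^ n = X"
      using Lpos by (simp add: \<rho>_def X_def powr_divide powr_diff powr_realpow power_divide)
    have rX: "r powr s = K powr (s - real n) * X * r ^ n"
    proof -
      have "r powr s = K powr s * \<rho> powr s" using Lpos K by (simp add: r_def \<rho>_def powr_divide)
      also have "\<dots> = K powr s * X * \<rho> ^ n" using \<rho>X \<rho>r by (simp add: field_simps)
      also have "\<rho> ^ n = r ^ n / K ^ n" using K by (simp add: r_def \<rho>_def power_divide)
      also have "K powr s * X * (r ^ n / K ^ n) = K powr (s - real n) * X * r ^ n"
        using K by (simp add: powr_diff powr_realpow)
      finally show ?thesis .
    qed
    have lev: "ev j \<le> L \<longleftrightarrow> ev j * \<rho> \<le> 1" for j using Lpos by (simp add: \<rho>_def field_simps)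
    have up: "coeff_sum M L \<le> Cu * C1 * X"
    proof -
      have "coeff_sum M L \<le> Cu / \<rho> ^ n * cell_sum M \<rho>"
        unfolding coeff_sum_def by (rule Cu(2)[OF M \<rho>r(1) \<rho>1(1) finite_ev]) (simp add: lev)
      also have "\<dots> \<le> Cu / \<rho> ^ n * (C1 * \<rho> powr s)"
        using cs[OF \<rho>r(1) \<rho>1(2)] Cu(1) \<rho>r by (intro mult_left_mono) auto
      also have "\<dots> = Cu * C1 * (\<rho> powr s / \<rho> ^ n)" by simp
      finally show ?thesis by (simp only: \<rho>X)
    qed
    define b where "b j = (\<integral>p. e j p \<partial>M)\<^sup>2" for j
    have b0: "b j \<ge> 0" for j by (simp add: b_def)
    have "cell_sum M r \<le> E * r ^ n * (coeff_sum M L + D * C1 * X / K ^ (4 * n))"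
    proof (rule E(2)[OF M \<rho>r(3) r4(1)])
      fix N
      have "(\<Sum>j<N. b j / (1 + r\<^sup>2 * (ev j)\<^sup>2) ^ (2 * n)) \<le>
        (\<Sum>j | j \<in> {..<N} \<and> ev j * \<rho> \<le> 1. b j) + (\<Sum>j | j \<in> {..<N} \<and> 1 < ev j * \<rho>. b j / (ev j * r) ^ (4 * n))"
        by (rule weighted_sum_split[OF finite_lessThan b0 \<rho>r(1,3)])
      also have "\<dots> \<le> coeff_sum M L + D * C1 * X / K ^ (4 * n)"
      proof (rule add_mono)
        show "(\<Sum>j | j \<in> {..<N} \<and> ev j * \<rho> \<le> 1. b j) \<le> coeff_sum M L"
          unfolding coeff_sum_def b_def by (rule sum_mono2[OF finite_ev]) (auto simp: lev)
        have "(\<Sum>j | j \<in> {..<N} \<and> 1 < ev j * \<rho>. b j / (ev j * r) ^ (4 * n)) =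
            (\<Sum>j | j \<in> {..<N} \<and> 1 < ev j * \<rho>. b j / (ev j * \<rho>) ^ (4 * n)) / K ^ (4 * n)"
          using K Lpos by (simp add: sum_divide_distrib r_def \<rho>_def power_mult_distrib power_divide)
        also have "\<dots> \<le> (D * (C1 * \<rho> powr s) / \<rho> ^ n) / K ^ (4 * n)"
        proof (rule divide_right_mono)
          show "(\<Sum>j | j \<in> {..<N} \<and> 1 < ev j * \<rho>. b j / (ev j * \<rho>) ^ (4 * n)) \<le> D * (C1 * \<rho> powr s) / \<rho> ^ n"
            unfolding b_def
          proof (rule D(2)[OF M \<rho>r(1) \<rho>1(1) finite_lessThan])
            fix \<sigma> assume \<sigma>: "0 < \<sigma>" "\<sigma> \<le> \<rho>"
            have "cell_sum M \<sigma> \<le> C1 * \<sigma> powr s" using cs[of \<sigma>] \<sigma> \<rho>1 by auto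
            also have "\<dots> \<le> C1 * \<rho> powr s" using pos s \<sigma> by (intro mult_left_mono powr_mono2) auto
            finally show "cell_sum M \<sigma> \<le> C1 * \<rho> powr s" .
          qed
        qed (use K in simp)
        also have "(D * (C1 * \<rho> powr s) / \<rho> ^ n) / K ^ (4 * n) = D * C1 * (\<rho> powr s / \<rho> ^ n) / K ^ (4 * n)" by simp
        also have "\<dots> = D * C1 * X / K ^ (4 * n)" by (simp only: \<rho>X)
        finally show "(\<Sum>j | j \<in> {..<N} \<and> 1 < ev j * \<rho>. b j / (ev j * r) ^ (4 * n)) \<le> D * C1 * X / K ^ (4 * n)" .
      qed
      finally show "(\<Sum>j<N. (\<integral>p. e j p \<partial>M)\<^sup>2 / (1 + r\<^sup>2 * (ev j)\<^sup>2) ^ (2 * n)) \<le> coeff_sum M L + D * C1 * X / K ^ (4 * n)"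
        by (simp only: b_def)
    qed
    moreover have "c1 * (K powr (s - real n) * X * r ^ n) \<le> cell_sum M r" using cs[OF \<rho>r(3) r4(2)] by (simp add: rX)
    ultimately have "r ^ n * (c1 * K powr (s - real n) * X) \<le> r ^ n * (E * (coeff_sum M L + D * C1 * X / K ^ (4 * n)))"
      by (simp add: mult_ac)
    then have 1: "c1 * K powr (s - real n) * X \<le> E * (coeff_sum M L + D * C1 * X / K ^ (4 * n))"
      using \<rho>r by (simp add: mult_le_cancel_left_pos)
    have "E * (D * C1 * X / K ^ (4 * n)) \<le> c1 * K powr (s - real n) * X / 2"
    proof -
      have "K powr (1 - 4 * real n) \<le> K powr (s - real n)" using K n s by (intro powr_mono) auto
      moreover have "K powr (1 - 4 * real n) = K / K ^ (4 * n)"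
        using K by (simp add: powr_diff powr_realpow[symmetric])
      ultimately have "c1 * (K / K ^ (4 * n)) \<le> c1 * K powr (s - real n)" using pos by (intro mult_left_mono) auto
      moreover have "2 * D * C1 * E / K ^ (4 * n) \<le> c1 * K / K ^ (4 * n)" using K by (intro divide_right_mono) auto
      ultimately have "2 * D * C1 * E / K ^ (4 * n) \<le> c1 * K powr (s - real n)" by simp
      then have "2 * D * C1 * E / K ^ (4 * n) * X \<le> c1 * K powr (s - real n) * X" using X0 by (intro mult_right_mono) auto
      then show ?thesis by (simp add: mult_ac)
    qed
    with 1 have "c1 * K powr (s - real n) * X / 2 \<le> E * coeff_sum M L" unfolding distrib_left by linarith
    then have lo: "c * X \<le> coeff_sum M L" using E(1) by (simp add: c_def field_simps)
    show "c * L powr (real CARD('n) - s) \<le> coeff_sum M L \<and> coeff_sum M L \<le> Cu * C1 * L powr (real CARD('n) - s)"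
      using up lo by (simp add: X_def n_def)
  qed
qed

lemma weyl_bounds:
  obtains c C L0 where "c > 0" "C > 0" "L0 \<ge> 1"
    "\<And>L. L0 \<le> L \<Longrightarrow> c * L powr real CARD('n) \<le> real (card {j. ev j \<le> L}) \<and>
      real (card {j. ev j \<le> L}) \<le> C * L powr real CARD('n)"
proof -
  define A where "A = real (card P * overlap TYPE('n))"
  have A: "A \<ge> 1" using cell_sum_return[of rad undefined] rad by (auto simp: A_def)
  obtain c C L0 where c: "c > 0" "C > 0" "L0 \<ge> 1"
    and b: "\<And>M L. finite_measure M \<Longrightarrow> sets M = sets borel \<Longrightarrow>
      (\<And>r. 0 < r \<Longrightarrow> r \<le> rad \<Longrightarrow> 1 * r powr 0 \<le> cell_sum M r \<and> cell_sum M r \<le> A * r powr 0) \<Longrightarrow> L0 \<le> L \<Longrightarrow>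
      c * L powr (real CARD('n) - 0) \<le> coeff_sum M L \<and> coeff_sum M L \<le> C * L powr (real CARD('n) - 0)"
  proof (rule spectral_two_sided[of 0 1 A rad], goal_cases)
    case (6 c C L0) show ?case by (rule 6(1), fact 6(2), fact 6(3), fact 6(4), rule 6(5))
  qed (use A rad in auto)
  interpret V: finite_measure vol by (rule finite_measure_vol)
  define V where "V = measure vol UNIV"
  have V: "V > 0" by (simp add: V_def measure_vol_pos)
  show thesis
  proof (rule that[of "c * V" "C * V" L0])
    fix L assume L: "L0 \<le> L"
    have pt: "c * L powr real CARD('n) \<le> (\<Sum>j | ev j \<le> L. (e j p)\<^sup>2) \<and> (\<Sum>j | ev j \<le> L. (e j p)\<^sup>2) \<le> C * L powr real CARD('n)" for p
    proof -
      define M where "M = return borel p"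
      have M: "finite_measure M" "sets M = sets borel" and ej: "\<And>j. (\<integral>q. e j q \<partial>M) = e j p"
        unfolding M_def by (rule return_point)+
      have "c * L powr (real CARD('n) - 0) \<le> coeff_sum M L \<and> coeff_sum M L \<le> C * L powr (real CARD('n) - 0)"
      proof (rule b[OF M _ L])
        fix r :: real assume "0 < r" "r \<le> rad"
        then show "1 * r powr 0 \<le> cell_sum M r \<and> cell_sum M r \<le> A * r powr 0"
          using cell_sum_return[of r p] by (simp add: M_def A_def)
      qed
      then show ?thesis by (simp add: coeff_sum_def ej)
    qed
    have i: "integrable vol (\<lambda>p. \<Sum>j | ev j \<le> L. (e j p)\<^sup>2)"
      by (intro integrable_continuous_finite_measure finite_measure_vol continuous_intros continuous_e) simp
    have "(\<integral>p. c * L powr real CARD('n) \<partial>vol) \<le> (\<integral>p. (\<Sum>j | ev j \<le> L. (e j p)\<^sup>2) \<partial>vol)"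
      using pt by (intro integral_mono i) auto
    moreover have "(\<integral>p. (\<Sum>j | ev j \<le> L. (e j p)\<^sup>2) \<partial>vol) \<le> (\<integral>p. C * L powr real CARD('n) \<partial>vol)"
      using pt by (intro integral_mono i) auto
    ultimately show "c * V * L powr real CARD('n) \<le> real (card {j. ev j \<le> L}) \<and>
      real (card {j. ev j \<le> L}) \<le> C * V * L powr real CARD('n)"
      using integral_sum_e_square[OF finite_ev[of L]] by (simp add: V_def mult_ac)
  qed (use c V in auto)
qed

theorem spectral_average_bounds:
  assumes M: "finite_measure M" "sets M = sets borel" and s: "0 \<le> s" "s \<le> real CARD('n)"
    and pos: "0 < c1" "0 < C1" "0 < \<rho>0"
    and cs: "\<And>r. 0 < r \<Longrightarrow> r \<le> \<rho>0 \<Longrightarrow> c1 * r powr s \<le> cell_sum M r \<and> cell_sum M r \<le> C1 * r powr s"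
  shows "\<exists>c>0. \<exists>C>0. \<exists>L0\<ge>1. \<forall>L\<ge>L0.
    c * L powr (- s) \<le> 1 / real (card {j. ev j \<le> L}) * coeff_sum M L \<and>
    1 / real (card {j. ev j \<le> L}) * coeff_sum M L \<le> C * L powr (- s)"
proof -
  let ?n = "real CARD('n)"
  obtain c C L0 where c: "c > 0" "C > 0" "L0 \<ge> 1"
    and b: "\<And>M L. finite_measure M \<Longrightarrow> sets M = sets borel \<Longrightarrow>
      (\<And>r. 0 < r \<Longrightarrow> r \<le> \<rho>0 \<Longrightarrow> c1 * r powr s \<le> cell_sum M r \<and> cell_sum M r \<le> C1 * r powr s) \<Longrightarrow> L0 \<le> L \<Longrightarrow>
      c * L powr (?n - s) \<le> coeff_sum M L \<and> coeff_sum M L \<le> C * L powr (?n - s)"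
  proof (rule spectral_two_sided[OF s pos], goal_cases)
    case (1 c C L0) show ?case by (rule 1(1), fact 1(2), fact 1(3), fact 1(4), rule 1(5))
  qed
  obtain c' C' L0' where c': "c' > 0" "C' > 0" "L0' \<ge> 1"
    and b': "\<And>L. L0' \<le> L \<Longrightarrow> c' * L powr ?n \<le> real (card {j. ev j \<le> L}) \<and> real (card {j. ev j \<le> L}) \<le> C' * L powr ?n"
  proof (rule weyl_bounds, goal_cases)
    case (1 c C L0) show ?case by (rule 1(1), fact 1(2), fact 1(3), fact 1(4), rule 1(5))
  qed
  have "\<forall>L\<ge>max L0 L0'. c / C' * L powr (- s) \<le> 1 / real (card {j. ev j \<le> L}) * coeff_sum M L \<and>
    1 / real (card {j. ev j \<le> L}) * coeff_sum M L \<le> C / c' * L powr (- s)"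
  proof (intro conjI allI impI)
    fix L assume L: "max L0 L0' \<le> L"
    then have Lpos: "L > 0" using c by simp
    define N where "N = real (card {j. ev j \<le> L})"
    define S where "S = coeff_sum M L"
    have S: "c * L powr (?n - s) \<le> S" "S \<le> C * L powr (?n - s)" using b[OF M cs] L by (auto simp: S_def)
    have N: "c' * L powr ?n \<le> N" "N \<le> C' * L powr ?n" using b'[of L] L by (auto simp: N_def)
    have Ln: "L powr ?n > 0" using Lpos by simp
    then have N0: "N > 0" using N(1) c'(1) by (meson less_le_trans mult_pos_pos)
    have eq: "L powr (?n - s) = L powr (- s) * L powr ?n" using Lpos by (simp add: powr_add[symmetric])
    have "c / C' * L powr (- s) * N \<le> c / C' * L powr (- s) * (C' * L powr ?n)"
      using N(2) c c' by (intro mult_left_mono) auto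
    also have "\<dots> = c * L powr (?n - s)" using c' by (simp add: eq)
    also note S(1)
    finally show "c / C' * L powr (- s) \<le> 1 / real (card {j. ev j \<le> L}) * coeff_sum M L"
      using N0 unfolding N_def S_def by (simp add: field_simps)
    have "S \<le> C / c' * L powr (- s) * (c' * L powr ?n)" using S(2) c' by (simp add: eq mult_ac)
    also have "\<dots> \<le> C / c' * L powr (- s) * N" using N(1) c c' by (intro mult_left_mono) auto
    finally show "1 / real (card {j. ev j \<le> L}) * coeff_sum M L \<le> C / c' * L powr (- s)"
      using N0 unfolding N_def S_def by (simp add: field_simps)
  qed
  moreover have "c / C' > 0" "C / c' > 0" "max L0 L0' \<ge> 1" using c c' by auto
  ultimately show ?thesis by blast
qed

end

section \<open>Riemannian distance in charts\<close>

context riemannian_manifold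
begin

text \<open>The speed in a given chart and with derivatives relative to \<open>I\<close>.
  \<open>curve_speed\<close> uses two-sided derivatives in a chart that changes from point to point;
  this version separates both choices, and is continuous up to the end points of a C1 piece.\<close>

definition speed_within :: "(real \<Rightarrow> 'm) \<Rightarrow> real set \<Rightarrow> ('m, 'n) chart \<Rightarrow> real \<Rightarrow> real" where
  "speed_within \<gamma> I c t =
    (let v = vector_derivative (chart_map c \<circ> \<gamma>) (at t within I) in sqrt (v \<bullet> (G c (\<gamma> t) *v v)))"

lemma curve_speed_eq: "curve_speed \<A> G \<gamma> t = speed_within \<gamma> UNIV (chart_at \<A> (\<gamma> t)) t"
  by (simp add: curve_speed_def speed_within_def Let_def)

lemma metric_inner_nonneg: "c \<in> \<A> \<Longrightarrow> p \<in> chart_dom c \<Longrightarrow> 0 \<le> v \<bullet> (G c p *v v)"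
  using metric_pos[of c p v] by (cases "v = 0") (auto simp: less_imp_le)

lemma curve_speed_nonneg: "0 \<le> curve_speed \<A> G \<gamma> t"
  using metric_inner_nonneg[OF chart_at] by (simp add: curve_speed_def Let_def)

lemma metric_inner_transition:
  assumes "c \<in> \<A>" "d \<in> \<A>" "p \<in> chart_dom c \<inter> chart_dom d"
  shows "frechet_derivative (transition c d) (at (chart_map c p)) v \<bullet>
      (G d p *v frechet_derivative (transition c d) (at (chart_map c p)) v) = v \<bullet> (G c p *v v)"
proof -
  define T' where "T' = frechet_derivative (transition c d) (at (chart_map c p))"
  have lin: "linear T'"
    unfolding T'_def by (rule has_derivative_linear[OF transition_has_derivative[OF assms]])
  have T': "T' v = matrix T' *v v" using matrix_vector_mul(2)[OF lin] by metis
  have "G c p = transpose (matrix T') ** G d p ** matrix T'"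
    using metric_transform[OF assms refl] by (simp add: T'_def)
  then have "v \<bullet> (G c p *v v) = v \<bullet> (transpose (matrix T') *v (G d p *v (matrix T' *v v)))"
    by (simp only: matrix_vector_mul_assoc matrix_mul_assoc)
  also have "\<dots> = (matrix T' *v v) \<bullet> (G d p *v (matrix T' *v v))"
    by (metis dot_lmul_matrix vector_transpose_matrix transpose_matrix_vector inner_commute)
  finally show ?thesis unfolding T'_def[symmetric] T' by simp
qed

lemma has_vector_derivative_transition:
  assumes c: "c \<in> \<A>" "d \<in> \<A>" and t: "t \<in> I" "\<gamma> t \<in> chart_dom c \<inter> chart_dom d"
    and cont: "continuous (at t within I) \<gamma>"
    and v: "((chart_map c \<circ> \<gamma>) has_vector_derivative v) (at t within I)"
  shows "((chart_map d \<circ> \<gamma>) has_vector_derivative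
    frechet_derivative (transition c d) (at (chart_map c (\<gamma> t))) v) (at t within I)"
proof -
  have 1: "((transition c d \<circ> (chart_map c \<circ> \<gamma>)) has_vector_derivative
    frechet_derivative (transition c d) (at (chart_map c (\<gamma> t))) v) (at t within I)"
    by (rule vector_derivative_diff_chain_within[OF v])
      (use has_derivative_at_withinI[OF transition_has_derivative[OF c t(2)]] in simp)
  have "\<forall>\<^sub>F u in at t within I. \<gamma> u \<in> chart_dom c"
    using cont open_dom[OF c(1)] t(2) unfolding continuous_within by (intro topological_tendstoD) auto
  then obtain \<epsilon> where \<epsilon>: "\<epsilon> > 0" "\<And>u. u \<in> I \<Longrightarrow> u \<noteq> t \<Longrightarrow> dist u t < \<epsilon> \<Longrightarrow> \<gamma> u \<in> chart_dom c"
    unfolding eventually_at by blast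
  show ?thesis
  proof (rule has_vector_derivative_transform_within[OF 1 \<epsilon>(1) t(1)])
    fix u assume "u \<in> I" "dist u t < \<epsilon>"
    then have "\<gamma> u \<in> chart_dom c" using \<epsilon>(2) t(2) by blast
    then show "(transition c d \<circ> (chart_map c \<circ> \<gamma>)) u = (chart_map d \<circ> \<gamma>) u"
      using transition_apply[OF c(1)] by simp
  qed
qed

lemma speed_within_chart_independent:
  assumes c: "c \<in> \<A>" "d \<in> \<A>" and t: "t \<in> I" "\<gamma> t \<in> chart_dom c \<inter> chart_dom d" and I: "at t within I \<noteq> bot"
    and cont: "continuous (at t within I) \<gamma>" and diff: "(chart_map c \<circ> \<gamma>) differentiable (at t within I)"
  shows "speed_within \<gamma> I d t = speed_within \<gamma> I c t"
proof -
  let ?v = "vector_derivative (chart_map c \<circ> \<gamma>) (at t within I)"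
  have v: "((chart_map c \<circ> \<gamma>) has_vector_derivative ?v) (at t within I)"
    using diff by (simp add: vector_derivative_works[symmetric])
  show ?thesis
    unfolding speed_within_def Let_def vector_derivative_within[OF I has_vector_derivative_transition[OF c t cont v]]
    by (simp only: metric_inner_transition[OF c t(2)])
qed

lemma Icc_nontrivial: "a < b \<Longrightarrow> t \<in> {a..b} \<Longrightarrow> at t within {a..b::real} \<noteq> bot"
  using islimpt_Icc trivial_limit_within by blast

lemma C1_curve_onD:
  assumes "C1_curve_on \<A> a b \<gamma>" "c \<in> \<A>"
  shows "continuous_on {a..b} \<gamma>"
    and "\<And>t. t \<in> {a..b} \<Longrightarrow> \<gamma> t \<in> chart_dom c \<Longrightarrow> (chart_map c \<circ> \<gamma>) differentiable (at t within {a..b})"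
    and "continuous_on {t\<in>{a..b}. \<gamma> t \<in> chart_dom c} (\<lambda>t. vector_derivative (chart_map c \<circ> \<gamma>) (at t within {a..b}))"
  using assms unfolding C1_curve_on_def Let_def by blast+

text \<open>The chart \<open>chart_at\<close> may jump along the curve. Near a given time one fixed
  chart covers the curve, the speed is the same in both charts, and in the fixed chart it is visibly
  continuous.\<close>

lemma continuous_speed_within:
  assumes \<gamma>: "C1_curve_on \<A> a b \<gamma>" and ab: "a < b"
  shows "continuous_on {a..b} (\<lambda>t. speed_within \<gamma> {a..b} (chart_at \<A> (\<gamma> t)) t)"
  unfolding continuous_on_eq_continuous_within
proof
  fix t0 assume t0: "t0 \<in> {a..b}"
  define c where "c = chart_at \<A> (\<gamma> t0)"
  have c: "c \<in> \<A>" "\<gamma> t0 \<in> chart_dom c" unfolding c_def by (rule chart_at)+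
  define T where "T = {t\<in>{a..b}. \<gamma> t \<in> chart_dom c}"
  have \<gamma>c: "continuous_on {a..b} \<gamma>" by (rule C1_curve_onD(1)[OF \<gamma> c(1)])
  have T0: "t0 \<in> T" using t0 c by (simp add: T_def)
  have T: "T \<subseteq> {a..b}" by (auto simp: T_def)
  have eq: "speed_within \<gamma> {a..b} (chart_at \<A> (\<gamma> t)) t = speed_within \<gamma> {a..b} c t" if "t \<in> T" for t
  proof (rule speed_within_chart_independent[OF c(1)])
    show "chart_at \<A> (\<gamma> t) \<in> \<A>" by (rule chart_at)
    show "t \<in> {a..b}" "\<gamma> t \<in> chart_dom c \<inter> chart_dom (chart_at \<A> (\<gamma> t))" using that chart_at(2) by (auto simp: T_def)
    then show "at t within {a..b} \<noteq> bot" "continuous (at t within {a..b}) \<gamma>"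
      "(chart_map c \<circ> \<gamma>) differentiable (at t within {a..b})"
      using Icc_nontrivial[OF ab] \<gamma>c C1_curve_onD(2)[OF \<gamma> c(1)] by (auto simp: continuous_on_eq_continuous_within)
  qed
  have cG: "continuous_on T (\<lambda>t. G c (\<gamma> t) $ i $ j)" for i j
  proof -
    have "continuous_on T (\<lambda>t. chart_map c (\<gamma> t))"
      by (rule continuous_on_compose2[OF continuous_on_chart_map[OF c(1)] continuous_on_subset[OF \<gamma>c T]]) (auto simp: T_def)
    then have "continuous_on T (\<lambda>t. gm c (chart_map c (\<gamma> t)) $ i $ j)"
      by (rule continuous_on_compose2[OF Ck_gm[OF c(1), of 0, simplified]]) (auto simp: T_def)
    then show ?thesis
      by (rule continuous_on_cong[THEN iffD1, rotated 2]) (auto simp: gm_def T_def chart_inv_map[OF c(1)])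
  qed
  let ?v = "\<lambda>t. vector_derivative (chart_map c \<circ> \<gamma>) (at t within {a..b})"
  have cv: "continuous_on T ?v" using C1_curve_onD(3)[OF \<gamma> c(1)] by (simp add: T_def)
  have "continuous_on T (\<lambda>t. sqrt (\<Sum>i\<in>UNIV. ?v t $ i * (\<Sum>j\<in>UNIV. G c (\<gamma> t) $ i $ j * ?v t $ j)))"
    by (intro continuous_intros cG cv)
  then have "continuous_on T (speed_within \<gamma> {a..b} c)"
    by (simp add: speed_within_def Let_def inner_vec_def matrix_vector_mult_def)
  then have "continuous_on T (\<lambda>t. speed_within \<gamma> {a..b} (chart_at \<A> (\<gamma> t)) t)"
    by (rule continuous_on_eq) (simp add: eq)
  then have 1: "continuous (at t0 within T) (\<lambda>t. speed_within \<gamma> {a..b} (chart_at \<A> (\<gamma> t)) t)"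
    using T0 by (simp add: continuous_on_eq_continuous_within)
  obtain U where U: "open U" "T = {a..b} \<inter> U"
  proof -
    have "openin (top_of_set {a..b}) ({a..b} \<inter> \<gamma> -` chart_dom c)"
      by (rule continuous_openin_preimage_gen[OF \<gamma>c open_dom[OF c(1)]])
    moreover have "{a..b} \<inter> \<gamma> -` chart_dom c = T" by (auto simp: T_def)
    ultimately show thesis using that by (auto simp: openin_open)
  qed
  then have "at t0 within T = at t0 within {a..b}"
    using T0 by (intro at_within_nhd[of _ U]) auto
  then show "continuous (at t0 within {a..b}) (\<lambda>t. speed_within \<gamma> {a..b} (chart_at \<A> (\<gamma> t)) t)" using 1 by simp
qed

lemma C1_curve_interior:
  assumes \<gamma>: "C1_curve_on \<A> a b \<gamma>" and t: "a < t" "t < b" and c: "c \<in> \<A>" "\<gamma> t \<in> chart_dom c"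
  shows "((chart_map c \<circ> \<gamma>) has_vector_derivative vector_derivative (chart_map c \<circ> \<gamma>) (at t)) (at t)"
    and "curve_speed \<A> G \<gamma> t = speed_within \<gamma> UNIV c t"
proof -
  have at: "at t within {a..b} = at t" using t by (rule at_within_Icc_at)
  have d: "(chart_map c \<circ> \<gamma>) differentiable (at t)"
    using C1_curve_onD(2)[OF \<gamma> c(1), of t] t c at by simp
  then show "((chart_map c \<circ> \<gamma>) has_vector_derivative vector_derivative (chart_map c \<circ> \<gamma>) (at t)) (at t)"
    by (simp add: vector_derivative_works[symmetric])
  have "continuous (at t) \<gamma>"
    using C1_curve_onD(1)[OF \<gamma> c(1)] t at unfolding continuous_on_eq_continuous_within by (metis atLeastAtMost_iff less_imp_le)
  then show "curve_speed \<A> G \<gamma> t = speed_within \<gamma> UNIV c t"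
    unfolding curve_speed_eq
    using chart_at[of "\<gamma> t"] c d by (intro speed_within_chart_independent) auto
qed

text \<open>The two-sided speed agrees with the continuous one-sided speed except possibly at the
  two end points.\<close>

lemma C1_curve_integrable:
  assumes \<gamma>: "C1_curve_on \<A> a b \<gamma>" and ab: "a < b"
  shows "curve_speed \<A> G \<gamma> integrable_on {a..b}"
proof (rule integrable_spike_finite[of "{a, b}"])
  show "(\<lambda>t. speed_within \<gamma> {a..b} (chart_at \<A> (\<gamma> t)) t) integrable_on {a..b}"
    by (rule integrable_continuous_real[OF continuous_speed_within[OF assms]])
  show "curve_speed \<A> G \<gamma> t = speed_within \<gamma> {a..b} (chart_at \<A> (\<gamma> t)) t" if "t \<in> {a..b} - {a, b}" for t
    using that at_within_Icc_at[of a t b] by (simp add: curve_speed_eq speed_within_def)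
qed simp

lemma piecewise_C1_curveE:
  assumes "piecewise_C1_curve \<A> \<gamma>"
  obtains S where "finite S" "continuous_on {0..1} \<gamma>" "curve_speed \<A> G \<gamma> integrable_on {0..1}"
    "\<And>t. t \<in> {0..1} - S \<Longrightarrow> \<exists>a b. a < t \<and> t < b \<and> C1_curve_on \<A> a b \<gamma>"
proof -
  obtain k :: nat and \<tau> where \<tau>: "\<tau> 0 = 0" "\<tau> k = 1" "\<And>i. i < k \<Longrightarrow> \<tau> i < \<tau> (Suc i)" "\<And>i. i < k \<Longrightarrow> C1_curve_on \<A> (\<tau> i) (\<tau> (Suc i)) \<gamma>"
    using assms unfolding piecewise_C1_curve_def by blast
  have "0 \<le> \<tau> i \<and> continuous_on {0..\<tau> i} \<gamma> \<and> curve_speed \<A> G \<gamma> integrable_on {0..\<tau> i} \<and>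
      (\<forall>t\<in>{0..\<tau> i} - \<tau> ` {..i}. \<exists>a b. a < t \<and> t < b \<and> C1_curve_on \<A> a b \<gamma>)" if "i \<le> k" for i
    using that
  proof (induction i)
    case 0
    show ?case using \<tau>(1) integrable_on_refl[of _ "0::real"] by auto
  next
    case (Suc i)
    then have IH: "0 \<le> \<tau> i" "continuous_on {0..\<tau> i} \<gamma>" "curve_speed \<A> G \<gamma> integrable_on {0..\<tau> i}"
      "\<forall>t\<in>{0..\<tau> i} - \<tau> ` {..i}. \<exists>a b. a < t \<and> t < b \<and> C1_curve_on \<A> a b \<gamma>" and i: "i < k" by auto
    have un: "{0..\<tau> (Suc i)} = {0..\<tau> i} \<union> {\<tau> i..\<tau> (Suc i)}" using IH(1) \<tau>(3)[OF i] by auto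
    have c\<gamma>: "continuous_on {\<tau> i..\<tau> (Suc i)} \<gamma>" using \<tau>(4)[OF i] unfolding C1_curve_on_def by blast
    show ?case
    proof (intro conjI ballI)
      show "0 \<le> \<tau> (Suc i)" using IH(1) \<tau>(3)[OF i] by simp
      show "continuous_on {0..\<tau> (Suc i)} \<gamma>" unfolding un by (intro continuous_on_closed_Un IH(2) c\<gamma>) auto
      show "curve_speed \<A> G \<gamma> integrable_on {0..\<tau> (Suc i)}"
        by (rule Henstock_Kurzweil_Integration.integrable_combine[OF IH(1) _ IH(3) C1_curve_integrable[OF \<tau>(4)[OF i] \<tau>(3)[OF i]]])
          (use \<tau>(3)[OF i] in simp)
      fix t assume t: "t \<in> {0..\<tau> (Suc i)} - \<tau> ` {..Suc i}"
      show "\<exists>a b. a < t \<and> t < b \<and> C1_curve_on \<A> a b \<gamma>"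
      proof (cases "t \<le> \<tau> i")
        case True
        then have "t \<in> {0..\<tau> i} - \<tau> ` {..i}" using t by force
        then show ?thesis using IH(4) by blast
      next
        case False
        moreover have "t \<noteq> \<tau> (Suc i)" using t by auto
        ultimately have "\<tau> i < t" "t < \<tau> (Suc i)" using t by auto
        then show ?thesis using \<tau>(4)[OF i] by blast
      qed
    qed
  qed
  from this[of k] show thesis using that[of "\<tau> ` {..k}"] \<tau>(2) by simp
qed

lemma curve_length_nonneg: "0 \<le> curve_length \<A> G \<gamma>"
  unfolding curve_length_def
  by (cases "curve_speed \<A> G \<gamma> integrable_on {0..1}")
    (auto intro!: integral_nonneg curve_speed_nonneg simp: not_integrable_integral)

lemma riemannian_dist_le:
  assumes "piecewise_C1_curve \<A> \<gamma>" "\<gamma> 0 = p" "\<gamma> 1 = q"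
  shows "riemannian_dist \<A> G p q \<le> curve_length \<A> G \<gamma>"
  unfolding riemannian_dist_def
proof (rule cInf_lower)
  show "bdd_below {curve_length \<A> G \<gamma> |\<gamma>. piecewise_C1_curve \<A> \<gamma> \<and> \<gamma> 0 = p \<and> \<gamma> 1 = q}"
    by (rule bdd_belowI[of _ 0]) (auto simp: curve_length_nonneg)
qed (use assms in blast)

lemma segment_curve:
  assumes c: "c \<in> \<A>" and seg: "\<And>t. t \<in> {0..1} \<Longrightarrow> u + t *\<^sub>R h \<in> chart_img c"
  shows "piecewise_C1_curve \<A> (\<lambda>t. chart_inv c (u + t *\<^sub>R h))"
    and "curve_length \<A> G (\<lambda>t. chart_inv c (u + t *\<^sub>R h)) =
      integral {0..1} (\<lambda>t. sqrt (h \<bullet> (gm c (u + t *\<^sub>R h) *v h)))"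
proof -
  define \<gamma> where "\<gamma> t = chart_inv c (u + t *\<^sub>R h)" for t
  have d\<gamma>: "((chart_map d \<circ> \<gamma>) has_vector_derivative frechet_derivative (transition c d) (at (u + t *\<^sub>R h)) h) (at t within I)"
    if d: "d \<in> \<A>" "t \<in> {0..1}" "\<gamma> t \<in> chart_dom d" for d t I
  proof -
    have td: "(transition c d has_derivative frechet_derivative (transition c d) (at (u + t *\<^sub>R h))) (at (u + t *\<^sub>R h))"
      using transition_has_derivative[OF c d(1), of "\<gamma> t"] d(3) chart_inv_in_dom[OF c seg[OF d(2)]] chart_map_inv[OF c seg[OF d(2)]]
      by (simp add: \<gamma>_def)
    have aff: "((\<lambda>t. u + t *\<^sub>R h) has_vector_derivative h) (at t within I)"
      by (auto intro!: derivative_eq_intros)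
    have "((transition c d \<circ> (\<lambda>t. u + t *\<^sub>R h)) has_vector_derivative frechet_derivative (transition c d) (at (u + t *\<^sub>R h)) h) (at t within I)"
      by (rule vector_derivative_diff_chain_within[OF aff has_derivative_at_withinI[OF td]])
    moreover have "transition c d \<circ> (\<lambda>t. u + t *\<^sub>R h) = chart_map d \<circ> \<gamma>"
      by (auto simp: transition_def \<gamma>_def)
    ultimately show ?thesis by simp
  qed
  have c\<gamma>: "continuous_on {0..1} \<gamma>"
    unfolding \<gamma>_def
    by (rule continuous_on_compose2[OF continuous_on_chart_inv[OF c]]) (use seg in \<open>auto intro!: continuous_intros\<close>)
  have "C1_curve_on \<A> 0 1 \<gamma>"
    unfolding C1_curve_on_def Let_def
  proof (intro conjI ballI c\<gamma>)
    fix d assume d: "d \<in> \<A>"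
    let ?T = "{t \<in> {0..1}. \<gamma> t \<in> chart_dom d}"
    show "(chart_map d \<circ> \<gamma>) differentiable (at t within {0..1})" if "t \<in> ?T" for t
      using d\<gamma>[OF d, of t "{0..1}"] that unfolding has_vector_derivative_def differentiable_def by blast
    have "continuous_on ?T (\<lambda>t. frechet_derivative (transition c d) (at (u + t *\<^sub>R h)) h)"
    proof (rule continuous_on_compose2[of _ _ ?T "\<lambda>t. u + t *\<^sub>R h"])
      show "continuous_on (chart_map c ` (chart_dom c \<inter> chart_dom d)) (\<lambda>y. frechet_derivative (transition c d) (at y) h)"
        using Ck_transition[OF c d, of "Suc 0"] by simp
      show "(\<lambda>t. u + t *\<^sub>R h) ` ?T \<subseteq> chart_map c ` (chart_dom c \<inter> chart_dom d)"
      proof safe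
        fix t :: real assume t: "t \<in> {0..1}" "\<gamma> t \<in> chart_dom d"
        have "u + t *\<^sub>R h = chart_map c (\<gamma> t)" "\<gamma> t \<in> chart_dom c"
          using chart_map_inv[OF c seg[OF t(1)]] chart_inv_in_dom[OF c seg[OF t(1)]] by (simp_all add: \<gamma>_def)
        then show "u + t *\<^sub>R h \<in> chart_map c ` (chart_dom c \<inter> chart_dom d)" using t(2) by blast
      qed
    qed (intro continuous_intros)
    then show "continuous_on ?T (\<lambda>t. vector_derivative (chart_map d \<circ> \<gamma>) (at t within {0..1}))"
    proof (rule continuous_on_eq)
      show "frechet_derivative (transition c d) (at (u + t *\<^sub>R h)) h =
          vector_derivative (chart_map d \<circ> \<gamma>) (at t within {0..1})" if "t \<in> ?T" for t
        using that by (intro vector_derivative_within_closed_interval[symmetric] d\<gamma> d) auto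
    qed
  qed
  then show "piecewise_C1_curve \<A> (\<lambda>t. chart_inv c (u + t *\<^sub>R h))"
    unfolding piecewise_C1_curve_def \<gamma>_def[abs_def, symmetric]
    by (intro exI[of _ "1::nat"] exI[of _ real]) auto
  have "curve_speed \<A> G \<gamma> t = sqrt (h \<bullet> (gm c (u + t *\<^sub>R h) *v h))" if t: "t \<in> {0..1}" for t
  proof -
    let ?d = "chart_at \<A> (\<gamma> t)"
    have d: "?d \<in> \<A>" "\<gamma> t \<in> chart_dom ?d" by (rule chart_at)+
    have v: "vector_derivative (chart_map ?d \<circ> \<gamma>) (at t) = frechet_derivative (transition c ?d) (at (u + t *\<^sub>R h)) h"
      by (rule vector_derivative_at[OF d\<gamma>[OF d(1) t d(2)]])
    have p: "\<gamma> t \<in> chart_dom c \<inter> chart_dom ?d" "chart_map c (\<gamma> t) = u + t *\<^sub>R h"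
      using d chart_map_inv[OF c seg[OF t]] chart_inv_in_dom[OF c seg[OF t]] by (simp_all add: \<gamma>_def)
    show ?thesis
      using metric_inner_transition[OF c d(1) p(1), of h]
      by (simp add: curve_speed_def Let_def v p(2) gm_def) (simp add: \<gamma>_def)
  qed
  then show "curve_length \<A> G (\<lambda>t. chart_inv c (u + t *\<^sub>R h)) =
      integral {0..1} (\<lambda>t. sqrt (h \<bullet> (gm c (u + t *\<^sub>R h) *v h)))"
    unfolding curve_length_def \<gamma>_def[abs_def, symmetric] by (intro integral_cong) auto
qed

text \<open>The coordinate segment, which convexity keeps inside \<open>K\<close>, is one of the
  curves over which the infimum is taken.\<close>

lemma riemannian_dist_chart_le:
  assumes c: "c \<in> \<A>" and K: "convex K" "K \<subseteq> chart_img c" and uw: "u \<in> K" "w \<in> K"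
    and \<Lambda>: "\<And>y h. y \<in> K \<Longrightarrow> sqrt (h \<bullet> (gm c y *v h)) \<le> \<Lambda> * norm h"
  shows "riemannian_dist \<A> G (chart_inv c u) (chart_inv c w) \<le> \<Lambda> * norm (w - u)"
proof -
  define h where "h = w - u"
  have seg: "u + t *\<^sub>R h \<in> K" if "t \<in> {0..1}" for t
  proof -
    have "u + t *\<^sub>R h = (1 - t) *\<^sub>R u + t *\<^sub>R w" by (simp add: h_def algebra_simps)
    then show ?thesis using K(1) uw that by (simp add: convexD)
  qed
  have segc: "u + t *\<^sub>R h \<in> chart_img c" if "t \<in> {0..1}" for t using seg[OF that] K(2) by blast
  have "riemannian_dist \<A> G (chart_inv c u) (chart_inv c w) \<le> curve_length \<A> G (\<lambda>t. chart_inv c (u + t *\<^sub>R h))"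
    by (rule riemannian_dist_le[OF segment_curve(1)[OF c segc]]) (auto simp: h_def)
  also have "\<dots> = integral {0..1} (\<lambda>t. sqrt (h \<bullet> (gm c (u + t *\<^sub>R h) *v h)))"
    by (rule segment_curve(2)[OF c segc])
  also have "\<dots> \<le> integral {0..1::real} (\<lambda>t. \<Lambda> * norm h)"
  proof (rule integral_le)
    have "continuous_on {0..1} (\<lambda>t. sqrt (\<Sum>i\<in>UNIV. h $ i * (\<Sum>j\<in>UNIV. gm c (u + t *\<^sub>R h) $ i $ j * h $ j)))"
      by (intro continuous_intros continuous_on_compose2[OF Ck_gm[OF c, of 0, simplified]]) (use segc in auto)
    then show "(\<lambda>t. sqrt (h \<bullet> (gm c (u + t *\<^sub>R h) *v h))) integrable_on {0..1}"
      by (simp add: inner_vec_def matrix_vector_mult_def integrable_continuous_real)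
  qed (use \<Lambda> seg in auto)
  also have "\<dots> = \<Lambda> * norm h" by simp
  finally show ?thesis by (simp add: h_def)
qed

text \<open>A curve that leaves a coordinate ball must first traverse its radius.\<close>

lemma short_curve_stays_in_chart:
  assumes c: "c \<in> \<A>" and K: "cball x \<rho> \<subseteq> chart_img c" and \<rho>: "\<rho> > 0"
    and \<Lambda>: "\<Lambda> > 0" "\<And>y h. y \<in> cball x \<rho> \<Longrightarrow> norm h \<le> \<Lambda> * sqrt (h \<bullet> (gm c y *v h))"
    and \<gamma>: "piecewise_C1_curve \<A> \<gamma>" "\<gamma> 0 = chart_inv c x" and len: "\<Lambda> * curve_length \<A> G \<gamma> < \<rho>"
  shows "\<gamma> 1 \<in> chart_inv c ` ball x \<rho>"
proof (rule ccontr)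
  assume out: "\<gamma> 1 \<notin> chart_inv c ` ball x \<rho>"
  obtain S where S: "finite S" "continuous_on {0..1} \<gamma>" "curve_speed \<A> G \<gamma> integrable_on {0..1}"
    "\<And>t. t \<in> {0..1} - S \<Longrightarrow> \<exists>a b. a < t \<and> t < b \<and> C1_curve_on \<A> a b \<gamma>"
  proof (rule piecewise_C1_curveE[OF \<gamma>(1)], goal_cases)
    case (1 S) show ?case by (rule 1(1)) (fact 1(2), fact 1(3), fact 1(4), fact 1(5))
  qed
  define B where "B = chart_inv c ` ball x \<rho>"
  have bK: "ball x \<rho> \<subseteq> chart_img c" using K ball_subset_cball by blast
  have xc: "x \<in> chart_img c" using bK \<rho> centre_in_ball by blast
  have opB: "open B" unfolding B_def by (rule open_chart_inv_image[OF c open_ball bK])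
  have clB: "closed (chart_inv c ` cball x \<rho>)"
    by (intro compact_imp_closed compact_chart_inv_image[OF c compact_cball K])
  define A where "A = {0..1} \<inter> \<gamma> -` (- B)"
  have "closed A" unfolding A_def using S(2) opB
    by (intro continuous_closed_preimage) auto
  have A1: "1 \<in> A" using out by (simp add: A_def B_def)
  \<comment> \<open>The first time outside the open coordinate ball. Up to this time the curve stays
    in the closed ball, hence in the chart, and at this time its coordinate distance from the centre
    is at least \<rho>.\<close>
  define T where "T = Inf A"
  have bdd: "bdd_below A" by (rule bdd_belowI[of _ 0]) (simp add: A_def)
  have TA: "T \<in> A" unfolding T_def using A1 bdd \<open>closed A\<close> by (intro closed_contains_Inf) auto
  have x0: "chart_inv c x \<in> B" using \<rho> by (simp add: B_def)
  have T: "0 < T" "T \<le> 1" using TA \<gamma>(2) x0 by (auto simp: A_def less_le)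
  have before: "\<gamma> t \<in> B" if "0 \<le> t" "t < T" for t
  proof (rule ccontr)
    assume "\<gamma> t \<notin> B"
    then have "t \<in> A" using that T by (simp add: A_def)
    then have "T \<le> t" unfolding T_def using bdd by (rule cInf_lower)
    then show False using that by simp
  qed
  have closure: "\<gamma> t \<in> chart_inv c ` cball x \<rho>" if t: "t \<in> {0..T}" for t
  proof (cases "t < T")
    case True
    then show ?thesis using before[of t] t ball_subset_cball unfolding B_def by auto
  next
    case False
    then have tT: "t = T" using t by simp
    have "continuous_on {0..T} \<gamma>" using S(2) T by (auto intro: continuous_on_subset)
    then have "closed ({0..T} \<inter> \<gamma> -` (chart_inv c ` cball x \<rho>))"
      using clB by (intro continuous_closed_preimage) auto
    moreover have "{0..<T} \<subseteq> {0..T} \<inter> \<gamma> -` (chart_inv c ` cball x \<rho>)"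
      using before ball_subset_cball unfolding B_def by fastforce
    ultimately have "closure {0..<T} \<subseteq> {0..T} \<inter> \<gamma> -` (chart_inv c ` cball x \<rho>)" by (rule closure_minimal[rotated])
    moreover have "T \<in> closure {0..<T}" using T by simp
    ultimately show ?thesis unfolding tT by blast
  qed
  have inb: "chart_map c (\<gamma> t) \<in> cball x \<rho>" "\<gamma> t \<in> chart_dom c" if "t \<in> {0..T}" for t
    using chart_map_chart_inv_image[OF c K closure[OF that]] by auto
  have "norm (chart_map c (\<gamma> T) - x) \<ge> \<rho>"
  proof (rule ccontr)
    assume "\<not> ?thesis"
    then have "chart_map c (\<gamma> T) \<in> ball x \<rho>" by (simp add: dist_norm norm_minus_commute)
    then have "chart_inv c (chart_map c (\<gamma> T)) \<in> B" by (simp add: B_def)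
    then show False using TA chart_inv_map[OF c inb(2)[of T]] T by (simp add: A_def)
  qed
  moreover have "norm (chart_map c (\<gamma> T) - x) \<le> \<Lambda> * curve_length \<A> G \<gamma>"
  proof -
    \<comment> \<open>The coordinate velocity, set to 0 at the finitely many times at which it may
      be undefined; the fundamental theorem of calculus tolerates such a set.\<close>
    define v where "v t = (if t \<in> insert 0 (insert T S) then 0 else vector_derivative (chart_map c \<circ> \<gamma>) (at t))" for t
    have int: "(v has_integral ((chart_map c \<circ> \<gamma>) T - (chart_map c \<circ> \<gamma>) 0)) {0..T}"
    proof (rule fundamental_theorem_of_calculus_interior_strong[OF S(1)])
      show "continuous_on {0..T} (chart_map c \<circ> \<gamma>)"
        using S(2) T inb(2) by (intro continuous_on_compose continuous_on_subset[OF continuous_on_chart_map[OF c]])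
          (auto intro: continuous_on_subset)
      fix t assume t: "t \<in> {0<..<T} - S"
      then have t': "t \<in> {0..1} - S" using T by auto
      obtain a b where ab: "a < t" "t < b" "C1_curve_on \<A> a b \<gamma>" using S(4)[OF t'] by blast
      show "((chart_map c \<circ> \<gamma>) has_vector_derivative v t) (at t)"
        using C1_curve_interior(1)[OF ab(3,1,2) c inb(2)[of t]] t by (simp add: v_def)
    qed (use T in simp)
    have sT: "curve_speed \<A> G \<gamma> integrable_on {0..T}"
      by (rule integrable_on_subinterval[OF S(3)]) (use T in auto)
    have "norm (integral {0..T} v) \<le> integral {0..T} (\<lambda>t. \<Lambda> * curve_speed \<A> G \<gamma> t)"
    proof (rule integral_norm_bound_integral)
      show "v integrable_on {0..T}" using int by blast
      show "(\<lambda>t. \<Lambda> * curve_speed \<A> G \<gamma> t) integrable_on {0..T}" using integrable_on_cmult_left[OF sT, of \<Lambda>] by simp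
      fix t assume t: "t \<in> {0..T}"
      show "norm (v t) \<le> \<Lambda> * curve_speed \<A> G \<gamma> t"
      proof (cases "t \<in> insert 0 (insert T S)")
        case True
        then show ?thesis using \<Lambda>(1) curve_speed_nonneg by (simp add: v_def)
      next
        case False
        then have t': "t \<in> {0..1} - S" using T t by auto
        obtain a b where ab: "a < t" "t < b" "C1_curve_on \<A> a b \<gamma>" using S(4)[OF t'] by blast
        have "norm (v t) \<le> \<Lambda> * sqrt (v t \<bullet> (gm c (chart_map c (\<gamma> t)) *v v t))" by (rule \<Lambda>(2)[OF inb(1)[OF t]])
        also have "gm c (chart_map c (\<gamma> t)) = G c (\<gamma> t)" using chart_inv_map[OF c inb(2)[OF t]] by (simp add: gm_def)
        also have "sqrt (v t \<bullet> (G c (\<gamma> t) *v v t)) = speed_within \<gamma> UNIV c t"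
          using False by (simp add: v_def speed_within_def Let_def)
        also have "\<dots> = curve_speed \<A> G \<gamma> t" using C1_curve_interior(2)[OF ab(3,1,2) c inb(2)[OF t]] by simp
        finally show ?thesis .
      qed
    qed
    also have "\<dots> = \<Lambda> * integral {0..T} (curve_speed \<A> G \<gamma>)" by simp
    also have "\<dots> \<le> \<Lambda> * curve_length \<A> G \<gamma>"
      unfolding curve_length_def using \<Lambda>(1) T
      by (intro mult_left_mono integral_subset_le sT S(3)) (auto simp: curve_speed_nonneg)
    also have "integral {0..T} v = chart_map c (\<gamma> T) - x"
      using integral_unique[OF int] \<gamma>(2) chart_map_inv[OF c xc] by simp
    finally show ?thesis .
  qed
  ultimately show False using len by simp
qed

end

section \<open>The distance distribution\<close>

context eigenbasis_manifold
begin

text \<open>By homogeneity it suffices to consider unit vectors, where the norm attains a positive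
  minimum and a maximum on a compact set. The sum of the maximum and of the inverse of the minimum
  serves in both inequalities.\<close>

lemma patch_metric_bounds:
  assumes c: "c \<in> \<A>" and K: "compact K" "K \<subseteq> chart_img c"
  shows "\<exists>\<Lambda>>0. \<forall>y\<in>K. \<forall>h. norm h \<le> \<Lambda> * sqrt (h \<bullet> (gm c y *v h)) \<and> sqrt (h \<bullet> (gm c y *v h)) \<le> \<Lambda> * norm h"
proof (cases "K = {}")
  case False
  define f where "f = (\<lambda>(y, h). sqrt (h \<bullet> (gm c y *v h)))"
  let ?S = "K \<times> sphere (0 :: real^'n) 1"
  have "continuous_on ?S (\<lambda>z. sqrt (\<Sum>i\<in>UNIV. snd z $ i * (\<Sum>j\<in>UNIV. gm c (fst z) $ i $ j * snd z $ j)))"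
    by (intro continuous_intros continuous_on_compose2[OF Ck_gm[OF c, of 0, simplified]]) (use K in auto)
  then have cf: "continuous_on ?S f" by (simp add: f_def case_prod_beta inner_vec_def matrix_vector_mult_def)
  have cS: "compact ?S" using K(1) by (intro compact_Times) auto
  have ne: "?S \<noteq> {}"
    using False vector_choose_size[of 1] by (metis Sigma_empty_iff empty_iff mem_sphere_0 zero_le_one Times_empty)
  obtain z0 where z0: "z0 \<in> ?S" "\<And>z. z \<in> ?S \<Longrightarrow> f z0 \<le> f z" using continuous_attains_inf[OF cS ne cf] by blast
  obtain z1 where z1: "z1 \<in> ?S" "\<And>z. z \<in> ?S \<Longrightarrow> f z \<le> f z1" using continuous_attains_sup[OF cS ne cf] by blast
  have f0: "f z > 0" if "z \<in> ?S" for z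
  proof -
    obtain y h where z: "z = (y, h)" "y \<in> K" "norm h = 1" using \<open>z \<in> ?S\<close> by auto
    moreover have "y \<in> chart_img c" "h \<noteq> 0" using z K(2) by auto
    ultimately show ?thesis using gm_pos[OF c, of y h] by (simp add: f_def)
  qed
  define \<Lambda> where "\<Lambda> = 1 / f z0 + f z1"
  have scale: "sqrt (h \<bullet> (gm c y *v h)) = norm h * f (y, (1 / norm h) *\<^sub>R h)" if "h \<noteq> 0" for y h
  proof -
    have "h \<bullet> (gm c y *v h) = (norm h)\<^sup>2 * (((1 / norm h) *\<^sub>R h) \<bullet> (gm c y *v ((1 / norm h) *\<^sub>R h)))"
      using that by (simp add: matrix_vector_mult_scaleR power2_eq_square)
    then have "sqrt (h \<bullet> (gm c y *v h)) =
        sqrt ((norm h)\<^sup>2 * (((1 / norm h) *\<^sub>R h) \<bullet> (gm c y *v ((1 / norm h) *\<^sub>R h))))" by (rule arg_cong)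
    also have "\<dots> = norm h * f (y, (1 / norm h) *\<^sub>R h)"
      unfolding real_sqrt_mult f_def by simp
    finally show ?thesis .
  qed
  have "norm h \<le> \<Lambda> * sqrt (h \<bullet> (gm c y *v h)) \<and> sqrt (h \<bullet> (gm c y *v h)) \<le> \<Lambda> * norm h" if y: "y \<in> K" for y h
  proof (cases "h = 0")
    case False
    define w where "w = f (y, (1 / norm h) *\<^sub>R h)"
    have w: "(y, (1 / norm h) *\<^sub>R h) \<in> ?S" using y False by simp
    have "1 / f z0 * w \<ge> 1" using z0(2)[OF w] f0[OF z0(1)] by (simp add: w_def field_simps)
    moreover have "f z1 * w \<ge> 0" using f0[OF z1(1)] f0[OF w] by (simp add: w_def)
    ultimately have "1 \<le> \<Lambda> * w" by (simp add: \<Lambda>_def distrib_right)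
    then have "norm h * 1 \<le> norm h * (\<Lambda> * w)" by (rule mult_left_mono) simp
    moreover have "w \<le> \<Lambda>" using z1(2)[OF w] f0[OF z0(1)] by (simp add: w_def \<Lambda>_def add_increasing)
    then have "norm h * w \<le> norm h * \<Lambda>" by (rule mult_left_mono) simp
    ultimately show ?thesis unfolding scale[OF False] w_def[symmetric] by (simp add: mult_ac)
  qed simp
  moreover have "\<Lambda> > 0" using f0[OF z0(1)] f0[OF z1(1)] by (simp add: \<Lambda>_def add_pos_pos)
  ultimately show ?thesis by blast
qed (auto intro: exI[of _ 1])

lemma metric_bounds:
  obtains \<Lambda> where "\<Lambda> > 0"
    "\<And>c x0 R y h. (c, x0, R) \<in> P \<Longrightarrow> y \<in> cball x0 (3 * R) \<Longrightarrow>
      norm h \<le> \<Lambda> * sqrt (h \<bullet> (gm c y *v h)) \<and> sqrt (h \<bullet> (gm c y *v h)) \<le> \<Lambda> * norm h"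
proof -
  have "\<forall>q\<in>P. \<exists>\<Lambda>>0. \<forall>y\<in>cball (fst (snd q)) (3 * snd (snd q)). \<forall>h.
    norm h \<le> \<Lambda> * sqrt (h \<bullet> (gm (fst q) y *v h)) \<and> sqrt (h \<bullet> (gm (fst q) y *v h)) \<le> \<Lambda> * norm h"
  proof
    fix q assume "q \<in> P"
    moreover obtain c x0 R where q: "q = (c, x0, R)" by (cases q)
    ultimately have "c \<in> \<A>" "cball x0 (4 * R) \<subseteq> chart_img c" "0 < R" using patch by auto
    moreover then have "cball x0 (3 * R) \<subseteq> chart_img c" by (auto simp: subset_iff)
    ultimately show "\<exists>\<Lambda>>0. \<forall>y\<in>cball (fst (snd q)) (3 * snd (snd q)). \<forall>h.
      norm h \<le> \<Lambda> * sqrt (h \<bullet> (gm (fst q) y *v h)) \<and> sqrt (h \<bullet> (gm (fst q) y *v h)) \<le> \<Lambda> * norm h"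
      unfolding q fst_conv snd_conv by (intro patch_metric_bounds) auto
  qed
  from bchoice[OF this] obtain \<Lambda> where \<Lambda>: "\<And>q. q \<in> P \<Longrightarrow> \<Lambda> q > 0"
    "\<And>q y h. q \<in> P \<Longrightarrow> y \<in> cball (fst (snd q)) (3 * snd (snd q)) \<Longrightarrow>
    norm h \<le> \<Lambda> q * sqrt (h \<bullet> (gm (fst q) y *v h)) \<and> sqrt (h \<bullet> (gm (fst q) y *v h)) \<le> \<Lambda> q * norm h" by blast
  define D where "D = 1 + (\<Sum>q\<in>P. \<Lambda> q)"
  have D0: "D > 0" unfolding D_def using \<Lambda>(1) by (intro add_pos_nonneg sum_nonneg) (auto simp: less_imp_le)
  show thesis
  proof (rule that[OF D0])
    fix c x0 R y h assume q: "(c, x0, R) \<in> P" and y: "y \<in> cball x0 (3 * R)"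
    have "\<Lambda> (c, x0, R) \<le> D"
      using member_le_sum[of "(c, x0, R)" P \<Lambda>] q \<Lambda>(1) finite_P by (force simp: D_def less_imp_le)
    moreover have "0 \<le> sqrt (h \<bullet> (gm c y *v h))"
    proof -
      have "y \<in> chart_img c" using patch[OF q] y by (auto simp: subset_iff)
      then show ?thesis using metric_inner_nonneg[of c "chart_inv c y" h] patch[OF q] chart_inv_in_dom[of c y] by (simp add: gm_def)
    qed
    ultimately have "\<Lambda> (c, x0, R) * sqrt (h \<bullet> (gm c y *v h)) \<le> D * sqrt (h \<bullet> (gm c y *v h))"
      "\<Lambda> (c, x0, R) * norm h \<le> D * norm h" by (auto intro: mult_right_mono)
    with \<Lambda>(2)[OF q, of y h] y show "norm h \<le> D * sqrt (h \<bullet> (gm c y *v h)) \<and> sqrt (h \<bullet> (gm c y *v h)) \<le> D * norm h"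
      by auto
  qed
qed

text \<open>Points of a cell are joined by a short coordinate segment. Conversely, a curve from p of
  length less than r/(4 \<Lambda>) cannot leave the coordinate ball of radius r/4 around p, and this
  ball lies in a single cell. The value \<delta> = 1/(8 \<Lambda>) is smaller by a factor 2, since
  the infimum need not be attained and a curve only slightly longer is chosen. The existence of a
  curve is a premise because the infimum of the empty set has a default value.\<close>

lemma cell_dist_comparison:
  obtains C \<delta> where "C > 0" "\<delta> > 0"
    "\<And>r \<kappa> p q. 0 < r \<Longrightarrow> r \<le> rad \<Longrightarrow> \<kappa> \<in> cells r \<Longrightarrow> p \<in> cell r \<kappa> \<Longrightarrow> q \<in> cell r \<kappa> \<Longrightarrow> riemannian_dist \<A> G p q \<le> C * r"
    "\<And>r p q. 0 < r \<Longrightarrow> r \<le> rad \<Longrightarrow> riemannian_dist \<A> G p q \<le> \<delta> * r \<Longrightarrow>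
      \<exists>\<gamma>. piecewise_C1_curve \<A> \<gamma> \<and> \<gamma> 0 = p \<and> \<gamma> 1 = q \<Longrightarrow> \<exists>\<kappa>\<in>cells r. p \<in> cell r \<kappa> \<and> q \<in> cell r \<kappa>"
proof -
  obtain \<Lambda> where \<Lambda>: "\<Lambda> > 0"
    "\<And>c x0 R y h. (c, x0, R) \<in> P \<Longrightarrow> y \<in> cball x0 (3 * R) \<Longrightarrow>
      norm h \<le> \<Lambda> * sqrt (h \<bullet> (gm c y *v h)) \<and> sqrt (h \<bullet> (gm c y *v h)) \<le> \<Lambda> * norm h"
  proof (rule metric_bounds, goal_cases)
    case (1 \<Lambda>) show ?case by (rule 1(1), fact 1(2), rule 1(3))
  qed
  show thesis
  proof (rule that[of \<Lambda> "1 / (8 * \<Lambda>)"])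
    fix r \<kappa> p q assume r: "0 < r" "r \<le> rad" and \<kappa>: "\<kappa> \<in> cells r" and pq: "p \<in> cell r \<kappa>" "q \<in> cell r \<kappa>"
    obtain c x0 R y where k: "\<kappa> = ((c, x0, R), y)" "(c, x0, R) \<in> P" "c \<in> \<A>" "cball y r \<subseteq> chart_img c" "cball y r \<subseteq> cball x0 (3 * R)"
      using cellsE[OF \<kappa> r(2)] by metis
    obtain u w where u: "u \<in> ball y (r / 2)" "p = chart_inv c u" and w: "w \<in> ball y (r / 2)" "q = chart_inv c w"
      using pq unfolding cell_def k by auto
    have "riemannian_dist \<A> G p q \<le> \<Lambda> * norm (w - u)"
      unfolding u(2) w(2)
    proof (rule riemannian_dist_chart_le[OF k(3) convex_cball k(4)])
      show "u \<in> cball y r" "w \<in> cball y r" using u w r by auto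
      show "sqrt (h \<bullet> (gm c y' *v h)) \<le> \<Lambda> * norm h" if "y' \<in> cball y r" for y' h
        using \<Lambda>(2)[OF k(2), of y' h] that k(5) by blast
    qed
    also have "norm (w - u) \<le> r"
      using dist_triangle[of w u y] u(1) w(1) by (simp add: dist_norm norm_minus_commute)
    finally show "riemannian_dist \<A> G p q \<le> \<Lambda> * r" using \<Lambda>(1) by (simp add: mult_left_mono)
  next
    fix r p q assume r: "0 < r" "r \<le> rad" and d: "riemannian_dist \<A> G p q \<le> 1 / (8 * \<Lambda>) * r"
      and ex: "\<exists>\<gamma>. piecewise_C1_curve \<A> \<gamma> \<and> \<gamma> 0 = p \<and> \<gamma> 1 = q"
    obtain c x0 R y x where k: "((c, x0, R), y) \<in> cells r" "(c, x0, R) \<in> P" "x \<in> ball x0 R" "p = chart_inv c x" "dist y x \<le> r / 4"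
      by (rule cells_cover[OF r, of p])
    have R: "r \<le> R" using rad(3)[OF k(2)] r by simp
    have c: "c \<in> \<A>" "cball x0 (4 * R) \<subseteq> chart_img c" "0 < R" using patch[OF k(2)] by auto
    have sub: "cball x (r / 4) \<subseteq> cball x0 (3 * R)"
    proof
      fix z assume "z \<in> cball x (r / 4)"
      then show "z \<in> cball x0 (3 * R)" using dist_triangle[of x0 z x] k(3) R r(1) by simp
    qed
    have subc: "cball x (r / 4) \<subseteq> chart_img c" using sub c(2,3) by (auto simp: subset_iff)
    have "1 / (8 * \<Lambda>) * r < r / (4 * \<Lambda>)" using r \<Lambda>(1) by (simp add: field_simps)
    with d have "Inf {curve_length \<A> G \<gamma> |\<gamma>. piecewise_C1_curve \<A> \<gamma> \<and> \<gamma> 0 = p \<and> \<gamma> 1 = q} < r / (4 * \<Lambda>)"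
      unfolding riemannian_dist_def by linarith
    then obtain \<gamma> where \<gamma>: "piecewise_C1_curve \<A> \<gamma>" "\<gamma> 0 = p" "\<gamma> 1 = q" "curve_length \<A> G \<gamma> < r / (4 * \<Lambda>)"
      using cInf_lessD[of "{curve_length \<A> G \<gamma> |\<gamma>. piecewise_C1_curve \<A> \<gamma> \<and> \<gamma> 0 = p \<and> \<gamma> 1 = q}"] ex by blast
    have "\<gamma> 1 \<in> chart_inv c ` ball x (r / 4)"
    proof (rule short_curve_stays_in_chart[OF c(1) subc _ \<Lambda>(1) _ \<gamma>(1)])
      show "norm h \<le> \<Lambda> * sqrt (h \<bullet> (gm c y *v h))" if "y \<in> cball x (r / 4)" for y h
        using \<Lambda>(2)[OF k(2), of y h] that sub by blast
      show "\<gamma> 0 = chart_inv c x" using \<gamma>(2) k(4) by simp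
      show "\<Lambda> * curve_length \<A> G \<gamma> < r / 4" using \<gamma>(4) \<Lambda>(1) by (simp add: field_simps)
    qed (use r in simp)
    then obtain z where z: "z \<in> ball x (r / 4)" "q = chart_inv c z" using \<gamma>(3) by auto
    have "z \<in> ball y (r / 2)" using z(1) k(5) dist_triangle[of y z x] by simp
    moreover have "x \<in> ball y (r / 2)" using k(5) r by simp
    ultimately have "p \<in> cell r ((c, x0, R), y)" "q \<in> cell r ((c, x0, R), y)" using z(2) k(4) by (auto simp: cell_def)
    then show "\<exists>\<kappa>\<in>cells r. p \<in> cell r \<kappa> \<and> q \<in> cell r \<kappa>" using k(1) by blast
  qed (use \<Lambda>(1) in auto)
qed

lemma measure_cell_square:
  assumes M: "finite_measure M" "sets M = sets borel" and r: "0 < r" "r \<le> rad" and \<kappa>: "\<kappa> \<in> cells r"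
  shows "cell r \<kappa> \<times> cell r \<kappa> \<in> sets (M \<Otimes>\<^sub>M M)"
    and "measure (M \<Otimes>\<^sub>M M) (cell r \<kappa> \<times> cell r \<kappa>) = (measure M (cell r \<kappa>))\<^sup>2"
proof -
  interpret finite_measure M by (rule M(1))
  have c: "cell r \<kappa> \<in> sets M" unfolding M(2) using r \<kappa> by (intro borel_open cell_open)
  then show "cell r \<kappa> \<times> cell r \<kappa> \<in> sets (M \<Otimes>\<^sub>M M)" by simp
  show "measure (M \<Otimes>\<^sub>M M) (cell r \<kappa> \<times> cell r \<kappa>) = (measure M (cell r \<kappa>))\<^sup>2"
    using emeasure_pair_measure_Times[OF c c] by (simp add: measure_def enn2real_mult power2_eq_square)
qed

text \<open>\<open>cell_sum\<close> is the integral of the sum of the indicators of the squares of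
  the cells; this sum vanishes off \<open>S\<close> and is at most the overlap on it.\<close>

lemma cell_sum_le_product:
  assumes M: "finite_measure M" "sets M = sets borel" and r: "0 < r" "r \<le> rad"
    and S: "S \<in> sets (M \<Otimes>\<^sub>M M)" "\<And>\<kappa>. \<kappa> \<in> cells r \<Longrightarrow> cell r \<kappa> \<times> cell r \<kappa> \<subseteq> S"
  shows "cell_sum M r \<le> real (card P * overlap TYPE('n)) * measure (M \<Otimes>\<^sub>M M) S"
proof -
  interpret MM: finite_measure "M \<Otimes>\<^sub>M M" by (rule finite_measure_pair_measure[OF M(1) M(1)])
  define B where "B \<kappa> = cell r \<kappa> \<times> cell r \<kappa>" for \<kappa>
  have B: "B \<kappa> \<in> sets (M \<Otimes>\<^sub>M M)" if "\<kappa> \<in> cells r" for \<kappa>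
    unfolding B_def by (rule measure_cell_square(1)[OF M r that])
  have iB: "integrable (M \<Otimes>\<^sub>M M) (indicator (B \<kappa>) :: _ \<Rightarrow> real)" if "\<kappa> \<in> cells r" for \<kappa>
    using B[OF that] MM.emeasure_finite[of "B \<kappa>"] by (intro integrable_real_indicator) (auto simp: less_top[symmetric])
  have "cell_sum M r = (\<Sum>\<kappa>\<in>cells r. \<integral>z. indicator (B \<kappa>) z \<partial>(M \<Otimes>\<^sub>M M))"
    unfolding cell_sum_def
  proof (rule sum.cong[OF refl])
    fix \<kappa> assume "\<kappa> \<in> cells r"
    then show "(measure M (cell r \<kappa>))\<^sup>2 = (\<integral>z. indicator (B \<kappa>) z \<partial>(M \<Otimes>\<^sub>M M))"
      using B[of \<kappa>] measure_cell_square(2)[OF M r, of \<kappa>] by (simp add: B_def)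
  qed
  also have "\<dots> = (\<integral>z. (\<Sum>\<kappa>\<in>cells r. indicator (B \<kappa>) z) \<partial>(M \<Otimes>\<^sub>M M))"
    by (rule Bochner_Integration.integral_sum[symmetric]) (rule iB)
  also have "\<dots> \<le> (\<integral>z. real (card P * overlap TYPE('n)) * indicator S z \<partial>(M \<Otimes>\<^sub>M M))"
  proof (rule integral_mono)
    show "integrable (M \<Otimes>\<^sub>M M) (\<lambda>z. \<Sum>\<kappa>\<in>cells r. indicator (B \<kappa>) z :: real)"
      by (intro Bochner_Integration.integrable_sum iB)
    show "integrable (M \<Otimes>\<^sub>M M) (\<lambda>z. real (card P * overlap TYPE('n)) * indicator S z)"
      using S(1) MM.emeasure_finite[of S] by (intro integrable_mult_right integrable_real_indicator) (auto simp: less_top[symmetric])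
    fix z
    have eq: "(\<Sum>\<kappa>\<in>cells r. indicator (B \<kappa>) z :: real) = real (card {\<kappa> \<in> cells r. z \<in> B \<kappa>})"
      using finite_cells[OF r(1)] by (simp add: indicator_def sum_of_bool_eq Int_def)
    have "card {\<kappa> \<in> cells r. z \<in> B \<kappa>} \<le> card {\<kappa> \<in> cells r. fst z \<in> tent_dom r \<kappa>}"
    proof (rule card_mono)
      show "finite {\<kappa> \<in> cells r. fst z \<in> tent_dom r \<kappa>}" using finite_cells[OF r(1)] by simp
      show "{\<kappa> \<in> cells r. z \<in> B \<kappa>} \<subseteq> {\<kappa> \<in> cells r. fst z \<in> tent_dom r \<kappa>}"
      proof
        fix \<kappa> assume \<kappa>: "\<kappa> \<in> {\<kappa> \<in> cells r. z \<in> B \<kappa>}"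
        then have "fst z \<in> cell r \<kappa>" unfolding B_def by (simp add: mem_Times_iff)
        then have "fst z \<in> tent_dom r \<kappa>" using cell_subset_tent_dom[OF r(1), of \<kappa>] by (rule subsetD[rotated])
        then show "\<kappa> \<in> {\<kappa> \<in> cells r. fst z \<in> tent_dom r \<kappa>}" using \<kappa> by simp
      qed
    qed
    also note card_tent_dom[OF r, of "fst z"]
    finally have le: "card {\<kappa> \<in> cells r. z \<in> B \<kappa>} \<le> card P * overlap TYPE('n)" .
    show "(\<Sum>\<kappa>\<in>cells r. indicator (B \<kappa>) z) \<le> real (card P * overlap TYPE('n)) * indicator S z"
    proof (cases "z \<in> S")
      case True
      then show ?thesis unfolding eq using of_nat_mono[OF le, where 'a=real] by simp
    next
      case False
      then have "z \<notin> B \<kappa>" if "\<kappa> \<in> cells r" for \<kappa> using S(2)[OF that] unfolding B_def by (rule contra_subsetD[rotated])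
      then have "{\<kappa> \<in> cells r. z \<in> B \<kappa>} = {}" by auto
      then show ?thesis unfolding eq by (simp only: card.empty) simp
    qed
  qed
  also have "\<dots> = real (card P * overlap TYPE('n)) * measure (M \<Otimes>\<^sub>M M) S" using S(1) by simp
  finally show ?thesis .
qed

text \<open>A union bound. The set \<open>T\<close> is there for pairs that no common cell contains;
  \<open>cell_sum_bounds\<close> fills it with pairs that no curve joins.\<close>

lemma product_le_cell_sum:
  assumes M: "finite_measure M" "sets M = sets borel" and r: "0 < r" "r \<le> rad"
    and T: "T \<in> sets (M \<Otimes>\<^sub>M M)" and S: "S \<subseteq> (\<Union>\<kappa>\<in>cells r. cell r \<kappa> \<times> cell r \<kappa>) \<union> T"
  shows "measure (M \<Otimes>\<^sub>M M) S \<le> cell_sum M r + measure (M \<Otimes>\<^sub>M M) T"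
proof -
  interpret MM: finite_measure "M \<Otimes>\<^sub>M M" by (rule finite_measure_pair_measure[OF M(1) M(1)])
  let ?U = "\<Union>\<kappa>\<in>cells r. cell r \<kappa> \<times> cell r \<kappa>"
  have U: "?U \<in> sets (M \<Otimes>\<^sub>M M)"
    using finite_cells[OF r(1)] measure_cell_square(1)[OF M r] by (intro sets.finite_UN) auto
  have "measure (M \<Otimes>\<^sub>M M) S \<le> measure (M \<Otimes>\<^sub>M M) (?U \<union> T)"
    using U T by (intro MM.finite_measure_mono S) auto
  also have "\<dots> \<le> measure (M \<Otimes>\<^sub>M M) ?U + measure (M \<Otimes>\<^sub>M M) T" by (rule measure_Un_le[OF U T])
  also have "measure (M \<Otimes>\<^sub>M M) ?U \<le> (\<Sum>\<kappa>\<in>cells r. measure (M \<Otimes>\<^sub>M M) (cell r \<kappa> \<times> cell r \<kappa>))"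
    by (intro measure_UNION_le finite_cells r measure_cell_square(1)[OF M r])
  also have "\<dots> = cell_sum M r"
    unfolding cell_sum_def by (intro sum.cong refl measure_cell_square(2)[OF M r])
  finally show ?thesis by simp
qed

text \<open>With the error w/2 in the asymptotics, F(r) lies between w/2 and 3w/2 times r^s for
  small r. Every cell has diameter at most C r, so \<open>cell_sum\<close> is at most the overlap
  times F(C r); pairs at distance at most \<delta> r share a cell, which gives the lower bound by
  F(\<delta> r) up to a small correction.\<close>

lemma cell_sum_bounds:
  assumes M: "finite_measure M" "sets M = sets borel" and s: "s > 0"
    and dens: "averaged_density_constant \<A> G M s a"
  obtains c1 C1 \<rho>0 where "c1 > 0" "C1 > 0" "\<rho>0 > 0"
    "\<And>r. 0 < r \<Longrightarrow> r \<le> \<rho>0 \<Longrightarrow> c1 * r powr s \<le> cell_sum M r \<and> cell_sum M r \<le> C1 * r powr s"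
proof -
  define F where "F = dist_distribution \<A> G M"
  define S where "S r = {(x, y). riemannian_dist \<A> G x y \<le> r}" for r
  have FS: "F r = measure (M \<Otimes>\<^sub>M M) (S r)" for r by (simp add: F_def S_def dist_distribution_def)
  define w where "w = unit_ball_vol s * a"
  have w: "w > 0" using dens s unfolding averaged_density_constant_def w_def by simp
  have "\<forall>\<^sub>F r in at_right 0. norm (F r - w * r powr s) \<le> w / 2 * norm (r powr s)"
    using dens w unfolding averaged_density_constant_def F_def w_def
    by (intro landau_o.smallD) auto
  then obtain b where b: "b > 0" "\<And>r. 0 < r \<Longrightarrow> r < b \<Longrightarrow> \<bar>F r - w * r powr s\<bar> \<le> w / 2 * r powr s"
    unfolding eventually_at_right_field by auto
  have F: "w / 2 * r powr s \<le> F r" "F r \<le> 3 / 2 * w * r powr s" if "0 < r" "r < b" for r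
  proof -
    have "F r - w * r powr s \<le> w / 2 * r powr s" "- (F r - w * r powr s) \<le> w / 2 * r powr s"
      using b(2)[OF that] by (simp_all only: abs_le_iff)
    then show "w / 2 * r powr s \<le> F r" "F r \<le> 3 / 2 * w * r powr s" by (simp_all add: mult.assoc)
  qed
  \<comment> \<open>Measurability of the sublevel sets comes from the assumption itself:
    \<open>measure\<close> is 0 on a set that is not measurable, but F is positive here.\<close>
  have Sm: "S r \<in> sets (M \<Otimes>\<^sub>M M)" if "0 < r" "r < b" for r
  proof (rule ccontr)
    assume "S r \<notin> sets (M \<Otimes>\<^sub>M M)"
    then have "F r = 0" by (simp add: FS measure_notin_sets)
    moreover have "0 < w / 2 * r powr s" using w that by simp
    ultimately show False using F(1)[OF that] by simp
  qed
  obtain C \<delta> where C: "C > 0" "\<delta> > 0"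
    "\<And>r \<kappa> p q. 0 < r \<Longrightarrow> r \<le> rad \<Longrightarrow> \<kappa> \<in> cells r \<Longrightarrow> p \<in> cell r \<kappa> \<Longrightarrow> q \<in> cell r \<kappa> \<Longrightarrow> riemannian_dist \<A> G p q \<le> C * r"
    "\<And>r p q. 0 < r \<Longrightarrow> r \<le> rad \<Longrightarrow> riemannian_dist \<A> G p q \<le> \<delta> * r \<Longrightarrow>
      \<exists>\<gamma>. piecewise_C1_curve \<A> \<gamma> \<and> \<gamma> 0 = p \<and> \<gamma> 1 = q \<Longrightarrow> \<exists>\<kappa>\<in>cells r. p \<in> cell r \<kappa> \<and> q \<in> cell r \<kappa>"
  proof (rule cell_dist_comparison, goal_cases)
    case (1 C \<delta>) show ?case by (rule 1(1), fact 1(2), fact 1(3), rule 1(4), assumption+, rule 1(5))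
  qed
  \<comment> \<open>The default value of \<open>riemannian_dist\<close> for pairs that no curve
    joins. If it is positive, radii below it exclude such pairs; otherwise such pairs belong to
    every sublevel set of positive radius, including the smaller one at \<epsilon> r.\<close>
  define d0 where "d0 = Inf ({} :: real set)"
  define d1 where "d1 = (if d0 > 0 then d0 else 1)"
  \<comment> \<open>The factor 1/6 gives F(\<epsilon> r) \<le> 3/2 w (\<epsilon> r)^s = w/4
    (\<delta> r)^s, half of the lower bound w/2 (\<delta> r)^s for F(\<delta> r).\<close>
  define \<epsilon> where "\<epsilon> = \<delta> * (1 / 6) powr (1 / s)"
  have "(1 / 6) powr (1 / s) \<le> 1" using s by (intro powr_le1) auto
  then have \<epsilon>: "\<epsilon> > 0" "\<epsilon> \<le> \<delta>" using C(2) by (auto simp: \<epsilon>_def mult_le_cancel_left2)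
  define \<rho>0 where "\<rho>0 = Min {rad, b / (2 * C), b / (2 * \<delta>), d1 / (2 * \<delta>)}"
  have \<rho>0: "\<rho>0 > 0" using rad(1) b(1) C(1,2) by (simp add: \<rho>0_def d1_def)
  have le: "r \<le> rad" "C * r < b" "\<delta> * r < b" "\<delta> * r < d1" if "0 < r" "r \<le> \<rho>0" for r
  proof -
    have "r \<le> rad" "r \<le> b / (2 * C)" "r \<le> b / (2 * \<delta>)" "r \<le> d1 / (2 * \<delta>)" using that by (auto simp: \<rho>0_def)
    then have "C * r * 2 \<le> b" "\<delta> * r * 2 \<le> b" "\<delta> * r * 2 \<le> d1" using C(1,2) by (auto simp: field_simps)
    moreover have "C * r > 0" "\<delta> * r > 0" using C that by auto
    ultimately show "r \<le> rad" "C * r < b" "\<delta> * r < b" "\<delta> * r < d1" using \<open>r \<le> rad\<close> by linarith+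
  qed
  define N0 where "N0 = real (card P * overlap TYPE('n)) + 1"
  have N0: "N0 > 0" by (simp add: N0_def add_nonneg_pos)
  show thesis
  proof (rule that[of "w / 4 * \<delta> powr s" "N0 * (3 / 2 * w * C powr s)" \<rho>0])
    fix r assume r: "0 < r" "r \<le> \<rho>0"
    have "cell_sum M r \<le> real (card P * overlap TYPE('n)) * measure (M \<Otimes>\<^sub>M M) (S (C * r))"
    proof (rule cell_sum_le_product[OF M r(1) le(1)[OF r]])
      show "S (C * r) \<in> sets (M \<Otimes>\<^sub>M M)" using C(1) r le(2)[OF r] by (intro Sm) auto
      show "cell r \<kappa> \<times> cell r \<kappa> \<subseteq> S (C * r)" if "\<kappa> \<in> cells r" for \<kappa>
        using C(3)[OF r(1) le(1)[OF r] that] by (auto simp: S_def)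
    qed
    also have "\<dots> \<le> N0 * F (C * r)" unfolding FS by (intro mult_right_mono) (auto simp: N0_def)
    also have "\<dots> \<le> N0 * (3 / 2 * w * (C * r) powr s)"
      using N0 C(1) r le(2)[OF r] by (intro mult_left_mono F(2)) auto
    also have "\<dots> = N0 * (3 / 2 * w * C powr s) * r powr s" using C(1) r by (simp add: powr_mult)
    finally have up: "cell_sum M r \<le> N0 * (3 / 2 * w * C powr s) * r powr s" .
    have \<epsilon>r: "0 < \<epsilon> * r" "\<epsilon> * r < b"
      using \<epsilon>(1) r(1) le_less_trans[OF mult_right_mono[OF \<epsilon>(2) less_imp_le[OF r(1)]] le(3)[OF r]] by simp_all
    have "measure (M \<Otimes>\<^sub>M M) (S (\<delta> * r)) \<le> cell_sum M r + measure (M \<Otimes>\<^sub>M M) (S (\<epsilon> * r))"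
    proof (rule product_le_cell_sum[OF M r(1) le(1)[OF r] Sm[OF \<epsilon>r]], rule subsetI)
      fix z assume "z \<in> S (\<delta> * r)"
      then obtain p q where z: "z = (p, q)" "riemannian_dist \<A> G p q \<le> \<delta> * r" by (auto simp: S_def)
      show "z \<in> (\<Union>\<kappa>\<in>cells r. cell r \<kappa> \<times> cell r \<kappa>) \<union> S (\<epsilon> * r)"
      proof (cases "\<exists>\<gamma>. piecewise_C1_curve \<A> \<gamma> \<and> \<gamma> 0 = p \<and> \<gamma> 1 = q")
        case True
        then show ?thesis using C(4)[OF r(1) le(1)[OF r] z(2)] z(1) by blast
      next
        case False
        then have "{curve_length \<A> G \<gamma> |\<gamma>. piecewise_C1_curve \<A> \<gamma> \<and> \<gamma> 0 = p \<and> \<gamma> 1 = q} = {}" by blast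
        then have dd: "riemannian_dist \<A> G p q = d0" unfolding riemannian_dist_def d0_def by (rule arg_cong)
        have "d0 \<le> 0" using z(2) le(4)[OF r] unfolding dd d1_def by (auto split: if_splits)
        then show ?thesis using dd z(1) \<epsilon>r(1) by (simp add: S_def)
      qed
    qed
    then have "F (\<delta> * r) \<le> cell_sum M r + F (\<epsilon> * r)" by (simp only: FS)
    moreover have "w / 2 * (\<delta> * r) powr s \<le> F (\<delta> * r)" using C(2) r le(3)[OF r] by (intro F(1)) auto
    moreover have "F (\<epsilon> * r) \<le> 3 / 2 * w * (\<epsilon> * r) powr s" by (rule F(2)[OF \<epsilon>r])
    moreover have "(\<epsilon> * r) powr s = 1 / 6 * (\<delta> * r) powr s"
      using C(2) r s by (simp add: \<epsilon>_def powr_mult powr_powr)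
    moreover have "(\<delta> * r) powr s = \<delta> powr s * r powr s" using C(2) r by (simp add: powr_mult)
    ultimately have "w / 4 * \<delta> powr s * r powr s \<le> cell_sum M r" by (simp add: mult.assoc)
    with up show "w / 4 * \<delta> powr s * r powr s \<le> cell_sum M r \<and> cell_sum M r \<le> N0 * (3 / 2 * w * C powr s) * r powr s" by simp
  qed (use w C N0 \<rho>0 in auto)
qed

end

theorem corollary1p4:
  fixes \<A> :: "('m::{second_countable_topology, t2_space}, 'n::finite) chart set"
    and G :: "('m, 'n) metric_coeffs"
    and e :: "nat \<Rightarrow> 'm \<Rightarrow> real" and ev :: "nat \<Rightarrow> real"
    and \<mu> :: "'m measure" and s a :: real
  assumes "riemannian_manifold \<A> G"
    and "compact (UNIV :: 'm set)" and "connected (UNIV :: 'm set)"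
    and "CARD('n) \<ge> 2"
    and "laplace_eigenbasis \<A> G e ev"
    and "0 < s" and "s < real CARD('n)"
    and "sets \<mu> = sets borel" and "finite_measure \<mu>"
    and "averaged_density_constant \<A> G \<mu> s a"
  shows "\<exists>c>0. \<exists>C>0. \<exists>L0\<ge>1. \<forall>L\<ge>L0.
    c * L powr (- s) \<le>
      1 / real (card {j. ev j \<le> L}) * (\<Sum>j\<in>{j. ev j \<le> L}. \<bar>\<integral>x. e j x \<partial>\<mu>\<bar>\<^sup>2) \<and>
    1 / real (card {j. ev j \<le> L}) * (\<Sum>j\<in>{j. ev j \<le> L}. \<bar>\<integral>x. e j x \<partial>\<mu>\<bar>\<^sup>2)
      \<le> C * L powr (- s)"
proof -
  interpret riemannian_manifold \<A> G by (rule assms(1))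
  obtain P where P: "finite P" "\<forall>(c, x0, R) \<in> P. c \<in> \<A> \<and> 0 < R \<and> cball x0 (4 * R) \<subseteq> chart_img c"
    "\<forall>p. \<exists>(c, x0, R) \<in> P. p \<in> chart_inv c ` ball x0 R"
    using ex_patches[OF assms(2)] by blast
  interpret eigenbasis_manifold \<A> G e ev P
    by unfold_locales (use assms P in auto)
  obtain c1 C1 \<rho>0 where c: "c1 > 0" "C1 > 0" "\<rho>0 > 0"
    "\<And>r. 0 < r \<Longrightarrow> r \<le> \<rho>0 \<Longrightarrow> c1 * r powr s \<le> cell_sum \<mu> r \<and> cell_sum \<mu> r \<le> C1 * r powr s"
  proof (rule cell_sum_bounds[OF assms(9,8,6,10)], goal_cases)
    case (1 c1 C1 \<rho>0) show ?case by (rule 1(1), fact 1(2), fact 1(3), fact 1(4), rule 1(5))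
  qed
  from spectral_average_bounds[OF assms(9,8) _ _ c] assms(6,7)
  show ?thesis by (simp only: coeff_sum_def power2_abs less_imp_le)
qed

end
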